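(* Let $Q$ be a symmetric quiver with vertex set $I$ and let $\mathbf w\in\mathbb N^I$. The kernel of the reduced coaction map $\bar\rho_{\mathbf w}:\mathcal P_Q\to\mathcal P_Q\otimes\overline{\mathcal P}_{\mathbf w}$ is isomorphic (as an $L\times\mathbb Z$-graded vector space) to the graded dual of the CoHA-module $$\mathcal M_{\mathbf w}=\mathcal H_Q/\big(e_{\mathbf d}^{\mathbf w}\mathcal H_{Q,\mathbf d}:\mathbf d>0\big).$$
   Context: The ground field is $\mathbb Q$. $Q$ is a finite quiver with vertex set $I$ which is symmetric (as many arrows $i\to j$ as $j\to i$). $L=\mathbb Z^I$ has standard basis $(e_i)$ and Euler form $\chi(\mathbf d,\mathbf e)=\sum_i\mathbf d_i\mathbf e_i-\sum_{a:i\to j}\mathbf d_i\mathbf e_j$. $L$-graded vector spaces have braiding $a\otimes b\mapsto(-1)^{\chi(\alpha,\beta)}b\otimes a$ for $a,b$ of $L$-degrees $\alpha,\beta$; Lie algebras, enveloping algebras, tensor products of modules are taken in this symmetric monoidal category. Shifts: $M[k]^n=M^{n+k}$. Graded dual: $(M^\vee)_{\mathbf d}^n=(M_{\mathbf d}^{-n})^\vee$. $\mathcal H_Q=\bigoplus_{\mathbf d\in\mathbb N^I}\mathcal H_{Q,\mathbf d}$, $\mathcal H_{Q,\mathbf d}=\Lambda_{\mathbf d}[-\chi(\mathbf d,\mathbf d)]$, $\Lambda_{\mathbf d}=\mathbb Q[x_{i,k}:i\in I,1\le k\le\mathbf d_i]^{\Sigma_{\mathbf d}}$, $\Sigma_{\mathbf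 d}=\prod_i\Sigma_{\mathbf d_i}$, $\deg x_{i,k}=2$, is the cohomological Hall algebra, with shuffle product $f*g=\sum_\sigma\sigma(f(x)g(y)K(x,y))$ for $f\in\mathcal H_{Q,\mathbf d}$, $g\in\mathcal H_{Q,\mathbf e}$, $K=\prod_{i,j}\prod_{k=1}^{\mathbf d_i}\prod_{\ell=1}^{\mathbf e_j}(y_{j,\ell}-x_{i,k})^{-\chi(e_i,e_j)}$, where $x_{i,k}$ are the first $\mathbf d_i$ and $y_{i,\ell}$ the last $\mathbf e_i$ variables of colour $i$ and $\sigma\in\Sigma_{\mathbf d+\mathbf e}$ runs over $(\mathbf d,\mathbf e)$-shuffles (each $\sigma_i$ increasing on $\{1,\dots,\mathbf d_i\}$ and on $\{\mathbf d_i+1,\dots,\mathbf d_i+\mathbf e_i\}$). Put $e_{\mathbf d}^{\mathbf w}=\prod_{i\in I}\prod_{k=1}^{\mathbf d_i}x_{i,k}^{\mathbf w_i}\in\Lambda_{\mathbf d}$; $e_{\mathbf d}^{\mathbf w}\mathcal H_{Q,\mathbf d}$ uses the ordinary product of $\Lambda_{\mathbf d}$, and $(e_{\mathbf d}^{\mathbf w}\mathcal H_{Q,\mathbf d}:\mathbf d>0)$ is the ideal generated with respect to $*$, i.e. $\sum_{\mathbf d'\ge0,\mathbf d>0}\mathcal H_{Q,\mathbf d'}*e_{\mathbf d}^{\mathbf w}\mathcal H_{Q,\mathbf d}$ ($\mathbf d>0$ means $\mathbf d\in\mathbb N^I\setminus\{0\}$). (By a known theorem this quotient is the CoHA-module made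 of the shifted Borel–Moore homologies of the non-commutative Hilbert schemes with framing $\mathbf w$.) $\mathcal N_+(i,j)=\max(-\chi(e_i,e_j),0)$. $\mathfrak L$ is the Lie algebra generated by symbols $i(n)$ ($i\in I$, $n\in\mathbb Z$) of $L$-degree $e_i$ and weight $\frac12\chi(e_i,e_i)-n-1$ (cohomological degree is $-2$ times weight), with relations $\sum_{k=0}^N(-1)^k\binom Nk[i(m-k),j(n+k)]=0$, $N=\mathcal N_+(i,j)$, for all $i,j\in I$, $m,n\in\mathbb Z$. The principal free vertex algebra is $\mathcal P_Q=U(\mathfrak L)/U(\mathfrak L)\{i(n):n\ge0\}$ with cyclic vector $\mathbf 1$. $\mathcal P_{\mathbf w}=U(\mathfrak L)/U(\mathfrak L)X_{\mathbf w}$, $X_{\mathbf w}=\{i(n):i\in I,n\ge-\mathbf w_i\}$, with cyclic vector $\mathbf 1_{\mathbf w}$; $\mathbf 1,\mathbf 1_{\mathbf w}$ have degree $0$. $\pi:\mathcal P_Q\to\mathcal P_{\mathbf w}$ is the canonical surjection. $\delta:\mathcal P_Q\to\mathcal P_Q\otimes\mathcal P_Q$ is the unique $U(\mathfrak L)$-module morphism with $\delta(\mathbf 1)=\mathbf 1\otimes\mathbf 1$ (elements of $\mathfrak L$ acting as primitive elements on the tensor product). $\rho_{\mathbf w}=(\mathrm{Id}\otimes\pi)\delta:\mathcal P_Q\to\mathcal P_Q\otimes\mathcal P_{\mathbf w}$, and $\bar\rho_{\mathbf w}$ is the composition of $\rho_{\mathbf w}$ with the projection to $\mathcal P_Q\otimes\overline{\mathcal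 P}_{\mathbf w}$, where $\overline{\mathcal P}_{\mathbf w}=\mathcal P_{\mathbf w}/\mathcal P_{\mathbf w,0}$ and $\mathcal P_{\mathbf w,0}$ is the component of $L$-degree $0$. *)

theory Defs
  imports
    "HOL-Library.Poly_Mapping"
    "HOL-Library.Product_Plus"
    "HOL-Library.FuncSet"
    "HOL-Combinatorics.Permutations"
    "HOL-Computational_Algebra.Fraction_Field"
    "HOL-Algebra.QuotRing"
    "HOL-Algebra.Module"
    "Graph_Theory.Digraph"
begin

section \<open>Vector spaces over the rationals\<close>

text \<open>
  Vector spaces and (possibly non-associative) algebras over the rationals are \<open>module\<close> records
  over \<open>rat_space\<close>. The fields \<open>mult\<close> and \<open>one\<close> carry no information for objects that are only
  vector spaces. A grading of a space \<open>V\<close> is a family of subspaces of \<open>carrier V\<close>.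
\<close>

definition rat_space :: "(rat, rat) module" where
  "rat_space = \<lparr>carrier = UNIV, mult = (*), one = 1, zero = 0, add = (+), smult = (*)\<rparr>"

definition lin_span :: "(rat, 'x) module \<Rightarrow> 'x set \<Rightarrow> 'x set" where
  "lin_span V S = \<Inter>{H. submodule H rat_space V \<and> S \<subseteq> H}"

definition gen_ideal :: "(rat, 'x) module \<Rightarrow> 'x set \<Rightarrow> 'x set" where
  "gen_ideal A S = \<Inter>{H. submodule H rat_space A \<and> S \<subseteq> H \<and>
     (\<forall>a\<in>carrier A. \<forall>h\<in>H. a \<otimes>\<^bsub>A\<^esub> h \<in> H \<and> h \<otimes>\<^bsub>A\<^esub> a \<in> H)}"

definition left_ideal :: "(rat, 'x) module \<Rightarrow> 'x set \<Rightarrow> 'x set" where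
  "left_ideal A S = lin_span A {a \<otimes>\<^bsub>A\<^esub> x | a x. a \<in> carrier A \<and> x \<in> S}"

definition lin_maps :: "(rat, 'x) module \<Rightarrow> (rat, 'y) module \<Rightarrow> ('x \<Rightarrow> 'y) set" where
  "lin_maps V W = {f \<in> carrier V \<rightarrow>\<^sub>E carrier W.
     (\<forall>x\<in>carrier V. \<forall>y\<in>carrier V. f (x \<oplus>\<^bsub>V\<^esub> y) = f x \<oplus>\<^bsub>W\<^esub> f y) \<and>
     (\<forall>c. \<forall>x\<in>carrier V. f (c \<odot>\<^bsub>V\<^esub> x) = c \<odot>\<^bsub>W\<^esub> f x)}"

text \<open>The quotient has the fields of \<open>V Quot W\<close>; its product is meaningful only if \<open>W\<close> is a
  two-sided ideal.\<close>

definition quot_space :: "(rat, 'x) module \<Rightarrow> 'x set \<Rightarrow> (rat, 'x set) module" where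
  "quot_space V W = \<lparr>carrier = a_rcosets\<^bsub>V\<^esub> W, mult = rcoset_mult V W, one = W +>\<^bsub>V\<^esub> \<one>\<^bsub>V\<^esub>,
     zero = W, add = set_add V, smult = (\<lambda>c A. \<Union>a\<in>A. W +>\<^bsub>V\<^esub> (c \<odot>\<^bsub>V\<^esub> a))\<rparr>"

definition quot_comp ::
  "(rat, 'x) module \<Rightarrow> 'x set \<Rightarrow> ('g \<Rightarrow> 'x set) \<Rightarrow> 'g \<Rightarrow> 'x set set" where
  "quot_comp V W G \<gamma> = (\<lambda>v. W +>\<^bsub>V\<^esub> v) ` G \<gamma>"

definition scale :: "rat \<Rightarrow> ('x \<Rightarrow>\<^sub>0 rat) \<Rightarrow> 'x \<Rightarrow>\<^sub>0 rat" where
  "scale c p = Poly_Mapping.map ((*) c) p"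

definition free_space :: "'x set \<Rightarrow> (rat, 'x \<Rightarrow>\<^sub>0 rat) module" where
  "free_space X = \<lparr>carrier = {p. Poly_Mapping.keys p \<subseteq> X}, mult = undefined, one = undefined,
     zero = 0, add = (+), smult = scale\<rparr>"

subsection \<open>Tensor products\<close>

definition bilinear_rels ::
  "(rat, 'x) module \<Rightarrow> (rat, 'y) module \<Rightarrow> ('x \<times> 'y \<Rightarrow>\<^sub>0 rat) set" where
  "bilinear_rels V W = lin_span (free_space (carrier V \<times> carrier W))
    ({Poly_Mapping.single (x \<oplus>\<^bsub>V\<^esub> x', y) 1 - Poly_Mapping.single (x, y) 1
        - Poly_Mapping.single (x', y) 1 | x x' y.
        x \<in> carrier V \<and> x' \<in> carrier V \<and> y \<in> carrier W} \<union>
     {Poly_Mapping.single (x, y \<oplus>\<^bsub>W\<^esub> y') 1 - Poly_Mapping.single (x, y) 1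
        - Poly_Mapping.single (x, y') 1 | x y y'.
        x \<in> carrier V \<and> y \<in> carrier W \<and> y' \<in> carrier W} \<union>
     {Poly_Mapping.single (c \<odot>\<^bsub>V\<^esub> x, y) 1 - Poly_Mapping.single (x, y) c | c x y.
        x \<in> carrier V \<and> y \<in> carrier W} \<union>
     {Poly_Mapping.single (x, c \<odot>\<^bsub>W\<^esub> y) 1 - Poly_Mapping.single (x, y) c | c x y.
        x \<in> carrier V \<and> y \<in> carrier W})"

definition tensor ::
  "(rat, 'x) module \<Rightarrow> (rat, 'y) module \<Rightarrow> (rat, ('x \<times> 'y \<Rightarrow>\<^sub>0 rat) set) module" where
  "tensor V W = quot_space (free_space (carrier V \<times> carrier W)) (bilinear_rels V W)"

definition pure_tensor ::
  "(rat, 'x) module \<Rightarrow> (rat, 'y) module \<Rightarrow> 'x \<Rightarrow> 'y \<Rightarrow> ('x \<times> 'y \<Rightarrow>\<^sub>0 rat) set" where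
  "pure_tensor V W x y =
     bilinear_rels V W +>\<^bsub>free_space (carrier V \<times> carrier W)\<^esub> Poly_Mapping.single (x, y) 1"

definition tensor_map ::
  "(rat, 'x) module \<Rightarrow> (rat, 'y) module \<Rightarrow> (rat, 'x1) module \<Rightarrow> (rat, 'y1) module \<Rightarrow>
   ('x \<Rightarrow> 'x1) \<Rightarrow> ('y \<Rightarrow> 'y1) \<Rightarrow> ('x \<times> 'y \<Rightarrow>\<^sub>0 rat) set \<Rightarrow> ('x1 \<times> 'y1 \<Rightarrow>\<^sub>0 rat) set" where
  "tensor_map V W V1 W1 f g = (THE T. T \<in> lin_maps (tensor V W) (tensor V1 W1) \<and>
     (\<forall>x\<in>carrier V. \<forall>y\<in>carrier W. T (pure_tensor V W x y) = pure_tensor V1 W1 (f x) (g y)))"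

subsection \<open>Modules over an associative algebra\<close>

definition is_action :: "(rat, 'u) module \<Rightarrow> (rat, 'x) module \<Rightarrow> ('u \<Rightarrow> 'x \<Rightarrow> 'x) \<Rightarrow> bool" where
  "is_action A V act \<longleftrightarrow> act \<in> carrier A \<rightarrow>\<^sub>E lin_maps V V \<and>
     (\<forall>x\<in>carrier V. act \<one>\<^bsub>A\<^esub> x = x \<and>
       (\<forall>u\<in>carrier A. (\<forall>c. act (c \<odot>\<^bsub>A\<^esub> u) x = c \<odot>\<^bsub>V\<^esub> act u x) \<and>
         (\<forall>v\<in>carrier A. act (u \<oplus>\<^bsub>A\<^esub> v) x = act u x \<oplus>\<^bsub>V\<^esub> act v x \<and>
           act (u \<otimes>\<^bsub>A\<^esub> v) x = act u (act v x))))"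

subsection \<open>Graded duals and graded isomorphisms\<close>

text \<open>
  For \<open>M\<close> graded by pairs \<open>(\<alpha>, n)\<close>, the graded dual is the direct sum, over all \<open>(\<alpha>, n)\<close>, of the
  dual spaces of the components of degree \<open>(\<alpha>, - n)\<close> of \<open>M\<close>: its elements are finitely supported
  families of functionals.
\<close>

definition comp_dual :: "(rat, 'x) module \<Rightarrow> ('l \<times> int \<Rightarrow> 'x set) \<Rightarrow> 'l \<times> int \<Rightarrow> ('x \<Rightarrow> rat) set" where
  "comp_dual V G = (\<lambda>(\<alpha>, n). lin_maps (V\<lparr>carrier := G (\<alpha>, - n)\<rparr>) rat_space)"

definition graded_dual ::
  "(rat, 'x) module \<Rightarrow> ('l \<times> int \<Rightarrow> 'x set) \<Rightarrow> (rat, 'l \<times> int \<Rightarrow> 'x \<Rightarrow> rat) module" where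
  "graded_dual V G =
     \<lparr>carrier = {F. (\<forall>\<gamma>. F \<gamma> \<in> comp_dual V G \<gamma>) \<and>
        finite {(\<alpha>, n). \<exists>v\<in>G (\<alpha>, - n). F (\<alpha>, n) v \<noteq> 0}},
      mult = undefined, one = undefined,
      zero = (\<lambda>(\<alpha>, n). \<lambda>v\<in>G (\<alpha>, - n). 0),
      add = (\<lambda>F F'. \<lambda>(\<alpha>, n). \<lambda>v\<in>G (\<alpha>, - n). F (\<alpha>, n) v + F' (\<alpha>, n) v),
      smult = (\<lambda>c F. \<lambda>(\<alpha>, n). \<lambda>v\<in>G (\<alpha>, - n). c * F (\<alpha>, n) v)\<rparr>"

definition graded_dual_comp ::
  "(rat, 'x) module \<Rightarrow> ('l \<times> int \<Rightarrow> 'x set) \<Rightarrow> 'l \<times> int \<Rightarrow> ('l \<times> int \<Rightarrow> 'x \<Rightarrow> rat) set" where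
  "graded_dual_comp V G \<gamma> = {F \<in> carrier (graded_dual V G).
     \<forall>\<alpha> n. (\<alpha>, n) \<noteq> \<gamma> \<longrightarrow> (\<forall>v\<in>G (\<alpha>, - n). F (\<alpha>, n) v = 0)}"

definition graded_iso ::
  "(rat, 'x) module \<Rightarrow> ('g \<Rightarrow> 'x set) \<Rightarrow> (rat, 'y) module \<Rightarrow> ('g \<Rightarrow> 'y set) \<Rightarrow> bool" where
  "graded_iso V G W K \<longleftrightarrow> (\<exists>\<phi>\<in>lin_maps V W. bij_betw \<phi> (carrier V) (carrier W) \<and>
     (\<forall>\<gamma>. \<phi> ` G \<gamma> = K \<gamma>))"

section \<open>Free algebras\<close>

datatype 'g magma = Gen 'g | Br "'g magma" "'g magma"

definition magma_bracket ::
  "('g magma \<Rightarrow>\<^sub>0 rat) \<Rightarrow> ('g magma \<Rightarrow>\<^sub>0 rat) \<Rightarrow> 'g magma \<Rightarrow>\<^sub>0 rat" where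
  "magma_bracket p q = (\<Sum>s\<in>Poly_Mapping.keys p. \<Sum>t\<in>Poly_Mapping.keys q.
     Poly_Mapping.single (Br s t) (Poly_Mapping.lookup p s * Poly_Mapping.lookup q t))"

definition magma_algebra :: "'g set \<Rightarrow> (rat, 'g magma \<Rightarrow>\<^sub>0 rat) module" where
  "magma_algebra X = (free_space {t. set_magma t \<subseteq> X})\<lparr>mult := magma_bracket\<rparr>"

text \<open>Since words form a monoid, the convolution product of \<open>Poly_Mapping\<close> is the product of the
  free associative algebra.\<close>

datatype 'x fmon = FMon (letters: "'x list")

instantiation fmon :: (type) monoid_add
begin

definition zero_fmon :: "'x fmon" where
  "zero_fmon = FMon []"

definition plus_fmon :: "'x fmon \<Rightarrow> 'x fmon \<Rightarrow> 'x fmon" where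
  "plus_fmon u v = FMon (letters u @ letters v)"

instance
  by standard (simp_all add: zero_fmon_def plus_fmon_def)

end

definition free_algebra :: "'x set \<Rightarrow> (rat, 'x fmon \<Rightarrow>\<^sub>0 rat) module" where
  "free_algebra X = (free_space {u. set (letters u) \<subseteq> X})\<lparr>mult := (*), one := 1\<rparr>"

definition letter :: "'x \<Rightarrow> 'x fmon \<Rightarrow>\<^sub>0 rat" where
  "letter x = Poly_Mapping.single (FMon [x]) 1"

section \<open>Polynomials in coloured variables\<close>

text \<open>
  \<open>Var i k\<close> is the variable of colour \<open>i\<close> with index \<open>k\<close> (indices start at 1). The order on
  variables is an arbitrary well-order; it only serves to make the polynomial ring an instance of
  \<open>idom\<close>, so that \<open>fract\<close> applies to it.
\<close>

datatype 'v qvar = Var 'v nat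

definition qvar_order :: "('v qvar \<times> 'v qvar) set" where
  "qvar_order = (SOME r. well_order_on UNIV r)"

lemma qvar_order: "well_order_on UNIV (qvar_order :: ('v qvar \<times> 'v qvar) set)"
  unfolding qvar_order_def by (rule someI_ex) (rule well_order_on)

instantiation qvar :: (type) linorder
begin

definition less_eq_qvar :: "'v qvar \<Rightarrow> 'v qvar \<Rightarrow> bool" where
  "less_eq_qvar x y \<longleftrightarrow> (x, y) \<in> qvar_order"

definition less_qvar :: "'v qvar \<Rightarrow> 'v qvar \<Rightarrow> bool" where
  "less_qvar x y \<longleftrightarrow> (x, y) \<in> qvar_order \<and> (y, x) \<notin> qvar_order"

instance
proof
  have lo: "linear_order_on UNIV (qvar_order :: ('v qvar \<times> 'v qvar) set)"
    using qvar_order[where 'v = 'v] by (simp add: well_order_on_def)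
  fix x y z :: "'v qvar"
  show "x < y \<longleftrightarrow> x \<le> y \<and> \<not> y \<le> x"
    by (simp add: less_eq_qvar_def less_qvar_def)
  show "x \<le> x"
    using lo by (auto simp: less_eq_qvar_def order_on_defs refl_on_def)
  show "x \<le> y \<Longrightarrow> y \<le> z \<Longrightarrow> x \<le> z"
    using lo unfolding less_eq_qvar_def order_on_defs by (meson transD)
  show "x \<le> y \<Longrightarrow> y \<le> x \<Longrightarrow> x = y"
    using lo unfolding less_eq_qvar_def order_on_defs by (meson antisymD)
  show "x \<le> y \<or> y \<le> x"
    using lo unfolding less_eq_qvar_def order_on_defs refl_on_def total_on_def
    by (metis UNIV_I)
qed

end

type_synonym 'v qpoly = "('v qvar \<Rightarrow>\<^sub>0 nat) \<Rightarrow>\<^sub>0 rat"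

definition qX :: "'v \<Rightarrow> nat \<Rightarrow> 'v qpoly" where
  "qX i k = Poly_Mapping.single (Poly_Mapping.single (Var i k) 1) 1"

definition push :: "('x \<Rightarrow> 'y) \<Rightarrow> ('x \<Rightarrow>\<^sub>0 'c::comm_monoid_add) \<Rightarrow> 'y \<Rightarrow>\<^sub>0 'c" where
  "push h p = (\<Sum>x\<in>Poly_Mapping.keys p. Poly_Mapping.single (h x) (Poly_Mapping.lookup p x))"

definition reindex :: "('v \<Rightarrow> nat \<Rightarrow> nat) \<Rightarrow> 'v qpoly \<Rightarrow> 'v qpoly" where
  "reindex \<sigma> = push (push (\<lambda>v. case v of Var i k \<Rightarrow> Var i (\<sigma> i k)))"

definition homogeneous_deg2 :: "int \<Rightarrow> 'v qpoly \<Rightarrow> bool" where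
  "homogeneous_deg2 n f \<longleftrightarrow> (\<forall>m\<in>Poly_Mapping.keys f.
     2 * int (\<Sum>v\<in>Poly_Mapping.keys m. Poly_Mapping.lookup m v) = n)"

abbreviation to_frac :: "'v qpoly \<Rightarrow> 'v qpoly fract" where
  "to_frac f \<equiv> Fraction_Field.Fract f 1"

section \<open>Symmetric quivers\<close>

type_synonym 'v lattice = "'v \<Rightarrow>\<^sub>0 int"
type_synonym 'v dimvec = "'v \<Rightarrow>\<^sub>0 nat"
type_synonym 'v degree = "'v lattice \<times> int"

type_synonym 'v lie_free = "('v \<times> int) magma \<Rightarrow>\<^sub>0 rat"
type_synonym 'v lie_elem = "'v lie_free set"
type_synonym 'v env_free = "'v lie_elem fmon \<Rightarrow>\<^sub>0 rat"
type_synonym 'v env_elem = "'v env_free set"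
type_synonym 'v mod_elem = "'v env_elem set"
type_synonym 'v tensor_elem = "('v mod_elem \<times> 'v mod_elem \<Rightarrow>\<^sub>0 rat) set"

locale symmetric_quiver = fin_digraph Q for Q :: "('v, 'a) pre_digraph" +
  assumes symmetric_arrows: "\<And>i j. i \<in> verts Q \<Longrightarrow> j \<in> verts Q \<Longrightarrow>
    card {a \<in> arcs Q. tail Q a = i \<and> head Q a = j} =
    card {a \<in> arcs Q. tail Q a = j \<and> head Q a = i}"
begin

definition dimvecs :: "'v dimvec set" where
  "dimvecs = {d. Poly_Mapping.keys d \<subseteq> verts Q}"

definition euler :: "'v lattice \<Rightarrow> 'v lattice \<Rightarrow> int" where
  "euler \<alpha> \<beta> = (\<Sum>i\<in>verts Q. Poly_Mapping.lookup \<alpha> i * Poly_Mapping.lookup \<beta> i)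
     - (\<Sum>a\<in>arcs Q. Poly_Mapping.lookup \<alpha> (tail Q a) * Poly_Mapping.lookup \<beta> (head Q a))"

definition basis :: "'v \<Rightarrow> 'v lattice" where
  "basis i = Poly_Mapping.single i 1"

definition braid_sign :: "'v lattice \<Rightarrow> 'v lattice \<Rightarrow> rat" where
  "braid_sign \<alpha> \<beta> = (- 1) powi euler \<alpha> \<beta>"

subsection \<open>The Lie algebra\<close>

text \<open>
  The \<open>\<int>\<close>-component of degrees is the cohomological degree, which for the generator \<open>i(n)\<close> is
  \<open>- 2 (\<chi>(e\<^sub>i, e\<^sub>i) / 2 - n - 1)\<close>.
\<close>

fun magma_degree :: "('v \<times> int) magma \<Rightarrow> 'v degree" where
  "magma_degree (Gen (i, n)) = (basis i, 2 * (n + 1) - euler (basis i) (basis i))"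
| "magma_degree (Br s t) = magma_degree s + magma_degree t"

abbreviation magma_lie :: "(rat, 'v lie_free) module" where
  "magma_lie \<equiv> magma_algebra (verts Q \<times> UNIV)"

definition N_plus :: "'v \<Rightarrow> 'v \<Rightarrow> nat" where
  "N_plus i j = nat (max (- euler (basis i) (basis j)) 0)"

text \<open>Anticommutativity and the Jacobi identity in the category of graded spaces with the given
  braiding; by multilinearity it suffices to impose them on bracketed monomials.\<close>

definition lie_axioms :: "'v lie_free set" where
  "lie_axioms =
     {Poly_Mapping.single (Br s t) 1
        + Poly_Mapping.single (Br t s) (braid_sign (fst (magma_degree s)) (fst (magma_degree t)))
      | s t. set_magma s \<subseteq> verts Q \<times> UNIV \<and> set_magma t \<subseteq> verts Q \<times> UNIV} \<union>
     {Poly_Mapping.single (Br r (Br s t)) 1 - Poly_Mapping.single (Br (Br r s) t) 1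
        - Poly_Mapping.single (Br s (Br r t))
            (braid_sign (fst (magma_degree r)) (fst (magma_degree s)))
      | r s t. set_magma r \<subseteq> verts Q \<times> UNIV \<and> set_magma s \<subseteq> verts Q \<times> UNIV \<and>
          set_magma t \<subseteq> verts Q \<times> UNIV}"

definition lie_relations :: "'v lie_free set" where
  "lie_relations =
     {\<Sum>k\<le>N_plus i j. Poly_Mapping.single (Br (Gen (i, m - int k)) (Gen (j, n + int k)))
        ((- 1) ^ k * of_nat (N_plus i j choose k)) | i j m n. i \<in> verts Q \<and> j \<in> verts Q}"

definition lie_ideal :: "'v lie_free set" where
  "lie_ideal = gen_ideal magma_lie (lie_axioms \<union> lie_relations)"

text \<open>The bracket is the \<open>mult\<close> field.\<close>

definition lie :: "(rat, 'v lie_elem) module" where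
  "lie = quot_space magma_lie lie_ideal"

definition lie_gen :: "'v \<Rightarrow> int \<Rightarrow> 'v lie_elem" where
  "lie_gen i n = lie_ideal +>\<^bsub>magma_lie\<^esub> Poly_Mapping.single (Gen (i, n)) 1"

definition lie_comp :: "'v degree \<Rightarrow> 'v lie_elem set" where
  "lie_comp = quot_comp magma_lie lie_ideal
     (\<lambda>\<gamma>. {p \<in> carrier magma_lie. \<forall>t\<in>Poly_Mapping.keys p. magma_degree t = \<gamma>})"

subsection \<open>The enveloping algebra\<close>

text \<open>
  The tensor algebra of \<open>lie\<close> is the free associative algebra on the set of its elements modulo
  linearity of \<open>letter\<close>; both this and the commutator relations are imposed here.
\<close>

abbreviation words :: "(rat, 'v env_free) module" where
  "words \<equiv> free_algebra (carrier lie)"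

definition env_ideal :: "'v env_free set" where
  "env_ideal = gen_ideal words
     ({letter (x \<oplus>\<^bsub>lie\<^esub> y) - letter x - letter y | x y. x \<in> carrier lie \<and> y \<in> carrier lie} \<union>
      {letter (c \<odot>\<^bsub>lie\<^esub> x) - scale c (letter x) | c x. x \<in> carrier lie} \<union>
      {letter x * letter y - scale (braid_sign \<alpha> \<beta>) (letter y * letter x) - letter (x \<otimes>\<^bsub>lie\<^esub> y)
        | x y \<alpha> \<beta> m n. x \<in> lie_comp (\<alpha>, m) \<and> y \<in> lie_comp (\<beta>, n)})"

definition env :: "(rat, 'v env_elem) module" where
  "env = quot_space words env_ideal"

definition env_incl :: "'v lie_elem \<Rightarrow> 'v env_elem" where
  "env_incl x = env_ideal +>\<^bsub>words\<^esub> letter x"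

definition env_comp :: "'v degree \<Rightarrow> 'v env_elem set" where
  "env_comp = quot_comp words env_ideal
     (\<lambda>\<gamma>. lin_span words {Poly_Mapping.single (FMon xs) 1 | xs \<gamma>s.
        list_all2 (\<lambda>x \<delta>. x \<in> lie_comp \<delta>) xs \<gamma>s \<and> sum_list \<gamma>s = \<gamma>})"

subsection \<open>Cyclic modules over the enveloping algebra\<close>

text \<open>\<open>cyc S\<close> is the quotient of the enveloping algebra by the left ideal generated by \<open>S\<close>.\<close>

definition cyc :: "'v env_elem set \<Rightarrow> (rat, 'v mod_elem) module" where
  "cyc S = quot_space env (left_ideal env S)"

definition cyc_vec :: "'v env_elem set \<Rightarrow> 'v mod_elem" where
  "cyc_vec S = left_ideal env S +>\<^bsub>env\<^esub> \<one>\<^bsub>env\<^esub>"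

definition cyc_act :: "'v env_elem set \<Rightarrow> 'v env_elem \<Rightarrow> 'v mod_elem \<Rightarrow> 'v mod_elem" where
  "cyc_act S u A = (\<Union>a\<in>A. left_ideal env S +>\<^bsub>env\<^esub> (u \<otimes>\<^bsub>env\<^esub> a))"

definition cyc_comp :: "'v env_elem set \<Rightarrow> 'v degree \<Rightarrow> 'v mod_elem set" where
  "cyc_comp S = quot_comp env (left_ideal env S) env_comp"

definition vac_gens :: "'v env_elem set" where
  "vac_gens = {env_incl (lie_gen i n) | i n. i \<in> verts Q \<and> n \<ge> 0}"

definition framed_gens :: "'v dimvec \<Rightarrow> 'v env_elem set" where
  "framed_gens w = {env_incl (lie_gen i n) | i n.
     i \<in> verts Q \<and> n \<ge> - int (Poly_Mapping.lookup w i)}"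

definition PQ :: "(rat, 'v mod_elem) module" where
  "PQ = cyc vac_gens"

definition PQ_comp :: "'v degree \<Rightarrow> 'v mod_elem set" where
  "PQ_comp = cyc_comp vac_gens"

definition Pw :: "'v dimvec \<Rightarrow> (rat, 'v mod_elem) module" where
  "Pw w = cyc (framed_gens w)"

definition Pw_proj :: "'v dimvec \<Rightarrow> 'v mod_elem \<Rightarrow> 'v mod_elem" where
  "Pw_proj w A = (\<Union>a\<in>A. left_ideal env (framed_gens w) +>\<^bsub>env\<^esub> a)"

definition Pw_zero :: "'v dimvec \<Rightarrow> 'v mod_elem set" where
  "Pw_zero w = lin_span (Pw w) (\<Union>n. cyc_comp (framed_gens w) (0, n))"

definition Pw_bar :: "'v dimvec \<Rightarrow> (rat, 'v mod_elem set) module" where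
  "Pw_bar w = quot_space (Pw w) (Pw_zero w)"

subsection \<open>The coaction\<close>

definition PQ2 :: "(rat, 'v tensor_elem) module" where
  "PQ2 = tensor PQ PQ"

text \<open>The module structure on the tensor square for which elements of the Lie algebra are
  primitive.\<close>

definition PQ2_act :: "'v env_elem \<Rightarrow> 'v tensor_elem \<Rightarrow> 'v tensor_elem" where
  "PQ2_act = (THE act. is_action env PQ2 act \<and>
     (\<forall>\<alpha> m \<beta> n. \<forall>x\<in>lie_comp (\<alpha>, m). \<forall>a\<in>PQ_comp (\<beta>, n). \<forall>b\<in>carrier PQ.
       act (env_incl x) (pure_tensor PQ PQ a b) =
         pure_tensor PQ PQ (cyc_act vac_gens (env_incl x) a) b \<oplus>\<^bsub>PQ2\<^esub>
         braid_sign \<alpha> \<beta> \<odot>\<^bsub>PQ2\<^esub> pure_tensor PQ PQ a (cyc_act vac_gens (env_incl x) b)))"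

definition coproduct :: "'v mod_elem \<Rightarrow> 'v tensor_elem" where
  "coproduct = (THE \<delta>. \<delta> \<in> lin_maps PQ PQ2 \<and>
     (\<forall>u\<in>carrier env. \<forall>p\<in>carrier PQ. \<delta> (cyc_act vac_gens u p) = PQ2_act u (\<delta> p)) \<and>
     \<delta> (cyc_vec vac_gens) = pure_tensor PQ PQ (cyc_vec vac_gens) (cyc_vec vac_gens))"

definition coaction :: "'v dimvec \<Rightarrow> 'v mod_elem \<Rightarrow> 'v tensor_elem" where
  "coaction w p = tensor_map PQ PQ PQ (Pw w) id (Pw_proj w) (coproduct p)"

definition reduced_coaction ::
  "'v dimvec \<Rightarrow> 'v mod_elem \<Rightarrow> ('v mod_elem \<times> 'v mod_elem set \<Rightarrow>\<^sub>0 rat) set" where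
  "reduced_coaction w p =
     tensor_map PQ (Pw w) PQ (Pw_bar w) id (\<lambda>b. Pw_zero w +>\<^bsub>Pw w\<^esub> b) (coaction w p)"

definition coaction_kernel :: "'v dimvec \<Rightarrow> 'v mod_elem set" where
  "coaction_kernel w = {p \<in> carrier PQ. reduced_coaction w p = \<zero>\<^bsub>tensor PQ (Pw_bar w)\<^esub>}"

subsection \<open>The cohomological Hall algebra\<close>

definition sym_polys :: "'v dimvec \<Rightarrow> 'v qpoly set" where
  "sym_polys d = {f.
     (\<forall>m\<in>Poly_Mapping.keys f. Poly_Mapping.keys m \<subseteq>
        {Var i k | i k. i \<in> verts Q \<and> k \<in> {1..Poly_Mapping.lookup d i}}) \<and>
     (\<forall>\<sigma>. (\<forall>i\<in>verts Q. \<sigma> i permutes {1..Poly_Mapping.lookup d i}) \<longrightarrow> reindex \<sigma> f = f)}"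

definition shuffle_perms :: "'v dimvec \<Rightarrow> 'v dimvec \<Rightarrow> ('v \<Rightarrow> nat \<Rightarrow> nat) set" where
  "shuffle_perms d e = {\<sigma>. \<forall>i.
     \<sigma> i permutes {1..Poly_Mapping.lookup d i + Poly_Mapping.lookup e i} \<and>
     strict_mono_on {1..Poly_Mapping.lookup d i} (\<sigma> i) \<and>
     strict_mono_on {Poly_Mapping.lookup d i + 1..Poly_Mapping.lookup d i + Poly_Mapping.lookup e i}
       (\<sigma> i)}"

text \<open>
  The shuffle \<open>\<sigma>\<close> acts by \<open>x\<^bsub>i,k\<^esub> \<mapsto> x\<^bsub>i,\<sigma>\<^sub>i(k)\<^esub>\<close> on rational functions. The sum is formed in the field
  of fractions, as the kernel has denominators at vertices without loops.
\<close>

definition shuffle_sum :: "'v dimvec \<Rightarrow> 'v dimvec \<Rightarrow> 'v qpoly \<Rightarrow> 'v qpoly \<Rightarrow> 'v qpoly fract" where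
  "shuffle_sum d e f g = (\<Sum>\<sigma>\<in>shuffle_perms d e.
     to_frac (reindex \<sigma> f) *
     to_frac (reindex (\<lambda>i l. \<sigma> i (Poly_Mapping.lookup d i + l)) g) *
     (\<Prod>i\<in>verts Q. \<Prod>j\<in>verts Q.
       \<Prod>k\<in>{1..Poly_Mapping.lookup d i}. \<Prod>l\<in>{1..Poly_Mapping.lookup e j}.
         (to_frac (qX j (\<sigma> j (Poly_Mapping.lookup d j + l))) - to_frac (qX i (\<sigma> i k)))
           powi (- euler (basis i) (basis j))))"

definition shuffle_prod :: "'v dimvec \<Rightarrow> 'v dimvec \<Rightarrow> 'v qpoly \<Rightarrow> 'v qpoly \<Rightarrow> 'v qpoly" where
  "shuffle_prod d e f g = (THE h. to_frac h = shuffle_sum d e f g)"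

text \<open>An element of the direct sum over all dimension vectors \<open>d\<close> is a finitely supported map
  \<open>d \<mapsto> f\<^sub>d\<close>.\<close>

definition coha :: "(rat, 'v dimvec \<Rightarrow>\<^sub>0 'v qpoly) module" where
  "coha = \<lparr>carrier = {h. Poly_Mapping.keys h \<subseteq> dimvecs \<and>
        (\<forall>d\<in>dimvecs. Poly_Mapping.lookup h d \<in> sym_polys d)},
     mult = (\<lambda>h h'. \<Sum>d\<in>Poly_Mapping.keys h. \<Sum>e\<in>Poly_Mapping.keys h'.
        Poly_Mapping.single (d + e)
          (shuffle_prod d e (Poly_Mapping.lookup h d) (Poly_Mapping.lookup h' e))),
     one = Poly_Mapping.single 0 1, zero = 0, add = (+),
     smult = (\<lambda>c. Poly_Mapping.map (scale c))\<rparr>"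

definition dim_degree :: "'v dimvec \<Rightarrow> 'v lattice" where
  "dim_degree d = Poly_Mapping.map int d"

text \<open>The shift by \<open>- \<chi>(d, d)\<close> turns polynomial degree \<open>n - \<chi>(d, d)\<close>, with all variables of degree 2,
  into cohomological degree \<open>n\<close>.\<close>

definition coha_comp :: "'v degree \<Rightarrow> ('v dimvec \<Rightarrow>\<^sub>0 'v qpoly) set" where
  "coha_comp = (\<lambda>(\<alpha>, n). {h \<in> carrier coha. \<forall>d\<in>Poly_Mapping.keys h. dim_degree d = \<alpha> \<and>
     homogeneous_deg2 (n - euler (dim_degree d) (dim_degree d)) (Poly_Mapping.lookup h d)})"

definition framing_class :: "'v dimvec \<Rightarrow> 'v dimvec \<Rightarrow> 'v qpoly" where
  "framing_class w d =
     (\<Prod>i\<in>verts Q. \<Prod>k\<in>{1..Poly_Mapping.lookup d i}. qX i k ^ Poly_Mapping.lookup w i)"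

definition framing_ideal :: "'v dimvec \<Rightarrow> ('v dimvec \<Rightarrow>\<^sub>0 'v qpoly) set" where
  "framing_ideal w = lin_span coha
     {Poly_Mapping.single d' f \<otimes>\<^bsub>coha\<^esub> Poly_Mapping.single d (framing_class w d * g) | d' d f g.
        d' \<in> dimvecs \<and> d \<in> dimvecs \<and> d \<noteq> 0 \<and> f \<in> sym_polys d' \<and> g \<in> sym_polys d}"

definition coha_module :: "'v dimvec \<Rightarrow> (rat, ('v dimvec \<Rightarrow>\<^sub>0 'v qpoly) set) module" where
  "coha_module w = quot_space coha (framing_ideal w)"

definition coha_module_comp :: "'v dimvec \<Rightarrow> 'v degree \<Rightarrow> ('v dimvec \<Rightarrow>\<^sub>0 'v qpoly) set set" where
  "coha_module_comp w = quot_comp coha (framing_ideal w) coha_comp"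

end

end

theory Submission
  imports Defs "HOL-Computational_Algebra.Formal_Laurent_Series"
begin

text \<open>
  The algebra \<open>P\<^sub>Q\<close> is a quotient of the free associative algebra on the letters \<open>i(n)\<close>, and the letter
  \<open>i(n)\<close> acts on symmetric polynomials: substitute \<open>z\<close> for the last variable of colour \<open>i\<close>, multiply by
  the product of \<open>(z - x)\<close> to the power \<open>\<chi>(i, j)\<close> over the remaining variables \<open>x\<close>, of colour \<open>j\<close>, expanded at
  \<open>z = \<infinity>\<close>, and take the coefficient of \<open>z\<close> to the power \<open>- n - 1\<close>. Applying the letters of a word one
  after the other pairs the words of degree \<open>d\<close> with \<open>\<Lambda>\<^sub>d\<close>. This pairing is nondegenerate in the
  polynomial, and the functionals of bounded degree on words of degree \<open>d\<close> that descend to \<open>P\<^sub>Q\<close> are exactly the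
  symmetric polynomials: the locality relations say that the coefficients, put together into a
  series in the variables, form a symmetric polynomial. The letters act on shuffle products as
  braided derivations, so the pairing turns the coproduct of \<open>P\<^sub>Q\<close> into the product of the CoHA.
  Multiplication by \<open>e\<^sup>w\<close> shifts \<open>i(n)\<close> to \<open>i(n + w\<^sub>i)\<close>, so the multiples of \<open>e\<^sup>w\<close> are the functionals that
  descend to \<open>P\<^sub>w\<close>. Hence the kernel of the reduced coaction is the orthogonal complement of the products
  \<open>f * e\<^sup>w g\<close> with \<open>g\<close> of degree \<open>d > 0\<close>, which is the graded dual of the quotient by them, as all graded
  components of the CoHA are finite-dimensional.
\<close>


section \<open>Linear algebra over the rationals\<close>

text \<open>The objects are nested cosets selected by definite descriptions, so everything is first
  pulled back to representatives in free spaces (\<open>pres\<close>). The tensor square becomes the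
  free space on pairs of words, where products of two homogeneous functionals detect the kernel
  (\<open>tensor_ker_separation\<close>). Homogeneity bounds a functional from below, and the bound
  makes its coefficients a Laurent series in 1/z. After division by the factors (z - x)^\<chi> this
  series must be shown to be polynomial in z. The obstacle is a vertex without loops: there
  \<chi>(i,i) = 1, N = 0 and the braiding is odd, so locality only yields an antisymmetric
  polynomial, which has to be divided by z - x. The same vertices give the shuffle kernel its
  denominators. That the shuffle sum is a polynomial is not computed: the functional dual to the
  coproduct is represented by a polynomial, which obeys the recursion of the shuffle sum. The sign
  (-1)^\<chi>(d,e) in the pairing of products arises because a letter picks up the braiding sign on
  the second factor of a pair of words, but on the first factor of a shuffle product.\<close>

abbreviation lookup :: "('x \<Rightarrow>\<^sub>0 'c::zero) \<Rightarrow> 'x \<Rightarrow> 'c" where "lookup \<equiv> Poly_Mapping.lookup"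
abbreviation keys :: "('x \<Rightarrow>\<^sub>0 'c::zero) \<Rightarrow> 'x set" where "keys \<equiv> Poly_Mapping.keys"
abbreviation single :: "'x \<Rightarrow> 'c \<Rightarrow> 'x \<Rightarrow>\<^sub>0 'c::zero" where "single \<equiv> Poly_Mapping.single"

lemma lookup_scale [simp]: "lookup (scale c p) x = c * lookup p x"
  unfolding scale_def by (simp add: Poly_Mapping.map.rep_eq when_def)

lemma vector_space_scale: "vector_space scale"
  by unfold_locales (auto intro!: poly_mapping_eqI simp: lookup_add algebra_simps)

interpretation pm: vector_space "scale :: rat \<Rightarrow> ('x \<Rightarrow>\<^sub>0 rat) \<Rightarrow> 'x \<Rightarrow>\<^sub>0 rat"
  by (rule vector_space_scale)

lemma vector_space_rat: "vector_space ((*) :: rat \<Rightarrow> rat \<Rightarrow> rat)"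
  by unfold_locales (auto simp: algebra_simps)

lemma scale_single [simp]: "scale c (single x a) = single x (c * a)"
  by (rule poly_mapping_eqI) (simp add: lookup_single when_def)

lemma keys_scale: "keys (scale c p) \<subseteq> keys p"
  by (auto simp: in_keys_iff)

lemma scale_mult_left: "scale c p * q = scale c (p * q :: 'm::monoid_add \<Rightarrow>\<^sub>0 rat)"
  unfolding scale_def mult_map_scale_conv_mult by (simp add: mult.assoc)

text \<open>Constants are central although the exponent monoid need not commute. Since
  \<open>mult_map_scale_conv_mult\<close> writes \<open>scale\<close> as left multiplication by a
  constant, moving a scalar past a left factor depends on this.\<close>

lemma single0_commute: "single 0 c * p = p * single (0::'m::monoid_add) (c::rat)"
proof (induction p rule: update_induct)
  case const then show ?case by simp
next
  case (update p a b)
  have e: "Poly_Mapping.update a b p = p + single a b"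
    using update by (intro poly_mapping_eqI) (auto simp: lookup_update lookup_add lookup_single when_def in_keys_iff)
  show ?case unfolding e using update by (simp add: algebra_simps mult_single)
qed

lemma scale_mult_right: "p * scale c q = scale c (p * q :: 'm::monoid_add \<Rightarrow>\<^sub>0 rat)"
  unfolding scale_def mult_map_scale_conv_mult by (metis single0_commute mult.assoc)

lemma pm_sum_single: "p = (\<Sum>x\<in>keys p. single x (lookup p x))"
  by (rule poly_mapping_eqI) (auto simp: lookup_sum lookup_single when_def in_keys_iff)

lemma pm_sum_scale: "p = (\<Sum>x\<in>keys p. scale (lookup p x) (single x 1))"
  using pm_sum_single[of p] by simp

lemma pm_in_span: "p \<in> pm.span ((\<lambda>x. single x 1) ` keys p)"
proof -
  have "(\<Sum>x\<in>keys p. scale (lookup p x) (single x 1)) \<in> pm.span ((\<lambda>x. single x 1) ` keys p)"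
    by (intro pm.span_sum pm.span_scale pm.span_base imageI)
  then show ?thesis using pm_sum_scale[of p] by simp
qed

lemma pm_span_single: "pm.span {single x 1 | x. x \<in> X} = {p. keys p \<subseteq> X}"
proof
  show "pm.span {single x 1 | x. x \<in> X} \<subseteq> {p. keys p \<subseteq> X}"
  proof (rule pm.span_minimal)
    show "pm.subspace {p. keys p \<subseteq> X}"
    proof (rule pm.subspaceI)
      fix p q :: "'a \<Rightarrow>\<^sub>0 rat" and c
      assume p: "p \<in> {p. keys p \<subseteq> X}"
      then show "scale c p \<in> {p. keys p \<subseteq> X}" using keys_scale[of c p] by blast
      assume "q \<in> {p. keys p \<subseteq> X}"
      then show "p + q \<in> {p. keys p \<subseteq> X}" using p keys_add[of p q] by blast
    qed simp
  qed auto
  show "{p. keys p \<subseteq> X} \<subseteq> pm.span {single x 1 | x. x \<in> X}"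
  proof
    fix p :: "'a \<Rightarrow>\<^sub>0 rat" assume "p \<in> {p. keys p \<subseteq> X}"
    then have "(\<lambda>x. single x 1) ` keys p \<subseteq> {single x 1 | x. x \<in> X}" by auto
    then show "p \<in> pm.span {single x 1 | x. x \<in> X}" 
      by (rule subsetD[OF pm.span_mono pm_in_span[of p]])
  qed
qed

lemma subspace_keys: "pm.subspace {p. keys p \<subseteq> X}"
  unfolding pm_span_single[symmetric] by (rule pm.subspace_span)

text \<open>The universal property of a free space. The scalar action \<open>s\<close> is a
  parameter so that one construction serves linear forms and linear maps between free
  spaces.\<close>

definition lin_ext :: "(rat \<Rightarrow> 'b \<Rightarrow> 'b::ab_group_add) \<Rightarrow> ('x \<Rightarrow> 'b) \<Rightarrow> ('x \<Rightarrow>\<^sub>0 rat) \<Rightarrow> 'b" where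
  "lin_ext s f p = (\<Sum>x\<in>keys p. s (lookup p x) (f x))"

lemma lin_ext_superset:
  assumes "vector_space s" "finite A" "keys p \<subseteq> A"
  shows "lin_ext s f p = (\<Sum>x\<in>A. s (lookup p x) (f x))"
proof -
  interpret vector_space s by fact
  show ?thesis unfolding lin_ext_def using assms(2,3)
    by (intro sum.mono_neutral_left) (auto simp: in_keys_iff)
qed

lemma lin_ext_linear:
  assumes "vector_space s" shows "Vector_Spaces.linear scale s (lin_ext s f)"
proof -
  interpret vector_space s by fact
  have "lin_ext s f (p + q) = lin_ext s f p + lin_ext s f q" for p q
    using keys_add[of p q]
    by (simp add: lin_ext_superset[OF assms, where A="keys p \<union> keys q"] lookup_add
      scale_left_distrib sum.distrib)
  moreover have "lin_ext s f (Defs.scale c p) = s c (lin_ext s f p)" for c p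
    using keys_scale[of c p]
    by (simp add: lin_ext_superset[OF assms, where A="keys p"] scale_sum_right)
  ultimately show ?thesis
    by (simp add: Vector_Spaces.linear_iff assms vector_space_scale)
qed

lemma lin_ext_single [simp]: "vector_space s \<Longrightarrow> lin_ext s f (single x c) = s c (f x)"
proof -
  assume "vector_space s" then interpret vector_space s .
  show ?thesis by (simp add: lin_ext_def)
qed

lemma linear_lin_ext:
  assumes "Vector_Spaces.linear scale s g" shows "g p = lin_ext s (\<lambda>x. g (single x 1)) p"
proof -
  interpret Vector_Spaces.linear scale s g by fact
  have "g (\<Sum>x\<in>keys p. Defs.scale (lookup p x) (single x 1)) = lin_ext s (\<lambda>x. g (single x 1)) p"
    unfolding lin_ext_def by (simp only: sum scale)
  then show ?thesis using pm_sum_scale[of p] by simp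
qed

lemma push_eq_lin_ext: "push h = lin_ext scale (\<lambda>x. single (h x) 1)"
  by (auto simp: push_def lin_ext_def fun_eq_iff)

lemmas lin_scale = lin_ext_linear[OF vector_space_scale]
lemmas lin_rat = lin_ext_linear[OF vector_space_rat]

lemma linear_in_subspace:
  assumes "Vector_Spaces.linear s1 s2 f" "module.subspace s2 S" "\<And>x. x \<in> A \<Longrightarrow> f x \<in> S"
    "x \<in> module.span s1 A"
  shows "f x \<in> S"
proof -
  interpret Vector_Spaces.linear s1 s2 f by fact
  have "vs1.subspace {x. f x \<in> S}" using assms(2)
    by (auto simp: vs1.subspace_def vs2.subspace_def add scale zero)
  then have "vs1.span A \<subseteq> {x. f x \<in> S}" using assms(3) by (intro vs1.span_minimal) auto
  then show ?thesis using assms(4) by auto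
qed

section \<open>Presentations of module records\<close>

text \<open>The records carry no vector space axioms and their elements are nested cosets. A
  presentation transports computations to a subspace \<open>D\<close> of a type-class vector space;
  equality in the record is then decided by the kernel of \<open>q\<close>, see
  \<open>q_eq\<close>.\<close>

definition pres :: "(rat \<Rightarrow> 'b \<Rightarrow> 'b::ab_group_add) \<Rightarrow> 'b set \<Rightarrow> (rat, 'x) module \<Rightarrow> ('b \<Rightarrow> 'x) \<Rightarrow> bool" where
  "pres s D V q \<longleftrightarrow> vector_space s \<and> module.subspace s D \<and> q ` D = carrier V \<and> \<zero>\<^bsub>V\<^esub> = q 0 \<and>
     (\<forall>x\<in>D. \<forall>y\<in>D. q x \<oplus>\<^bsub>V\<^esub> q y = q (x + y)) \<and> (\<forall>c. \<forall>x\<in>D. c \<odot>\<^bsub>V\<^esub> q x = q (s c x))"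

locale presentation =
  fixes s :: "rat \<Rightarrow> 'b \<Rightarrow> 'b::ab_group_add" and D :: "'b set" and V :: "(rat, 'x) module" and q :: "'b \<Rightarrow> 'x"
  assumes pres: "pres s D V q"
begin

sublocale vs: vector_space s using pres by (simp add: pres_def)

lemma subD: "vs.subspace D" and im: "q ` D = carrier V" and zero: "\<zero>\<^bsub>V\<^esub> = q 0"
  and add: "\<And>x y. x \<in> D \<Longrightarrow> y \<in> D \<Longrightarrow> q x \<oplus>\<^bsub>V\<^esub> q y = q (x + y)"
  and smul: "\<And>c x. x \<in> D \<Longrightarrow> c \<odot>\<^bsub>V\<^esub> q x = q (s c x)"
  using pres by (auto simp: pres_def)

lemma D0 [simp, intro]: "0 \<in> D" and Dadd [intro]: "x \<in> D \<Longrightarrow> y \<in> D \<Longrightarrow> x + y \<in> D"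
  and Dscale [intro]: "x \<in> D \<Longrightarrow> s c x \<in> D" and Dminus [intro]: "x \<in> D \<Longrightarrow> y \<in> D \<Longrightarrow> x - y \<in> D"
  and Dneg [intro]: "x \<in> D \<Longrightarrow> - x \<in> D"
  using vs.subspace_0[OF subD] vs.subspace_add[OF subD] vs.subspace_scale[OF subD]
    vs.subspace_diff[OF subD] vs.subspace_neg[OF subD] by simp_all

lemma q_carrier [intro]: "x \<in> D \<Longrightarrow> q x \<in> carrier V"
  using im by blast

lemma q_eq: "x \<in> D \<Longrightarrow> y \<in> D \<Longrightarrow> q x = q y \<longleftrightarrow> q (x - y) = q 0"
proof
  assume D: "x \<in> D" "y \<in> D"
  { assume "q x = q y"
    then have "q x \<oplus>\<^bsub>V\<^esub> q (- y) = q y \<oplus>\<^bsub>V\<^esub> q (- y)" by simp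
    then show "q (x - y) = q 0" using D add[of _ "- y"] by (simp add: Dneg) }
  assume "q (x - y) = q 0"
  then have "q (x - y) \<oplus>\<^bsub>V\<^esub> q y = q 0 \<oplus>\<^bsub>V\<^esub> q y" by simp
  then show "q x = q y" using D add[of _ y] by (simp add: Dminus)
qed

text \<open>\<open>submodule\<close> rests on the group structure of \<open>add_monoid V\<close>,
  whose inverse is a definite description; uniqueness comes from \<open>q_eq\<close>.\<close>

lemma inv_q: assumes "x \<in> D" shows "inv\<^bsub>add_monoid V\<^esub> (q x) = q (- x)"
proof -
  have "(THE y. y \<in> carrier V \<and> q x \<oplus>\<^bsub>V\<^esub> y = q 0 \<and> y \<oplus>\<^bsub>V\<^esub> q x = q 0) = q (- x)"
  proof (rule the_equality)
    show "q (- x) \<in> carrier V \<and> q x \<oplus>\<^bsub>V\<^esub> q (- x) = q 0 \<and> q (- x) \<oplus>\<^bsub>V\<^esub> q x = q 0"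
      using assms Dneg[OF assms] by (simp add: add q_carrier)
  next
    fix y assume y: "y \<in> carrier V \<and> q x \<oplus>\<^bsub>V\<^esub> y = q 0 \<and> y \<oplus>\<^bsub>V\<^esub> q x = q 0"
    then obtain z where z: "z \<in> D" "y = q z" using im by blast
    with y assms have "q (x + z) = q 0" by (simp add: add)
    moreover have "x + z = z - (- x)" by simp
    ultimately show "y = q (- x)" using q_eq[of z "- x"] z assms by (simp add: Dneg)
  qed
  then show ?thesis by (simp add: m_inv_def zero)
qed

lemma submodule_image: assumes "vs.subspace K" "K \<subseteq> D" shows "submodule (q ` K) rat_space V"
proof -
  have "subgroup (q ` K) (add_monoid V)"
  proof
    show "q ` K \<subseteq> carrier (add_monoid V)" using assms im by auto
    show "\<one>\<^bsub>add_monoid V\<^esub> \<in> q ` K" using vs.subspace_0[OF assms(1)] by (simp add: zero)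
  next
    fix x y assume "x \<in> q ` K" "y \<in> q ` K"
    then obtain a b where "a \<in> K" "x = q a" "b \<in> K" "y = q b" by blast
    then show "x \<otimes>\<^bsub>add_monoid V\<^esub> y \<in> q ` K"
      using assms add[of a b] vs.subspace_add[OF assms(1), of a b] by auto
  next
    fix x assume "x \<in> q ` K"
    then obtain a where "a \<in> K" "x = q a" by blast
    then show "inv\<^bsub>add_monoid V\<^esub> x \<in> q ` K"
      using assms inv_q[of a] vs.subspace_neg[OF assms(1), of a] by auto
  qed
  moreover have "c \<odot>\<^bsub>V\<^esub> x \<in> q ` K" if "x \<in> q ` K" for c x
    using that assms smul vs.subspace_scale[OF assms(1)] by blast
  ultimately show ?thesis by (simp add: submodule_def submodule_axioms_def)
qed

lemma submodule_vimage: assumes "submodule H rat_space V" shows "vs.subspace {x \<in> D. q x \<in> H}" "H \<subseteq> carrier V"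
proof -
  interpret submodule H rat_space V by fact
  show "H \<subseteq> carrier V" using subset by simp
  show "vs.subspace {x \<in> D. q x \<in> H}"
  proof (rule vs.subspaceI)
    show "0 \<in> {x \<in> D. q x \<in> H}" using one_closed by (simp add: zero)
    fix x y assume "x \<in> {x \<in> D. q x \<in> H}" "y \<in> {x \<in> D. q x \<in> H}"
    then show "x + y \<in> {x \<in> D. q x \<in> H}" using m_closed[of "q x" "q y"] by (auto simp: add)
  next
    fix x c assume "x \<in> {x \<in> D. q x \<in> H}"
    then show "s c x \<in> {x \<in> D. q x \<in> H}" using smult_closed[of c "q x"] by (auto simp: smul rat_space_def)
  qed
qed

lemma span_subset_D: "S \<subseteq> D \<Longrightarrow> vs.span S \<subseteq> D"
  using vs.span_minimal subD by blast

lemma lin_span_image: assumes "S \<subseteq> D" shows "lin_span V (q ` S) = q ` vs.span S"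
proof
  show "lin_span V (q ` S) \<subseteq> q ` vs.span S"
    unfolding lin_span_def
    using submodule_image[OF vs.subspace_span span_subset_D[OF assms]] vs.span_superset[of S] by blast
  show "q ` vs.span S \<subseteq> lin_span V (q ` S)"
    unfolding lin_span_def
  proof (rule Inter_greatest, clarify)
    fix H x assume H: "submodule H rat_space V" "q ` S \<subseteq> H" and x: "x \<in> vs.span S"
    have "vs.span S \<subseteq> {x \<in> D. q x \<in> H}"
      using H assms by (intro vs.span_minimal submodule_vimage) auto
    then show "q x \<in> H" using x by blast
  qed
qed

text \<open>Elements of a quotient are cosets of \<open>q ` K\<close>, where \<open>K\<close> contains the kernel of \<open>q\<close>.\<close>

definition coset :: "'b set \<Rightarrow> 'b \<Rightarrow> 'x set" where
  "coset K x = (q ` K) +>\<^bsub>V\<^esub> q x"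

lemma coset_eq: assumes "vs.subspace K" "K \<subseteq> D" "x \<in> D" shows "coset K x = {q (k + x) | k. k \<in> K}"
proof -
  have "coset K x = (\<lambda>k. q k \<oplus>\<^bsub>V\<^esub> q x) ` K" unfolding coset_def a_r_coset_def r_coset_def by auto
  then show ?thesis using assms by (auto simp: add subset_iff)
qed

lemma coset_mem: assumes "vs.subspace K" "K \<subseteq> D" "\<And>x. x \<in> D \<Longrightarrow> q x = q 0 \<Longrightarrow> x \<in> K" "x \<in> D" "y \<in> D"
  shows "q y \<in> coset K x \<longleftrightarrow> y - x \<in> K"
proof
  assume "q y \<in> coset K x"
  then obtain k where k: "k \<in> K" "q y = q (k + x)" using coset_eq[OF assms(1,2,4)] by auto
  have kD: "k + x \<in> D" using k(1) assms(2,4) by (simp add: Dadd subset_iff)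
  then have "q (y - (k + x)) = q 0" using q_eq[of y "k + x"] assms(5) k(2) by simp
  then have "y - (k + x) \<in> K" by (rule assms(3)[OF Dminus[OF assms(5) kD]])
  then have "y - (k + x) + k \<in> K" using k vs.subspace_add[OF assms(1)] by blast
  then show "y - x \<in> K" by (simp add: algebra_simps)
next
  assume "y - x \<in> K" then show "q y \<in> coset K x"
    unfolding coset_eq[OF assms(1,2,4)] by (intro CollectI exI[of _ "y - x"]) simp
qed

lemma coset_eq_iff: assumes "vs.subspace K" "K \<subseteq> D" "\<And>x. x \<in> D \<Longrightarrow> q x = q 0 \<Longrightarrow> x \<in> K" "x \<in> D" "y \<in> D"
  shows "coset K x = coset K y \<longleftrightarrow> x - y \<in> K"
proof
  assume "coset K x = coset K y"
  moreover have "q x \<in> coset K x" using coset_mem[OF assms(1-3), of x x] assms vs.subspace_0 by simp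
  ultimately show "x - y \<in> K" using coset_mem[OF assms(1-3), of y x] assms by simp
next
  have *: "coset K x \<subseteq> coset K y" if xy: "x - y \<in> K" "x \<in> D" "y \<in> D" for x y
  proof
    fix z assume "z \<in> coset K x"
    then obtain k where k: "k \<in> K" "z = q (k + x)" using coset_eq[OF assms(1,2) xy(2)] by auto
    have "k + (x - y) \<in> K" using k xy vs.subspace_add[OF assms(1)] by blast
    then show "z \<in> coset K y" unfolding coset_eq[OF assms(1,2) xy(3)]
      using k by (intro CollectI exI[of _ "k + (x - y)"]) (simp add: algebra_simps)
  qed
  assume "x - y \<in> K"
  moreover then have "y - x \<in> K" using vs.subspace_neg[OF assms(1)] by fastforce
  ultimately show "coset K x = coset K y" using * assms by blast
qed

lemma pres_quot:
  assumes K: "vs.subspace K" "K \<subseteq> D" "\<And>x. x \<in> D \<Longrightarrow> q x = q 0 \<Longrightarrow> x \<in> K"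
  shows "pres s D (quot_space V (q ` K)) (coset K)"
  unfolding pres_def
proof (intro conjI ballI allI)
  show "vector_space s" "vs.subspace D" by (rule vs.vector_space_axioms subD)+
  show "coset K ` D = carrier (quot_space V (q ` K))"
    unfolding quot_space_def A_RCOSETS_def RCOSETS_def coset_def a_r_coset_def
    by (simp add: im[symmetric] image_image) blast
  show "\<zero>\<^bsub>quot_space V (q ` K)\<^esub> = coset K 0"
    by (auto simp: quot_space_def coset_eq[OF K(1,2)])
next
  fix x y assume xy: "x \<in> D" "y \<in> D"
  have "coset K x <+>\<^bsub>V\<^esub> coset K y = {a \<oplus>\<^bsub>V\<^esub> b | a b. a \<in> coset K x \<and> b \<in> coset K y}"
    unfolding set_add_def set_mult_def by auto
  also have "\<dots> = {q (k + x) \<oplus>\<^bsub>V\<^esub> q (l + y) | k l. k \<in> K \<and> l \<in> K}"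
    using xy by (auto simp: coset_eq[OF K(1,2)])
  also have "\<dots> = {q (k + x + (l + y)) | k l. k \<in> K \<and> l \<in> K}"
  proof -
    have "q (k + x) \<oplus>\<^bsub>V\<^esub> q (l + y) = q (k + x + (l + y))" if "k \<in> K" "l \<in> K" for k l
      using that xy K(2) by (intro add) auto
    then show ?thesis by (intro Collect_cong) metis
  qed
  also have "\<dots> = coset K (x + y)"
    unfolding coset_eq[OF K(1,2) Dadd[OF xy]]
  proof (intro equalityI subsetI; clarify)
    fix k l assume "k \<in> K" "l \<in> K"
    then show "\<exists>k'. q (k + x + (l + y)) = q (k' + (x + y)) \<and> k' \<in> K"
      using vs.subspace_add[OF K(1)] by (intro exI[of _ "k + l"]) (simp add: algebra_simps)
  next
    fix k assume "k \<in> K"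
    then show "\<exists>k' l. q (k + (x + y)) = q (k' + x + (l + y)) \<and> k' \<in> K \<and> l \<in> K"
      using vs.subspace_0[OF K(1)] by (intro exI[of _ k] exI[of _ 0]) (simp add: algebra_simps)
  qed
  finally show "coset K x \<oplus>\<^bsub>quot_space V (q ` K)\<^esub> coset K y = coset K (x + y)"
    by (simp add: quot_space_def)
next
  fix c x assume x: "x \<in> D"
  have "(\<Union>a\<in>coset K x. (q ` K) +>\<^bsub>V\<^esub> (c \<odot>\<^bsub>V\<^esub> a)) = (\<Union>k\<in>K. coset K (s c (k + x)))"
  proof -
    have "(q ` K) +>\<^bsub>V\<^esub> (c \<odot>\<^bsub>V\<^esub> q (k + x)) = coset K (s c (k + x))" if "k \<in> K" for k
      using that K x unfolding coset_def by (subst smul) auto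
    moreover have "coset K x = (\<lambda>k. q (k + x)) ` K" using coset_eq[OF K(1,2) x] by auto
    ultimately show ?thesis by auto
  qed
  also have "\<dots> = (\<Union>k\<in>K. coset K (s c x))"
  proof (rule SUP_cong[OF refl])
    fix k assume k: "k \<in> K"
    have "s c (k + x) - s c x \<in> K" using vs.subspace_scale[OF K(1) k] by (simp add: vs.scale_right_distrib)
    then show "coset K (s c (k + x)) = coset K (s c x)"
      using coset_eq_iff[OF K, of "s c (k + x)" "s c x"] k x K(2) by blast
  qed
  also have "\<dots> = coset K (s c x)" using vs.subspace_0[OF K(1)] by auto
  finally show "c \<odot>\<^bsub>quot_space V (q ` K)\<^esub> coset K x = coset K (s c x)"
    by (simp add: quot_space_def)
qed

text \<open>\<open>rcoset_mult\<close> is a union over all pairs of representatives. It collapses to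
  a single coset when changing both representatives within \<open>K\<close> changes the product
  within \<open>K\<close>, which is the hypothesis \<open>mK\<close>; two-sided ideals satisfy
  it.\<close>

lemma quot_mult:
  assumes K: "vs.subspace K" "K \<subseteq> D" "\<And>x. x \<in> D \<Longrightarrow> q x = q 0 \<Longrightarrow> x \<in> K"
    and m: "\<And>x y. x \<in> D \<Longrightarrow> y \<in> D \<Longrightarrow> m x y \<in> D \<and> q x \<otimes>\<^bsub>V\<^esub> q y = q (m x y)"
    and mK: "\<And>k l. k \<in> K \<Longrightarrow> l \<in> K \<Longrightarrow> m (k + x) (l + y) - m x y \<in> K"
    and xy: "x \<in> D" "y \<in> D"
  shows "coset K x \<otimes>\<^bsub>quot_space V (q ` K)\<^esub> coset K y = coset K (m x y)"
proof -
  have "(\<Union>a\<in>coset K x. \<Union>b\<in>coset K y. (q ` K) +>\<^bsub>V\<^esub> (a \<otimes>\<^bsub>V\<^esub> b))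
    = (\<Union>k\<in>K. \<Union>l\<in>K. coset K (m (k + x) (l + y)))"
  proof -
    have "(q ` K) +>\<^bsub>V\<^esub> (q (k + x) \<otimes>\<^bsub>V\<^esub> q (l + y)) = coset K (m (k + x) (l + y))"
      if "k \<in> K" "l \<in> K" for k l
      using that K xy m[of "k + x" "l + y"] unfolding coset_def by (auto simp: subset_iff Dadd)
    moreover have "coset K x = (\<lambda>k. q (k + x)) ` K" "coset K y = (\<lambda>k. q (k + y)) ` K"
      using coset_eq[OF K(1,2)] xy by auto
    ultimately show ?thesis by auto
  qed
  also have "\<dots> = (\<Union>k\<in>K. \<Union>l\<in>K. coset K (m x y))"
  proof (intro SUP_cong refl)
    fix k l assume kl: "k \<in> K" "l \<in> K"
    then have "m (k + x) (l + y) \<in> D" "m x y \<in> D" using m xy K(2) by blast+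
    then show "coset K (m (k + x) (l + y)) = coset K (m x y)"
      using coset_eq_iff[OF K] mK[OF kl] by blast
  qed
  also have "\<dots> = coset K (m x y)" using vs.subspace_0[OF K(1)] by auto
  finally show ?thesis by (simp add: quot_space_def rcoset_mult_def)
qed

end

lemma lin_maps_step:
  assumes "f \<in> lin_maps V W" "pres s D V q" "pres s' D' W r"
  shows "x \<in> D \<Longrightarrow> y \<in> D \<Longrightarrow> f (q (s c x + y)) = c \<odot>\<^bsub>W\<^esub> f (q x) \<oplus>\<^bsub>W\<^esub> f (q y)" "f (q 0) = r 0"
proof -
  interpret V: presentation s D V q using assms(2) by unfold_locales
  interpret W: presentation s' D' W r using assms(3) by unfold_locales
  { assume xy: "x \<in> D" "y \<in> D"
    then have "q (s c x + y) = c \<odot>\<^bsub>V\<^esub> q x \<oplus>\<^bsub>V\<^esub> q y" by (simp add: V.smul V.add V.Dscale)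
    then show "f (q (s c x + y)) = c \<odot>\<^bsub>W\<^esub> f (q x) \<oplus>\<^bsub>W\<^esub> f (q y)"
      using assms(1) xy V.q_carrier[OF xy(1)] V.q_carrier[OF xy(2)] V.q_carrier[OF V.Dscale[OF xy(1)], of c]
      by (simp add: lin_maps_def flip: V.smul) }
  have "f (q 0) \<in> carrier W" using assms(1) V.q_carrier[of 0] by (auto simp: lin_maps_def)
  then obtain z where z: "z \<in> D'" "f (q 0) = r z" using W.im by (metis imageE)
  have "f (0 \<odot>\<^bsub>V\<^esub> q 0) = 0 \<odot>\<^bsub>W\<^esub> f (q 0)"
    using assms(1) V.q_carrier[of 0] by (auto simp: lin_maps_def)
  then show "f (q 0) = r 0" using z by (simp add: V.smul W.smul)
qed

text \<open>Off the carrier both maps take the default value of extensional functions, so agreement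
  on a spanning set forces equality as functions. The definite descriptions need uniqueness in this
  strong form.\<close>

lemma lin_maps_eqI:
  assumes f: "f \<in> lin_maps V W" and g: "g \<in> lin_maps V W" and p: "pres s (module.span s S) V q"
    and r: "pres s' D' W r" and eq: "\<And>x. x \<in> S \<Longrightarrow> f (q x) = g (q x)"
  shows "f = g"
proof -
  interpret presentation s "module.span s S" V q using p by unfold_locales
  have "f (q x) = g (q x) \<and> x \<in> vs.span S" if "x \<in> vs.span S" for x
    using that
  proof (induction rule: vs.span_induct_alt)
    case base
    show ?case using lin_maps_step(2)[OF f p r] lin_maps_step(2)[OF g p r] by simp
  next
    case (step c x y)
    then have "x \<in> vs.span S" by (simp add: vs.span_base)
    then show ?case using lin_maps_step(1)[OF f p r] lin_maps_step(1)[OF g p r] step eq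
      by (simp add: vs.span_add vs.span_scale)
  qed
  then have "f v = g v" if "v \<in> carrier V" for v using that im by (metis imageE)
  moreover have "f v = g v" if "v \<notin> carrier V" for v
    using that f g by (auto simp: lin_maps_def PiE_def extensional_def)
  ultimately show ?thesis by blast
qed

text \<open>Supplies the existence half for the maps given by definite descriptions: a linear map of
  representatives descends as soon as it respects the kernel, which by linearity needs testing only
  against zero.\<close>

lemma lin_maps_descend:
  assumes V: "pres s D V q" and W: "pres s' D' W r" and L: "\<And>x. x \<in> D \<Longrightarrow> L x \<in> D'"
    and add: "\<And>x y. x \<in> D \<Longrightarrow> y \<in> D \<Longrightarrow> L (x + y) = L x + L y"
    and scl: "\<And>c x. x \<in> D \<Longrightarrow> L (s c x) = s' c (L x)"
    and ker: "\<And>x. x \<in> D \<Longrightarrow> q x = q 0 \<Longrightarrow> r (L x) = r 0"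
  shows "\<exists>f\<in>lin_maps V W. \<forall>x\<in>D. f (q x) = r (L x)"
proof -
  interpret V: presentation s D V q using assms(1) by unfold_locales
  interpret W: presentation s' D' W r using assms(2) by unfold_locales
  define f where "f = (\<lambda>v\<in>carrier V. r (L (SOME x. x \<in> D \<and> q x = v)))"
  have f: "f (q x) = r (L x)" if "x \<in> D" for x
  proof -
    define y where "y = (SOME y. y \<in> D \<and> q y = q x)"
    have y: "y \<in> D" "q y = q x" using someI[of "\<lambda>y. y \<in> D \<and> q y = q x" x] that by (auto simp: y_def)
    then have "r (L (y - x)) = r 0" using V.q_eq[of y x] ker[of "y - x"] that by (simp add: V.Dminus)
    moreover have "L (y - x) = L y - L x" using add[of "y - x" x] that y by (simp add: V.Dminus)
    ultimately have "r (L y) = r (L x)" using W.q_eq[of "L y" "L x"] L y that by simp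
    then show ?thesis using that by (simp add: f_def y_def V.q_carrier)
  qed
  have "f \<in> lin_maps V W"
    unfolding lin_maps_def
  proof (intro CollectI conjI ballI allI)
    show "f \<in> carrier V \<rightarrow>\<^sub>E carrier W"
    proof (rule PiE_I)
      fix v assume "v \<in> carrier V" then obtain x where "x \<in> D" "v = q x" using V.im by blast
      then show "f v \<in> carrier W" using f L by (simp add: W.q_carrier)
    qed (simp add: f_def)
    fix v assume "v \<in> carrier V" then obtain x where x: "x \<in> D" "v = q x" using V.im by blast
    then show "f (c \<odot>\<^bsub>V\<^esub> v) = c \<odot>\<^bsub>W\<^esub> f v" for c using f L scl by (simp add: V.smul W.smul V.Dscale)
    fix w assume "w \<in> carrier V" then obtain y where "y \<in> D" "w = q y" using V.im by blast
    then show "f (v \<oplus>\<^bsub>V\<^esub> w) = f v \<oplus>\<^bsub>W\<^esub> f w" using x f L add by (simp add: V.add W.add V.Dadd)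
  qed
  then show ?thesis using f by blast
qed


section \<open>Tensor products and separation by functionals\<close>

lemma pm_induct [case_names single add scale]:
  assumes "\<And>x. P (single x 1)" "\<And>p q. P p \<Longrightarrow> P q \<Longrightarrow> P (p + q)" "\<And>c p. P p \<Longrightarrow> P (scale c p)"
  shows "P p"
proof -
  have 0: "P 0" using assms(3)[OF assms(1), of 0] by (simp add: pm.scale_zero_left)
  have "P (\<Sum>x\<in>A. scale (lookup p x) (single x 1))" if "finite A" for A
    using that
  proof (induction A rule: finite_induct)
    case empty then show ?case using 0 by simp
  next
    case (insert a A)
    show ?case unfolding sum.insert[OF insert.hyps(1,2)] by (intro assms insert.IH)
  qed
  from this[of "keys p"] show ?thesis using pm_sum_scale[of p] by simp
qed

definition pairing :: "('x \<Rightarrow> rat) \<Rightarrow> ('x \<Rightarrow>\<^sub>0 rat) \<Rightarrow> rat" where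
  "pairing = lin_ext (*)"

lemma linear_pairing: "Vector_Spaces.linear scale (*) (pairing \<xi>)"
  unfolding pairing_def by (rule lin_rat)

lemma pairing_add: "pairing \<xi> (p + q) = pairing \<xi> p + pairing \<xi> q"
  and pairing_diff: "pairing \<xi> (p - q) = pairing \<xi> p - pairing \<xi> q"
  and pairing_scale: "pairing \<xi> (scale c p) = c * pairing \<xi> p"
  and pairing_0 [simp]: "pairing \<xi> 0 = 0"
  and pairing_sum: "pairing \<xi> (sum f A) = (\<Sum>x\<in>A. pairing \<xi> (f x))"
proof -
  interpret Vector_Spaces.linear scale "(*)" "pairing \<xi>" by (rule linear_pairing)
  show "pairing \<xi> (p + q) = pairing \<xi> p + pairing \<xi> q" "pairing \<xi> (p - q) = pairing \<xi> p - pairing \<xi> q"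
    "pairing \<xi> (scale c p) = c * pairing \<xi> p" "pairing \<xi> 0 = 0"
    "pairing \<xi> (sum f A) = (\<Sum>x\<in>A. pairing \<xi> (f x))"
    by (simp_all add: add diff scale sum)
qed

lemma pairing_single [simp]: "pairing \<xi> (single x c) = c * \<xi> x"
  unfolding pairing_def by (rule lin_ext_single[OF vector_space_rat])

lemma pairing_eq: "pairing \<xi> p = (\<Sum>x\<in>keys p. lookup p x * \<xi> x)"
  by (simp add: pairing_def lin_ext_def)

lemma subspace_pairing_0: "pm.subspace {p. pairing \<xi> p = 0}"
  by (rule pm.subspaceI) (simp_all add: pairing_add pairing_scale)

lemma pairing_fun_cong: "(\<And>x. x \<in> keys p \<Longrightarrow> \<xi> x = \<eta> x) \<Longrightarrow> pairing \<xi> p = pairing \<eta> p"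
  by (simp add: pairing_eq)

lemma pairing_lin_ext: "pairing \<xi> (lin_ext scale f p) = pairing (\<lambda>x. pairing \<xi> (f x)) p"
  unfolding pairing_eq[of "\<lambda>x. pairing \<xi> (f x)"] lin_ext_def by (simp add: pairing_sum pairing_scale)

text \<open>Identifies the tensor product of two free spaces with the free space on pairs of basis
  elements.\<close>

definition otimes :: "('x \<Rightarrow>\<^sub>0 rat) \<Rightarrow> ('y \<Rightarrow>\<^sub>0 rat) \<Rightarrow> 'x \<times> 'y \<Rightarrow>\<^sub>0 rat" where
  "otimes p p' = lin_ext scale (\<lambda>u. lin_ext scale (\<lambda>v. single (u, v) 1) p') p"

lemma lin_scale_simps:
  "lin_ext scale f (p + q) = lin_ext scale f p + lin_ext scale f q"
  "lin_ext scale f (p - q) = lin_ext scale f p - lin_ext scale f q"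
  "lin_ext scale f (scale c p) = scale c (lin_ext scale f p)"
  "lin_ext scale f 0 = 0"
  "lin_ext scale f (sum g A) = (\<Sum>x\<in>A. lin_ext scale f (g x))"
proof -
  interpret Vector_Spaces.linear scale scale "lin_ext scale f" by (rule lin_scale)
  show "lin_ext scale f (p + q) = lin_ext scale f p + lin_ext scale f q"
  "lin_ext scale f (p - q) = lin_ext scale f p - lin_ext scale f q"
  "lin_ext scale f (scale c p) = scale c (lin_ext scale f p)"
  "lin_ext scale f 0 = 0"
  "lin_ext scale f (sum g A) = (\<Sum>x\<in>A. lin_ext scale f (g x))" by (simp_all add: add diff scale sum)
qed

lemma lin_ext_scale_single [simp]: "lin_ext scale f (single x c) = scale c (f x)"
  by (simp add: vector_space_scale)

lemma lookup_lin_ext: "lookup (lin_ext scale f p) a = pairing (\<lambda>x. lookup (f x) a) p"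
  by (simp add: lin_ext_def pairing_eq lookup_sum)

lemma pairing_delta: "pairing (\<lambda>x. if x = a then c else 0) p = lookup p a * c"
  by (simp add: pairing_eq if_distrib[of "\<lambda>x. _ * x"] sum.delta in_keys_iff cong: if_cong)

lemma lookup_otimes: "lookup (otimes p p') (a, b) = lookup p a * lookup p' b"
proof -
  have "lookup (otimes p p') (a, b) = pairing (\<lambda>u. pairing (\<lambda>v. lookup (single (u, v) 1) (a, b)) p') p"
    by (simp add: otimes_def lookup_lin_ext)
  also have "(\<lambda>u. pairing (\<lambda>v. lookup (single (u, v) 1) (a, b)) p') = (\<lambda>u. if u = a then lookup p' b else 0)"
  proof
    fix u
    have "pairing (\<lambda>v. lookup (single (u, v) 1) (a, b)) p' = pairing (\<lambda>v. if v = b then (if u = a then 1 else 0) else 0) p'"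
      by (intro pairing_fun_cong) (auto simp: lookup_single when_def)
    then show "pairing (\<lambda>v. lookup (single (u, v) 1) (a, b)) p' = (if u = a then lookup p' b else 0)"
      by (simp add: pairing_delta)
  qed
  finally show ?thesis by (simp add: pairing_delta)
qed

lemma otimes_simps:
  "otimes (p + q) t = otimes p t + otimes q t" "otimes (p - q) t = otimes p t - otimes q t"
  "otimes t (p' + q') = otimes t p' + otimes t q'" "otimes t (p' - q') = otimes t p' - otimes t q'"
  "otimes (scale c p) t = scale c (otimes p t)" "otimes t (scale c p') = scale c (otimes t p')"
  "otimes 0 t = 0" "otimes t 0 = 0" "otimes (single u c) (single v d) = single (u, v) (c * d)"
  by (auto intro!: poly_mapping_eqI simp: lookup_otimes lookup_add lookup_minus algebra_simps
      lookup_single when_def)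

lemma pairing_otimes: "pairing (\<lambda>(u, v). \<xi> u * \<eta> v) (otimes p p') = pairing \<xi> p * pairing \<eta> p'"
proof -
  have "pairing (\<lambda>(u, v). \<xi> u * \<eta> v) (otimes p p') = pairing (\<lambda>u. pairing (\<lambda>v. \<xi> u * \<eta> v) p') p"
    by (simp add: otimes_def pairing_lin_ext)
  also have "\<dots> = pairing \<xi> p * pairing \<eta> p'"
  proof -
    have "pairing (\<lambda>v. \<xi> u * \<eta> v) p' = pairing \<eta> p' * \<xi> u" for u
      by (simp add: pairing_eq sum_distrib_left mult_ac)
    moreover have "pairing (\<lambda>u. c * \<xi> u) p = pairing \<xi> p * c" for c
      by (simp add: pairing_eq sum_distrib_left mult_ac)
    ultimately show ?thesis by simp
  qed
  finally show ?thesis .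
qed

text \<open>If \<open>J\<close> and \<open>J'\<close> are the kernels of two surjections from free
  spaces, this is the kernel of their tensor product, see \<open>tq_ker\<close>.\<close>

definition tensor_ker :: "('x \<Rightarrow>\<^sub>0 rat) set \<Rightarrow> ('y \<Rightarrow>\<^sub>0 rat) set \<Rightarrow> ('x \<times> 'y \<Rightarrow>\<^sub>0 rat) set" where
  "tensor_ker J J' = pm.span ({otimes j t | j t. j \<in> J} \<union> {otimes t j | t j. j \<in> J'})"

lemma tensor_ker_left: "j \<in> J \<Longrightarrow> otimes j t \<in> tensor_ker J J'"
  and tensor_ker_right: "j' \<in> J' \<Longrightarrow> otimes t' j' \<in> tensor_ker J J'"
  and subspace_tensor_ker: "pm.subspace (tensor_ker J J')"
  by (auto simp: tensor_ker_def pm.subspace_span intro!: pm.span_base)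

lemma tensor_ker_diff:
  assumes "p - p' \<in> J" "t - t' \<in> J'" shows "otimes p t - otimes p' t' \<in> tensor_ker J J'"
proof -
  have "otimes p t - otimes p' t' = otimes (p - p') t + otimes p' (t - t')" by (simp add: otimes_simps)
  then show ?thesis
    by (simp only:) (intro pm.subspace_add subspace_tensor_ker tensor_ker_left tensor_ker_right assms)
qed

lemma pairing_tensor_ker:
  assumes "x \<in> tensor_ker J J'" "\<And>j. j \<in> J \<Longrightarrow> pairing \<xi> j = 0" "\<And>j. j \<in> J' \<Longrightarrow> pairing \<eta> j = 0"
  shows "pairing (\<lambda>(u, v). \<xi> u * \<eta> v) x = 0"
proof -
  have "pairing (\<lambda>(u, v). \<xi> u * \<eta> v) x \<in> {0}"
  proof (rule linear_in_subspace[OF linear_pairing])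
    show "module.subspace (*) {0::rat}"
    proof -
      interpret vector_space "(*) :: rat \<Rightarrow> _" by (rule vector_space_rat)
      show ?thesis by (rule subspace_single_0)
    qed
    show "x \<in> pm.span ({otimes j t | j t. j \<in> J} \<union> {otimes t j | t j. j \<in> J'})"
      using assms(1) by (simp add: tensor_ker_def)
  qed (use assms in \<open>auto simp: pairing_otimes\<close>)
  then show ?thesis by simp
qed

lemma tensor_ker_mono: "J \<subseteq> K \<Longrightarrow> J' \<subseteq> K' \<Longrightarrow> tensor_ker J J' \<subseteq> tensor_ker K K'"
  unfolding tensor_ker_def by (intro pm.span_mono) blast

subsection \<open>Graded projections\<close>

definition hpart :: "('x \<Rightarrow> 'g) \<Rightarrow> 'g \<Rightarrow> ('x \<Rightarrow>\<^sub>0 rat) \<Rightarrow> 'x \<Rightarrow>\<^sub>0 rat" where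
  "hpart deg g = lin_ext scale (\<lambda>x. if deg x = g then single x 1 else 0)"

lemma lookup_hpart: "lookup (hpart deg g p) x = (if deg x = g then lookup p x else 0)"
proof (induction p rule: pm_induct)
  case (single y)
  then show ?case by (auto simp: hpart_def lookup_single when_def)
qed (simp_all add: hpart_def lin_scale_simps lookup_add)

lemma keys_hpart: "keys (hpart deg g p) = {x \<in> keys p. deg x = g}"
  by (auto simp: in_keys_iff lookup_hpart split: if_splits)

lemma hpart_simps: "hpart deg g (p + q) = hpart deg g p + hpart deg g q"
  "hpart deg g (p - q) = hpart deg g p - hpart deg g q"
  "hpart deg g (scale c p) = scale c (hpart deg g p)"
  by (simp_all add: hpart_def lin_scale_simps)

lemma sum_hpart: "finite A \<Longrightarrow> deg ` keys p \<subseteq> A \<Longrightarrow> p = (\<Sum>g\<in>A. hpart deg g p)"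
proof (rule poly_mapping_eqI)
  fix k assume *: "finite A" "deg ` keys p \<subseteq> A"
  then have "k \<in> keys p \<Longrightarrow> deg k \<in> A" by blast
  then show "lookup p k = lookup (\<Sum>g\<in>A. hpart deg g p) k"
    using * by (cases "deg k \<in> A") (auto simp: lookup_sum lookup_hpart in_keys_iff)
qed

definition graded_subspace :: "('x \<Rightarrow> 'g) \<Rightarrow> ('x \<Rightarrow>\<^sub>0 rat) set \<Rightarrow> bool" where
  "graded_subspace deg J \<longleftrightarrow> pm.subspace J \<and> (\<forall>p\<in>J. \<forall>g. hpart deg g p \<in> J)"

lemma graded_subspace_span:
  assumes "\<And>p. p \<in> S \<Longrightarrow> \<exists>g. \<forall>x\<in>keys p. deg x = g"
  shows "graded_subspace deg (pm.span S)"
proof -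
  have "hpart deg g p \<in> pm.span S" if "p \<in> pm.span S" for p g
  proof (rule linear_in_subspace[OF lin_scale[of "\<lambda>x. if deg x = g then single x 1 else 0", folded hpart_def] _ _ that])
    show "pm.subspace (pm.span S)" by simp
    fix p assume "p \<in> S"
    with assms obtain h where "\<forall>x\<in>keys p. deg x = h" by blast
    then have "hpart deg g p = (if g = h then p else 0)"
      by (auto intro!: poly_mapping_eqI simp: lookup_hpart in_keys_iff)
    then show "hpart deg g p \<in> pm.span S" using \<open>p \<in> S\<close> by (auto simp: pm.span_base pm.span_zero)
  qed
  then show ?thesis by (auto simp: graded_subspace_def)
qed

text \<open>A basis of \<open>J\<close> is extended to the whole space; its members in
  \<open>J\<close> go to 0, the others to themselves. So \<pi> splits the quotient by
  \<open>J\<close>, and its coordinates are linear forms on the quotient.\<close>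

lemma projection_exists:
  assumes "pm.subspace J"
  shows "\<exists>\<pi>. Vector_Spaces.linear scale scale \<pi> \<and> (\<forall>p\<in>J. \<pi> p = 0) \<and> (\<forall>p. p - \<pi> p \<in> J)"
proof -
  obtain B where B: "B \<subseteq> J" "pm.independent B" "J \<subseteq> pm.span B" using pm.basis_exists by metis
  define C where "C = pm.extend_basis B"
  have C: "B \<subseteq> C" "pm.independent C" "pm.span C = UNIV"
    using pm.extend_basis_superset[OF B(2)] pm.independent_extend_basis[OF B(2)] pm.span_extend_basis[OF B(2)]
    by (simp_all add: C_def)
  interpret vector_space_pair "scale :: rat \<Rightarrow> ('a \<Rightarrow>\<^sub>0 rat) \<Rightarrow> _" "scale :: rat \<Rightarrow> ('a \<Rightarrow>\<^sub>0 rat) \<Rightarrow> _"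
    by unfold_locales
  obtain \<pi> where \<pi>: "Vector_Spaces.linear scale scale \<pi>" "\<forall>x\<in>C. \<pi> x = (if x \<in> B then 0 else x)"
    using linear_independent_extend[OF C(2), of "\<lambda>x. if x \<in> B then 0 else x"] by blast
  interpret pi: Vector_Spaces.linear scale scale \<pi> by fact
  have "\<pi> p = 0" if "p \<in> J" for p
  proof -
    have "\<pi> x \<in> {0}" if "x \<in> B" for x using that \<pi>(2) C(1) by auto
    moreover have "p \<in> pm.span B" using that B by blast
    ultimately have "\<pi> p \<in> {0}" by (rule linear_in_subspace[OF \<pi>(1) pm.subspace_single_0])
    then show ?thesis by simp
  qed
  moreover have "p - \<pi> p \<in> J" for p
  proof -
    have "Vector_Spaces.linear scale scale (\<lambda>p. p - \<pi> p)"
      by (simp add: Vector_Spaces.linear_iff vector_space_scale pi.add pi.scale pm.scale_right_diff_distrib)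
    moreover have "x - \<pi> x \<in> J" if "x \<in> C" for x using that \<pi>(2) B(1) pm.subspace_0[OF assms] by auto
    ultimately show ?thesis using linear_in_subspace[of scale scale "\<lambda>p. p - \<pi> p" J C p] C assms by auto
  qed
  ultimately show ?thesis using \<pi>(1) by blast
qed

text \<open>Of the image of a basis element \<open>u\<close> only the part of degree
  \<open>deg u\<close> is kept. On elements of one degree this is the homogeneous part of \<pi>, and
  \<open>J\<close> contains the homogeneous parts of its elements, so the truncated map still kills
  \<open>J\<close> and is the identity modulo \<open>J\<close>.\<close>

lemma graded_projection_exists:
  assumes "graded_subspace deg J"
  shows "\<exists>\<pi>. (\<forall>p\<in>J. lin_ext scale \<pi> p = 0) \<and> (\<forall>p. p - lin_ext scale \<pi> p \<in> J) \<and>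
    (\<forall>u. \<forall>x\<in>keys (\<pi> u). deg x = deg u)"
proof -
  have J: "pm.subspace J" "\<And>p g. p \<in> J \<Longrightarrow> hpart deg g p \<in> J" using assms by (auto simp: graded_subspace_def)
  obtain \<pi> where \<pi>: "Vector_Spaces.linear scale scale \<pi>" "\<forall>p\<in>J. \<pi> p = 0" "\<forall>p. p - \<pi> p \<in> J"
    using projection_exists[OF J(1)] by blast
  define \<rho> where "\<rho> u = hpart deg (deg u) (\<pi> (single u 1))" for u
  have hom: "lin_ext scale \<rho> p = hpart deg g (\<pi> p)" if "\<forall>x\<in>keys p. deg x = g" for p g
  proof -
    have "lin_ext scale \<rho> p = lin_ext scale (\<lambda>u. hpart deg g (\<pi> (single u 1))) p"
      unfolding lin_ext_def \<rho>_def using that by (intro sum.cong) auto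
    also have "\<dots> = hpart deg g (\<pi> p)"
    proof -
      interpret Vector_Spaces.linear scale scale \<pi> by fact
      have "Vector_Spaces.linear scale scale (\<lambda>p. hpart deg g (\<pi> p))"
        by (simp add: Vector_Spaces.linear_iff vector_space_scale hpart_simps add scale)
      from linear_lin_ext[OF this, of p] show ?thesis by simp
    qed
    finally show ?thesis .
  qed
  have "lin_ext scale \<rho> p = 0" if "p \<in> J" for p
  proof -
    have "lin_ext scale \<rho> p = lin_ext scale \<rho> (\<Sum>g\<in>deg ` keys p. hpart deg g p)"
      using sum_hpart[of "deg ` keys p" deg p] by simp
    also have "\<dots> = (\<Sum>g\<in>deg ` keys p. lin_ext scale \<rho> (hpart deg g p))"
      by (rule lin_scale_simps)
    also have "\<dots> = 0"
    proof (rule sum.neutral, clarify)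
      fix x
      have "lin_ext scale \<rho> (hpart deg (deg x) p) = hpart deg (deg x) (\<pi> (hpart deg (deg x) p))"
        by (rule hom) (simp add: keys_hpart)
      also have "\<dots> = 0" using \<pi>(2) J(2)[OF that] by (simp add: hpart_def lin_scale_simps)
      finally show "lin_ext scale \<rho> (hpart deg (deg x) p) = 0" .
    qed
    finally show ?thesis .
  qed
  moreover have "p - lin_ext scale \<rho> p \<in> J" for p
  proof (induction p rule: pm_induct)
    case (single x)
    have "single x 1 - lin_ext scale \<rho> (single x 1) = hpart deg (deg x) (single x 1 - \<pi> (single x 1))"
      by (simp add: \<rho>_def hpart_simps) (simp add: hpart_def)
    then show ?case using \<pi>(3) J(2) by simp
  next
    case (add p q)
    then show ?case using pm.subspace_add[OF J(1) add] by (simp add: lin_scale_simps algebra_simps)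
  next
    case (scale c p)
    then show ?case using pm.subspace_scale[OF J(1) scale, of c] by (simp add: lin_scale_simps pm.scale_right_diff_distrib)
  qed
  moreover have "\<forall>u. \<forall>x\<in>keys (\<rho> u). deg x = deg u" by (simp add: \<rho>_def keys_hpart)
  ultimately show ?thesis by blast
qed

text \<open>The forms that matter are the coordinates of a graded projection along \<open>J\<close>:
  each lives in one degree and kills \<open>J\<close>, and if all of them vanish on
  \<open>p\<close>, so does the projection of \<open>p\<close>. Forms living in one degree are
  automatically bounded below, as \<open>functional_representation\<close> demands.\<close>

lemma graded_separation:
  assumes J: "graded_subspace deg J"
    and "\<And>\<xi> a. (\<And>j. j \<in> J \<Longrightarrow> pairing \<xi> j = 0) \<Longrightarrow> (\<And>u. deg u \<noteq> a \<Longrightarrow> \<xi> u = 0) \<Longrightarrow> pairing \<xi> p = 0"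
  shows "p \<in> J"
proof -
  obtain \<pi> where \<pi>: "\<And>p. p \<in> J \<Longrightarrow> lin_ext scale \<pi> p = 0" "\<And>p. p - lin_ext scale \<pi> p \<in> J"
    "\<And>u x. x \<in> keys (\<pi> u) \<Longrightarrow> deg x = deg u"
    using graded_projection_exists[OF J] by metis
  have "lin_ext scale \<pi> p = 0"
  proof (rule poly_mapping_eqI)
    fix k
    have "pairing (\<lambda>u. lookup (\<pi> u) k) p = 0"
    proof (rule assms(2)[where a="deg k"])
      show "pairing (\<lambda>u. lookup (\<pi> u) k) j = 0" if "j \<in> J" for j
        using \<pi>(1)[OF that] by (simp flip: lookup_lin_ext)
      show "lookup (\<pi> u) k = 0" if "deg u \<noteq> deg k" for u using that \<pi>(3)[of k u] by (auto simp: in_keys_iff)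
    qed
    then show "lookup (lin_ext scale \<pi> p) k = lookup 0 k" by (simp add: lookup_lin_ext)
  qed
  then show ?thesis using \<pi>(2)[of p] by simp
qed

text \<open>Two graded projections are applied side by side. The coordinates of their tensor product
  are products of coordinates, so products of two forms separate the points of a tensor product of
  quotients of any dimension.\<close>

lemma tensor_ker_separation:
  assumes J: "graded_subspace deg J" and J': "graded_subspace deg' J'"
    and sep: "\<And>\<xi> \<eta> a b. (\<And>j. j \<in> J \<Longrightarrow> pairing \<xi> j = 0) \<Longrightarrow> (\<And>u. deg u \<noteq> a \<Longrightarrow> \<xi> u = 0) \<Longrightarrow>
      (\<And>j. j \<in> J' \<Longrightarrow> pairing \<eta> j = 0) \<Longrightarrow> (\<And>u. deg' u \<noteq> b \<Longrightarrow> \<eta> u = 0) \<Longrightarrow>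
      pairing (\<lambda>(u, v). \<xi> u * \<eta> v) x = 0"
  shows "x \<in> tensor_ker J J'"
proof -
  obtain \<pi> where \<pi>: "\<And>p. p \<in> J \<Longrightarrow> lin_ext scale \<pi> p = 0" "\<And>p. p - lin_ext scale \<pi> p \<in> J"
    "\<And>u x. x \<in> keys (\<pi> u) \<Longrightarrow> deg x = deg u"
    using graded_projection_exists[OF J] by metis
  obtain \<pi>' where \<pi>': "\<And>p. p \<in> J' \<Longrightarrow> lin_ext scale \<pi>' p = 0" "\<And>p. p - lin_ext scale \<pi>' p \<in> J'"
    "\<And>u x. x \<in> keys (\<pi>' u) \<Longrightarrow> deg' x = deg' u"
    using graded_projection_exists[OF J'] by metis
  define \<Phi> where "\<Phi> = lin_ext scale (\<lambda>(u, v). otimes (\<pi> u) (\<pi>' v))"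
  have "x - \<Phi> x \<in> tensor_ker J J'"
  proof (induction x rule: pm_induct)
    case (single x)
    obtain u v where x: "x = (u, v)" by force
    have "otimes (single u 1) (single v 1) - otimes (\<pi> u) (\<pi>' v) \<in> tensor_ker J J'"
      using \<pi>(2)[of "single u 1"] \<pi>'(2)[of "single v 1"] by (intro tensor_ker_diff) simp_all
    then show ?case by (simp add: \<Phi>_def x otimes_simps)
  next
    case (add p q)
    then show ?case using pm.subspace_add[OF subspace_tensor_ker add] by (simp add: \<Phi>_def lin_scale_simps algebra_simps)
  next
    case (scale c p)
    then show ?case using pm.subspace_scale[OF subspace_tensor_ker scale, of c]
      by (simp add: \<Phi>_def lin_scale_simps pm.scale_right_diff_distrib)
  qed
  moreover have "\<Phi> x = 0"
  proof (rule poly_mapping_eqI)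
    fix k :: "'a \<times> 'c" obtain a b where k: "k = (a, b)" by force
    have "pairing (\<lambda>(u, v). lookup (\<pi> u) a * lookup (\<pi>' v) b) x = 0"
    proof (rule sep[where a="deg a" and b="deg' b"])
      show "pairing (\<lambda>u. lookup (\<pi> u) a) j = 0" if "j \<in> J" for j
        using \<pi>(1)[OF that] by (simp flip: lookup_lin_ext)
      show "lookup (\<pi> u) a = 0" if "deg u \<noteq> deg a" for u using that \<pi>(3)[of a u] by (auto simp: in_keys_iff)
      show "pairing (\<lambda>u. lookup (\<pi>' u) b) j = 0" if "j \<in> J'" for j
        using \<pi>'(1)[OF that] by (simp flip: lookup_lin_ext)
      show "lookup (\<pi>' u) b = 0" if "deg' u \<noteq> deg' b" for u using that \<pi>'(3)[of b u] by (auto simp: in_keys_iff)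
    qed
    then show "lookup (\<Phi> x) k = lookup 0 k"
      by (simp add: \<Phi>_def lookup_lin_ext k lookup_otimes case_prod_unfold)
  qed
  ultimately show ?thesis by simp
qed

subsection \<open>Presentation of a tensor product\<close>

lemma linear_push: "Vector_Spaces.linear scale scale (push h)"
  unfolding push_eq_lin_ext by (rule lin_scale)

lemma push_simps: "push h (p + q) = push h p + push h q" "push h (p - q) = push h p - push h q"
  "push h (scale c p) = scale c (push h p)" "push h (0 :: 'x \<Rightarrow>\<^sub>0 rat) = 0" for p q :: "'x \<Rightarrow>\<^sub>0 rat"
  by (simp_all add: push_eq_lin_ext lin_scale_simps)

lemma push_single [simp]: "push h (single x c) = single (h x) (c::rat)"
  by (simp add: push_eq_lin_ext)

lemma pres_free_space: "pres scale {p. keys p \<subseteq> X} (free_space X) id"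
  by (simp add: pres_def vector_space_scale subspace_keys free_space_def)

locale tensor_presentation = V: presentation scale UNIV V q + W: presentation scale UNIV W r
  for V :: "(rat, 'x) module" and q :: "('a \<Rightarrow>\<^sub>0 rat) \<Rightarrow> 'x"
    and W :: "(rat, 'y) module" and r :: "('b \<Rightarrow>\<^sub>0 rat) \<Rightarrow> 'y"
begin

abbreviation "tcar \<equiv> carrier V \<times> carrier W"
abbreviation "tdom \<equiv> {p :: 'x \<times> 'y \<Rightarrow>\<^sub>0 rat. keys p \<subseteq> tcar}"

sublocale F: presentation scale tdom "free_space tcar" id
  by unfold_locales (rule pres_free_space)

definition "trels = {single (x \<oplus>\<^bsub>V\<^esub> x', y) 1 - single (x, y) 1 - single (x', y) (1::rat) | x x' y.
        x \<in> carrier V \<and> x' \<in> carrier V \<and> y \<in> carrier W} \<union>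
     {single (x, y \<oplus>\<^bsub>W\<^esub> y') 1 - single (x, y) 1 - single (x, y') 1 | x y y'.
        x \<in> carrier V \<and> y \<in> carrier W \<and> y' \<in> carrier W} \<union>
     {single (c \<odot>\<^bsub>V\<^esub> x, y) 1 - single (x, y) c | c x y. x \<in> carrier V \<and> y \<in> carrier W} \<union>
     {single (x, c \<odot>\<^bsub>W\<^esub> y) 1 - single (x, y) c | c x y. x \<in> carrier V \<and> y \<in> carrier W}"

lemma qc: "q p \<in> carrier V" and rc: "r p' \<in> carrier W"
  using V.q_carrier W.q_carrier by auto

lemma Vadd: "q p \<oplus>\<^bsub>V\<^esub> q p' = q (p + p')" and Wadd: "r t \<oplus>\<^bsub>W\<^esub> r t' = r (t + t')"
  and Vsmul: "c \<odot>\<^bsub>V\<^esub> q p = q (scale c p)" and Wsmul: "c \<odot>\<^bsub>W\<^esub> r t = r (scale c t)"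
  using V.add W.add V.smul W.smul by auto

lemma trelsE:
  assumes "x \<in> trels"
  obtains x1 x2 y where "x = single (x1 \<oplus>\<^bsub>V\<^esub> x2, y) 1 - single (x1, y) 1 - single (x2, y) 1" "x1 \<in> carrier V" "x2 \<in> carrier V" "y \<in> carrier W"
        | x1 y1 y2 where "x = single (x1, y1 \<oplus>\<^bsub>W\<^esub> y2) 1 - single (x1, y1) 1 - single (x1, y2) 1" "x1 \<in> carrier V" "y1 \<in> carrier W" "y2 \<in> carrier W"
        | c x1 y1 where "x = single (c \<odot>\<^bsub>V\<^esub> x1, y1) 1 - single (x1, y1) c" "x1 \<in> carrier V" "y1 \<in> carrier W"
        | c x1 y1 where "x = single (x1, c \<odot>\<^bsub>W\<^esub> y1) 1 - single (x1, y1) c" "x1 \<in> carrier V" "y1 \<in> carrier W"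
  using assms unfolding trels_def
  apply (elim UnE CollectE exE conjE)
     apply (rule that(1); assumption)
    apply (rule that(2); assumption)
   apply (rule that(3); assumption)
  apply (rule that(4); assumption)
  done

lemma trels_D: "trels \<subseteq> tdom"
proof
  have s: "single (x, y) c \<in> tdom" if "x \<in> carrier V" "y \<in> carrier W" for x y and c :: rat using that by simp
  have c: "x \<oplus>\<^bsub>V\<^esub> x' \<in> carrier V" if "x \<in> carrier V" "x' \<in> carrier V" for x x'
    using that V.im Vadd qc by (metis imageE)
  have c': "x \<oplus>\<^bsub>W\<^esub> x' \<in> carrier W" if "x \<in> carrier W" "x' \<in> carrier W" for x x'
    using that W.im Wadd rc by (metis imageE)
  have d: "c \<odot>\<^bsub>V\<^esub> x \<in> carrier V" if "x \<in> carrier V" for c x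
    using that V.im Vsmul qc by (metis imageE)
  have d': "c \<odot>\<^bsub>W\<^esub> x \<in> carrier W" if "x \<in> carrier W" for c x
    using that W.im Wsmul rc by (metis imageE)
  fix x assume "x \<in> trels"
  then show "x \<in> tdom"
    by (cases rule: trelsE) (simp_all only:, (intro F.Dminus s c c' d d'; assumption)+)
qed

definition "tK = pm.span trels"

lemma tK: "pm.subspace tK" "tK \<subseteq> tdom" "\<And>x. x \<in> tdom \<Longrightarrow> id x = id 0 \<Longrightarrow> x \<in> tK" "trels \<subseteq> tK"
  using F.span_subset_D[OF trels_D] by (auto simp: tK_def pm.span_zero pm.span_base)

lemma trelsI:
  "x \<in> carrier V \<Longrightarrow> x' \<in> carrier V \<Longrightarrow> y \<in> carrier W \<Longrightarrow>
    single (x \<oplus>\<^bsub>V\<^esub> x', y) 1 - single (x, y) 1 - single (x', y) 1 \<in> tK"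
  "x \<in> carrier V \<Longrightarrow> y \<in> carrier W \<Longrightarrow> y' \<in> carrier W \<Longrightarrow>
    single (x, y \<oplus>\<^bsub>W\<^esub> y') 1 - single (x, y) 1 - single (x, y') 1 \<in> tK"
  "x \<in> carrier V \<Longrightarrow> y \<in> carrier W \<Longrightarrow> single (c \<odot>\<^bsub>V\<^esub> x, y) 1 - single (x, y) c \<in> tK"
  "x \<in> carrier V \<Longrightarrow> y \<in> carrier W \<Longrightarrow> single (x, c \<odot>\<^bsub>W\<^esub> y) 1 - single (x, y) c \<in> tK"
     apply (rule subsetD[OF tK(4)], unfold trels_def, rule UnI1, rule UnI1, rule UnI1, intro CollectI exI conjI; (rule refl | assumption))
    apply (rule subsetD[OF tK(4)], unfold trels_def, rule UnI1, rule UnI1, rule UnI2, intro CollectI exI conjI; (rule refl | assumption))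
   apply (rule subsetD[OF tK(4)], unfold trels_def, rule UnI1, rule UnI2, intro CollectI exI conjI; (rule refl | assumption))
  apply (rule subsetD[OF tK(4)], unfold trels_def, rule UnI2, intro CollectI exI conjI; (rule refl | assumption))
  done

lemma bilinear_rels_eq: "bilinear_rels V W = id ` tK"
proof -
  have "bilinear_rels V W = lin_span (free_space tcar) (id ` trels)"
    unfolding bilinear_rels_def trels_def by simp
  also have "\<dots> = id ` tK" unfolding tK_def by (rule F.lin_span_image[OF trels_D])
  finally show ?thesis .
qed

sublocale T: presentation scale tdom "tensor V W" "F.coset tK"
  unfolding tensor_def bilinear_rels_eq by unfold_locales (rule F.pres_quot[OF tK(1-3)])

lemma tcoset_eq_iff: "x \<in> tdom \<Longrightarrow> y \<in> tdom \<Longrightarrow> F.coset tK x = F.coset tK y \<longleftrightarrow> x - y \<in> tK"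
  using F.coset_eq_iff[OF tK(1-3)] by blast

lemma pure_tensor_eq: "pure_tensor V W x y = F.coset tK (single (x, y) 1)"
  unfolding pure_tensor_def bilinear_rels_eq F.coset_def by simp

abbreviation "th \<equiv> (\<lambda>(u, v). (q (single u 1), r (single v 1)))"
text \<open>The tensor product of the two presentations, again defined on a free space.\<close>

definition "tq p = F.coset tK (push th p)"

lemma push_D: "push th p \<in> tdom"
proof (induction p rule: pm_induct)
  case (single x) then show ?case by (cases x) (simp add: qc rc)
next
  case (add p q) then show ?case unfolding push_simps by (rule F.Dadd)
next
  case (scale c p) then show ?case unfolding push_simps by (rule F.Dscale)
qed

lemma push_otimes: "push th (otimes p p') - single (q p, r p') 1 \<in> tK"
proof -
  have comb: "A + B - C \<in> tK" if "A - A' \<in> tK" "B - B' \<in> tK" "C - A' - B' \<in> tK" for A B C A' B'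
  proof -
    have "A + B - C = (A - A') + (B - B') - (C - A' - B')" by simp
    then show ?thesis using that pm.subspace_add[OF tK(1)] pm.subspace_diff[OF tK(1)] by metis
  qed
  have comb': "scale c A - C \<in> tK" if "A - A' \<in> tK" "C - scale c A' \<in> tK" for A A' C c
  proof -
    have "scale c A - C = scale c (A - A') - (C - scale c A')" by (simp add: pm.scale_right_diff_distrib)
    then show ?thesis using that pm.subspace_scale[OF tK(1)] pm.subspace_diff[OF tK(1)] by metis
  qed
  show ?thesis
  proof (induction p rule: pm_induct)
    case (single u)
    show ?case
    proof (induction p' rule: pm_induct)
      case (single v) show ?case by (simp add: otimes_simps pm.subspace_0[OF tK(1)])
    next
      case (add p q')
      have "single (q (single u 1), r (p + q')) 1 - single (q (single u 1), r p) 1 - single (q (single u 1), r q') 1 \<in> tK"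
        unfolding Wadd[symmetric] by (intro trelsI qc rc)
      then show ?case unfolding otimes_simps push_simps by (rule comb[OF add])
    next
      case (scale c p)
      have "single (q (single u 1), r (Defs.scale c p)) 1 - Defs.scale c (single (q (single u 1), r p) 1) \<in> tK"
        unfolding Wsmul[symmetric] scale_single mult_1_right by (intro trelsI qc rc)
      then show ?case unfolding otimes_simps push_simps by (rule comb'[OF scale])
    qed
  next
    case (add p q')
    have "single (q (p + q'), r p') 1 - single (q p, r p') 1 - single (q q', r p') 1 \<in> tK"
      unfolding Vadd[symmetric] by (intro trelsI qc rc)
    then show ?case unfolding otimes_simps push_simps by (rule comb[OF add])
  next
    case (scale c p)
    have "single (q (Defs.scale c p), r p') 1 - Defs.scale c (single (q p, r p') 1) \<in> tK"
      unfolding Vsmul[symmetric] scale_single mult_1_right by (intro trelsI qc rc)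
    then show ?case unfolding otimes_simps push_simps by (rule comb'[OF scale])
  qed
qed

lemma tq_otimes: "tq (otimes p p') = pure_tensor V W (q p) (r p')"
proof -
  have "single (q p, r p') 1 \<in> tdom" using qc rc by simp
  then show ?thesis unfolding tq_def pure_tensor_eq using tcoset_eq_iff[OF push_D] push_otimes by blast
qed

lemma tq_linear: "tq (p + p') = tq p \<oplus>\<^bsub>tensor V W\<^esub> tq p'" "tq (scale c p) = c \<odot>\<^bsub>tensor V W\<^esub> tq p"
  unfolding tq_def push_simps by (rule T.add[OF push_D push_D, symmetric], rule T.smul[OF push_D, symmetric])

lemma pres_tq: "pres scale UNIV (tensor V W) tq"
proof -
  have "tq ` UNIV = carrier (tensor V W)"
  proof
    show "tq ` UNIV \<subseteq> carrier (tensor V W)" unfolding tq_def using push_D T.q_carrier by blast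
    have "x \<in> pm.span {single z 1 |z. z \<in> tcar} \<Longrightarrow> x \<in> tdom \<and> F.coset tK x \<in> tq ` UNIV" for x
    proof (induction rule: pm.span_induct_alt)
      case base
      have "F.coset tK 0 = tq 0" by (simp add: tq_def push_simps)
      then show ?case by (intro conjI F.D0) (metis rangeI)
    next
      case (step c x y)
      then obtain a b where x: "x = single (a, b) 1" "a \<in> carrier V" "b \<in> carrier W" by auto
      then obtain p p' where p: "a = q p" "b = r p'" using V.im W.im by blast
      have xD: "x \<in> tdom" using x by simp
      obtain t where t: "F.coset tK y = tq t" using step by blast
      have "F.coset tK (scale c x + y) = tq (scale c (otimes p p') + t)"
        unfolding tq_linear tq_otimes pure_tensor_eq t[symmetric] using x p xD step F.Dscale[OF xD]
        by (simp add: T.add T.smul)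
      then show ?case using step xD F.Dscale[OF xD] F.Dadd by blast
    qed
    then show "carrier (tensor V W) \<subseteq> tq ` UNIV" unfolding T.im[symmetric] pm_span_single by blast
  qed
  then show ?thesis
    unfolding pres_def using vector_space_scale T.zero by (auto simp: tq_linear) (auto simp: tq_def push_simps)
qed

text \<open>Right exactness of the tensor product. For the inclusion that is not formal, sections
  \<open>a\<close>, \<open>b\<close> of \<open>q\<close> and \<open>r\<close> are chosen; they
  induce a map \<open>G\<close> back from the free space on pairs of classes, which sends the
  bilinear relations into \<open>?K\<close> and inverts \<open>push th\<close> modulo
  \<open>?K\<close>.\<close>

lemma tq_ker: "tq p = tq 0 \<longleftrightarrow> p \<in> tensor_ker {j. q j = q 0} {j. r j = r 0}"
proof
  let ?K = "tensor_ker {j. q j = q 0} {j. r j = r 0}"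
  note K = subspace_tensor_ker[of "{j. q j = q 0}" "{j. r j = r 0}"]
  define a where "a x = (SOME p. q p = x)" for x
  define b where "b x = (SOME p. r p = x)" for x
  have a: "q (a x) = x" if "x \<in> carrier V" for x using that V.im unfolding a_def by (metis (mono_tags) imageE someI)
  have b: "r (b x) = x" if "x \<in> carrier W" for x using that W.im unfolding b_def by (metis (mono_tags) imageE someI)
  define G where "G = lin_ext scale (\<lambda>(x, y). otimes (a x) (b y))"
  have Geq: "q p = q p' \<Longrightarrow> r t = r t' \<Longrightarrow> otimes p t - otimes p' t' \<in> ?K" for p p' t t'
    using V.q_eq[of p p'] W.q_eq[of t t'] by (intro tensor_ker_diff) simp_all
  have Gs: "G (single (x, y) c) = scale c (otimes (a x) (b y))" for x y c by (simp add: G_def)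
  { assume "tq p = tq 0"
    then have "push th p \<in> tK" unfolding tq_def using tcoset_eq_iff[OF push_D push_D, of p 0] by (simp add: push_simps)
    moreover have "G x \<in> ?K" if "x \<in> trels" for x
    proof -
      have R: "otimes p t - otimes p' t' - otimes p'' t'' \<in> ?K" if "otimes p t - (otimes p' t' + otimes p'' t'') \<in> ?K" for p t p' t' p'' t''
        using that by (simp add: algebra_simps)
      have Gd: "G (x - y) = G x - G y" "G (x + y) = G x + G y" for x y by (simp_all add: G_def lin_scale_simps)
      from that show ?thesis
      proof (cases rule: trelsE)
        case (1 x1 x2 y)
        have "q (a (x1 \<oplus>\<^bsub>V\<^esub> x2)) = q (a x1 + a x2)" using 1 a qc by (metis Vadd)
        from Geq[OF this refl, of "b y"] show ?thesis by (simp add: 1 Gd Gs otimes_simps algebra_simps)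
      next
        case (2 x1 y1 y2)
        have "r (b (y1 \<oplus>\<^bsub>W\<^esub> y2)) = r (b y1 + b y2)" using 2 b rc by (metis Wadd)
        from Geq[OF refl this, of "a x1"] show ?thesis by (simp add: 2 Gd Gs otimes_simps algebra_simps)
      next
        case (3 c x1 y1)
        have "q (a (c \<odot>\<^bsub>V\<^esub> x1)) = q (scale c (a x1))" using 3 a qc by (metis Vsmul)
        from Geq[OF this refl, of "b y1"] show ?thesis by (simp add: 3 Gd Gs otimes_simps)
      next
        case (4 c x1 y1)
        have "r (b (c \<odot>\<^bsub>W\<^esub> y1)) = r (scale c (b y1))" using 4 b rc by (metis Wsmul)
        from Geq[OF refl this, of "a x1"] show ?thesis by (simp add: 4 Gd Gs otimes_simps)
      qed
    qed
    ultimately have 1: "G (push th p) \<in> ?K"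
      unfolding tK_def using linear_in_subspace[OF lin_scale[of "\<lambda>(x, y). otimes (a x) (b y)", folded G_def] K] by blast
    have "G (push th p) - p \<in> ?K"
    proof (induction p rule: pm_induct)
      case (single x)
      obtain u v where x: "x = (u, v)" by force
      have "otimes (a (q (single u 1))) (b (r (single v 1))) - otimes (single u 1) (single v 1) \<in> ?K"
        by (intro Geq a b qc rc)
      then show ?case by (simp add: x Gs otimes_simps)
    next
      case (add p q')
      then show ?case using pm.subspace_add[OF K add] by (simp add: push_simps G_def lin_scale_simps algebra_simps)
    next
      case (scale c p)
      then show ?case using pm.subspace_scale[OF K scale, of c]
        by (simp add: push_simps G_def lin_scale_simps pm.scale_right_diff_distrib)
    qed
    from pm.subspace_diff[OF K 1 this] show "p \<in> ?K" by simp }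
  assume "p \<in> ?K"
  interpret S: presentation scale UNIV "tensor V W" tq using pres_tq by unfold_locales
  have z: "q 0 = 0 \<odot>\<^bsub>V\<^esub> q 0" "r 0 = 0 \<odot>\<^bsub>W\<^esub> r 0" by (simp_all add: Vsmul Wsmul)
  have "pm.subspace {p. tq p = tq 0}"
  proof (rule pm.subspaceI)
    fix x y :: "'a \<times> 'b \<Rightarrow>\<^sub>0 rat" and c assume x: "x \<in> {p. tq p = tq 0}"
    have "tq (scale c x) = tq (scale c 0)" using x by (simp only: tq_linear mem_Collect_eq)
    then show "scale c x \<in> {p. tq p = tq 0}" by simp
    assume "y \<in> {p. tq p = tq 0}"
    then have "tq (x + y) = tq (0 + 0)" using x by (simp only: tq_linear mem_Collect_eq)
    then show "x + y \<in> {p. tq p = tq 0}" by simp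
  qed simp
  moreover have "tq (otimes j t) = tq 0" if "q j = q 0" for j t
    using tq_otimes[of j t] tq_otimes[of 0 t] that by (simp add: otimes_simps)
  moreover have "tq (otimes t j) = tq 0" if "r j = r 0" for j t
    using tq_otimes[of t j] tq_otimes[of t 0] that by (simp add: otimes_simps)
  ultimately have "?K \<subseteq> {p. tq p = tq 0}" unfolding tensor_ker_def by (intro pm.span_minimal) auto
  then show "tq p = tq 0" using \<open>p \<in> ?K\<close> by blast
qed

end

lemma span_otimes: "pm.span {otimes p t | p t. True} = (UNIV :: ('b \<times> 'd \<Rightarrow>\<^sub>0 rat) set)"
proof -
  have "x \<in> pm.span {otimes p t | p t. True}" for x :: "'b \<times> 'd \<Rightarrow>\<^sub>0 rat"
  proof (induction x rule: pm_induct)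
    case (single x)
    have "single x 1 = otimes (single (fst x) 1) (single (snd x) 1)" by (simp add: otimes_simps)
    then show ?case by (intro pm.span_base) blast
  qed (auto intro: pm.span_add pm.span_scale)
  then show ?thesis by blast
qed

text \<open>Both maps are induced by the identity of the free spaces, hence so is their tensor
  product. The definite description is met because pure tensors span.\<close>

lemma tensor_map_tq:
  assumes "tensor_presentation V q W r" "tensor_presentation V1 q1 W1 r1"
    and f: "\<And>p. f (q p) = q1 p" and g: "\<And>p. g (r p) = r1 p"
  shows "tensor_map V W V1 W1 f g (tensor_presentation.tq V q W r p) = tensor_presentation.tq V1 q1 W1 r1 p"
proof -
  interpret A: tensor_presentation V q W r by fact
  interpret B: tensor_presentation V1 q1 W1 r1 by fact
  have pA: "pres scale (pm.span {otimes p t | p t. True}) (tensor V W) A.tq"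
    using A.pres_tq by (simp only: span_otimes)
  have q0: "q j = q 0 \<Longrightarrow> q1 j = q1 0" "r t = r 0 \<Longrightarrow> r1 t = r1 0" for j t using f g by metis+
  have "\<exists>T\<in>lin_maps (tensor V W) (tensor V1 W1). \<forall>x\<in>UNIV. T (A.tq x) = B.tq (id x)"
  proof (rule lin_maps_descend[OF A.pres_tq B.pres_tq])
    fix x assume "A.tq x = A.tq 0"
    then have "x \<in> tensor_ker {j. q j = q 0} {j. r j = r 0}" by (simp add: A.tq_ker)
    also have "\<dots> \<subseteq> tensor_ker {j. q1 j = q1 0} {j. r1 j = r1 0}"
      by (rule tensor_ker_mono; rule Collect_mono; rule impI) (erule q0)+
    finally show "B.tq (id x) = B.tq 0" by (simp add: B.tq_ker)
  qed auto
  then obtain T where T: "T \<in> lin_maps (tensor V W) (tensor V1 W1)" "\<And>x. T (A.tq x) = B.tq x" by auto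
  have "tensor_map V W V1 W1 f g = T"
    unfolding tensor_map_def
  proof (rule the_equality)
    show "T \<in> lin_maps (tensor V W) (tensor V1 W1) \<and>
      (\<forall>x\<in>carrier V. \<forall>y\<in>carrier W. T (pure_tensor V W x y) = pure_tensor V1 W1 (f x) (g y))"
      using T f g by (auto simp: A.V.im[symmetric] A.W.im[symmetric] A.tq_otimes[symmetric] B.tq_otimes[symmetric])
    fix T' assume T': "T' \<in> lin_maps (tensor V W) (tensor V1 W1) \<and>
      (\<forall>x\<in>carrier V. \<forall>y\<in>carrier W. T' (pure_tensor V W x y) = pure_tensor V1 W1 (f x) (g y))"
    show "T' = T"
    proof (rule lin_maps_eqI[OF conjunct1[OF T'] T(1) pA B.pres_tq])
      fix x assume "x \<in> {otimes p t | (p :: 'b \<Rightarrow>\<^sub>0 rat) (t :: 'd \<Rightarrow>\<^sub>0 rat). True}"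
      then obtain p t where "x = otimes p t" by blast
      then show "T' (A.tq x) = T (A.tq x)"
        using T' f g unfolding T(2) B.tq_otimes by (simp add: A.tq_otimes A.qc A.rc B.tq_otimes)
    qed
  qed
  then show ?thesis using T by simp
qed


section \<open>Free associative algebras\<close>

type_synonym 'x walg = "'x fmon \<Rightarrow>\<^sub>0 rat"

lemma fmon_plus [simp]: "FMon u + FMon v = FMon (u @ v)" by (simp add: plus_fmon_def)
lemma letters_plus [simp]: "letters (u + v) = letters u @ letters v" by (simp add: plus_fmon_def)
lemma letters_zero [simp]: "letters 0 = []" by (simp add: zero_fmon_def)

lemma single_mult_single: "single u a * single v b = single (u + v) (a * b :: rat)"
  for u v :: "'m::monoid_add" by (rule mult_single)

lemma single_0_1: "single (0::'m::monoid_add) (1::rat) = 1" by (rule single_one)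

definition whom :: "('x \<Rightarrow> 'y fmon \<Rightarrow>\<^sub>0 rat) \<Rightarrow> ('x fmon \<Rightarrow>\<^sub>0 rat) \<Rightarrow> 'y fmon \<Rightarrow>\<^sub>0 rat" where
  "whom h = lin_ext scale (\<lambda>u. prod_list (map h (letters u)))"

lemma whom_simps: "whom h (p + q) = whom h p + whom h q" "whom h (p - q) = whom h p - whom h q"
  "whom h (scale c p) = scale c (whom h p)" "whom h 0 = 0"
  "whom h (single u c) = scale c (prod_list (map h (letters u)))" "whom h (letter x) = h x"
  "whom h 1 = 1"
proof -
  have "whom h (single 0 1) = 1"
    by (simp only: whom_def lin_ext_scale_single letters_zero list.map prod_list.Nil pm.scale_one)
  then show "whom h 1 = 1" by (simp only: single_0_1)
qed (simp_all add: whom_def lin_scale_simps letter_def)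

lemma whom_mult: "whom h (p * q) = whom h p * whom h q"
proof (induction p rule: pm_induct)
  case (single x)
  show ?case
  proof (induction q rule: pm_induct)
    case (single y) then show ?case by (simp add: single_mult_single whom_simps)
  qed (simp_all add: whom_simps distrib_left scale_mult_right)
qed (simp_all add: whom_simps distrib_right scale_mult_left)

lemma linear_whom: "Vector_Spaces.linear scale scale (whom h)"
  unfolding whom_def by (rule lin_scale)

lemma push_lin_ext: "push h (lin_ext scale f p) = lin_ext scale (\<lambda>x. push h (f x)) p"
  by (induction p rule: pm_induct) (simp_all add: lin_scale_simps push_simps)

lemma magma_bracket_push: "magma_bracket p q = push (\<lambda>(s, t). Br s t) (otimes p q)"
proof -
  have "push (\<lambda>(s, t). Br s t) (otimes p q) = lin_ext scale (\<lambda>s. lin_ext scale (\<lambda>t. single (Br s t) 1) q) p"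
    by (simp add: otimes_def push_lin_ext)
  also have "\<dots> = magma_bracket p q"
    by (simp add: lin_ext_def magma_bracket_def pm.scale_sum_right)
  finally show ?thesis by simp
qed

lemma magma_bracket_simps:
  "magma_bracket (p + q) t = magma_bracket p t + magma_bracket q t"
  "magma_bracket (p - q) t = magma_bracket p t - magma_bracket q t"
  "magma_bracket t (p + q) = magma_bracket t p + magma_bracket t q"
  "magma_bracket t (p - q) = magma_bracket t p - magma_bracket t q"
  "magma_bracket (scale c p) t = scale c (magma_bracket p t)"
  "magma_bracket t (scale c p) = scale c (magma_bracket t p)"
  "magma_bracket (single u a) (single v b) = single (Br u v) (a * b)"
  by (simp_all add: magma_bracket_push otimes_simps push_simps)

text \<open>The axioms are weak enough to cover both the nonassociative algebra of bracket terms and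
  the algebra of words.\<close>

locale algebra_presentation =
  fixes D :: "('b \<Rightarrow>\<^sub>0 rat) set" and A :: "(rat, 'b \<Rightarrow>\<^sub>0 rat) module" and m :: "('b \<Rightarrow>\<^sub>0 rat) \<Rightarrow> ('b \<Rightarrow>\<^sub>0 rat) \<Rightarrow> ('b \<Rightarrow>\<^sub>0 rat)"
  assumes pA: "pres scale D A id" and mA: "mult A = m"
    and mD: "\<And>x y. x \<in> D \<Longrightarrow> y \<in> D \<Longrightarrow> m x y \<in> D"
    and ml: "\<And>x y z. m (x + y) z = m x z + m y z" and mr: "\<And>x y z. m z (x + y) = m z x + m z y"
begin

sublocale A: presentation scale D A id by unfold_locales (rule pA)

lemma car: "carrier A = D" using A.im by simp

lemma submodule_iff: "submodule H rat_space A \<longleftrightarrow> pm.subspace H \<and> H \<subseteq> D"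
proof
  assume "submodule H rat_space A"
  from A.submodule_vimage[OF this] have "pm.subspace {x \<in> D. x \<in> H}" "H \<subseteq> D" by (auto simp: car)
  moreover from this have "{x \<in> D. x \<in> H} = H" by blast
  ultimately show "pm.subspace H \<and> H \<subseteq> D" by simp
next
  assume "pm.subspace H \<and> H \<subseteq> D" then show "submodule H rat_space A"
    using A.submodule_image[of H] by simp
qed

lemma gen_ideal_min:
  assumes "pm.subspace H" "S \<subseteq> H" "\<And>x h. x \<in> D \<Longrightarrow> h \<in> H \<Longrightarrow> h \<in> D \<Longrightarrow> m x h \<in> H \<and> m h x \<in> H" "S \<subseteq> D"
  shows "gen_ideal A S \<subseteq> H"
proof -
  have "pm.subspace (H \<inter> D)" using assms(1) A.subD by (rule pm.subspace_inter)
  then show ?thesis using assms mD unfolding gen_ideal_def submodule_iff car mA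
    by (intro subset_trans[OF Inter_lower[of "H \<inter> D"]]) auto
qed

lemma gen_ideal_props:
  assumes "S \<subseteq> D"
  shows "pm.subspace (gen_ideal A S)" "gen_ideal A S \<subseteq> D" "S \<subseteq> gen_ideal A S"
    "\<And>x h. x \<in> D \<Longrightarrow> h \<in> gen_ideal A S \<Longrightarrow> m x h \<in> gen_ideal A S"
    "\<And>x h. x \<in> D \<Longrightarrow> h \<in> gen_ideal A S \<Longrightarrow> m h x \<in> gen_ideal A S"
proof -
  show "pm.subspace (gen_ideal A S)" unfolding gen_ideal_def by (rule pm.subspace_Int[of _ "\<lambda>H. H", simplified]) (auto simp: submodule_iff)
  show "gen_ideal A S \<subseteq> D" by (rule gen_ideal_min) (use assms mD A.subD in auto)
  show "S \<subseteq> gen_ideal A S" unfolding gen_ideal_def by blast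
  fix x h assume "x \<in> D" "h \<in> gen_ideal A S"
  then show "m x h \<in> gen_ideal A S" "m h x \<in> gen_ideal A S" unfolding gen_ideal_def car mA by blast+
qed

lemma quot_gen_ideal:
  assumes "S \<subseteq> D"
  defines "G \<equiv> gen_ideal A S"
  shows "pres scale D (quot_space A G) (A.coset G)"
    and "x \<in> D \<Longrightarrow> y \<in> D \<Longrightarrow> A.coset G x = A.coset G y \<longleftrightarrow> x - y \<in> G"
    and "x \<in> D \<Longrightarrow> y \<in> D \<Longrightarrow> A.coset G x \<otimes>\<^bsub>quot_space A G\<^esub> A.coset G y = A.coset G (m x y)"
proof -
  note G = gen_ideal_props[OF assms(1), folded G_def]
  have K: "pm.subspace G" "G \<subseteq> D" "\<And>x. x \<in> D \<Longrightarrow> id x = id 0 \<Longrightarrow> x \<in> G"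
    using G pm.subspace_0[OF G(1)] by auto
  show "pres scale D (quot_space A G) (A.coset G)" using A.pres_quot[OF K] by simp
  show "x \<in> D \<Longrightarrow> y \<in> D \<Longrightarrow> A.coset G x = A.coset G y \<longleftrightarrow> x - y \<in> G" using A.coset_eq_iff[OF K] .
  assume xy: "x \<in> D" "y \<in> D"
  have mm: "m (k + x) (l + y) - m x y \<in> G" if "k \<in> G" "l \<in> G" for k l
  proof -
    have "m (k + x) (l + y) - m x y = m k (l + y) + m x l" by (simp add: ml mr)
    moreover have "l + y \<in> D" using that xy G(2) by (intro A.Dadd) auto
    ultimately show ?thesis using that xy G(4,5) pm.subspace_add[OF G(1)] by simp
  qed
  have "A.coset G x \<otimes>\<^bsub>quot_space A (id ` G)\<^esub> A.coset G y = A.coset G (m x y)"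
    by (rule A.quot_mult[OF K _ mm xy]) (simp_all add: mD mA)
  then show "A.coset G x \<otimes>\<^bsub>quot_space A G\<^esub> A.coset G y = A.coset G (m x y)" by simp
qed

end

lemma algebra_presentation_magma:
  "algebra_presentation {p. keys p \<subseteq> {t. set_magma t \<subseteq> X}} (magma_algebra X) magma_bracket"
proof
  show "pres scale {p. keys p \<subseteq> {t. set_magma t \<subseteq> X}} (magma_algebra X) id"
    using pres_free_space[of "{t. set_magma t \<subseteq> X}"] by (simp add: pres_def magma_algebra_def free_space_def)
  fix x y :: "'a magma \<Rightarrow>\<^sub>0 rat"
  assume *: "x \<in> {p. keys p \<subseteq> {t. set_magma t \<subseteq> X}}" "y \<in> {p. keys p \<subseteq> {t. set_magma t \<subseteq> X}}"
  have "keys (magma_bracket x y) \<subseteq> (\<Union>s\<in>keys x. \<Union>t\<in>keys y. {Br s t})"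
    unfolding magma_bracket_def
    by (rule subset_trans[OF keys_sum] UN_mono subset_refl)+ auto
  then show "magma_bracket x y \<in> {p. keys p \<subseteq> {t. set_magma t \<subseteq> X}}" using * by fastforce
qed (simp_all add: magma_algebra_def magma_bracket_simps)

lemma algebra_presentation_free:
  "algebra_presentation {p. keys p \<subseteq> {u. set (letters u) \<subseteq> X}} (free_algebra X) (*)"
proof
  show "pres scale {p. keys p \<subseteq> {u. set (letters u) \<subseteq> X}} (free_algebra X) id"
    using pres_free_space[of "{u. set (letters u) \<subseteq> X}"] by (simp add: pres_def free_algebra_def free_space_def)
  fix x y :: "'a fmon \<Rightarrow>\<^sub>0 rat"
  assume *: "x \<in> {p. keys p \<subseteq> {u. set (letters u) \<subseteq> X}}" "y \<in> {p. keys p \<subseteq> {u. set (letters u) \<subseteq> X}}"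
  then show "x * y \<in> {p. keys p \<subseteq> {u. set (letters u) \<subseteq> X}}" using keys_mult[of x y] by fastforce
qed (simp_all add: free_algebra_def algebra_simps)

section \<open>The enveloping algebra as a quotient of a free algebra\<close>

context symmetric_quiver
begin

lemma euler_add: "euler (\<alpha> + \<alpha>') \<beta> = euler \<alpha> \<beta> + euler \<alpha>' \<beta>" "euler \<beta> (\<alpha> + \<alpha>') = euler \<beta> \<alpha> + euler \<beta> \<alpha>'"
  by (simp_all add: euler_def lookup_add algebra_simps sum.distrib)

lemma euler_0 [simp]: "euler 0 \<beta> = 0" "euler \<beta> 0 = 0"
  by (simp_all add: euler_def)

text \<open>Sorting the arrows by their end points, \<open>symmetric_arrows\<close> exchanges tail
  and head. Through this identity the symmetry of the quiver makes the braiding an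
  involution.\<close>

lemma euler_commute: "euler \<alpha> \<beta> = euler \<beta> \<alpha>"
proof -
  have e: "(\<Sum>a\<in>arcs Q. lookup \<alpha> (tail Q a) * lookup \<beta> (head Q a)) =
    (\<Sum>i\<in>verts Q. \<Sum>j\<in>verts Q. int (card {a \<in> arcs Q. tail Q a = i \<and> head Q a = j}) * (lookup \<alpha> i * lookup \<beta> j))"
    for \<alpha> \<beta> :: "'v lattice"
  proof -
    have "(\<Sum>a\<in>arcs Q. lookup \<alpha> (tail Q a) * lookup \<beta> (head Q a)) =
      (\<Sum>i\<in>verts Q. \<Sum>a | a \<in> arcs Q \<and> tail Q a = i. lookup \<alpha> (tail Q a) * lookup \<beta> (head Q a))"
      by (rule sum.group[symmetric]) auto
    also have "\<dots> = (\<Sum>i\<in>verts Q. \<Sum>j\<in>verts Q. \<Sum>a | a \<in> {a \<in> arcs Q. tail Q a = i} \<and> head Q a = j. lookup \<alpha> (tail Q a) * lookup \<beta> (head Q a))"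
      by (intro sum.cong refl sum.group[symmetric]) auto
    also have "\<dots> = (\<Sum>i\<in>verts Q. \<Sum>j\<in>verts Q. int (card {a \<in> arcs Q. tail Q a = i \<and> head Q a = j}) * (lookup \<alpha> i * lookup \<beta> j))"
      by (intro sum.cong refl) simp
    finally show ?thesis .
  qed
  have "(\<Sum>i\<in>verts Q. \<Sum>j\<in>verts Q. int (card {a \<in> arcs Q. tail Q a = i \<and> head Q a = j}) * (lookup \<alpha> i * lookup \<beta> j))
    = (\<Sum>i\<in>verts Q. \<Sum>j\<in>verts Q. int (card {a \<in> arcs Q. tail Q a = j \<and> head Q a = i}) * (lookup \<alpha> i * lookup \<beta> j))"
    by (intro sum.cong refl arg_cong2[where f="(*)"] arg_cong[where f=int] symmetric_arrows)
  also have "\<dots> = (\<Sum>i\<in>verts Q. \<Sum>j\<in>verts Q. int (card {a \<in> arcs Q. tail Q a = i \<and> head Q a = j}) * (lookup \<beta> i * lookup \<alpha> j))"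
    by (subst sum.swap) (simp add: mult.commute)
  finally show ?thesis unfolding euler_def e by (simp add: mult.commute)
qed

abbreviation "sg \<equiv> braid_sign"

lemma sg_add: "sg (\<alpha> + \<alpha>') \<beta> = sg \<alpha> \<beta> * sg \<alpha>' \<beta>" "sg \<beta> (\<alpha> + \<alpha>') = sg \<beta> \<alpha> * sg \<beta> \<alpha>'"
  by (simp_all add: braid_sign_def euler_add power_int_add)

lemma sg_commute: "sg \<alpha> \<beta> = sg \<beta> \<alpha>" by (simp add: braid_sign_def euler_commute)

lemma sg_sq [simp]: "sg \<alpha> \<beta> * sg \<alpha> \<beta> = 1" "sg \<alpha> \<beta> * (sg \<alpha> \<beta> * c) = c"
proof -
  show "sg \<alpha> \<beta> * sg \<alpha> \<beta> = 1" by (simp add: braid_sign_def flip: power_int_mult_distrib)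
  then show "sg \<alpha> \<beta> * (sg \<alpha> \<beta> * c) = c" by (simp add: mult.assoc[symmetric])
qed

lemma sg_0 [simp]: "sg 0 \<beta> = 1" "sg \<beta> 0 = 1" by (simp_all add: braid_sign_def)

lemma sg_nonzero [simp]: "sg \<alpha> \<beta> \<noteq> 0" by (metis sg_sq(1) mult_zero_left zero_neq_one)

definition gdeg :: "'v \<times> int \<Rightarrow> 'v degree" where
  "gdeg g = magma_degree (Gen g)"

lemma gdeg_simp: "gdeg (i, n) = (basis i, 2 * (n + 1) - euler (basis i) (basis i))"
  by (simp add: gdeg_def)

definition wdeg :: "('v \<times> int) fmon \<Rightarrow> 'v degree" where
  "wdeg u = sum_list (map gdeg (letters u))"

abbreviation "ldeg u \<equiv> fst (wdeg u)"

lemma wdeg_add [simp]: "wdeg (u + v) = wdeg u + wdeg v" by (simp add: wdeg_def)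
lemma wdeg_simps [simp]: "wdeg 0 = 0" "wdeg (FMon []) = 0" "wdeg (FMon (g # u)) = gdeg g + wdeg (FMon u)"
  "wdeg (FMon (u @ v)) = wdeg (FMon u) + wdeg (FMon v)"
  by (simp_all add: wdeg_def)

definition homog :: "'v degree \<Rightarrow> ('v \<times> int) walg \<Rightarrow> bool" where
  "homog \<gamma> p \<longleftrightarrow> (\<forall>u\<in>keys p. wdeg u = \<gamma>)"

lemma homog_simps: "homog \<gamma> p \<Longrightarrow> homog \<gamma> q \<Longrightarrow> homog \<gamma> (p + q)" "homog \<gamma> p \<Longrightarrow> homog \<gamma> q \<Longrightarrow> homog \<gamma> (p - q)"
  "homog \<gamma> p \<Longrightarrow> homog \<gamma> (scale c p)" "homog \<gamma> 0" "homog \<gamma> p \<Longrightarrow> homog \<delta> q \<Longrightarrow> homog (\<gamma> + \<delta>) (p * q)"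
proof -
  show "homog \<gamma> p \<Longrightarrow> homog \<gamma> q \<Longrightarrow> homog \<gamma> (p + q)" using keys_add[of p q] by (auto simp: homog_def)
  show "homog \<gamma> p \<Longrightarrow> homog \<gamma> q \<Longrightarrow> homog \<gamma> (p - q)" using keys_diff[of p q] by (auto simp: homog_def)
  show "homog \<gamma> p \<Longrightarrow> homog \<gamma> (scale c p)" using keys_scale[of c p] by (auto simp: homog_def)
  show "homog \<gamma> p \<Longrightarrow> homog \<delta> q \<Longrightarrow> homog (\<gamma> + \<delta>) (p * q)" using keys_mult[of p q] by (fastforce simp: homog_def)
qed (simp add: homog_def)

lemma homog_single: "homog (wdeg u) (single u c)" and homog_letter: "homog (gdeg g) (letter g)"
  by (simp_all add: homog_def letter_def)

lemma homog_sum: "(\<And>x. x \<in> A \<Longrightarrow> homog \<gamma> (f x)) \<Longrightarrow> homog \<gamma> (sum f A)"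
  by (induction A rule: infinite_finite_induct) (auto simp: homog_simps)

text \<open>Expands a bracket monomial in the free associative algebra on the letters
  \<open>i(n)\<close>, with brackets read as braided commutators.\<close>

fun phi :: "('v \<times> int) magma \<Rightarrow> ('v \<times> int) walg" where
  "phi (Gen g) = letter g"
| "phi (Br s t) = phi s * phi t - scale (sg (fst (magma_degree s)) (fst (magma_degree t))) (phi t * phi s)"

definition "Phi = lin_ext scale phi"

lemma Phi_simps: "Phi (p + q) = Phi p + Phi q" "Phi (p - q) = Phi p - Phi q" "Phi (scale c p) = scale c (Phi p)"
  "Phi 0 = 0" "Phi (single s c) = scale c (phi s)" "Phi (sum f A) = (\<Sum>x\<in>A. Phi (f x))"
  by (simp_all add: Phi_def lin_scale_simps)

lemma homog_phi: "homog (magma_degree s) (phi s)"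
proof (induction s)
  case (Gen g) then show ?case using homog_letter by (simp add: gdeg_def)
next
  case (Br s t)
  have "homog (magma_degree s + magma_degree t) (phi t * phi s)"
    using homog_simps(5)[OF Br(2,1)] by (simp add: add.commute)
  then show ?case using homog_simps(5)[OF Br] by (simp add: homog_simps)
qed

lemma homog_Phi: assumes "\<forall>t\<in>keys p. magma_degree t = \<gamma>" shows "homog \<gamma> (Phi p)"
  unfolding Phi_def lin_ext_def using assms homog_phi by (intro homog_sum homog_simps) metis

text \<open>Twisting by the braiding with a fixed degree; it turns the braided commutator with an
  inhomogeneous element into a bilinear expression.\<close>

definition tw :: "'v lattice \<Rightarrow> ('v \<times> int) walg \<Rightarrow> ('v \<times> int) walg" where
  "tw \<alpha> = lin_ext scale (\<lambda>u. single u (sg \<alpha> (ldeg u)))"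

lemma lookup_tw: "lookup (tw \<alpha> p) u = sg \<alpha> (ldeg u) * lookup p u"
proof (induction p rule: pm_induct)
  case (single x) then show ?case by (auto simp: tw_def lookup_single when_def)
qed (simp_all add: tw_def lin_scale_simps lookup_add algebra_simps)

lemma tw_homog: "homog \<gamma> p \<Longrightarrow> tw \<alpha> p = scale (sg \<alpha> (fst \<gamma>)) p"
  by (rule poly_mapping_eqI) (auto simp: lookup_tw homog_def in_keys_iff)

lemma Phi_bracket_left:
  "Phi (magma_bracket (single s 1) p) = phi s * Phi p - tw (fst (magma_degree s)) (Phi p) * phi s"
proof (induction p rule: pm_induct)
  case (single t)
  show ?case by (simp add: magma_bracket_simps Phi_simps tw_homog[OF homog_phi] scale_mult_left)
qed (simp_all add: magma_bracket_simps Phi_simps distrib_left distrib_right add_diff_add tw_def lin_scale_simps scale_mult_left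
   scale_mult_right pm.scale_right_diff_distrib)

lemma Phi_bracket_right:
  "Phi (magma_bracket p (single s 1)) = Phi p * phi s - phi s * tw (fst (magma_degree s)) (Phi p)"
proof (induction p rule: pm_induct)
  case (single t)
  show ?case by (simp add: magma_bracket_simps Phi_simps tw_homog[OF homog_phi] scale_mult_right sg_commute)
qed (simp_all add: magma_bracket_simps Phi_simps distrib_left distrib_right add_diff_add tw_def lin_scale_simps scale_mult_left
   scale_mult_right pm.scale_right_diff_distrib)

lemma Phi_bracket_homog:
  assumes "\<forall>t\<in>keys p. fst (magma_degree t) = \<alpha>" "\<forall>t\<in>keys q. fst (magma_degree t) = \<beta>"
  shows "Phi (magma_bracket p q) = Phi p * Phi q - scale (sg \<alpha> \<beta>) (Phi q * Phi p)"
proof -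
  have "Phi (magma_bracket p q) = (\<Sum>s\<in>keys p. \<Sum>t\<in>keys q. scale (lookup p s * lookup q t) (phi s * phi t)
      - scale (sg \<alpha> \<beta>) (scale (lookup q t * lookup p s) (phi t * phi s)))"
    unfolding magma_bracket_def Phi_simps using assms
    by (intro sum.cong refl) (simp add: pm.scale_right_diff_distrib mult_ac)
  also have "\<dots> = (\<Sum>s\<in>keys p. \<Sum>t\<in>keys q. scale (lookup p s * lookup q t) (phi s * phi t))
      - scale (sg \<alpha> \<beta>) (\<Sum>t\<in>keys q. \<Sum>s\<in>keys p. scale (lookup q t * lookup p s) (phi t * phi s))"
    by (subst (3) sum.swap) (simp only: sum_subtractf pm.scale_sum_right)
  also have "\<dots> = Phi p * Phi q - scale (sg \<alpha> \<beta>) (Phi q * Phi p)"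
    unfolding Phi_def lin_ext_def sum_product
    by (simp add: scale_mult_left scale_mult_right mult.commute)
  finally show ?thesis .
qed

definition locrel :: "'v \<Rightarrow> 'v \<Rightarrow> int \<Rightarrow> int \<Rightarrow> ('v \<times> int) walg" where
  "locrel i j m n = (\<Sum>k\<le>N_plus i j. scale ((- 1) ^ k * of_nat (N_plus i j choose k))
     (letter (i, m - int k) * letter (j, n + int k)
        - scale (sg (basis i) (basis j)) (letter (j, n + int k) * letter (i, m - int k))))"

text \<open>Besides the images of the Lie relations (\<open>Phi_relation\<close>), the letters
  \<open>i(n)\<close> with \<open>i\<close> outside the quiver are set to zero, so that words,
  degrees and functionals can be handled on the whole type.\<close>

definition "rels = {locrel i j m n | i j m n. i \<in> verts Q \<and> j \<in> verts Q} \<union> {letter (i, n) | i n. i \<notin> verts Q}"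

abbreviation "rel_gens \<equiv> {single u 1 * r * single v 1 | u r v. r \<in> rels}"
abbreviation "letter_gens X \<equiv> {single u 1 * letter g | u g. g \<in> X}"

definition "II = pm.span rel_gens"

lemma subspace_II: "pm.subspace II" by (simp add: II_def)

lemma gdeg_shift: "gdeg (j, n + k) + gdeg (i, m - k) = gdeg (i, m) + gdeg (j, n)"
  by (simp add: gdeg_simp algebra_simps)

lemma homog_locrel: "homog (gdeg (i, m) + gdeg (j, n)) (locrel i j m n)"
proof -
  have "homog (gdeg (i, m) + gdeg (j, n)) (letter (j, n + int k) * letter (i, m - int k))" for k
    unfolding gdeg_shift[of j n "int k" i m, symmetric] by (intro homog_simps homog_letter)
  moreover have "homog (gdeg (i, m) + gdeg (j, n)) (letter (i, m - int k) * letter (j, n + int k))" for k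
    unfolding gdeg_shift[of j n "int k" i m, symmetric] add.commute[of "gdeg (j, _)"] by (intro homog_simps homog_letter)
  ultimately show ?thesis unfolding locrel_def by (intro homog_sum homog_simps(1-4))
qed

lemma homog_rels: "r \<in> rels \<Longrightarrow> \<exists>\<gamma>. homog \<gamma> r"
  unfolding rels_def using homog_locrel homog_letter by blast

lemma homog_II_gens: "p \<in> rel_gens \<Longrightarrow> \<exists>\<gamma>. homog \<gamma> p"
  using homog_rels homog_simps(5) homog_single by blast

lemma II_ideal: "p \<in> II \<Longrightarrow> t * p \<in> II" "p \<in> II \<Longrightarrow> p * t \<in> II"
proof -
  show "t * p \<in> II" if "p \<in> II"
  proof (induction t rule: pm_induct)
    case (single x)
    have "Vector_Spaces.linear scale scale ((*) (single x 1 :: ('v \<times> int) walg))"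
      by (simp add: Vector_Spaces.linear_iff vector_space_scale distrib_left scale_mult_right)
    then show ?case
    proof (rule linear_in_subspace[OF _ subspace_II _ that[unfolded II_def]])
      fix p assume "p \<in> rel_gens"
      then obtain u r v where "p = single u 1 * r * single v 1" "r \<in> rels" by blast
      then have "single x 1 * p = single (x + u) 1 * r * single v 1" by (simp add: single_mult_single flip: mult.assoc)
      then show "single x 1 * p \<in> II" unfolding II_def using \<open>r \<in> rels\<close> by (intro pm.span_base) blast
    qed
  qed (simp_all add: distrib_right scale_mult_left pm.subspace_add[OF subspace_II] pm.subspace_scale[OF subspace_II])
  show "p * t \<in> II" if "p \<in> II"
  proof (induction t rule: pm_induct)
    case (single x)
    have "Vector_Spaces.linear scale scale (\<lambda>p. p * (single x 1 :: ('v \<times> int) walg))"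
      by (simp add: Vector_Spaces.linear_iff vector_space_scale distrib_right scale_mult_left)
    then show ?case
    proof (rule linear_in_subspace[OF _ subspace_II _ that[unfolded II_def]])
      fix p assume "p \<in> rel_gens"
      then obtain u r v where "p = single u 1 * r * single v 1" "r \<in> rels" by blast
      then have "p * single x 1 = single u 1 * r * single (v + x) 1" by (simp add: single_mult_single mult.assoc)
      then show "p * single x 1 \<in> II" unfolding II_def using \<open>r \<in> rels\<close> by (intro pm.span_base) blast
    qed
  qed (simp_all add: distrib_left scale_mult_right pm.subspace_add[OF subspace_II] pm.subspace_scale[OF subspace_II])
qed

lemma rels_II: "r \<in> rels \<Longrightarrow> r \<in> II"
proof -
  assume r: "r \<in> rels"
  have "r = single 0 1 * r * single 0 1" by simp
  with r show ?thesis unfolding II_def by (intro pm.span_base) blast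
qed

text \<open>The generators of \<open>II\<close> are homogeneous, and a twist only rescales
  homogeneous elements. The braided commutator with an inhomogeneous element of the ideal involves
  its twist, whence the need for this.\<close>

lemma tw_II: "p \<in> II \<Longrightarrow> tw \<alpha> p \<in> II"
proof -
  assume "p \<in> II"
  show ?thesis unfolding tw_def
  proof (rule linear_in_subspace[OF lin_scale subspace_II _ \<open>p \<in> II\<close>[unfolded II_def]])
    fix p assume p: "p \<in> rel_gens"
    then obtain \<gamma> where "homog \<gamma> p" using homog_II_gens by blast
    then have "tw \<alpha> p = scale (sg \<alpha> (fst \<gamma>)) p" by (rule tw_homog)
    moreover have "p \<in> II" unfolding II_def by (rule pm.span_base[OF p])
    ultimately show "lin_ext scale (\<lambda>u. single u (sg \<alpha> (ldeg u))) p \<in> II"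
      using pm.subspace_scale[OF subspace_II] by (simp add: tw_def)
  qed
qed

subsection \<open>The Lie algebra\<close>

abbreviation "mdom \<equiv> {p :: 'v lie_free. keys p \<subseteq> {t. set_magma t \<subseteq> verts Q \<times> UNIV}}"

sublocale M: algebra_presentation mdom magma_lie magma_bracket
  by (rule algebra_presentation_magma)

lemma lie_gens_D: "lie_axioms \<union> lie_relations \<subseteq> mdom"
proof -
  have s: "single t c \<in> mdom" if "set_magma t \<subseteq> verts Q \<times> UNIV" for t c using that by simp
  have "lie_axioms \<subseteq> mdom"
    unfolding lie_axioms_def by (intro Un_least subsetI; elim CollectE exE conjE; hypsubst; intro M.A.Dadd M.A.Dminus s) auto
  moreover have "lie_relations \<subseteq> mdom"
    unfolding lie_relations_def by (intro subsetI; elim CollectE exE conjE; hypsubst; intro pm.subspace_sum[OF M.A.subD] s) auto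
  ultimately show ?thesis by blast
qed

lemmas lie_ideal_props = M.gen_ideal_props[OF lie_gens_D, folded lie_ideal_def]
lemmas lie_quot = M.quot_gen_ideal[OF lie_gens_D, folded lie_ideal_def lie_def]

definition "lc = M.A.coset lie_ideal"

sublocale L: presentation scale mdom lie lc
  unfolding lc_def by unfold_locales (rule lie_quot(1))

lemma lc_eq_iff: "x \<in> mdom \<Longrightarrow> y \<in> mdom \<Longrightarrow> lc x = lc y \<longleftrightarrow> x - y \<in> lie_ideal"
  unfolding lc_def by (rule lie_quot(2))

lemma lc_mult: "x \<in> mdom \<Longrightarrow> y \<in> mdom \<Longrightarrow> lc x \<otimes>\<^bsub>lie\<^esub> lc y = lc (magma_bracket x y)"
  unfolding lc_def by (rule lie_quot(3))

lemma lie_gen_lc: "lie_gen i n = lc (single (Gen (i, n)) 1)"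
  by (simp add: lie_gen_def lc_def M.A.coset_def)

lemma lie_comp_lc: "lie_comp \<gamma> = lc ` {p \<in> mdom. \<forall>t\<in>keys p. magma_degree t = \<gamma>}"
  by (simp add: lie_comp_def quot_comp_def lc_def M.A.coset_def[abs_def] M.car)

lemma Phi_relation:
  "Phi (\<Sum>k\<le>N_plus i j. single (Br (Gen (i, m - int k)) (Gen (j, n + int k))) ((- 1) ^ k * of_nat (N_plus i j choose k)))
    = locrel i j m n"
  by (simp add: Phi_simps locrel_def)

text \<open>Braided commutators satisfy anticommutativity and the Jacobi identity identically, so
  \<open>Phi\<close> kills \<open>lie_axioms\<close>, and it sends \<open>lie_relations\<close> into
  \<open>rels\<close>. It remains to see that the preimage of \<open>II\<close> is an ideal; the
  twist formulas take care of inhomogeneous elements.\<close>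

lemma Phi_lie_ideal: "p \<in> lie_ideal \<Longrightarrow> Phi p \<in> II"
proof -
  have "lie_ideal \<subseteq> {p. Phi p \<in> II}"
    unfolding lie_ideal_def
  proof (rule M.gen_ideal_min[OF _ _ _ lie_gens_D])
    show "pm.subspace {p. Phi p \<in> II}"
      using subspace_II by (simp add: pm.subspace_def Phi_simps)
    have "lie_axioms \<subseteq> {p. Phi p = 0}"
      unfolding lie_axioms_def
      by (intro Un_least subsetI; elim CollectE exE conjE; hypsubst)
        (simp_all add: Phi_simps algebra_simps scale_mult_left scale_mult_right pm.scale_right_diff_distrib
          sg_add sg_commute)
    then have "lie_axioms \<subseteq> {p. Phi p \<in> II}" using pm.subspace_0[OF subspace_II] by auto
    moreover have "lie_relations \<subseteq> {p. Phi p \<in> II}"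
    proof -
      have "locrel i j m n \<in> II" if "i \<in> verts Q" "j \<in> verts Q" for i j m n
        by (rule rels_II) (use that in \<open>auto simp: rels_def\<close>)
      then show ?thesis unfolding lie_relations_def by (auto simp: Phi_relation)
    qed
    ultimately show "lie_axioms \<union> lie_relations \<subseteq> {p. Phi p \<in> II}" by blast
    fix x h :: "'v lie_free" assume h: "h \<in> {p. Phi p \<in> II}"
    have "Phi (magma_bracket x h) \<in> II"
    proof (induction x rule: pm_induct)
      case (single s)
      show ?case unfolding Phi_bracket_left using h by (intro pm.subspace_diff subspace_II II_ideal tw_II) auto
    qed (simp_all add: magma_bracket_simps Phi_simps pm.subspace_add[OF subspace_II] pm.subspace_scale[OF subspace_II])
    moreover have "Phi (magma_bracket h x) \<in> II"
    proof (induction x rule: pm_induct)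
      case (single s)
      show ?case unfolding Phi_bracket_right using h by (intro pm.subspace_diff subspace_II II_ideal tw_II) auto
    qed (simp_all add: magma_bracket_simps Phi_simps pm.subspace_add[OF subspace_II] pm.subspace_scale[OF subspace_II])
    ultimately show "magma_bracket x h \<in> {p. Phi p \<in> II} \<and> magma_bracket h x \<in> {p. Phi p \<in> II}" by simp
  qed
  then show "p \<in> lie_ideal \<Longrightarrow> Phi p \<in> II" by blast
qed

end


lemma prod_list_zero: "0 \<in> set xs \<Longrightarrow> prod_list xs = (0 :: 'a::semiring_1)"
  by (induction xs) auto

context symmetric_quiver
begin

subsection \<open>The enveloping algebra\<close>

abbreviation "wdom \<equiv> {p :: 'v env_free. keys p \<subseteq> {u. set (letters u) \<subseteq> carrier lie}}"

sublocale W: algebra_presentation wdom words "(*)"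
  by (rule algebra_presentation_free)

definition "env_gens = {letter (x \<oplus>\<^bsub>lie\<^esub> y) - letter x - letter y | x y. x \<in> carrier lie \<and> y \<in> carrier lie} \<union>
      {letter (c \<odot>\<^bsub>lie\<^esub> x) - scale c (letter x) | c x. x \<in> carrier lie} \<union>
      {letter x * letter y - scale (braid_sign \<alpha> \<beta>) (letter y * letter x) - letter (x \<otimes>\<^bsub>lie\<^esub> y)
        | x y \<alpha> \<beta> m n. x \<in> lie_comp (\<alpha>, m) \<and> y \<in> lie_comp (\<beta>, n)}"

lemma env_gensE:
  assumes "r \<in> env_gens"
  obtains p p' where "p \<in> mdom" "p' \<in> mdom" "r = letter (lc (p + p')) - letter (lc p) - letter (lc p')"
  | c p where "p \<in> mdom" "r = letter (lc (scale c p)) - scale c (letter (lc p))"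
  | p p' \<alpha> \<beta> m n where "p \<in> mdom" "p' \<in> mdom" "\<forall>t\<in>keys p. magma_degree t = (\<alpha>, m)" "\<forall>t\<in>keys p'. magma_degree t = (\<beta>, n)"
     "r = letter (lc p) * letter (lc p') - scale (sg \<alpha> \<beta>) (letter (lc p') * letter (lc p)) - letter (lc (magma_bracket p p'))"
proof -
  from assms consider (1) "r \<in> {letter (x \<oplus>\<^bsub>lie\<^esub> y) - letter x - letter y | x y. x \<in> carrier lie \<and> y \<in> carrier lie}"
    | (2) "r \<in> {letter (c \<odot>\<^bsub>lie\<^esub> x) - scale c (letter x) | c x. x \<in> carrier lie}"
    | (3) "r \<in> {letter x * letter y - scale (braid_sign \<alpha> \<beta>) (letter y * letter x) - letter (x \<otimes>\<^bsub>lie\<^esub> y)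
        | x y \<alpha> \<beta> m n. x \<in> lie_comp (\<alpha>, m) \<and> y \<in> lie_comp (\<beta>, n)}"
    unfolding env_gens_def by blast
  then show thesis
  proof cases
    case 1
    then obtain x y where r: "r = letter (x \<oplus>\<^bsub>lie\<^esub> y) - letter x - letter y" "x \<in> carrier lie" "y \<in> carrier lie" by blast
    then obtain p p' where p: "p \<in> mdom" "x = lc p" "p' \<in> mdom" "y = lc p'" unfolding L.im[symmetric] by (elim imageE)
    show thesis using that(1)[OF p(1,3)] r(1) L.add[OF p(1,3)] p by simp
  next
    case 2
    then obtain c x where r: "r = letter (c \<odot>\<^bsub>lie\<^esub> x) - scale c (letter x)" "x \<in> carrier lie" by blast
    then obtain p where p: "p \<in> mdom" "x = lc p" unfolding L.im[symmetric] by (elim imageE)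
    show thesis using that(2)[OF p(1)] r(1) L.smul[OF p(1)] p by simp
  next
    case 3
    then obtain x y \<alpha> \<beta> m n where r: "r = letter x * letter y - scale (sg \<alpha> \<beta>) (letter y * letter x) - letter (x \<otimes>\<^bsub>lie\<^esub> y)"
      "x \<in> lie_comp (\<alpha>, m)" "y \<in> lie_comp (\<beta>, n)" by blast
    then obtain p p' where p: "p \<in> mdom" "\<forall>t\<in>keys p. magma_degree t = (\<alpha>, m)" "x = lc p"
       "p' \<in> mdom" "\<forall>t\<in>keys p'. magma_degree t = (\<beta>, n)" "y = lc p'" unfolding lie_comp_lc by blast
    show thesis using that(3)[OF p(1,4,2,5)] r(1) lc_mult[OF p(1,4)] p by simp
  qed
qed

lemma letter_D: "x \<in> carrier lie \<Longrightarrow> letter x \<in> wdom"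
  by (simp add: letter_def)

lemma lc_D: "p \<in> mdom \<Longrightarrow> letter (lc p) \<in> wdom"
  by (rule letter_D[OF L.q_carrier])

lemma env_gens_D: "env_gens \<subseteq> wdom"
proof
  fix r assume "r \<in> env_gens"
  then show "r \<in> wdom"
  proof (cases rule: env_gensE)
    case (1 p p')
    then show ?thesis by (simp only:) (intro W.A.Dminus lc_D M.A.Dadd)
  next
    case (2 c p)
    then show ?thesis by (simp only:) (intro W.A.Dminus lc_D W.A.Dscale M.A.Dscale)
  next
    case (3 p p')
    then show ?thesis by (simp only:) (intro W.A.Dminus lc_D W.A.Dscale W.mD M.mD)
  qed
qed

lemma env_ideal_eq: "env_ideal = gen_ideal words env_gens"
  by (simp add: env_ideal_def env_gens_def)

lemmas env_ideal_props = W.gen_ideal_props[OF env_gens_D, folded env_ideal_eq]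
lemmas env_quot = W.quot_gen_ideal[OF env_gens_D, folded env_ideal_eq env_def]

definition "ec = W.A.coset env_ideal"

sublocale E: presentation scale wdom env ec
  unfolding ec_def by unfold_locales (rule env_quot(1))

lemma ec_eq_iff: "x \<in> wdom \<Longrightarrow> y \<in> wdom \<Longrightarrow> ec x = ec y \<longleftrightarrow> x - y \<in> env_ideal"
  unfolding ec_def by (rule env_quot(2))

lemma ec_mult: "x \<in> wdom \<Longrightarrow> y \<in> wdom \<Longrightarrow> ec x \<otimes>\<^bsub>env\<^esub> ec y = ec (x * y)"
  unfolding ec_def by (rule env_quot(3))

lemma env_incl_ec: "env_incl x = ec (letter x)"
  by (simp add: env_incl_def ec_def W.A.coset_def)

lemma env_one: "\<one>\<^bsub>env\<^esub> = ec 1"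
proof -
  have "\<one>\<^bsub>words\<^esub> = 1" by (simp add: free_algebra_def)
  then show ?thesis by (simp add: env_def quot_space_def ec_def W.A.coset_def)
qed

definition "gen_map g = (if fst g \<in> verts Q then letter (lie_gen (fst g) (snd g)) else 0)"

text \<open>Replaces words in arbitrary Lie algebra elements, from which \<open>env\<close> is
  built, by words in the letters \<open>i(n)\<close> alone.\<close>

definition "qe p = ec (whom gen_map p)"

lemma gen_D: "i \<in> verts Q \<Longrightarrow> single (Gen (i, n)) 1 \<in> mdom" by simp

lemma one_D: "1 \<in> wdom"
  by (simp flip: single_0_1 add: single_one del: single_one)

lemma gen_map_D: "gen_map g \<in> wdom"
proof (cases "fst g \<in> verts Q")
  case True
  then show ?thesis unfolding gen_map_def lie_gen_lc using lc_D[OF gen_D[of "fst g" "snd g"]] by simp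
qed (simp add: gen_map_def)

lemma prod_list_D: "(\<And>x. x \<in> set xs \<Longrightarrow> f x \<in> wdom) \<Longrightarrow> prod_list (map f xs) \<in> wdom"
proof (induction xs)
  case Nil then show ?case using one_D by simp
next
  case (Cons a xs)
  have "f a * prod_list (map f xs) \<in> wdom" by (rule W.mD) (use Cons in auto)
  then show ?case by simp
qed

lemma whom_gen_D: "whom gen_map p \<in> wdom"
proof (induction p rule: pm_induct)
  case (single x)
  have "prod_list (map gen_map (letters x)) \<in> wdom" by (rule prod_list_D) (rule gen_map_D)
  then show ?case by (simp only: whom_simps pm.scale_one)
next
  case (add p q) then show ?case unfolding whom_simps by (rule W.A.Dadd)
next
  case (scale c p) then show ?case unfolding whom_simps by (rule W.A.Dscale)
qed

lemma qe_add: "qe p \<oplus>\<^bsub>env\<^esub> qe p' = qe (p + p')" and qe_smul: "c \<odot>\<^bsub>env\<^esub> qe p = qe (scale c p)"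
  and qe_mult: "qe p \<otimes>\<^bsub>env\<^esub> qe p' = qe (p * p')" and qe_one: "\<one>\<^bsub>env\<^esub> = qe 1"
  unfolding qe_def whom_simps whom_mult env_one
  by (rule E.add[OF whom_gen_D whom_gen_D] E.smul[OF whom_gen_D] ec_mult[OF whom_gen_D whom_gen_D] refl)+

lemma env_idealI:
  "x \<in> carrier lie \<Longrightarrow> y \<in> carrier lie \<Longrightarrow> letter (x \<oplus>\<^bsub>lie\<^esub> y) - letter x - letter y \<in> env_ideal"
  "x \<in> carrier lie \<Longrightarrow> letter (c \<odot>\<^bsub>lie\<^esub> x) - scale c (letter x) \<in> env_ideal"
  "x \<in> lie_comp (\<alpha>, m) \<Longrightarrow> y \<in> lie_comp (\<beta>, n) \<Longrightarrow>
    letter x * letter y - scale (sg \<alpha> \<beta>) (letter y * letter x) - letter (x \<otimes>\<^bsub>lie\<^esub> y) \<in> env_ideal"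
    apply (rule subsetD[OF env_ideal_props(3)], unfold env_gens_def, rule UnI1, rule UnI1, intro CollectI exI conjI; (rule refl | assumption))
   apply (rule subsetD[OF env_ideal_props(3)], unfold env_gens_def, rule UnI1, rule UnI2, intro CollectI exI conjI; (rule refl | assumption))
  apply (rule subsetD[OF env_ideal_props(3)], unfold env_gens_def, rule UnI2, intro CollectI exI conjI; (rule refl | assumption))
  done

lemma env_incl_add: assumes "p \<in> mdom" "p' \<in> mdom"
  shows "env_incl (lc (p + p')) = env_incl (lc p) \<oplus>\<^bsub>env\<^esub> env_incl (lc p')"
proof -
  have "letter (lc p \<oplus>\<^bsub>lie\<^esub> lc p') - letter (lc p) - letter (lc p') \<in> env_ideal"
    by (intro env_idealI L.q_carrier assms)
  then have "letter (lc (p + p')) - (letter (lc p) + letter (lc p')) \<in> env_ideal"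
    using L.add[OF assms] by (simp add: algebra_simps)
  then show ?thesis unfolding env_incl_ec E.add[OF lc_D lc_D, OF assms]
    by (subst ec_eq_iff[OF lc_D[OF M.A.Dadd[OF assms]] W.A.Dadd[OF lc_D[OF assms(1)] lc_D[OF assms(2)]]])
qed

lemma env_incl_scale: assumes "p \<in> mdom"
  shows "env_incl (lc (scale c p)) = c \<odot>\<^bsub>env\<^esub> env_incl (lc p)"
proof -
  have "letter (c \<odot>\<^bsub>lie\<^esub> lc p) - scale c (letter (lc p)) \<in> env_ideal"
    by (intro env_idealI L.q_carrier assms)
  then have "letter (lc (scale c p)) - scale c (letter (lc p)) \<in> env_ideal"
    using L.smul[OF assms] by simp
  then show ?thesis unfolding env_incl_ec E.smul[OF lc_D, OF assms]
    by (subst ec_eq_iff[OF lc_D[OF M.A.Dscale[OF assms]] W.A.Dscale[OF lc_D[OF assms]]])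
qed

lemma env_incl_bracket:
  assumes "p \<in> mdom" "p' \<in> mdom" "\<forall>t\<in>keys p. magma_degree t = (\<alpha>, m)" "\<forall>t\<in>keys p'. magma_degree t = (\<beta>, n)"
  shows "env_incl (lc (magma_bracket p p')) = ec (letter (lc p) * letter (lc p') - scale (sg \<alpha> \<beta>) (letter (lc p') * letter (lc p)))"
proof -
  have "lc p \<in> lie_comp (\<alpha>, m)" "lc p' \<in> lie_comp (\<beta>, n)" unfolding lie_comp_lc using assms by blast+
  then have "letter (lc p) * letter (lc p') - scale (sg \<alpha> \<beta>) (letter (lc p') * letter (lc p)) - letter (lc p \<otimes>\<^bsub>lie\<^esub> lc p') \<in> env_ideal"
    by (intro env_idealI)
  then have *: "letter (lc p) * letter (lc p') - scale (sg \<alpha> \<beta>) (letter (lc p') * letter (lc p)) - letter (lc (magma_bracket p p')) \<in> env_ideal"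
    by (simp add: lc_mult[OF assms(1,2)])
  have "letter (lc p) * letter (lc p') - scale (sg \<alpha> \<beta>) (letter (lc p') * letter (lc p)) \<in> wdom"
    by (intro W.A.Dminus W.A.Dscale W.mD lc_D assms(1,2))
  from ec_eq_iff[OF this lc_D[OF M.mD[OF assms(1,2)]]] * show ?thesis unfolding env_incl_ec by simp
qed

text \<open>The commutator relations of \<open>env\<close>, which hold for homogeneous elements,
  unfold a bracket monomial step by step; monomials are homogeneous.\<close>

lemma env_incl_phi: "set_magma s \<subseteq> verts Q \<times> UNIV \<Longrightarrow> env_incl (lc (single s 1)) = qe (phi s)"
proof (induction s)
  case (Gen g)
  then show ?case by (cases g) (simp add: env_incl_ec qe_def whom_simps gen_map_def lie_gen_lc)
next
  case (Br s t)
  have D: "single s 1 \<in> mdom" "single t 1 \<in> mdom" using Br.prems by auto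
  have e: "ec (letter (lc (single s 1))) = qe (phi s)" "ec (letter (lc (single t 1))) = qe (phi t)"
    using Br by (auto simp: env_incl_ec)
  have "env_incl (lc (single (Br s t) 1)) = env_incl (lc (magma_bracket (single s 1) (single t 1)))"
    by (simp add: magma_bracket_simps)
  also have "\<dots> = ec (letter (lc (single s 1)) * letter (lc (single t 1)) +
     scale (- sg (fst (magma_degree s)) (fst (magma_degree t))) (letter (lc (single t 1)) * letter (lc (single s 1))))"
    by (subst env_incl_bracket[OF D, where \<alpha>="fst (magma_degree s)" and m="snd (magma_degree s)" and \<beta>="fst (magma_degree t)" and n="snd (magma_degree t)"])
      (simp_all add: pm.scale_minus_left)
  also have "\<dots> = (qe (phi s) \<otimes>\<^bsub>env\<^esub> qe (phi t)) \<oplus>\<^bsub>env\<^esub> (- sg (fst (magma_degree s)) (fst (magma_degree t))) \<odot>\<^bsub>env\<^esub> (qe (phi t) \<otimes>\<^bsub>env\<^esub> qe (phi s))"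
    unfolding e[symmetric]
    by (simp only: ec_mult[OF lc_D[OF D(1)] lc_D[OF D(2)]] ec_mult[OF lc_D[OF D(2)] lc_D[OF D(1)]]
      E.smul[OF W.mD[OF lc_D[OF D(2)] lc_D[OF D(1)]]]
      E.add[OF W.mD[OF lc_D[OF D(1)] lc_D[OF D(2)]] W.A.Dscale[OF W.mD[OF lc_D[OF D(2)] lc_D[OF D(1)]]]])
  also have "\<dots> = qe (phi (Br s t))"
    unfolding qe_mult qe_add qe_smul by (simp add: pm.scale_minus_left)
  finally show ?case .
qed

lemma env_incl_Phi: "p \<in> mdom \<Longrightarrow> env_incl (lc p) = qe (Phi p)"
proof -
  assume "p \<in> mdom"
  then have "p \<in> pm.span {single x 1 | x. x \<in> {t. set_magma t \<subseteq> verts Q \<times> UNIV}}" by (simp only: pm_span_single)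
  then have "p \<in> mdom \<and> env_incl (lc p) = qe (Phi p)"
  proof (induction rule: pm.span_induct_alt)
    case base
    have "env_incl (lc (scale 0 0)) = 0 \<odot>\<^bsub>env\<^esub> env_incl (lc 0)" by (rule env_incl_scale) simp
    also have "\<dots> = ec (scale 0 (letter (lc 0)))" unfolding env_incl_ec by (rule E.smul) (rule lc_D, simp)
    also have "\<dots> = qe (Phi 0)" by (simp add: Phi_simps qe_def whom_simps)
    finally show ?case by simp
  next
    case (step c x y)
    then obtain s where s: "x = single s 1" "set_magma s \<subseteq> verts Q \<times> UNIV" by blast
    then have xD: "x \<in> mdom" by simp
    have "env_incl (lc (scale c x + y)) = c \<odot>\<^bsub>env\<^esub> env_incl (lc x) \<oplus>\<^bsub>env\<^esub> env_incl (lc y)"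
      using step.IH by (simp only: env_incl_add[OF M.A.Dscale[OF xD]] env_incl_scale[OF xD])
    also have "\<dots> = qe (Phi (scale c x + y))"
      using step.IH s env_incl_phi[OF s(2)] by (simp add: qe_smul qe_add Phi_simps)
    finally show ?case using M.A.Dadd[OF M.A.Dscale[OF xD]] step.IH by blast
  qed
  then show ?thesis by blast
qed

definition "rep x = (SOME p. p \<in> mdom \<and> lc p = x)"

lemma rep: "x \<in> carrier lie \<Longrightarrow> rep x \<in> mdom \<and> lc (rep x) = x"
  unfolding rep_def L.im[symmetric] by (rule someI_ex) auto

lemma rep_lc: "p \<in> mdom \<Longrightarrow> Phi (rep (lc p)) - Phi p \<in> II"
  using lc_eq_iff[of "rep (lc p)" p] rep[OF L.q_carrier, of p] Phi_lie_ideal by (simp flip: Phi_simps)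

text \<open>A map opposite to \<open>whom gen_map\<close>: each Lie algebra element is written in
  bracket monomials and expanded. Because of the choice in \<open>rep\<close> it respects the linear
  relations between letters only modulo \<open>II\<close>, see \<open>rep_lc\<close>.\<close>

definition "Psi = whom (\<lambda>x. Phi (rep x))"

lemma II_mult_cong: assumes "a - a' \<in> II" "b - b' \<in> II" shows "a * b - a' * b' \<in> II"
proof -
  have "a * b - a' * b' = (a - a') * b + a' * (b - b')" by (simp add: algebra_simps)
  then show ?thesis using assms II_ideal pm.subspace_add[OF subspace_II] by metis
qed

lemma Psi_ideal: "p \<in> env_ideal \<Longrightarrow> Psi p \<in> II"
proof -
  have S: "a - b - c \<in> II" if "a - a' \<in> II" "b - b' \<in> II" "c - c' \<in> II" "a' - b' - c' = 0" for a b c a' b' c'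
  proof -
    have "a - b - c = (a - a') - (b - b') - (c - c') + (a' - b' - c')" by simp
    then show ?thesis using that pm.subspace_diff[OF subspace_II] by (metis add.right_neutral)
  qed
  have sc: "scale c a - scale c b \<in> II" if "a - b \<in> II" for a b c
    using pm.subspace_scale[OF subspace_II that, of c] by (simp add: pm.scale_right_diff_distrib)
  have "env_ideal \<subseteq> {p. Psi p \<in> II}"
    unfolding env_ideal_eq
  proof (rule W.gen_ideal_min[OF _ _ _ env_gens_D])
    show "pm.subspace {p. Psi p \<in> II}"
      using subspace_II by (simp add: pm.subspace_def Psi_def whom_simps)
    show "env_gens \<subseteq> {p. Psi p \<in> II}"
    proof
      fix r assume "r \<in> env_gens"
      then have "Psi r \<in> II"
      proof (cases rule: env_gensE)
        case (1 p p')
        then show ?thesis unfolding 1(3) Psi_def whom_simps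
          by (intro S[OF rep_lc rep_lc rep_lc] M.A.Dadd) (simp_all add: Phi_simps)
      next
        case (2 c p)
        have "Phi (rep (lc (scale c p))) - scale c (Phi (rep (lc p))) - 0 \<in> II"
          by (intro S[OF rep_lc[OF M.A.Dscale[OF 2(1)]] sc[OF rep_lc[OF 2(1)]], where c'=0])
            (simp_all add: Phi_simps pm.subspace_0[OF subspace_II])
        then show ?thesis unfolding 2(2) Psi_def whom_simps by simp
      next
        case (3 p p' \<alpha> \<beta> m n)
        show ?thesis unfolding 3(5) Psi_def whom_simps whom_mult
          by (rule S[OF II_mult_cong[OF rep_lc[OF 3(1)] rep_lc[OF 3(2)]] sc[OF II_mult_cong[OF rep_lc[OF 3(2)] rep_lc[OF 3(1)]]]
              rep_lc[OF M.mD[OF 3(1,2)]]])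
            (use 3 in \<open>simp add: Phi_bracket_homog[of p \<alpha> p' \<beta>]\<close>)
      qed
      then show "r \<in> {p. Psi p \<in> II}" by simp
    qed
  qed (auto simp: Psi_def whom_mult II_ideal)
  then show "p \<in> env_ideal \<Longrightarrow> Psi p \<in> II" by blast
qed

lemma prod_list_II: "(\<And>x. x \<in> set xs \<Longrightarrow> f x - g x \<in> II) \<Longrightarrow> prod_list (map f xs) - prod_list (map g xs) \<in> II"
  by (induction xs) (auto simp: pm.subspace_0[OF subspace_II] intro: II_mult_cong)

lemma prod_list_letters: "prod_list (map letter u) = single (FMon u) 1"
  by (induction u) (simp_all add: letter_def single_mult_single zero_fmon_def[symmetric])

lemma whom_prod_list: "whom h (prod_list xs) = prod_list (map (whom h) xs)"
  by (induction xs) (simp_all add: whom_simps whom_mult)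

lemma Psi_whom: "Psi (whom gen_map p) - p \<in> II"
proof (induction p rule: pm_induct)
  case (single u)
  have "Psi (gen_map g) - letter g \<in> II" for g
  proof (cases "fst g \<in> verts Q")
    case True
    then show ?thesis using rep_lc[OF gen_D[of "fst g" "snd g"]]
      by (simp add: gen_map_def Psi_def whom_simps lie_gen_lc Phi_simps)
  next
    case False
    then have "letter g \<in> rels" unfolding rels_def by (cases g) auto
    from pm.subspace_neg[OF subspace_II rels_II[OF this]] show ?thesis using False by (simp add: gen_map_def Psi_def whom_simps)
  qed
  then have "prod_list (map (\<lambda>g. Psi (gen_map g)) (letters u)) - prod_list (map letter (letters u)) \<in> II"
    by (intro prod_list_II)
  then show ?case by (simp add: prod_list_letters whom_simps Psi_def whom_prod_list comp_def)
next
  case (add p q)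
  then show ?case using pm.subspace_add[OF subspace_II add] by (simp add: whom_simps Psi_def algebra_simps)
next
  case (scale c p)
  then show ?case using pm.subspace_scale[OF subspace_II scale, of c] by (simp add: whom_simps Psi_def pm.scale_right_diff_distrib)
qed

text \<open>The enveloping algebra has the generators and relations of the Lie algebra, brackets
  being read as braided commutators. An element that becomes zero in \<open>env\<close> is carried
  by \<open>Psi\<close> into \<open>II\<close>, and \<open>Psi\<close> undoes \<open>gen_map\<close>
  modulo \<open>II\<close>; conversely, each relation already holds in \<open>lie\<close>.\<close>

lemma qe_eq_iff: "qe p = qe p' \<longleftrightarrow> p - p' \<in> II"
proof -
  have "qe p = qe p' \<longleftrightarrow> whom gen_map (p - p') \<in> env_ideal"
    unfolding qe_def whom_simps by (rule ec_eq_iff[OF whom_gen_D whom_gen_D])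
  also have "\<dots> \<longleftrightarrow> p - p' \<in> II"
  proof
    assume "whom gen_map (p - p') \<in> env_ideal"
    from pm.subspace_diff[OF subspace_II Psi_ideal[OF this] Psi_whom[of "p - p'"]] show "p - p' \<in> II" by simp
  next
    have r: "whom gen_map r \<in> env_ideal" if "r \<in> rels" for r
      using that[unfolded rels_def]
    proof (elim UnE)
      assume "r \<in> {locrel i j m n |i j m n. i \<in> verts Q \<and> j \<in> verts Q}"
      then obtain i j m n where r: "r = locrel i j m n" "i \<in> verts Q" "j \<in> verts Q" by blast
      define x where "x = (\<Sum>k\<le>N_plus i j. single (Br (Gen (i, m - int k)) (Gen (j, n + int k))) ((- 1) ^ k * of_nat (N_plus i j choose k) :: rat))"
      have "x \<in> lie_relations" unfolding x_def lie_relations_def using r by blast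
      then have x: "x \<in> lie_ideal" using lie_ideal_props(3) by blast
      then have xD: "x \<in> mdom" using lie_ideal_props(2) by blast
      have "lc x = lc 0" using lc_eq_iff[OF xD, of 0] x by simp
      then have "qe (Phi x) = qe (Phi 0)" using env_incl_Phi[OF xD] env_incl_Phi[of 0] by simp
      moreover have "Phi x = r" unfolding x_def Phi_relation r ..
      ultimately have "ec (whom gen_map r) = ec 0" by (simp add: qe_def Phi_simps(4) whom_simps(4))
      then show "whom gen_map r \<in> env_ideal" using ec_eq_iff[OF whom_gen_D, of 0 r] by simp
    next
      assume "r \<in> {letter (i, n) |i n. i \<notin> verts Q}"
      then have "whom gen_map r = 0" by (auto simp: whom_simps gen_map_def)
      then show ?thesis using pm.subspace_0[OF env_ideal_props(1)] by simp
    qed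
    assume "p - p' \<in> II"
    then have "p - p' \<in> pm.span {single u 1 * r * single v 1 |u r v. r \<in> rels}" by (simp only: II_def)
    then show "whom gen_map (p - p') \<in> env_ideal"
    proof (rule linear_in_subspace[OF linear_whom env_ideal_props(1), rotated])
      fix x assume "x \<in> {single u 1 * r * single v 1 |u r v. r \<in> rels}"
      then obtain u v s where "x = single u 1 * s * single v 1" "s \<in> rels" by blast
      then show "whom gen_map x \<in> env_ideal"
        using env_ideal_props(4)[OF whom_gen_D r, of s "single u 1"] env_ideal_props(5)[OF whom_gen_D]
        by (simp only: whom_mult)
    qed
  qed
  finally show ?thesis .
qed

lemma qe_word: assumes "set xs \<subseteq> carrier lie"
  shows "ec (single (FMon xs) 1) = qe (prod_list (map (\<lambda>x. Phi (rep x)) xs))"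
  using assms
proof (induction xs)
  case Nil
  show ?case by (simp add: qe_def whom_simps flip: zero_fmon_def)
next
  case (Cons x xs)
  have D: "letter x \<in> wdom" "single (FMon xs) 1 \<in> wdom" using Cons.prems by (auto simp: letter_def)
  have "ec (single (FMon (x # xs)) 1) = ec (letter x * single (FMon xs) 1)"
    by (simp add: letter_def single_mult_single)
  also have "\<dots> = ec (letter x) \<otimes>\<^bsub>env\<^esub> ec (single (FMon xs) 1)" using ec_mult[OF D] by simp
  also have "ec (letter x) = qe (Phi (rep x))" using env_incl_Phi[of "rep x"] rep[of x] Cons.prems by (simp add: env_incl_ec)
  finally show ?case using Cons by (simp add: qe_mult)
qed

lemma pres_qe: "pres scale UNIV env qe"
proof -
  have "qe ` UNIV = carrier env"
  proof
    show "qe ` UNIV \<subseteq> carrier env" unfolding qe_def using E.q_carrier[OF whom_gen_D] by blast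
    have "x \<in> wdom \<and> ec x \<in> range qe" if "x \<in> pm.span {single z 1 |z. z \<in> {u. set (letters u) \<subseteq> carrier lie}}" for x
      using that
    proof (induction rule: pm.span_induct_alt)
      case base
      have "ec 0 = qe 0" by (simp add: qe_def whom_simps)
      then show ?case by (intro conjI W.A.D0) (metis rangeI)
    next
      case (step c x y)
      then obtain u where u: "x = single u 1" "set (letters u) \<subseteq> carrier lie" by blast
      then have xD: "x \<in> wdom" by simp
      obtain a where a: "ec x = qe a" using qe_word[OF u(2)] u(1) by (cases u) auto
      obtain b where b: "ec y = qe b" using step.IH by blast
      have "ec (scale c x + y) = qe (scale c a + b)"
        using step.IH xD by (simp only: qe_add[symmetric] qe_smul[symmetric] a[symmetric] b[symmetric] E.smul[OF xD] E.add[OF W.A.Dscale[OF xD]])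
      then show ?case using step.IH W.A.Dadd[OF W.A.Dscale[OF xD]] by (intro conjI) (blast, simp only: rangeI)
    qed
    then show "carrier env \<subseteq> qe ` UNIV" unfolding E.im[symmetric] pm_span_single by blast
  qed
  moreover have "\<zero>\<^bsub>env\<^esub> = qe 0" by (simp add: E.zero qe_def whom_simps)
  ultimately show ?thesis by (simp add: pres_def vector_space_scale qe_add qe_smul)
qed

sublocale QE: presentation scale UNIV env qe
  by unfold_locales (rule pres_qe)

lemma env_comp_eq: "env_comp \<gamma> = qe ` {t. homog \<gamma> t}"
proof -
  let ?S = "{single (FMon xs) 1 | xs \<gamma>s. list_all2 (\<lambda>x \<delta>. x \<in> lie_comp \<delta>) xs \<gamma>s \<and> sum_list \<gamma>s = \<gamma>} :: 'v env_free set"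
  have lcar: "x \<in> carrier lie" if "x \<in> lie_comp \<delta>" for x \<delta>
    using that L.q_carrier unfolding lie_comp_lc by blast
  have xsD: "set xs \<subseteq> carrier lie" if "list_all2 (\<lambda>x \<delta>. x \<in> lie_comp \<delta>) xs \<gamma>s" for xs \<gamma>s
    using that lcar by (induction rule: list_all2_induct) auto
  have SD: "?S \<subseteq> wdom" using xsD by fastforce
  have "lin_span words (id ` ?S) = id ` pm.span ?S" by (rule W.A.lin_span_image[OF SD])
  then have "env_comp \<gamma> = ec ` pm.span ?S"
    by (simp add: env_comp_def quot_comp_def ec_def W.A.coset_def[abs_def])
  also have "\<dots> = qe ` {t. homog \<gamma> t}"
  proof
    have word: "\<exists>t. homog (sum_list \<gamma>s) t \<and> qe (prod_list (map (\<lambda>x. Phi (rep x)) xs)) = qe t"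
      if "list_all2 (\<lambda>x \<delta>. x \<in> lie_comp \<delta>) xs \<gamma>s" for xs \<gamma>s
      using that
    proof (induction rule: list_all2_induct)
      case Nil
      have "homog 0 1" by (simp add: homog_def)
      then show ?case by auto
    next
      case (Cons x xs \<delta> \<gamma>s)
      then obtain p where p: "x = lc p" "p \<in> mdom" "\<forall>t\<in>keys p. magma_degree t = \<delta>" unfolding lie_comp_lc by blast
      obtain t where t: "homog (sum_list \<gamma>s) t" "qe (prod_list (map (\<lambda>x. Phi (rep x)) xs)) = qe t" using Cons by blast
      have "qe (Phi (rep x)) = qe (Phi p)" using rep_lc[OF p(2)] p(1) by (simp add: qe_eq_iff)
      then have "qe (prod_list (map (\<lambda>x. Phi (rep x)) (x # xs))) = qe (Phi p * t)"
        using t by (simp add: qe_mult[symmetric])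
      then show ?case using homog_simps(5)[OF homog_Phi[OF p(3)] t(1)] by auto
    qed
    have "x \<in> wdom \<and> ec x \<in> qe ` {t. homog \<gamma> t}" if "x \<in> pm.span ?S" for x
      using that
    proof (induction rule: pm.span_induct_alt)
      case base
      have "ec 0 = qe 0" by (simp add: qe_def whom_simps)
      then show ?case by (intro conjI W.A.D0) (metis homog_simps(4) image_eqI mem_Collect_eq)
    next
      case (step c x y)
      then obtain xs \<gamma>s where u: "x = single (FMon xs) 1" "list_all2 (\<lambda>x \<delta>. x \<in> lie_comp \<delta>) xs \<gamma>s" "sum_list \<gamma>s = \<gamma>" by blast
      have xD: "x \<in> wdom" using SD step by blast
      obtain a where a: "ec x = qe a" "homog \<gamma> a" using qe_word[OF xsD[OF u(2)]] word[OF u(2)] u by auto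
      obtain b where b: "ec y = qe b" "homog \<gamma> b" using step.IH by blast
      have "ec (scale c x + y) = qe (scale c a + b)"
        using step.IH xD by (simp only: qe_add[symmetric] qe_smul[symmetric] a(1)[symmetric] b(1)[symmetric] E.smul[OF xD] E.add[OF W.A.Dscale[OF xD]])
      moreover have "homog \<gamma> (scale c a + b)" using a b by (intro homog_simps(1,3))
      ultimately show ?case using step.IH W.A.Dadd[OF W.A.Dscale[OF xD]] by blast
    qed
    then show "ec ` pm.span ?S \<subseteq> qe ` {t. homog \<gamma> t}" by blast
    have "whom gen_map t \<in> pm.span ?S" if "homog \<gamma> t" for t
    proof -
      have "whom gen_map t = (\<Sum>u\<in>keys t. scale (lookup t u) (prod_list (map gen_map (letters u))))"
        by (simp add: whom_def lin_ext_def)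
      also have "\<dots> \<in> pm.span ?S"
      proof (intro pm.span_sum pm.span_scale)
        fix u assume u: "u \<in> keys t"
        show "prod_list (map gen_map (letters u)) \<in> pm.span ?S"
        proof (cases "\<forall>g\<in>set (letters u). fst g \<in> verts Q")
          case False
          then have "prod_list (map gen_map (letters u)) = 0"
            by (intro prod_list_zero) (force simp: gen_map_def image_iff)
          then show ?thesis by (simp add: pm.span_zero)
        next
          case True
          have "map gen_map (letters u) = map letter (map (\<lambda>g. lie_gen (fst g) (snd g)) (letters u))"
            using True by (simp add: gen_map_def)
          then have "prod_list (map gen_map (letters u)) = single (FMon (map (\<lambda>g. lie_gen (fst g) (snd g)) (letters u))) 1"
            by (simp only: prod_list_letters)
          moreover have "list_all2 (\<lambda>x \<delta>. x \<in> lie_comp \<delta>) (map (\<lambda>g. lie_gen (fst g) (snd g)) (letters u)) (map gdeg (letters u))"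
          proof -
            have "lie_gen (fst g) (snd g) \<in> lie_comp (gdeg g)" if "fst g \<in> verts Q" for g
              unfolding lie_comp_lc lie_gen_lc gdeg_def using that by (intro imageI) (auto simp: mem_Times_iff)
            then show ?thesis using True by (auto simp: list_all2_conv_all_nth)
          qed
          moreover have "sum_list (map gdeg (letters u)) = \<gamma>" using that u by (simp add: homog_def wdeg_def)
          ultimately show ?thesis by (intro pm.span_base) blast
        qed
      qed
      finally show ?thesis .
    qed
    then show "qe ` {t. homog \<gamma> t} \<subseteq> ec ` pm.span ?S" unfolding qe_def by blast
  qed
  finally show ?thesis .
qed

end

section \<open>Cyclic modules, coproduct and the coaction kernel\<close>

context symmetric_quiver
begin

text \<open>For \<open>X\<close> inside the quiver, the preimage in the free algebra of the left
  ideal generated by the letters in \<open>X\<close>. Hence relations occur with words on both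
  sides, but letters of \<open>X\<close> only as last factors.\<close>

definition JX :: "('v \<times> int) set \<Rightarrow> ('v \<times> int) walg set" where
  "JX X = pm.span (rel_gens \<union> letter_gens X)"

lemma subspace_JX: "pm.subspace (JX X)" by (simp add: JX_def)

lemma II_JX: "II \<subseteq> JX X" unfolding II_def JX_def by (rule pm.span_mono) blast

lemma JX_mono: "X \<subseteq> Y \<Longrightarrow> JX X \<subseteq> JX Y" unfolding JX_def by (rule pm.span_mono) blast

lemma JX_gen: "g \<in> X \<Longrightarrow> t * letter g \<in> JX X"
proof (induction t rule: pm_induct)
  case (single u) then show ?case unfolding JX_def by (intro pm.span_base) blast
qed (simp_all add: distrib_right scale_mult_left pm.subspace_add[OF subspace_JX] pm.subspace_scale[OF subspace_JX])

lemma JX_left: "p \<in> JX X \<Longrightarrow> t * p \<in> JX X"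
proof (induction t rule: pm_induct)
  case (single x)
  have "Vector_Spaces.linear scale scale ((*) (single x 1 :: ('v \<times> int) walg))"
    by (simp add: Vector_Spaces.linear_iff vector_space_scale distrib_left scale_mult_right)
  then show ?case
  proof (rule linear_in_subspace[OF _ subspace_JX _ single[unfolded JX_def]])
    fix p assume "p \<in> rel_gens \<union> letter_gens X"
    then show "single x 1 * p \<in> JX X"
    proof
      assume "p \<in> rel_gens"
      then have "p \<in> II" unfolding II_def by (rule pm.span_base)
      from II_ideal(1)[OF this] show ?thesis using II_JX by blast
    next
      assume "p \<in> letter_gens X"
      then obtain u g where "p = single u 1 * letter g" "g \<in> X" by blast
      then show ?thesis using JX_gen[of g X "single x 1 * single u 1"] by (simp add: mult.assoc)
    qed
  qed
qed (simp_all add: distrib_right scale_mult_left pm.subspace_add[OF subspace_JX] pm.subspace_scale[OF subspace_JX])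

lemma graded_JX: "graded_subspace wdeg (JX X)"
  unfolding JX_def
proof (rule graded_subspace_span)
  fix p assume "p \<in> rel_gens \<union> letter_gens X"
  then have "\<exists>\<gamma>. homog \<gamma> p"
  proof
    assume "p \<in> letter_gens X"
    then obtain u g where "p = single u 1 * letter g" by blast
    then show ?thesis using homog_simps(5)[OF homog_single homog_letter] by blast
  qed (rule homog_II_gens)
  then show "\<exists>\<gamma>. \<forall>x\<in>keys p. wdeg x = \<gamma>" by (simp add: homog_def)
qed

abbreviation "egens X \<equiv> {env_incl (lie_gen i n) | i n. (i, n) \<in> X}"

lemma env_incl_letter: "i \<in> verts Q \<Longrightarrow> env_incl (lie_gen i n) = qe (letter (i, n))"
  using env_incl_phi[of "Gen (i, n)"] by (simp add: lie_gen_lc)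

text \<open>In \<open>env\<close> the relations are zero, so the two-sided part
  \<open>rel_gens\<close> contributes nothing to the image and the left multiples of the letters
  remain.\<close>

lemma left_ideal_eq: assumes "X \<subseteq> verts Q \<times> UNIV" shows "left_ideal env (egens X) = qe ` JX X"
proof -
  have "{a \<otimes>\<^bsub>env\<^esub> x | a x. a \<in> carrier env \<and> x \<in> egens X} = qe ` {t * letter g | t g. g \<in> X}"
  proof (intro equalityI subsetI)
    fix y assume "y \<in> {a \<otimes>\<^bsub>env\<^esub> x | a x. a \<in> carrier env \<and> x \<in> egens X}"
    then obtain a i n where y: "y = a \<otimes>\<^bsub>env\<^esub> env_incl (lie_gen i n)" "a \<in> carrier env" "(i, n) \<in> X" by blast
    then obtain t where "a = qe t" using QE.im by blast
    then have "y = qe (t * letter (i, n))" using y assms by (auto simp: env_incl_letter qe_mult)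
    then show "y \<in> qe ` {t * letter g | t g. g \<in> X}" using y by blast
  next
    fix y assume "y \<in> qe ` {t * letter g | t g. g \<in> X}"
    then obtain t i n where y: "y = qe (t * letter (i, n))" "(i, n) \<in> X" by auto
    then have "y = qe t \<otimes>\<^bsub>env\<^esub> env_incl (lie_gen i n)" using assms by (auto simp: env_incl_letter qe_mult)
    then show "y \<in> {a \<otimes>\<^bsub>env\<^esub> x | a x. a \<in> carrier env \<and> x \<in> egens X}" using y(2) QE.q_carrier[of t] by blast
  qed
  then have "left_ideal env (egens X) = qe ` pm.span {t * letter g | t g. g \<in> X}"
    unfolding left_ideal_def by (simp only: QE.lin_span_image[OF subset_UNIV])
  also have "\<dots> = qe ` JX X"
  proof
    have "pm.span {t * letter g | t g. g \<in> X} \<subseteq> JX X"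
      by (rule pm.span_minimal[OF _ subspace_JX]) (use JX_gen in blast)
    then show "qe ` pm.span {t * letter g | t g. g \<in> X} \<subseteq> qe ` JX X" by (rule image_mono)
    show "qe ` JX X \<subseteq> qe ` pm.span {t * letter g | t g. g \<in> X}"
    proof
      fix y assume "y \<in> qe ` JX X"
      then obtain a b where y: "y = qe (a + b)" "a \<in> II" "b \<in> pm.span (letter_gens X)"
        unfolding JX_def pm.span_Un II_def by blast
      have "y = qe b" using y qe_eq_iff[of "a + b" b] by simp
      moreover have "letter_gens X \<subseteq> {t * letter g | t g. g \<in> X}" by blast
      from pm.span_mono[OF this] have "b \<in> pm.span {t * letter g | t g. g \<in> X}" using y(3) by blast
      ultimately show "y \<in> qe ` pm.span {t * letter g | t g. g \<in> X}" by blast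
    qed
  qed
  finally show ?thesis .
qed

lemma JXK: "pm.subspace (JX X)" "JX X \<subseteq> UNIV" "\<And>x. x \<in> UNIV \<Longrightarrow> qe x = qe 0 \<Longrightarrow> x \<in> JX X"
  using subspace_JX II_JX by (auto simp: qe_eq_iff)

definition "cq X = QE.coset (JX X)"

lemma cq_coset: "X \<subseteq> verts Q \<times> UNIV \<Longrightarrow> left_ideal env (egens X) +>\<^bsub>env\<^esub> qe p = cq X p"
  by (simp add: left_ideal_eq cq_def QE.coset_def)

lemma pres_cq: "X \<subseteq> verts Q \<times> UNIV \<Longrightarrow> pres scale UNIV (cyc (egens X)) (cq X)"
  unfolding cyc_def cq_def by (simp only: left_ideal_eq QE.pres_quot[OF JXK])

lemma cq_eq_iff: "cq X p = cq X p' \<longleftrightarrow> p - p' \<in> JX X"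
  unfolding cq_def using QE.coset_eq_iff[OF JXK] by blast

lemma cq_eq: "cq X p = {qe (k + p) | k. k \<in> JX X}"
  unfolding cq_def using QE.coset_eq[OF JXK(1,2)] by blast

lemma cq_self: "qe p \<in> cq X p"
  unfolding cq_eq using pm.subspace_0[OF subspace_JX] by (intro CollectI exI[of _ 0]) simp

lemma cyc_vec_cq: "X \<subseteq> verts Q \<times> UNIV \<Longrightarrow> cyc_vec (egens X) = cq X 1"
  unfolding cyc_vec_def qe_one by (rule cq_coset)

lemma cyc_act_cq: assumes "X \<subseteq> verts Q \<times> UNIV" shows "cyc_act (egens X) (qe u) (cq X p) = cq X (u * p)"
proof -
  have "left_ideal env (egens X) +>\<^bsub>env\<^esub> (qe u \<otimes>\<^bsub>env\<^esub> a) = cq X (u * p)" if "a \<in> cq X p" for a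
  proof -
    obtain k where "a = qe (k + p)" "k \<in> JX X" using \<open>a \<in> cq X p\<close> unfolding cq_eq by blast
    then show ?thesis using JX_left[of k X u] by (simp add: qe_mult cq_coset[OF assms] cq_eq_iff algebra_simps)
  qed
  then show ?thesis unfolding cyc_act_def using cq_self[of p X] by auto
qed

lemma cyc_comp_cq: assumes "X \<subseteq> verts Q \<times> UNIV" shows "cyc_comp (egens X) \<gamma> = cq X ` {t. homog \<gamma> t}"
  unfolding cyc_comp_def quot_comp_def env_comp_eq image_image cq_coset[OF assms] ..

definition "X0 = {(i, n). i \<in> verts Q \<and> n \<ge> 0}"
definition "Xw w = {(i, n). i \<in> verts Q \<and> n \<ge> - int (lookup w i)}"

lemma X0_verts: "X0 \<subseteq> verts Q \<times> UNIV" and Xw_verts: "Xw w \<subseteq> verts Q \<times> UNIV" and X0_Xw: "X0 \<subseteq> Xw w"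
  by (auto simp: X0_def Xw_def)

lemma vac_gens_eq: "vac_gens = egens X0" and framed_gens_eq: "framed_gens w = egens (Xw w)"
  by (auto simp: vac_gens_def framed_gens_def X0_def Xw_def)

abbreviation "q0 \<equiv> cq X0"
abbreviation "qw w \<equiv> cq (Xw w)"

sublocale PQ: presentation scale UNIV PQ q0
  unfolding PQ_def vac_gens_eq by unfold_locales (rule pres_cq[OF X0_verts])

lemma Pw_presentation: "presentation scale UNIV (Pw w) (qw w)"
  unfolding Pw_def framed_gens_eq by unfold_locales (rule pres_cq[OF Xw_verts])

lemma PQ_comp_eq: "PQ_comp \<gamma> = q0 ` {t. homog \<gamma> t}"
  unfolding PQ_comp_def vac_gens_eq by (rule cyc_comp_cq[OF X0_verts])

lemma Pw_proj_cq: "Pw_proj w (q0 p) = qw w p"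
proof -
  have "left_ideal env (framed_gens w) +>\<^bsub>env\<^esub> a = qw w p" if "a \<in> q0 p" for a
  proof -
    obtain k where "a = qe (k + p)" "k \<in> JX X0" using \<open>a \<in> q0 p\<close> unfolding cq_eq by blast
    then show ?thesis using JX_mono[OF X0_Xw, of w] by (auto simp: framed_gens_eq cq_coset[OF Xw_verts] cq_eq_iff)
  qed
  then show ?thesis unfolding Pw_proj_def using cq_self[of p X0] by auto
qed

text \<open>The kernel of the map from the free algebra to \<open>Pw_bar w\<close>, see
  \<open>qb\<close>. The L-degree of a letter is a basis vector, so the last set contains only the
  empty word.\<close>

definition "Jb w = pm.span ((rel_gens \<union> letter_gens (Xw w)) \<union> {single u 1 | u. ldeg u = 0})"

lemma subspace_Jb: "pm.subspace (Jb w)" by (simp add: Jb_def)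

lemma JX_Jb: "JX (Xw w) \<subseteq> Jb w" unfolding JX_def Jb_def by (rule pm.span_mono) blast

lemma Jb_single: "ldeg u = 0 \<Longrightarrow> single u 1 \<in> Jb w" unfolding Jb_def by (rule pm.span_base) blast

lemma graded_Jb: "graded_subspace wdeg (Jb w)"
  unfolding Jb_def
proof (rule graded_subspace_span)
  fix p assume "p \<in> (rel_gens \<union> letter_gens (Xw w)) \<union> {single u 1 | u. ldeg u = 0}"
  then consider "p \<in> rel_gens" | "p \<in> letter_gens (Xw w)"
    | "p \<in> {single u 1 | u. ldeg u = 0}" by blast
  then have "\<exists>\<gamma>. homog \<gamma> p"
  proof cases
    case 1 then show ?thesis by (rule homog_II_gens)
  next
    case 2
    then obtain u g where "p = single u 1 * letter g" by blast
    then show ?thesis using homog_simps(5)[OF homog_single homog_letter] by blast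
  next
    case 3 then show ?thesis using homog_single by blast
  qed
  then show "\<exists>\<gamma>. \<forall>x\<in>keys p. wdeg x = \<gamma>" by (simp add: homog_def)
qed

lemma Pw_zero_eq: "Pw_zero w = qw w ` Jb w"
proof -
  interpret P: presentation scale UNIV "Pw w" "qw w" by (rule Pw_presentation)
  have "(\<Union>n. cyc_comp (framed_gens w) (0, n)) = qw w ` {t. \<exists>n. homog (0, n) t}"
    unfolding framed_gens_eq cyc_comp_cq[OF Xw_verts] by blast
  then have "Pw_zero w = qw w ` pm.span {t. \<exists>n. homog (0, n) t}"
    unfolding Pw_zero_def by (simp only: P.lin_span_image[OF subset_UNIV])
  also have "\<dots> = qw w ` Jb w"
  proof
    have "t \<in> Jb w" if "homog (0, n) t" for t n
    proof -
      have "(\<Sum>u\<in>keys t. scale (lookup t u) (single u 1)) \<in> Jb w"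
        using that by (intro pm.subspace_sum[OF subspace_Jb] pm.subspace_scale[OF subspace_Jb] Jb_single) (simp add: homog_def)
      then show ?thesis using pm_sum_scale[of t] by simp
    qed
    then have "pm.span {t. \<exists>n. homog (0, n) t} \<subseteq> Jb w" by (intro pm.span_minimal[OF _ subspace_Jb]) blast
    then show "qw w ` pm.span {t. \<exists>n. homog (0, n) t} \<subseteq> qw w ` Jb w" by (rule image_mono)
    show "qw w ` Jb w \<subseteq> qw w ` pm.span {t. \<exists>n. homog (0, n) t}"
    proof
      fix y assume "y \<in> qw w ` Jb w"
      then obtain a b where y: "y = qw w (a + b)" "a \<in> JX (Xw w)" "b \<in> pm.span {single u 1 | u. ldeg u = 0}"
        unfolding Jb_def pm.span_Un[of _ "{single u 1 | u. ldeg u = 0}"] JX_def by blast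
      have "y = qw w b" using y cq_eq_iff[of "Xw w" "a + b" b] by simp
      moreover have "homog (0, snd (wdeg u)) (single u 1)" if "ldeg u = 0" for u
        using homog_single[of u 1] that by (metis prod.collapse)
      then have "{single u 1 | u. ldeg u = 0} \<subseteq> {t. \<exists>n. homog (0, n) t}" by blast
      from pm.span_mono[OF this] have "b \<in> pm.span {t. \<exists>n. homog (0, n) t}" using y(3) by blast
      ultimately show "y \<in> qw w ` pm.span {t. \<exists>n. homog (0, n) t}" by blast
    qed
  qed
  finally show ?thesis .
qed

definition "qb w p = Pw_zero w +>\<^bsub>Pw w\<^esub> qw w p"

lemma qb: "pres scale UNIV (Pw_bar w) (qb w)" "qb w p = qb w p' \<longleftrightarrow> p - p' \<in> Jb w"
proof -
  interpret P: presentation scale UNIV "Pw w" "qw w" by (rule Pw_presentation)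
  have K: "pm.subspace (Jb w)" "Jb w \<subseteq> UNIV" "\<And>x. x \<in> UNIV \<Longrightarrow> qw w x = qw w 0 \<Longrightarrow> x \<in> Jb w"
    using subspace_Jb JX_Jb by (auto simp: cq_eq_iff)
  have e: "qb w = P.coset (Jb w)" by (simp add: qb_def P.coset_def Pw_zero_eq fun_eq_iff)
  show "pres scale UNIV (Pw_bar w) (qb w)" unfolding e Pw_bar_def Pw_zero_eq by (rule P.pres_quot[OF K])
  show "qb w p = qb w p' \<longleftrightarrow> p - p' \<in> Jb w" unfolding e using P.coset_eq_iff[OF K] by blast
qed

subsection \<open>The action on the tensor square of the free algebra\<close>

text \<open>The action of a letter as a primitive element on pairs of words; the sign is the
  braiding of the letter past the first word.\<close>

definition Dl :: "'v \<times> int \<Rightarrow> (('v \<times> int) fmon \<times> ('v \<times> int) fmon \<Rightarrow>\<^sub>0 rat) \<Rightarrow> ('v \<times> int) fmon \<times> ('v \<times> int) fmon \<Rightarrow>\<^sub>0 rat" where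
  "Dl g = lin_ext scale (\<lambda>(u, v). single (FMon [g] + u, v) 1 + single (u, FMon [g] + v) (sg (basis (fst g)) (ldeg u)))"

definition Dact :: "('v \<times> int) walg \<Rightarrow> (('v \<times> int) fmon \<times> ('v \<times> int) fmon \<Rightarrow>\<^sub>0 rat) \<Rightarrow> ('v \<times> int) fmon \<times> ('v \<times> int) fmon \<Rightarrow>\<^sub>0 rat" where
  "Dact t x = lin_ext scale (\<lambda>u. foldr Dl (letters u) x) t"

lemma Dl_simps: "Dl g (x + y) = Dl g x + Dl g y" "Dl g (scale c x) = scale c (Dl g x)" "Dl g 0 = 0"
  by (simp_all add: Dl_def lin_scale_simps)

lemma foldr_Dl_simps: "foldr Dl u (x + y) = foldr Dl u x + foldr Dl u y" "foldr Dl u (scale c x) = scale c (foldr Dl u x)"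
  by (induction u) (simp_all add: Dl_simps)

lemma Dact_simps: "Dact (t + t') x = Dact t x + Dact t' x" "Dact (t - t') x = Dact t x - Dact t' x"
  "Dact (scale c t) x = scale c (Dact t x)" "Dact 0 x = 0"
  "Dact (single u c) x = scale c (foldr Dl (letters u) x)" "Dact (letter g) x = Dl g x"
  "Dact (sum f A) x = (\<Sum>a\<in>A. Dact (f a) x)"
  by (simp_all add: Dact_def lin_scale_simps letter_def)

lemma Dact_1 [simp]: "Dact 1 x = x"
  using Dact_simps(5)[of 0 1 x] by simp

lemma Dact_right: "Dact t (x + y) = Dact t x + Dact t y" "Dact t (scale c x) = scale c (Dact t x)"
  by (induction t rule: pm_induct) (simp_all add: Dact_simps foldr_Dl_simps pm.scale_right_distrib mult.commute)

lemma Dact_mult: "Dact (t * t') x = Dact t (Dact t' x)"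
proof (induction t rule: pm_induct)
  case (single u)
  show ?case
  proof (induction t' rule: pm_induct)
    case (single v) then show ?case by (simp add: single_mult_single Dact_simps)
  qed (simp_all add: Dact_simps distrib_left scale_mult_right foldr_Dl_simps)
qed (simp_all add: Dact_simps distrib_right scale_mult_left)

lemma tw_simps: "tw \<alpha> (p + q) = tw \<alpha> p + tw \<alpha> q" "tw \<alpha> (scale c p) = scale c (tw \<alpha> p)" "tw \<alpha> (single u c) = single u (sg \<alpha> (ldeg u) * c)"
  by (simp_all add: tw_def lin_scale_simps mult.commute)

lemma tw_mult: "tw \<alpha> (p * q) = tw \<alpha> p * tw \<alpha> q"
proof (induction p rule: pm_induct)
  case (single u)
  show ?case
  proof (induction q rule: pm_induct)
    case (single v) then show ?case by (simp add: single_mult_single tw_simps sg_add)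
  qed (simp_all add: tw_simps distrib_left scale_mult_right)
qed (simp_all add: tw_simps distrib_right scale_mult_left)

lemma tw_tw: "tw \<alpha> (tw \<beta> p) = tw (\<alpha> + \<beta>) p"
  by (rule poly_mapping_eqI) (simp add: lookup_tw sg_add)

lemma Dact_letter: "Dact (letter g) (otimes a b) = otimes (letter g * a) b + otimes (tw (basis (fst g)) a) (letter g * b)"
proof (induction a rule: pm_induct)
  case (single u)
  show ?case
  proof (induction b rule: pm_induct)
    case (single v)
    show ?case by (simp add: Dact_simps otimes_simps Dl_def letter_def single_mult_single tw_simps)
  qed (simp_all add: otimes_simps Dact_right distrib_left scale_mult_right pm.scale_right_distrib)
qed (simp_all add: otimes_simps Dact_right distrib_left scale_mult_right tw_simps pm.scale_right_distrib)

text \<open>Braided commutators of primitive elements are primitive: the mixed terms cancel because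
  the braiding signs are symmetric and square to 1.\<close>

lemma Dact_phi: "Dact (phi s) (otimes a b) = otimes (phi s * a) b + otimes (tw (fst (magma_degree s)) a) (phi s * b)"
proof (induction s arbitrary: a b)
  case (Gen g) then show ?case by (cases g) (simp add: Dact_letter)
next
  case (Br s t)
  have tws: "tw \<alpha> (phi s * a) = scale (sg \<alpha> (fst (magma_degree s))) (phi s * tw \<alpha> a)" for \<alpha> a s
    by (simp add: tw_mult tw_homog[OF homog_phi] scale_mult_left)
  have d: "(p - r) * a = p * a - r * a" for p r a :: "('v \<times> int) walg" by (rule left_diff_distrib)
  show ?case
    by (simp add: Dact_simps Dact_mult Br Dact_right tws otimes_simps d scale_mult_left mult.assoc tw_tw
        pm.scale_right_distrib sg_commute[of "fst (magma_degree t)" "fst (magma_degree s)"] add.commute[of "fst (magma_degree t)" "fst (magma_degree s)"] algebra_simps)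
qed

lemma Dact_Phi: assumes "\<forall>t\<in>keys p. fst (magma_degree t) = \<alpha>"
  shows "Dact (Phi p) (otimes a b) = otimes (Phi p * a) b + otimes (tw \<alpha> a) (Phi p * b)"
proof -
  have l: "otimes (sum f A) b = (\<Sum>x\<in>A. otimes (f x) b)" "otimes b (sum f A) = (\<Sum>x\<in>A. otimes b (f x))"
    for f :: "('v \<times> int) magma \<Rightarrow> ('v \<times> int) walg" and A b
    by (induction A rule: infinite_finite_induct) (simp_all add: otimes_simps)
  have "Dact (Phi p) (otimes a b) = (\<Sum>s\<in>keys p. scale (lookup p s) (otimes (phi s * a) b + otimes (tw \<alpha> a) (phi s * b)))"
    using assms by (simp add: Phi_def lin_ext_def Dact_simps Dact_phi)
  also have "\<dots> = otimes (Phi p * a) b + otimes (tw \<alpha> a) (Phi p * b)"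
    by (simp add: Phi_def lin_ext_def sum_distrib_right l pm.scale_right_distrib sum.distrib scale_mult_left otimes_simps)
  finally show ?thesis .
qed

text \<open>A relation is either a single letter or a combination of braided commutators of one
  L-degree, so it acts as a primitive element. Each of the two resulting terms then contains the
  relation as a left factor.\<close>

lemma Dact_rels: assumes "r \<in> rels" shows "\<exists>\<alpha>. \<forall>a b. Dact r (otimes a b) = otimes (r * a) b + otimes (tw \<alpha> a) (r * b)"
  using assms[unfolded rels_def]
proof
  assume "r \<in> {letter (i, n) |i n. i \<notin> verts Q}" then show ?thesis using Dact_letter by auto
next
  assume "r \<in> {locrel i j m n |i j m n. i \<in> verts Q \<and> j \<in> verts Q}"
  then obtain i j m n where r: "r = locrel i j m n" by blast
  let ?p = "(\<Sum>k\<le>N_plus i j. single (Br (Gen (i, m - int k)) (Gen (j, n + int k))) ((- 1) ^ k * of_nat (N_plus i j choose k))) :: 'v lie_free"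
  have "\<forall>t\<in>keys ?p. fst (magma_degree t) = basis i + basis j"
  proof
    fix t assume "t \<in> keys ?p"
    then obtain k where "t \<in> keys (single (Br (Gen (i, m - int k)) (Gen (j, n + int k))) ((- 1) ^ k * of_nat (N_plus i j choose k) :: rat))"
      using keys_sum by (metis (no_types, lifting) UN_E in_mono)
    then show "fst (magma_degree t) = basis i + basis j" by (auto split: if_splits)
  qed
  from Dact_Phi[OF this] show ?thesis unfolding r Phi_relation by blast
qed

text \<open>Gradedness makes such an ideal stable under the twists that a primitive action applies
  to the first factor.\<close>

definition lideal :: "('v \<times> int) walg set \<Rightarrow> bool" where
  "lideal J \<longleftrightarrow> graded_subspace wdeg J \<and> II \<subseteq> J \<and> (\<forall>p\<in>J. \<forall>t. t * p \<in> J)"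

lemma lideal_JX: "lideal (JX X)" by (simp add: lideal_def graded_JX II_JX JX_left)

lemma lideal_tw: assumes "lideal J" "p \<in> J" shows "tw \<alpha> p \<in> J"
proof -
  have J: "pm.subspace J" "\<And>g. hpart wdeg g p \<in> J" using assms by (auto simp: lideal_def graded_subspace_def)
  have "p = (\<Sum>g\<in>wdeg ` keys p. hpart wdeg g p)" by (rule sum_hpart) auto
  then have "tw \<alpha> p = tw \<alpha> (\<Sum>g\<in>wdeg ` keys p. hpart wdeg g p)" by simp
  also have "\<dots> = (\<Sum>g\<in>wdeg ` keys p. tw \<alpha> (hpart wdeg g p))" by (simp add: tw_def lin_scale_simps)
  also have "\<dots> = (\<Sum>g\<in>wdeg ` keys p. scale (sg \<alpha> (fst g)) (hpart wdeg g p))"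
    by (intro sum.cong refl tw_homog) (simp add: homog_def keys_hpart)
  also have "\<dots> \<in> J" using J by (intro pm.subspace_sum pm.subspace_scale)
  finally show ?thesis .
qed

lemma Dact_tensor_ker:
  assumes J: "lideal J" and J': "lideal J'" and x: "x \<in> tensor_ker J J'"
  shows "Dact t x \<in> tensor_ker J J'"
proof -
  note K = subspace_tensor_ker[of J J']
  have lin: "Vector_Spaces.linear scale scale (Dl g)" for g
    by (simp add: Vector_Spaces.linear_iff vector_space_scale Dl_simps)
  have D: "Dl g x \<in> tensor_ker J J'" if "x \<in> tensor_ker J J'" for g x
  proof (rule linear_in_subspace[OF lin K _ that[unfolded tensor_ker_def]])
    fix x assume "x \<in> {otimes j t |j t. j \<in> J} \<union> {otimes t j |t j. j \<in> J'}"
    then show "Dl g x \<in> tensor_ker J J'"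
    proof
      assume "x \<in> {otimes j t |j t. j \<in> J}"
      then obtain j t where x: "x = otimes j t" "j \<in> J" by blast
      then have "letter g * j \<in> J" "tw (basis (fst g)) j \<in> J" using J lideal_tw by (auto simp: lideal_def)
      then show ?thesis unfolding x Dact_simps(6)[symmetric] Dact_letter
        by (intro pm.subspace_add[OF K] tensor_ker_left)
    next
      assume "x \<in> {otimes t j |t j. j \<in> J'}"
      then obtain j t where x: "x = otimes t j" "j \<in> J'" by blast
      then have "letter g * j \<in> J'" using J' by (auto simp: lideal_def)
      with x show ?thesis unfolding x Dact_simps(6)[symmetric] Dact_letter
        by (intro pm.subspace_add[OF K] tensor_ker_right)
    qed
  qed
  have "foldr Dl u x \<in> tensor_ker J J'" for u by (induction u) (use x D in auto)
  then show ?thesis unfolding Dact_def lin_ext_def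
    by (intro pm.subspace_sum[OF K] pm.subspace_scale[OF K])
qed

lemma otimes_induct [case_names otimes add scale]:
  assumes "\<And>a b. P (otimes a b)" "\<And>p q. P p \<Longrightarrow> P q \<Longrightarrow> P (p + q)" "\<And>c p. P p \<Longrightarrow> P (scale c p)"
  shows "P x"
proof (induction x rule: pm_induct)
  case (single x)
  have "single x 1 = otimes (single (fst x) 1) (single (snd x) 1)" by (simp add: otimes_simps)
  then show ?case using assms(1) by metis
qed (use assms in auto)

lemma Dact_II:
  assumes J: "lideal J" and J': "lideal J'" and t: "t \<in> II"
  shows "Dact t x \<in> tensor_ker J J'"
proof -
  note K = subspace_tensor_ker[of J J']
  have lin: "Vector_Spaces.linear scale scale (\<lambda>t. Dact t x)"
    by (simp add: Vector_Spaces.linear_iff vector_space_scale Dact_simps)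
  show ?thesis
  proof (rule linear_in_subspace[OF lin K _ t[unfolded II_def]])
    fix p assume "p \<in> {single u 1 * r * single v 1 |u r v. r \<in> rels}"
    then obtain u r v where p: "p = single u 1 * r * single v 1" "r \<in> rels" by blast
    then obtain \<alpha> where \<alpha>: "\<And>a b. Dact r (otimes a b) = otimes (r * a) b + otimes (tw \<alpha> a) (r * b)" using Dact_rels by blast
    have "r * a \<in> J" "r * a \<in> J'" for a using II_ideal(2)[OF rels_II[OF p(2)]] J J' by (auto simp: lideal_def)
    then have "Dact r y \<in> tensor_ker J J'" for y
    proof (induction y rule: otimes_induct)
      case (otimes a b)
      then show ?case unfolding \<alpha> by (intro pm.subspace_add[OF K] tensor_ker_left tensor_ker_right)
    qed (simp_all add: Dact_right pm.subspace_add[OF K] pm.subspace_scale[OF K])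
    from Dact_tensor_ker[OF J J' this] show "Dact p x \<in> tensor_ker J J'" by (simp add: p Dact_mult)
  qed
qed

end


context symmetric_quiver
begin

section \<open>Evaluation of the action, the coproduct and the coaction on representatives\<close>

abbreviation "J0 \<equiv> JX X0"

lemma q0_ker: "{j. q0 j = q0 0} = J0" by (simp add: cq_eq_iff)

sublocale TT: tensor_presentation PQ q0 PQ q0 ..

lemma tensor_PQ_Pw: "tensor_presentation PQ q0 (Pw w) (qw w)"
proof -
  interpret P: presentation scale UNIV "Pw w" "qw w" by (rule Pw_presentation)
  show ?thesis ..
qed

lemma tensor_PQ_Pw_bar: "tensor_presentation PQ q0 (Pw_bar w) (qb w)"
proof -
  interpret P: presentation scale UNIV "Pw_bar w" "qb w" by unfold_locales (rule qb(1))
  show ?thesis ..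
qed

abbreviation "tq0 \<equiv> TT.tq"

lemma pres_tq0: "pres scale UNIV PQ2 tq0"
  unfolding PQ2_def by (rule TT.pres_tq)

sublocale T2: presentation scale UNIV PQ2 tq0
  by unfold_locales (rule pres_tq0)

lemma tq0_eq_iff: "tq0 x = tq0 y \<longleftrightarrow> x - y \<in> tensor_ker J0 J0"
  using T2.q_eq[of x y] TT.tq_ker by (simp add: q0_ker)

lemma span_pairs: "pm.span {single z 1 | z. True} = UNIV"
  using pm_span_single[of UNIV] by simp

lemma tq0_single: "tq0 (single (u, v) 1) = pure_tensor PQ PQ (q0 (single u 1)) (q0 (single v 1))"
  using TT.tq_otimes[of "single u 1" "single v 1"] by (simp add: otimes_simps)

lemma lin_maps_PQ2_eqI:
  assumes "f \<in> lin_maps PQ2 PQ2" "g \<in> lin_maps PQ2 PQ2"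
    "\<And>u v. f (tq0 (single (u, v) 1)) = g (tq0 (single (u, v) 1))"
  shows "f = g"
proof (rule lin_maps_eqI[OF assms(1,2) _ pres_tq0])
  show "pres scale (pm.span {single z 1 | z. True}) PQ2 tq0" unfolding span_pairs by (rule pres_tq0)
qed (use assms(3) in auto)

definition act_map :: "('v \<times> int) walg \<Rightarrow> 'v tensor_elem \<Rightarrow> 'v tensor_elem" where
  "act_map t = (SOME f. f \<in> lin_maps PQ2 PQ2 \<and> (\<forall>x. f (tq0 x) = tq0 (Dact t x)))"

lemma act_map: "act_map t \<in> lin_maps PQ2 PQ2" "act_map t (tq0 x) = tq0 (Dact t x)"
proof -
  have "\<exists>f\<in>lin_maps PQ2 PQ2. \<forall>x\<in>UNIV. f (tq0 x) = tq0 (Dact t x)"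
  proof (rule lin_maps_descend[OF pres_tq0 pres_tq0])
    fix x assume "tq0 x = tq0 0"
    then have "x \<in> tensor_ker J0 J0" by (simp add: tq0_eq_iff)
    then show "tq0 (Dact t x) = tq0 0" by (simp add: tq0_eq_iff Dact_tensor_ker lideal_JX)
  qed (auto simp: Dact_right)
  then have "\<exists>f. f \<in> lin_maps PQ2 PQ2 \<and> (\<forall>x. f (tq0 x) = tq0 (Dact t x))" by blast
  from someI_ex[OF this] show "act_map t \<in> lin_maps PQ2 PQ2" "act_map t (tq0 x) = tq0 (Dact t x)"
    unfolding act_map_def by blast+
qed

lemma act_map_cong: "qe t = qe t' \<Longrightarrow> act_map t = act_map t'"
proof (rule lin_maps_PQ2_eqI[OF act_map(1) act_map(1)])
  fix u v assume "qe t = qe t'"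
  then have "Dact (t - t') (single (u, v) 1) \<in> tensor_ker J0 J0"
    by (intro Dact_II lideal_JX) (simp add: qe_eq_iff)
  then show "act_map t (tq0 (single (u, v) 1)) = act_map t' (tq0 (single (u, v) 1))"
    by (simp add: act_map(2) tq0_eq_iff Dact_simps)
qed

definition "act2 = (\<lambda>u\<in>carrier env. act_map (SOME t. qe t = u))"

lemma act2_qe: "act2 (qe t) = act_map t"
proof -
  have "qe (SOME t'. qe t' = qe t) = qe t" by (rule someI[of "\<lambda>t'. qe t' = qe t" t]) simp
  from act_map_cong[OF this] show ?thesis by (simp add: act2_def QE.q_carrier)
qed

definition primitive_action :: "('v env_elem \<Rightarrow> 'v tensor_elem \<Rightarrow> 'v tensor_elem) \<Rightarrow> bool" where
  "primitive_action act \<longleftrightarrow> is_action env PQ2 act \<and>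
     (\<forall>\<alpha> m \<beta> n. \<forall>x\<in>lie_comp (\<alpha>, m). \<forall>a\<in>PQ_comp (\<beta>, n). \<forall>b\<in>carrier PQ.
       act (env_incl x) (pure_tensor PQ PQ a b) =
         pure_tensor PQ PQ (cyc_act vac_gens (env_incl x) a) b \<oplus>\<^bsub>PQ2\<^esub>
         braid_sign \<alpha> \<beta> \<odot>\<^bsub>PQ2\<^esub> pure_tensor PQ PQ a (cyc_act vac_gens (env_incl x) b))"

lemma cyc_act_vac: "cyc_act vac_gens (qe u) (q0 p) = q0 (u * p)"
  unfolding vac_gens_eq by (rule cyc_act_cq[OF X0_verts])

lemma primitive_act2: "primitive_action act2"
  unfolding primitive_action_def is_action_def
proof (intro conjI ballI allI)
  show "act2 \<in> carrier env \<rightarrow>\<^sub>E lin_maps PQ2 PQ2" using act_map(1) by (auto simp: act2_def)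
next
  fix x assume "x \<in> carrier PQ2"
  then obtain p where x: "x = tq0 p" using T2.im by blast
  show "act2 \<one>\<^bsub>env\<^esub> x = x" by (simp add: qe_one act2_qe act_map x)
  fix u assume "u \<in> carrier env" then obtain t where u: "u = qe t" using QE.im by blast
  show "act2 (c \<odot>\<^bsub>env\<^esub> u) x = c \<odot>\<^bsub>PQ2\<^esub> act2 u x" for c
    by (simp add: u x qe_smul act2_qe act_map T2.smul Dact_simps)
  fix v assume "v \<in> carrier env" then obtain t' where v: "v = qe t'" using QE.im by blast
  show "act2 (u \<oplus>\<^bsub>env\<^esub> v) x = act2 u x \<oplus>\<^bsub>PQ2\<^esub> act2 v x"
    by (simp add: u v x qe_add act2_qe act_map T2.add Dact_simps)
  show "act2 (u \<otimes>\<^bsub>env\<^esub> v) x = act2 u (act2 v x)"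
    by (simp add: u v x qe_mult act2_qe act_map Dact_mult)
next
  fix \<alpha> m \<beta> n x a b
  assume "x \<in> lie_comp (\<alpha>, m)" "a \<in> PQ_comp (\<beta>, n)" "b \<in> carrier PQ"
  then obtain p t t' where p: "x = lc p" "p \<in> mdom" "\<forall>t\<in>keys p. magma_degree t = (\<alpha>, m)"
    and t: "a = q0 t" "homog (\<beta>, n) t" "b = q0 t'" unfolding lie_comp_lc PQ_comp_eq PQ.im[symmetric] by blast
  have x: "env_incl x = qe (Phi p)" using p env_incl_Phi by simp
  have "act2 (env_incl x) (pure_tensor PQ PQ a b) = tq0 (otimes (Phi p * t) t' + scale (sg \<alpha> \<beta>) (otimes t (Phi p * t')))"
    using p(3) tw_homog[OF t(2), of \<alpha>]
    by (simp add: x act2_qe t TT.tq_otimes[symmetric] act_map Dact_Phi[of p \<alpha>] otimes_simps)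
  also have "\<dots> = tq0 (otimes (Phi p * t) t') \<oplus>\<^bsub>PQ2\<^esub> sg \<alpha> \<beta> \<odot>\<^bsub>PQ2\<^esub> tq0 (otimes t (Phi p * t'))"
    by (simp add: T2.add T2.smul)
  finally show "act2 (env_incl x) (pure_tensor PQ PQ a b) =
         pure_tensor PQ PQ (cyc_act vac_gens (env_incl x) a) b \<oplus>\<^bsub>PQ2\<^esub>
         braid_sign \<alpha> \<beta> \<odot>\<^bsub>PQ2\<^esub> pure_tensor PQ PQ a (cyc_act vac_gens (env_incl x) b)"
    by (simp add: x t cyc_act_vac TT.tq_otimes)
qed

lemma lie_gen_comp: "i \<in> verts Q \<Longrightarrow> lie_gen i n \<in> lie_comp (gdeg (i, n))"
  unfolding lie_comp_lc lie_gen_lc gdeg_def by (intro imageI) auto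

lemma PQ2_carrierE: assumes "x \<in> carrier PQ2" obtains y where "x = tq0 y"
  using assms unfolding T2.im[symmetric] by (elim imageE)

lemma act2_simps: assumes "x \<in> carrier PQ2"
  shows "act2 (qe (t * t')) x = act2 (qe t) (act2 (qe t') x)" "act2 (qe (t + t')) x = act2 (qe t) x \<oplus>\<^bsub>PQ2\<^esub> act2 (qe t') x"
    "act2 (qe (scale c t)) x = c \<odot>\<^bsub>PQ2\<^esub> act2 (qe t) x"
  using assms by (auto elim!: PQ2_carrierE simp: act2_qe act_map Dact_mult Dact_simps T2.add T2.smul)

text \<open>The defining formula fixes the operator of each Lie generator on pure tensors with
  homogeneous first factor, and these span; multiplicativity extends this to words in the
  generators.\<close>

lemma primitive_action_unique: assumes "primitive_action act" shows "act = act2"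
proof
  have A: "is_action env PQ2 act" using assms by (simp add: primitive_action_def)
  then have lm: "act u \<in> lin_maps PQ2 PQ2" if "u \<in> carrier env" for u
    using that by (auto simp: is_action_def)
  have a: "act (qe 1) x = x" "act (qe (scale c t)) x = c \<odot>\<^bsub>PQ2\<^esub> act (qe t) x"
    "act (qe (t + t')) x = act (qe t) x \<oplus>\<^bsub>PQ2\<^esub> act (qe t') x" "act (qe (t * t')) x = act (qe t) (act (qe t') x)"
    if "x \<in> carrier PQ2" for x c t t'
    using A that QE.q_carrier by (auto simp: is_action_def qe_smul[symmetric] qe_add[symmetric] qe_mult[symmetric] qe_one[symmetric])
  have e: "act (qe t) x = act2 (qe t) x" if "x \<in> carrier PQ2" for x t
    using that
  proof (induction t arbitrary: x rule: pm_induct)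
    case (single u)
    have "act (qe (single (FMon gs) 1)) x = act2 (qe (single (FMon gs) 1)) x" if "x \<in> carrier PQ2" for gs x
    proof (induction gs)
      case Nil
      obtain y where "x = tq0 y" using \<open>x \<in> carrier PQ2\<close> unfolding T2.im[symmetric] by (elim imageE)
      then show ?case using a(1)[OF that] by (simp add: act2_qe act_map flip: zero_fmon_def)
    next
      case (Cons g gs)
      obtain i n where g: "g = (i, n)" by force
      have l: "act (qe (letter g)) y = act2 (qe (letter g)) y" if "y \<in> carrier PQ2" for y
      proof (cases "i \<in> verts Q")
        case True
        have "act (qe (letter g)) = act2 (qe (letter g))"
        proof (rule lin_maps_PQ2_eqI)
          show "act (qe (letter g)) \<in> lin_maps PQ2 PQ2" using lm QE.q_carrier by blast
          show "act2 (qe (letter g)) \<in> lin_maps PQ2 PQ2" by (simp add: act2_qe act_map)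
          fix u v
          have "q0 (single u 1) \<in> PQ_comp (wdeg u)" unfolding PQ_comp_eq using homog_single by blast
          then have "q0 (single u 1) \<in> PQ_comp (ldeg u, snd (wdeg u))" by simp
          moreover have "lie_gen i n \<in> lie_comp (fst (gdeg g), snd (gdeg g))" using lie_gen_comp[OF True] g by simp
          moreover have "q0 (single v 1) \<in> carrier PQ" using PQ.q_carrier by blast
          ultimately show "act (qe (letter g)) (tq0 (single (u, v) 1)) = act2 (qe (letter g)) (tq0 (single (u, v) 1))"
            using assms primitive_act2 unfolding primitive_action_def tq0_single g env_incl_letter[OF True, symmetric] by metis
        qed
        then show ?thesis by simp
      next
        case False
        then have "letter g \<in> II" using g by (intro rels_II) (auto simp: rels_def)
        \<comment> \<open>Writing the zero of \<open>env\<close> as 0 times the unit lets the axioms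
          of \<open>is_action\<close> compute its operator.\<close>
        then have z: "qe (letter g) = qe (scale 0 1)" by (simp add: qe_eq_iff)
        obtain x where y: "y = tq0 x" using \<open>y \<in> carrier PQ2\<close> unfolding T2.im[symmetric] by (elim imageE)
        show ?thesis unfolding z a(2)[OF that] a(1)[OF that] unfolding y
          by (simp add: act2_qe act_map Dact_simps T2.smul)
      qed
      have "act (qe (single (FMon gs) 1)) x \<in> carrier PQ2"
        using lm[OF QE.q_carrier[OF UNIV_I], of "single (FMon gs) 1"] \<open>x \<in> carrier PQ2\<close>
        by (auto simp: lin_maps_def dest: PiE_mem)
      then have "act (qe (letter g * single (FMon gs) 1)) x = act2 (qe (letter g)) (act2 (qe (single (FMon gs) 1)) x)"
        using a(4)[OF that] Cons l by simp
      also have "\<dots> = act2 (qe (letter g * single (FMon gs) 1)) x"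
        by (simp only: act2_simps[OF \<open>x \<in> carrier PQ2\<close>])
      finally show ?case by (simp add: letter_def single_mult_single)
    qed
    from this[OF single, of "letters u"] show ?case by simp
  next
    case (add p q)
    then show ?case by (simp add: act2_simps a(3))
  next
    case (scale c p)
    then show ?case by (simp add: act2_simps a(2))
  qed
  fix u
  show "act u = act2 u"
  proof (cases "u \<in> carrier env")
    case True
    then obtain t where u: "u = qe t" using QE.im by blast
    have "act (qe t) \<in> lin_maps PQ2 PQ2" "act2 (qe t) \<in> lin_maps PQ2 PQ2" using lm QE.q_carrier by (auto simp: act2_qe act_map)
    then show ?thesis unfolding u
      by (rule lin_maps_PQ2_eqI) (rule e, rule T2.q_carrier, simp)
  next
    case False
    then show ?thesis using A by (auto simp: is_action_def act2_def PiE_def extensional_def)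
  qed
qed

lemma PQ2_act_qe: "PQ2_act (qe t) (tq0 x) = tq0 (Dact t x)"
proof -
  have "PQ2_act = act2"
    unfolding PQ2_act_def primitive_action_def[symmetric]
    using primitive_act2 primitive_action_unique by (rule the_equality)
  then show ?thesis by (simp add: act2_qe act_map)
qed

text \<open>This makes the coproduct well defined: a letter \<open>i(n)\<close> with n >= 0, acting
  as a primitive element on the pair of empty words, gives two terms, each with that letter alone in
  one factor.\<close>

lemma Dact_J0: assumes "t \<in> J0" shows "Dact t (otimes 1 1) \<in> tensor_ker J0 J0"
proof -
  note K = subspace_tensor_ker[of J0 J0]
  have lin: "Vector_Spaces.linear scale scale (\<lambda>t. Dact t (otimes 1 1))"
    by (simp add: Vector_Spaces.linear_iff vector_space_scale Dact_simps)
  show ?thesis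
  proof (rule linear_in_subspace[OF lin K _ assms[unfolded JX_def]])
    fix p assume "p \<in> rel_gens \<union> letter_gens X0"
    then show "Dact p (otimes 1 1) \<in> tensor_ker J0 J0"
    proof
      assume "p \<in> rel_gens"
      then have "p \<in> II" unfolding II_def by (rule pm.span_base)
      then show ?thesis by (intro Dact_II lideal_JX)
    next
      assume "p \<in> letter_gens X0"
      then obtain u g where p: "p = single u 1 * letter g" "g \<in> X0" by blast
      have "letter g * 1 \<in> J0" using JX_gen[OF p(2), of 1] by simp
      then have "Dl g (otimes 1 1) \<in> tensor_ker J0 J0"
        unfolding Dact_simps(6)[symmetric] Dact_letter by (intro pm.subspace_add[OF K] tensor_ker_left tensor_ker_right)
      then show ?thesis unfolding p(1) Dact_mult Dact_simps(6)
        by (rule Dact_tensor_ker[OF lideal_JX lideal_JX])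
    qed
  qed
qed

definition is_coproduct :: "('v mod_elem \<Rightarrow> 'v tensor_elem) \<Rightarrow> bool" where
  "is_coproduct \<delta> \<longleftrightarrow> \<delta> \<in> lin_maps PQ PQ2 \<and>
     (\<forall>u\<in>carrier env. \<forall>p\<in>carrier PQ. \<delta> (cyc_act vac_gens u p) = PQ2_act u (\<delta> p)) \<and>
     \<delta> (cyc_vec vac_gens) = pure_tensor PQ PQ (cyc_vec vac_gens) (cyc_vec vac_gens)"

lemma cyc_vec_vac: "cyc_vec vac_gens = q0 1"
  unfolding vac_gens_eq by (rule cyc_vec_cq[OF X0_verts])

lemma is_coproduct_value: assumes "is_coproduct \<delta>" shows "\<delta> (q0 t) = tq0 (Dact t (otimes 1 1))"
proof -
  have "\<delta> (cyc_act vac_gens (qe t) (q0 1)) = PQ2_act (qe t) (\<delta> (q0 1))"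
    using assms QE.q_carrier PQ.q_carrier unfolding is_coproduct_def by blast
  then show ?thesis using assms
    by (simp add: cyc_act_vac is_coproduct_def cyc_vec_vac TT.tq_otimes[symmetric] PQ2_act_qe)
qed

lemma coproduct_q0: "coproduct (q0 t) = tq0 (Dact t (otimes 1 1))"
proof -
  have "\<exists>f\<in>lin_maps PQ PQ2. \<forall>t\<in>UNIV. f (q0 t) = tq0 (Dact t (otimes 1 1))"
  proof (rule lin_maps_descend[OF PQ.pres pres_tq0])
    fix t assume "q0 t = q0 0"
    then have "t \<in> J0" by (simp add: cq_eq_iff)
    then show "tq0 (Dact t (otimes 1 1)) = tq0 0" by (simp add: tq0_eq_iff Dact_J0)
  qed (auto simp: Dact_simps)
  then obtain f where f: "f \<in> lin_maps PQ PQ2" "\<And>t. f (q0 t) = tq0 (Dact t (otimes 1 1))" by blast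
  have "is_coproduct f"
    unfolding is_coproduct_def
  proof (intro conjI ballI)
    fix u p assume u: "u \<in> carrier env" and p: "p \<in> carrier PQ"
    obtain s where "u = qe s" using u unfolding QE.im[symmetric] by (elim imageE)
    moreover obtain t where "p = q0 t" using p unfolding PQ.im[symmetric] by (elim imageE)
    ultimately show "f (cyc_act vac_gens u p) = PQ2_act u (f p)" by (simp add: cyc_act_vac f PQ2_act_qe Dact_mult)
  qed (simp_all add: f cyc_vec_vac TT.tq_otimes)
  moreover have "\<delta> = f" if "is_coproduct \<delta>" for \<delta>
  proof (rule lin_maps_eqI[OF _ f(1) _ pres_tq0])
    show "\<delta> \<in> lin_maps PQ PQ2" using that by (simp add: is_coproduct_def)
    show "pres scale (pm.span {single z 1 | z. True}) PQ q0" unfolding span_pairs by (rule PQ.pres)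
  qed (simp add: f is_coproduct_value[OF that])
  ultimately have "coproduct = f" unfolding coproduct_def is_coproduct_def[symmetric] by (rule the_equality)
  then show ?thesis by (simp add: f)
qed

lemma reduced_coaction_q0:
  "reduced_coaction w (q0 t) = tensor_presentation.tq PQ q0 (Pw_bar w) (qb w) (Dact t (otimes 1 1))"
proof -
  have "coaction w (q0 t) = tensor_presentation.tq PQ q0 (Pw w) (qw w) (Dact t (otimes 1 1))"
    unfolding coaction_def coproduct_q0
    by (rule tensor_map_tq[OF TT.tensor_presentation_axioms tensor_PQ_Pw]) (simp_all add: Pw_proj_cq)
  then show ?thesis unfolding reduced_coaction_def
    by (simp only:) (rule tensor_map_tq[OF tensor_PQ_Pw tensor_PQ_Pw_bar], simp_all add: qb_def)
qed

text \<open>All quotients are absorbed into \<open>tensor_ker\<close>; from here on the coaction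
  kernel is a condition on elements of the free algebra.\<close>

lemma coaction_kernel_eq: "coaction_kernel w = q0 ` {t. Dact t (otimes 1 1) \<in> tensor_ker J0 (Jb w)}"
proof -
  interpret B: tensor_presentation PQ q0 "Pw_bar w" "qb w" by (rule tensor_PQ_Pw_bar)
  have "reduced_coaction w (q0 t) = \<zero>\<^bsub>tensor PQ (Pw_bar w)\<^esub> \<longleftrightarrow> Dact t (otimes 1 1) \<in> tensor_ker J0 (Jb w)" for t
  proof -
    have "\<zero>\<^bsub>tensor PQ (Pw_bar w)\<^esub> = B.tq 0" using B.pres_tq by (simp add: pres_def)
    then show ?thesis unfolding reduced_coaction_q0 using B.tq_ker by (simp add: q0_ker qb(2))
  qed
  then show ?thesis unfolding coaction_kernel_def PQ.im[symmetric] by blast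
qed

end

section \<open>Expansion of a polynomial in one variable at infinity\<close>

type_synonym 'x mp = "('x \<Rightarrow>\<^sub>0 nat) \<Rightarrow>\<^sub>0 rat"

notation fls_nth (infixl "$$" 75)

text \<open>Applying a map to coefficients can raise the subdegree; summation between arbitrary
  lower bounds does not depend on it.\<close>

lemma fls_times_nth_bound:
  fixes f g :: "'a::comm_ring_1 fls"
  assumes "\<And>i. i < a \<Longrightarrow> f $$ i = 0" "\<And>i. i < b \<Longrightarrow> g $$ i = 0"
  shows "(f * g) $$ n = (\<Sum>i=a..n-b. f $$ i * g $$ (n - i))"
proof -
  have "(f * g) $$ n = (\<Sum>i=fls_subdegree f..n - fls_subdegree g. f $$ i * g $$ (n - i))" by (rule fls_times_nth(2))
  also have "\<dots> = (\<Sum>i\<in>{min a (fls_subdegree f)..max (n-b) (n - fls_subdegree g)}. f $$ i * g $$ (n - i))"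
  proof (rule sum.mono_neutral_left)
    show "\<forall>i\<in>{min a (fls_subdegree f)..max (n-b) (n - fls_subdegree g)} - {fls_subdegree f..n - fls_subdegree g}. f $$ i * g $$ (n - i) = 0"
    proof
      fix i assume "i \<in> {min a (fls_subdegree f)..max (n-b) (n - fls_subdegree g)} - {fls_subdegree f..n - fls_subdegree g}"
      then have "i < fls_subdegree f \<or> n - i < fls_subdegree g" by auto
      then show "f $$ i * g $$ (n - i) = 0" by auto
    qed
  qed auto
  also have "\<dots> = (\<Sum>i=a..n-b. f $$ i * g $$ (n - i))"
    by (rule sum.mono_neutral_right) (auto simp: assms not_le)
  finally show ?thesis .
qed

definition fls_lift :: "('a::zero \<Rightarrow> 'b::zero) \<Rightarrow> 'a fls \<Rightarrow> 'b fls" where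
  "fls_lift \<psi> G = Abs_fls (\<lambda>n. \<psi> (G $$ n))"

lemma fls_lift_nth: assumes "\<psi> 0 = 0" shows "fls_lift \<psi> G $$ n = \<psi> (G $$ n)"
  unfolding fls_lift_def
proof (rule nth_Abs_fls_lower_bound)
  show "\<forall>n<fls_subdegree G. \<psi> (G $$ n) = 0" using assms by simp
qed

text \<open>Two maps are allowed so that \<psi> may be merely linear over the coefficients of
  \<open>U\<close>, with \<chi> the identity. This is the case for an expansion coefficient in a
  variable that does not occur in \<open>U\<close>. For ring homomorphisms \<psi> and \<chi>
  coincide.\<close>

lemma fls_lift_times:
  fixes \<psi> :: "'a::comm_ring_1 \<Rightarrow> 'b::comm_ring_1"
  assumes "\<psi> 0 = 0" "\<And>x y. \<psi> (x + y) = \<psi> x + \<psi> y" "\<chi> 0 = 0" "\<And>x n. \<psi> (x * U $$ n) = \<psi> x * \<chi> (U $$ n)"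
  shows "fls_lift \<psi> (G * U) = fls_lift \<psi> G * fls_lift \<chi> U"
proof (rule fls_eqI)
  fix n
  have s: "\<psi> (sum h A) = (\<Sum>x\<in>A. \<psi> (h x))" for h and A :: "int set"
    by (induction A rule: infinite_finite_induct) (simp_all add: assms)
  let ?a = "fls_subdegree G" let ?b = "fls_subdegree U"
  have "(fls_lift \<psi> G * fls_lift \<chi> U) $$ n = (\<Sum>i=?a..n-?b. fls_lift \<psi> G $$ i * fls_lift \<chi> U $$ (n - i))"
    by (rule fls_times_nth_bound) (simp_all add: fls_lift_nth assms)
  also have "\<dots> = fls_lift \<psi> (G * U) $$ n"
    by (simp add: fls_lift_nth assms fls_times_nth(2)[of G U] s)
  finally show "fls_lift \<psi> (G * U) $$ n = (fls_lift \<psi> G * fls_lift \<chi> U) $$ n" ..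
qed

lemma fls_lift_id: "fls_lift (\<lambda>x. x) U = U"
  by (rule fls_eqI) (simp add: fls_lift_nth)

lemma fls_lift_times':
  fixes \<psi> :: "'a::comm_ring_1 \<Rightarrow> 'a"
  assumes "\<psi> 0 = 0" "\<And>x y. \<psi> (x + y) = \<psi> x + \<psi> y" "\<And>x n. \<psi> (x * U $$ n) = \<psi> x * U $$ n"
  shows "fls_lift \<psi> (G * U) = fls_lift \<psi> G * U"
  using fls_lift_times[of \<psi> "\<lambda>x. x" U G] assms by (simp add: fls_lift_id)

text \<open>The series variable is 1/z: thus \<open>fls_X_inv\<close> is z, \<open>zmx x\<close> is
  z - x, and this is the geometric series of 1/(z - x) at infinity.\<close>

definition zinv :: "'a::comm_ring_1 \<Rightarrow> 'a fls" where
  "zinv x = Abs_fls (\<lambda>n. if n \<ge> 1 then x ^ nat (n - 1) else 0)"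

lemma zinv_nth: "zinv x $$ n = (if n \<ge> 1 then x ^ nat (n - 1) else 0)"
  unfolding zinv_def by (rule nth_Abs_fls_lower_bound[where N=1]) simp

abbreviation zmx :: "'a::comm_ring_1 \<Rightarrow> 'a fls" where "zmx x \<equiv> fls_X_inv - fls_const x"

lemma fls_const_times_nth: "(fls_const c * f) $$ n = (c::'a::comm_ring_1) * f $$ n"
  by simp

lemma zmx_nth: "(zmx x * f) $$ n = f $$ (n + 1) - x * f $$ n" for f :: "'a::comm_ring_1 fls"
  by (simp add: left_diff_distrib fls_X_inv_times_conv_shift)

lemma zmx_zinv: "zmx x * zinv x = 1"
proof (rule fls_eqI)
  fix n :: int
  consider "n \<ge> 1" | "n = 0" | "n < 0" by linarith
  then show "(zmx x * zinv x) $$ n = 1 $$ n"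
  proof cases
    case 1
    then have "nat n = Suc (nat (n - 1))" by simp
    then show ?thesis using 1 by (simp only: zmx_nth zinv_nth) simp
  qed (simp_all only: zmx_nth zinv_nth, simp_all)
qed

text \<open>An integer power of z - x. The coefficients form only a ring, so negative powers are
  powers of the explicit inverse.\<close>

definition zf :: "'a::comm_ring_1 \<Rightarrow> int \<Rightarrow> 'a fls" where
  "zf x c = (if c \<ge> 0 then zmx x ^ nat c else zinv x ^ nat (- c))"

lemma zf_0 [simp]: "zf x 0 = 1" by (simp add: zf_def)
lemma zf_nat: "zf x (int n) = zmx x ^ n" by (simp add: zf_def)

lemma zf_Suc: "zf x (c + 1) = zmx x * zf x c"
proof -
  consider "c \<ge> 0" | "c = -1" | "c < -1" by linarith
  then show ?thesis
  proof cases
    case 1 then show ?thesis by (simp add: zf_def nat_add_distrib)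
  next
    case 2 then show ?thesis by (simp add: zf_def zmx_zinv)
  next
    case 3
    then have "nat (- c) = Suc (nat (- (c + 1)))" by simp
    then have "zmx x * zinv x ^ nat (- c) = (zmx x * zinv x) * zinv x ^ nat (- (c + 1))" by (simp only: power_Suc mult.assoc)
    then show ?thesis using 3 by (simp add: zf_def zmx_zinv)
  qed
qed

lemma zf_minus1: "zf x (c - 1) = zinv x * zf x c"
proof -
  have "zinv x * zf x c = zinv x * (zmx x * zf x (c - 1))" using zf_Suc[of x "c - 1"] by simp
  also have "\<dots> = (zmx x * zinv x) * zf x (c - 1)" by (simp only: mult_ac)
  finally show ?thesis by (simp add: zmx_zinv)
qed

lemma zf_add: "zf x (a + b) = zf x a * zf x b"
proof (induction a rule: int_induct[where k=0])
  case (step1 i)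
  have "zf x (i + 1 + b) = zf x (i + b + 1)" by (simp add: ac_simps)
  then show ?case using step1 by (simp add: zf_Suc mult.assoc)
next
  case (step2 i)
  have "zf x (i - 1 + b) = zf x (i + b - 1)" by (simp add: algebra_simps)
  then show ?case using step2 by (simp add: zf_minus1 mult.assoc)
qed simp

lemma zf_inverse: "zf x c * zf x (- c) = 1"
  using zf_add[of x c "- c"] by simp

lemma fls_lift_hom:
  fixes \<psi> :: "'a::comm_ring_1 \<Rightarrow> 'b::comm_ring_1"
  assumes "\<psi> 0 = 0" "\<psi> 1 = 1" "\<And>x y. \<psi> (x + y) = \<psi> x + \<psi> y" "\<And>x y. \<psi> (x * y) = \<psi> x * \<psi> y"
  shows "fls_lift \<psi> (G * H) = fls_lift \<psi> G * fls_lift \<psi> H" "fls_lift \<psi> 1 = 1" "fls_lift \<psi> (zf x c) = zf (\<psi> x) c"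
    "fls_lift \<psi> (prod f A) = (\<Prod>x\<in>A. fls_lift \<psi> (f x))"
proof -
  show m: "fls_lift \<psi> (G * H) = fls_lift \<psi> G * fls_lift \<psi> H" for G H by (rule fls_lift_times) (use assms in auto)
  show o: "fls_lift \<psi> 1 = 1" by (rule fls_eqI) (simp add: fls_lift_nth assms)
  show "fls_lift \<psi> (prod f A) = (\<Prod>x\<in>A. fls_lift \<psi> (f x))"
    by (induction A rule: infinite_finite_induct) (simp_all add: m o)
  have neg: "\<psi> (- y) = - \<psi> y" for y using assms(3)[of y "- y"] assms(1) by (simp add: eq_neg_iff_add_eq_0 add.commute)
  have z: "fls_lift \<psi> (zmx x) = zmx (\<psi> x)" by (rule fls_eqI) (simp add: fls_lift_nth assms neg)
  have pw: "fls_lift \<psi> (G ^ n) = fls_lift \<psi> G ^ n" for G n by (induction n) (simp_all add: m o)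
  have "\<psi> (x ^ n) = \<psi> x ^ n" for n by (induction n) (simp_all add: assms)
  then have "fls_lift \<psi> (zinv x) = zinv (\<psi> x)" by (intro fls_eqI) (simp add: fls_lift_nth assms zinv_nth)
  then show "fls_lift \<psi> (zf x c) = zf (\<psi> x) c" by (simp add: zf_def pw z)
qed

subsection \<open>Variables occurring in a polynomial\<close>

definition pin :: "'x set \<Rightarrow> 'x mp \<Rightarrow> bool" where
  "pin S f \<longleftrightarrow> (\<forall>m\<in>keys f. keys m \<subseteq> S)"

lemma keys_add_nat: "keys (m + m') = keys m \<union> keys m'" for m m' :: "'x \<Rightarrow>\<^sub>0 nat"
  by (auto simp: in_keys_iff lookup_add)

lemma pin_add: "pin S f \<Longrightarrow> pin S g \<Longrightarrow> pin S (f + g)" and pin_diff: "pin S f \<Longrightarrow> pin S g \<Longrightarrow> pin S (f - g)"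
  and pin_scale: "pin S f \<Longrightarrow> pin S (scale c f)" and pin_0 [simp]: "pin S 0"
  and pin_mult: "pin S f \<Longrightarrow> pin S g \<Longrightarrow> pin S (f * g)" and pin_uminus: "pin S f \<Longrightarrow> pin S (- f)"
proof -
  show "pin S f \<Longrightarrow> pin S g \<Longrightarrow> pin S (f + g)" using keys_add[of f g] by (auto simp: pin_def)
  show "pin S f \<Longrightarrow> pin S g \<Longrightarrow> pin S (f - g)" using keys_diff[of f g] by (auto simp: pin_def)
  show "pin S f \<Longrightarrow> pin S (scale c f)" using keys_scale[of c f] by (auto simp: pin_def)
  show "pin S f \<Longrightarrow> pin S g \<Longrightarrow> pin S (f * g)" using keys_mult[of f g] by (fastforce simp: pin_def keys_add_nat)
qed (simp_all add: pin_def)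

lemma pin_single: "keys m \<subseteq> S \<Longrightarrow> pin S (single m c)"
  by (auto simp: pin_def)

lemma pin_1 [simp]: "pin S 1" by (simp add: pin_def)

lemma pin_sum: "(\<And>x. x \<in> A \<Longrightarrow> pin S (f x)) \<Longrightarrow> pin S (sum f A)"
  by (induction A rule: infinite_finite_induct) (auto intro: pin_add)

lemma pin_power: "pin S f \<Longrightarrow> pin S (f ^ n)"
  by (induction n) (auto intro: pin_mult)

lemma pin_mono: "pin S f \<Longrightarrow> S \<subseteq> T \<Longrightarrow> pin T f" by (auto simp: pin_def)

definition fpin :: "'x set \<Rightarrow> 'x mp fls \<Rightarrow> bool" where
  "fpin S G \<longleftrightarrow> (\<forall>n. pin S (G $$ n))"

lemma fpin_mult: "fpin S F \<Longrightarrow> fpin S G \<Longrightarrow> fpin S (F * G)"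
  unfolding fpin_def fls_times_nth(2) by (auto intro!: pin_sum pin_mult)

lemma fpin_1 [simp]: "fpin S 1" by (simp add: fpin_def)

lemma fpin_prod: "(\<And>x. x \<in> A \<Longrightarrow> fpin S (f x)) \<Longrightarrow> fpin S (prod f A)"
  by (induction A rule: infinite_finite_induct) (auto intro: fpin_mult)

lemma fpin_power: "fpin S f \<Longrightarrow> fpin S (f ^ n)"
  by (induction n) (auto intro: fpin_mult)

lemma fpin_zf: "pin S x \<Longrightarrow> fpin S (zf x c)"
proof -
  assume x: "pin S x"
  have "fpin S (zmx x)" using x by (auto simp: fpin_def intro: pin_uminus pin_diff)
  moreover have "fpin S (zinv x)" using x by (auto simp: fpin_def zinv_nth intro: pin_power)
  ultimately show ?thesis by (auto simp: zf_def intro: fpin_power)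
qed

lemma fpin_mono: "fpin S f \<Longrightarrow> S \<subseteq> T \<Longrightarrow> fpin T f" by (auto simp: fpin_def intro: pin_mono)

subsection \<open>Total degree\<close>

definition mdeg :: "('x \<Rightarrow>\<^sub>0 nat) \<Rightarrow> nat" where "mdeg m = (\<Sum>v\<in>keys m. lookup m v)"

lemma mdeg_superset: "finite A \<Longrightarrow> keys m \<subseteq> A \<Longrightarrow> mdeg m = (\<Sum>v\<in>A. lookup m v)"
  unfolding mdeg_def by (rule sum.mono_neutral_left) (auto simp: in_keys_iff)

lemma mdeg_add: "mdeg (m + m') = mdeg m + mdeg m'"
  by (simp add: mdeg_superset[of "keys m \<union> keys m'"] keys_add_nat lookup_add sum.distrib)

lemma mdeg_single [simp]: "mdeg (single v k) = k" by (simp add: mdeg_def)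

text \<open>All variables have degree 2.\<close>

definition hd2 :: "int \<Rightarrow> 'x mp \<Rightarrow> bool" where
  "hd2 n f \<longleftrightarrow> (\<forall>m\<in>keys f. 2 * int (mdeg m) = n)"

lemma hd2_add: "hd2 n f \<Longrightarrow> hd2 n g \<Longrightarrow> hd2 n (f + g)"
  and hd2_scale: "hd2 n f \<Longrightarrow> hd2 n (scale c f)" and hd2_0 [simp]: "hd2 n 0" and hd2_1: "hd2 0 1"
  and hd2_mult: "hd2 n f \<Longrightarrow> hd2 k g \<Longrightarrow> hd2 (n + k) (f * g)" and hd2_uminus: "hd2 n f \<Longrightarrow> hd2 n (- f)"
proof -
  show "hd2 n f \<Longrightarrow> hd2 n g \<Longrightarrow> hd2 n (f + g)" using keys_add[of f g] by (auto simp: hd2_def)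
  show "hd2 n f \<Longrightarrow> hd2 n (scale c f)" using keys_scale[of c f] by (auto simp: hd2_def)
  show "hd2 n f \<Longrightarrow> hd2 k g \<Longrightarrow> hd2 (n + k) (f * g)" using keys_mult[of f g] by (fastforce simp: hd2_def mdeg_add)
qed (simp_all add: hd2_def mdeg_def)

lemma hd2_sum: "(\<And>x. x \<in> A \<Longrightarrow> hd2 n (f x)) \<Longrightarrow> hd2 n (sum f A)"
  by (induction A rule: infinite_finite_induct) (auto intro: hd2_add)

lemma hd2_power: "hd2 n f \<Longrightarrow> hd2 (int k * n) (f ^ k)"
  by (induction k) (use hd2_1 hd2_mult in \<open>auto simp: algebra_simps\<close>)

text \<open>The variable z also has degree 2, so in a homogeneous series of degree n the coefficient
  of z to the power -k has degree n + 2k.\<close>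

definition hdf :: "int \<Rightarrow> 'x mp fls \<Rightarrow> bool" where
  "hdf n G \<longleftrightarrow> (\<forall>k. hd2 (n + 2 * k) (G $$ k))"

lemma hdf_mult: assumes "hdf n F" "hdf k G" shows "hdf (n + k) (F * G)"
proof -
  have "hd2 (n + k + 2 * l) (F $$ i * G $$ (l - i))" for i l
  proof -
    have "hd2 (n + 2 * i + (k + 2 * (l - i))) (F $$ i * G $$ (l - i))" using assms unfolding hdf_def by (intro hd2_mult) blast+
    moreover have "n + 2 * i + (k + 2 * (l - i)) = n + k + 2 * l" by simp
    ultimately show ?thesis by (simp add: add.assoc)
  qed
  then show ?thesis unfolding hdf_def fls_times_nth(2) by (intro allI hd2_sum)
qed

lemma hdf_1: "hdf 0 1" by (auto simp: hdf_def hd2_1)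

lemma hdf_power: "hdf n f \<Longrightarrow> hdf (int k * n) (f ^ k)"
  by (induction k) (use hdf_1 hdf_mult in \<open>auto simp: algebra_simps\<close>)

lemma hdf_prod: "(\<And>x. x \<in> A \<Longrightarrow> hdf (n x) (f x)) \<Longrightarrow> hdf (sum n A) (prod f A)"
  by (induction A rule: infinite_finite_induct) (auto simp: hdf_1 intro: hdf_mult)

lemma hdf_zf: assumes "hd2 2 x" shows "hdf (2 * c) (zf x c)"
proof -
  have "hdf 2 (zmx x)" using assms hd2_1 by (auto simp: hdf_def intro: hd2_uminus)
  moreover have "hdf (- 2) (zinv x)"
    unfolding hdf_def
  proof
    fix k :: int
    show "hd2 (- 2 + 2 * k) (zinv x $$ k)" using hd2_power[OF assms, of "nat (k - 1)"] by (auto simp: zinv_nth algebra_simps)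
  qed
  ultimately show ?thesis using hdf_power[of 2 "zmx x" "nat c"] hdf_power[of "-2" "zinv x" "nat (- c)"]
    by (auto simp: zf_def algebra_simps)
qed

subsection \<open>The expansion\<close>

definition mX :: "'x \<Rightarrow> 'x mp" where "mX v = single (single v 1) 1"

lemma hd2_mX: "hd2 2 (mX v)" by (simp add: hd2_def mX_def)
lemma pin_mX: "v \<in> S \<Longrightarrow> pin S (mX v)" by (simp add: mX_def pin_single)

definition rmv :: "'x \<Rightarrow> ('x \<Rightarrow>\<^sub>0 nat) \<Rightarrow> 'x \<Rightarrow>\<^sub>0 nat" where "rmv v m = Poly_Mapping.update v 0 m"

lemma lookup_rmv: "lookup (rmv v m) x = (if x = v then 0 else lookup m x)"
  by (simp add: rmv_def lookup_update)

lemma rmv_add: "rmv v (m + m') = rmv v m + rmv v m'"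
  by (rule poly_mapping_eqI) (simp add: lookup_rmv lookup_add)

text \<open>Substitution of a new variable \<open>z\<close> for \<open>v\<close>. Laurent series are series in \<open>1 / z\<close>, so the
  coefficient \<open>esub v f $$ n\<close> is the one of \<open>z\<close> to the power \<open>- n\<close>.\<close>

definition esub :: "'x \<Rightarrow> 'x mp \<Rightarrow> 'x mp fls" where
  "esub v f = (\<Sum>m\<in>keys f. fls_const (single (rmv v m) (lookup f m)) * fls_X_inv ^ lookup m v)"

lemma lookup_nth_esub:
  "lookup (esub v f $$ a) m = (if lookup m v = 0 \<and> a \<le> 0 then lookup f (m + single v (nat (- a))) else 0)"
proof -
  have "lookup (esub v f $$ a) m = (\<Sum>m'\<in>keys f. if rmv v m' = m \<and> a = - int (lookup m' v) then lookup f m' else 0)"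
    by (auto simp: esub_def fls_nth_sum lookup_sum lookup_single when_def intro!: sum.cong)
  also have "\<dots> = (\<Sum>m'\<in>keys f. if m' = m + single v (nat (- a)) then (if lookup m v = 0 \<and> a \<le> 0 then lookup f m' else 0) else 0)"
  proof (rule sum.cong[OF refl])
    fix m'
    have "rmv v m' = m \<and> a = - int (lookup m' v) \<longleftrightarrow> m' = m + single v (nat (- a)) \<and> lookup m v = 0 \<and> a \<le> 0"
      by (auto simp: poly_mapping_eq_iff fun_eq_iff lookup_rmv lookup_add lookup_single when_def)
    then show "(if rmv v m' = m \<and> a = - int (lookup m' v) then lookup f m' else 0) =
      (if m' = m + single v (nat (- a)) then (if lookup m v = 0 \<and> a \<le> 0 then lookup f m' else 0) else 0)" by auto
  qed
  also have "\<dots> = (if lookup m v = 0 \<and> a \<le> 0 then lookup f (m + single v (nat (- a))) else 0)"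
    by (auto simp: sum.delta' in_keys_iff)
  finally show ?thesis .
qed

lemma esub_add: "esub v (f + g) = esub v f + esub v g"
  by (intro fls_eqI poly_mapping_eqI) (simp add: lookup_nth_esub lookup_add)

lemma esub_scale: "esub v (scale c f) = fls_const (single 0 c) * esub v f"
  by (intro fls_eqI poly_mapping_eqI)
    (simp add: lookup_nth_esub mult_map_scale_conv_mult[symmetric] scale_def[symmetric])

lemma esub_scale_nth: "esub v (scale c f) $$ n = scale c (esub v f $$ n)"
  by (simp add: esub_scale mult_map_scale_conv_mult[symmetric] scale_def[symmetric])

lemma esub_0 [simp]: "esub v 0 = 0" by (simp add: esub_def)

lemma esub_single: "esub v (single m 1) = fls_const (single (rmv v m) 1) * fls_X_inv ^ lookup m v"
  by (simp add: esub_def)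

lemma esub_mult: "esub v (f * g) = esub v f * esub v g"
proof (induction f rule: pm_induct)
  case (single m)
  show ?case
  proof (induction g rule: pm_induct)
    case (single m')
    have "esub v (single m 1 * single m' 1) = (fls_const (single (rmv v m) 1) * fls_const (single (rmv v m') 1)) * (fls_X_inv ^ lookup m v * fls_X_inv ^ lookup m' v)"
      by (simp add: single_mult_single esub_single rmv_add lookup_add power_add)
    then show ?case by (simp add: esub_single mult_ac)
  qed (simp_all add: distrib_left esub_add scale_mult_right esub_scale mult.left_commute)
qed (simp_all add: distrib_right esub_add scale_mult_left esub_scale mult.assoc)

lemma esub_1 [simp]: "esub v 1 = 1"
proof -
  have "rmv v 0 = 0" by (rule poly_mapping_eqI) (simp add: lookup_rmv)
  then show ?thesis using esub_single[of v 0] by simp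
qed

lemma esub_free: assumes "pin (- {v}) f" shows "esub v f = fls_const f"
proof (intro fls_eqI poly_mapping_eqI)
  fix n m
  have "lookup f m = 0" if "lookup m v \<noteq> 0" for m
  proof (rule ccontr)
    assume "lookup f m \<noteq> 0"
    then have "keys m \<subseteq> - {v}" using assms by (auto simp: pin_def in_keys_iff)
    then show False using that by (auto simp: in_keys_iff)
  qed
  then show "lookup (esub v f $$ n) m = lookup (fls_const f $$ n) m"
    by (auto simp: lookup_nth_esub lookup_add)
qed

lemma esub_var: "esub v (mX v) = fls_X_inv"
proof -
  have "rmv v (single v 1) = 0" by (rule poly_mapping_eqI) (simp add: lookup_rmv lookup_single when_def)
  then show ?thesis by (simp add: mX_def esub_single)
qed

lemma esub_inj: "esub v f = esub v g \<longleftrightarrow> f = g"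
proof
  assume *: "esub v f = esub v g"
  show "f = g"
  proof (rule poly_mapping_eqI)
    fix m
    have m: "rmv v m + single v (lookup m v) = m"
      by (rule poly_mapping_eqI) (simp add: lookup_rmv lookup_add lookup_single when_def)
    have "lookup (esub v h $$ (- int (lookup m v))) (rmv v m) = lookup h m" for h
      by (simp add: lookup_nth_esub lookup_rmv m)
    from this[of f] this[of g] show "lookup f m = lookup g m" using * by simp
  qed
qed simp

lemma esub_eq_0_iff: "esub v f = 0 \<longleftrightarrow> f = 0" using esub_inj[of v f 0] by simp

lemma esub_pos [simp]: "n > 0 \<Longrightarrow> esub v f $$ n = 0"
  by (rule poly_mapping_eqI) (simp add: lookup_nth_esub)

lemma fpin_esub: "pin S f \<Longrightarrow> fpin (S - {v}) (esub v f)"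
  unfolding fpin_def pin_def
proof (intro allI ballI subsetI)
  fix n m x assume f: "\<forall>m\<in>keys f. keys m \<subseteq> S" and m: "m \<in> keys (esub v f $$ n)" and x: "x \<in> keys m"
  then have "lookup m v = 0" "m + single v (nat (- n)) \<in> keys f" by (auto simp: in_keys_iff lookup_nth_esub split: if_splits)
  then have "keys (m + single v (nat (- n))) \<subseteq> S" using f by blast
  then show "x \<in> S - {v}" using x \<open>lookup m v = 0\<close> by (auto simp: keys_add_nat in_keys_iff[of v m])
qed

lemma fpin_esub': "pin S f \<Longrightarrow> fpin S (esub v f)" "fpin (- {v}) (esub v f)"
proof -
  show "pin S f \<Longrightarrow> fpin S (esub v f)" by (erule fpin_mono[OF fpin_esub]) (rule Diff_subset)
  have "pin UNIV f" by (simp add: pin_def)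
  from fpin_esub[OF this] show "fpin (- {v}) (esub v f)" by (simp add: Compl_eq_Diff_UNIV)
qed

lemma hdf_esub: "hd2 n f \<Longrightarrow> hdf n (esub v f)"
  unfolding hdf_def
proof
  fix k assume f: "hd2 n f"
  show "hd2 (n + 2 * k) (esub v f $$ k)"
    unfolding hd2_def
  proof
    fix m assume "m \<in> keys (esub v f $$ k)"
    then have m: "lookup m v = 0" "k \<le> 0" "m + single v (nat (- k)) \<in> keys f" by (auto simp: in_keys_iff lookup_nth_esub split: if_splits)
    then have "2 * int (mdeg (m + single v (nat (- k)))) = n" using f unfolding hd2_def by blast
    then show "2 * int (mdeg m) = n + 2 * k" using m(2) by (simp add: mdeg_add)
  qed
qed

lemma esub_commute: "v \<noteq> w \<Longrightarrow> esub w (esub v f $$ a) $$ b = esub v (esub w f $$ b) $$ a"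
  by (intro poly_mapping_eqI) (auto simp: lookup_nth_esub lookup_add lookup_single when_def add_ac)

text \<open>Substitutes \<open>v\<close> back for z. It inverts \<open>esub\<close> on series that
  have no negative powers of z and whose coefficients are free of \<open>v\<close>.\<close>

definition unsub :: "'x \<Rightarrow> 'x mp fls \<Rightarrow> 'x mp" where
  "unsub v G = (\<Sum>n\<in>{fls_subdegree G..0}. G $$ n * mX v ^ nat (- n))"

lemma esub_sum: "esub v (sum f A) = (\<Sum>x\<in>A. esub v (f x))"
  by (induction A rule: infinite_finite_induct) (simp_all add: esub_add)

lemma esub_power: "esub v (f ^ n) = esub v f ^ n"
  by (induction n) (simp_all add: esub_mult)

lemma esub_unsub: assumes "fpin (- {v}) G" "\<And>n. n > 0 \<Longrightarrow> G $$ n = 0" shows "esub v (unsub v G) = G"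
proof (rule fls_eqI)
  fix k
  have "esub v (unsub v G) = (\<Sum>n\<in>{fls_subdegree G..0}. fls_const (G $$ n) * fls_X_inv ^ nat (- n))"
    unfolding unsub_def esub_sum using assms(1) by (intro sum.cong refl) (simp add: esub_mult esub_power esub_var esub_free fpin_def)
  then have "esub v (unsub v G) $$ k = (\<Sum>n\<in>{fls_subdegree G..0}. G $$ n * (if k = n then 1 else 0))"
    by (simp add: fls_nth_sum)
  also have "\<dots> = G $$ k" using assms(2) by (auto simp: sum.delta' if_distrib[of "(*) _"] cong: if_cong)
  finally show "esub v (unsub v G) $$ k = G $$ k" .
qed

text \<open>The common shape of the letter operators, with an arbitrary series \<open>P\<close> in
  place of the product over the remaining variables.\<close>

definition opc :: "'x \<Rightarrow> 'x mp fls \<Rightarrow> int \<Rightarrow> 'x mp \<Rightarrow> 'x mp" where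
  "opc v P a g = (esub v g * P) $$ a"

lemma opc_add: "opc v P a (f + g) = opc v P a f + opc v P a g"
  by (simp add: opc_def esub_add distrib_right)

lemma opc_scale: "opc v P a (scale c f) = scale c (opc v P a f)"
  by (simp add: opc_def esub_scale mult.assoc mult_map_scale_conv_mult[symmetric] scale_def[symmetric])

lemma opc_0 [simp]: "opc v P a 0 = 0" by (simp add: opc_def)

lemma opc_sum: "opc v P a (sum f A) = (\<Sum>x\<in>A. opc v P a (f x))"
  by (induction A rule: infinite_finite_induct) (simp_all add: opc_add)

lemma opc_free: "pin (- {v}) h \<Longrightarrow> opc v P a (h * g) = h * opc v P a g"
  by (simp add: opc_def esub_mult esub_free mult.assoc)

text \<open>The expansion turns \<open>v\<close> into z, so powers of \<open>v\<close> merely shift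
  the coefficient that is read off. Both the treatment of the locality relation and the shift by the
  framing rest on this.\<close>

lemma opc_power: "opc v P a (mX v ^ k * g) = opc v P (a + int k) g"
proof -
  have "esub v (mX v ^ k * g) * P = fls_X_inv ^ k * (esub v g * P)"
    by (simp only: esub_mult esub_power esub_var mult.assoc)
  then show ?thesis by (simp add: opc_def fls_X_inv_power_times_conv_shift(1))
qed


section \<open>Locality in terms of expansions\<close>

lemma scale_sign: "scale ((- 1) ^ k * of_nat n) p = (- 1) ^ k * of_nat n * (p :: 'x mp)"
proof -
  have 1: "scale (of_nat n) p = of_nat n * p"
    by (induction n) (simp_all add: pm.scale_left_distrib distrib_right)
  show ?thesis
  proof (cases "even k")
    case True then show ?thesis using 1 by simp
  next
    case False
    then have "scale ((- 1) ^ k * of_nat n) p = - scale (of_nat n) p" by (simp add: pm.scale_minus_left)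
    then show ?thesis using 1 False by simp
  qed
qed

lemma fls_const_Xinv_nth: "(fls_const c * fls_X_inv ^ j * F) $$ n = c * F $$ (n + int j)" for c :: "'a::comm_ring_1"
  by (simp add: mult.assoc fls_X_inv_power_times_conv_shift(1))

lemma fls_const_binom: "fls_const (of_nat m * (- x) ^ k) = of_nat m * (- fls_const x) ^ k" for x :: "'a::comm_ring_1"
proof -
  have "(- fls_const x) ^ k = fls_const ((- x) ^ k)" by (simp add: fls_const_power)
  then show ?thesis by (simp only: fls_of_nat fls_const_mult_const)
qed

text \<open>Reads the binomial sum of the locality relation as one coefficient of (z - x)^N F. The
  companion \<open>binomial_zmx'\<close> runs through the binomial expansion in the opposite order,
  for the term whose index grows with k; the reversal costs the sign (-1)^N.\<close>

lemma binomial_zmx: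
  "(zmx x ^ N * F) $$ (a - int N) = (\<Sum>k\<le>N. (- 1) ^ k * of_nat (N choose k) * (x ^ k * F $$ (a - int k)))"
  for x :: "'a::comm_ring_1"
proof -
  have "zmx x ^ N = (\<Sum>k\<le>N. fls_const (of_nat (N choose k) * (- x) ^ k) * fls_X_inv ^ (N - k))"
    using binomial_ring[of "- fls_const x" fls_X_inv N]
    by (simp only: fls_const_binom) simp
  then have "(zmx x ^ N * F) $$ (a - int N) = (\<Sum>k\<le>N. (fls_const (of_nat (N choose k) * (- x) ^ k) * fls_X_inv ^ (N - k) * F) $$ (a - int N))"
    by (simp only: sum_distrib_right fls_nth_sum)
  also have "\<dots> = (\<Sum>k\<le>N. (- 1) ^ k * of_nat (N choose k) * (x ^ k * F $$ (a - int k)))"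
    unfolding fls_const_Xinv_nth
  proof (rule sum.cong[OF refl])
    fix k assume "k \<in> {..N}"
    then have "a - int N + int (N - k) = a - int k" by simp
    then show "of_nat (N choose k) * (- x) ^ k * F $$ (a - int N + int (N - k)) = (- 1) ^ k * of_nat (N choose k) * (x ^ k * F $$ (a - int k))"
      by (simp add: power_minus[of x k] mult_ac)
  qed
  finally show ?thesis .
qed

lemma binomial_zmx':
  "(- 1) ^ N * (zmx x ^ N * F) $$ b = (\<Sum>k\<le>N. (- 1) ^ k * of_nat (N choose k) * (x ^ (N - k) * F $$ (b + int k)))"
  for x :: "'a::comm_ring_1"
proof -
  have "zmx x ^ N = (\<Sum>k\<le>N. fls_const (of_nat (N choose k) * (- x) ^ (N - k)) * fls_X_inv ^ k)"
    using binomial_ring[of fls_X_inv "- fls_const x" N]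
    by (simp only: fls_const_binom) (simp add: mult_ac)
  then have "(zmx x ^ N * F) $$ b = (\<Sum>k\<le>N. (fls_const (of_nat (N choose k) * (- x) ^ (N - k)) * fls_X_inv ^ k * F) $$ b)"
    by (simp only: sum_distrib_right fls_nth_sum)
  then have "(- 1) ^ N * (zmx x ^ N * F) $$ b = (\<Sum>k\<le>N. (- 1) ^ N * (of_nat (N choose k) * (- x) ^ (N - k) * F $$ (b + int k)))"
    unfolding fls_const_Xinv_nth by (simp only: sum_distrib_left)
  also have "\<dots> = (\<Sum>k\<le>N. (- 1) ^ k * of_nat (N choose k) * (x ^ (N - k) * F $$ (b + int k)))"
  proof (rule sum.cong[OF refl])
    fix k assume k: "k \<in> {..N}"
    have "(- 1) ^ N * (- x) ^ (N - k) = ((- 1) ^ N * (- 1) ^ (N - k)) * x ^ (N - k)"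
      by (simp add: power_minus[of x "N - k"])
    also have "(- 1) ^ N * (- 1) ^ (N - k) = ((- 1) ^ k :: 'a)"
    proof -
      have "even (N + (N - k)) \<longleftrightarrow> even k" using k by auto
      then show ?thesis unfolding power_add[symmetric] by (simp add: minus_one_power_iff)
    qed
    finally have e: "(- 1) ^ N * (- x) ^ (N - k) = (- 1) ^ k * x ^ (N - k)" .
    have "(- 1) ^ N * (of_nat (N choose k) * (- x) ^ (N - k) * F $$ (b + int k)) = ((- 1) ^ N * (- x) ^ (N - k)) * (of_nat (N choose k) * F $$ (b + int k))"
      by (simp only: mult_ac)
    also have "\<dots> = (- 1) ^ k * of_nat (N choose k) * (x ^ (N - k) * F $$ (b + int k))"
      unfolding e by (simp only: mult_ac)
    finally show "(- 1) ^ N * (of_nat (N choose k) * (- x) ^ (N - k) * F $$ (b + int k)) = (- 1) ^ k * of_nat (N choose k) * (x ^ (N - k) * F $$ (b + int k))" .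
  qed
  finally show ?thesis .
qed

lemma fls_unit_cancel:
  assumes "P * P' = (1 :: 'a::comm_ring_1 fls)" shows "A * P = B * P \<longleftrightarrow> A = B"
proof
  assume "A * P = B * P"
  then have "A * P * P' = B * P * P'" by simp
  then show "A = B" using assms by (simp add: mult.assoc)
qed simp

text \<open>By \<open>opc_power\<close> and the binomial lemmas, the relation compares coefficients
  of (z - w)^N F and (z - v)^N F' up to (-1)^N, so the exponent c inside F and F' becomes c + N.
  Since \<open>Pw\<close> is free of \<open>v\<close> and \<open>Pv\<close> is free of
  \<open>w\<close>, each passes through the other expansion and, being a unit, cancels. What is left
  is an equality of two double expansions up to sign.\<close>

lemma locality_iff:
  fixes Pv Pw :: "'x mp fls"
  assumes Pv: "fpin (- {w}) Pv" "Pv * Pv' = 1" and Pw: "fpin (- {v}) Pw" "Pw * Pw' = 1"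
    and F: "F = G * Pv * zf (mX w) c" "F' = G' * Pw * zf (mX v) c" and s: "s = s0 * (- 1) ^ N"
  shows "(\<forall>a b. (\<Sum>k\<le>N. scale ((- 1) ^ k * of_nat (N choose k))
      (opc w Pw (b + int k) (F $$ (a - int k)) - scale s0 (opc v Pv (a - int k) (F' $$ (b + int k))))) = 0) \<longleftrightarrow>
    (\<forall>a b. esub w ((G * zf (mX w) (c + int N)) $$ a) $$ b = scale s (esub v ((G' * zf (mX v) (c + int N)) $$ b) $$ a))"
    (is "?A \<longleftrightarrow> ?B")
proof -
  define H where "H = G * zf (mX w) (c + int N)"
  define H' where "H' = G' * zf (mX v) (c + int N)"
  have H: "zmx (mX w) ^ N * F = H * Pv" "zmx (mX v) ^ N * F' = H' * Pw"
    unfolding F H_def H'_def zf_add zf_nat by (simp_all only: mult_ac)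
  have i: "(\<Sum>k\<le>N. scale ((- 1) ^ k * of_nat (N choose k)) (opc w Pw (b + int k) (F $$ (a - int k)))) = opc w Pw b ((H * Pv) $$ (a - int N))" for a b
    unfolding H[symmetric] binomial_zmx opc_sum scale_sign[symmetric] opc_scale opc_power ..
  have ii: "(\<Sum>k\<le>N. scale ((- 1) ^ k * of_nat (N choose k)) (opc v Pv (a - int k) (F' $$ (b + int k)))) = scale ((-1) ^ N) (opc v Pv (a - int N) ((H' * Pw) $$ b))" for a b
  proof -
    have "scale ((-1) ^ N) (opc v Pv (a - int N) ((H' * Pw) $$ b)) = opc v Pv (a - int N) ((- 1) ^ N * (H' * Pw) $$ b)"
      using scale_sign[of N 1 "(H' * Pw) $$ b"] by (simp flip: opc_scale)
    also have "\<dots> = (\<Sum>k\<le>N. scale ((- 1) ^ k * of_nat (N choose k)) (opc v Pv (a - int N + int (N - k)) (F' $$ (b + int k))))"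
      unfolding H[symmetric] binomial_zmx' opc_sum scale_sign[symmetric] opc_scale opc_power ..
    also have "\<dots> = (\<Sum>k\<le>N. scale ((- 1) ^ k * of_nat (N choose k)) (opc v Pv (a - int k) (F' $$ (b + int k))))"
      by (intro sum.cong refl) (simp add: of_nat_diff)
    finally show ?thesis ..
  qed
  have "?A \<longleftrightarrow> (\<forall>a b. opc w Pw b ((H * Pv) $$ (a - int N)) = scale s (opc v Pv (a - int N) ((H' * Pw) $$ b)))"
  proof -
    have "(\<Sum>k\<le>N. scale ((- 1) ^ k * of_nat (N choose k))
      (opc w Pw (b + int k) (F $$ (a - int k)) - scale s0 (opc v Pv (a - int k) (F' $$ (b + int k))))) =
      opc w Pw b ((H * Pv) $$ (a - int N)) - scale s (opc v Pv (a - int N) ((H' * Pw) $$ b))" for a b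
    proof -
      have "(\<Sum>k\<le>N. scale ((- 1) ^ k * of_nat (N choose k)) (scale s0 (opc v Pv (a - int k) (F' $$ (b + int k))))) =
        scale s0 (\<Sum>k\<le>N. scale ((- 1) ^ k * of_nat (N choose k)) (opc v Pv (a - int k) (F' $$ (b + int k))))"
        by (simp add: pm.scale_sum_right mult.commute)
      then show ?thesis by (simp add: pm.scale_right_diff_distrib sum_subtractf i ii s)
    qed
    then show ?thesis by simp
  qed
  also have "\<dots> \<longleftrightarrow> (\<forall>a b. opc w Pw b ((H * Pv) $$ a) = scale s (opc v Pv a ((H' * Pw) $$ b)))"
    by (metis add_diff_cancel_right')
  \<comment> \<open>For fixed \<open>a\<close> both sides are the coefficients of series indexed by
    \<open>b\<close>, from which the unit \<open>Pw\<close> is divided out.\<close>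
  also have "\<dots> \<longleftrightarrow> (\<forall>a b. esub w ((H * Pv) $$ a) $$ b = scale s (opc v Pv a (H' $$ b)))"
  proof (rule all_cong1)
    fix a
    define L where "L = fls_lift (\<lambda>r. scale s (opc v Pv a r)) H'"
    have "fls_lift (\<lambda>r. scale s (opc v Pv a r)) (H' * Pw) = L * Pw"
      unfolding L_def
    proof (rule fls_lift_times')
      fix x n
      have "pin (- {v}) (Pw $$ n)" using Pw(1) by (simp add: fpin_def)
      from opc_free[OF this, of Pv a x] show "scale s (opc v Pv a (x * Pw $$ n)) = scale s (opc v Pv a x) * Pw $$ n"
        by (simp add: mult.commute scale_mult_right)
    qed (simp_all add: opc_add pm.scale_right_distrib)
    then have "(\<forall>b. opc w Pw b ((H * Pv) $$ a) = scale s (opc v Pv a ((H' * Pw) $$ b))) \<longleftrightarrow> esub w ((H * Pv) $$ a) * Pw = L * Pw"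
      by (auto simp: fls_eq_iff opc_def[of w] fls_lift_nth[symmetric] simp del: fls_times_nth(1))
        (metis fls_lift_nth opc_0 pm.scale_zero_right)+
    also have "\<dots> \<longleftrightarrow> esub w ((H * Pv) $$ a) = L" by (rule fls_unit_cancel[OF Pw(2)])
    also have "\<dots> \<longleftrightarrow> (\<forall>b. esub w ((H * Pv) $$ a) $$ b = scale s (opc v Pv a (H' $$ b)))"
      by (simp add: fls_eq_iff L_def fls_lift_nth)
    finally show "(\<forall>b. opc w Pw b ((H * Pv) $$ a) = scale s (opc v Pv a ((H' * Pw) $$ b))) \<longleftrightarrow>
      (\<forall>b. esub w ((H * Pv) $$ a) $$ b = scale s (opc v Pv a (H' $$ b)))" .
  qed
  also have "\<dots> \<longleftrightarrow> (\<forall>b a. esub w ((H * Pv) $$ a) $$ b = scale s (opc v Pv a (H' $$ b)))" by blast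
  \<comment> \<open>Now \<open>b\<close> is fixed, and \<open>Pv\<close> is divided out of series
    indexed by \<open>a\<close>.\<close>
  also have "\<dots> \<longleftrightarrow> (\<forall>b a. esub w (H $$ a) $$ b = scale s (esub v (H' $$ b) $$ a))"
  proof (rule all_cong1)
    fix b
    define L where "L = fls_lift (\<lambda>r. esub w r $$ b) H"
    define M where "M = fls_const (single 0 s) * esub v (H' $$ b)"
    have M: "M $$ a = scale s (esub v (H' $$ b) $$ a)" "(M * Pv) $$ a = scale s (opc v Pv a (H' $$ b))" for a
      by (simp_all add: M_def mult.assoc opc_def mult_map_scale_conv_mult[symmetric] scale_def[symmetric])
    have "fls_lift (\<lambda>r. esub w r $$ b) (H * Pv) = L * Pv"
      unfolding L_def
    proof (rule fls_lift_times')
      fix x n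
      have "pin (- {w}) (Pv $$ n)" using Pv(1) by (simp add: fpin_def)
      then show "esub w (x * Pv $$ n) $$ b = esub w x $$ b * Pv $$ n"
        by (simp add: esub_mult esub_free)
    qed (simp_all add: esub_add)
    then have L: "(L * Pv) $$ a = esub w ((H * Pv) $$ a) $$ b" for a
      by (metis (no_types, lifting) fls_lift_nth esub_0 fls_zero_nth)
    have "(\<forall>a. esub w ((H * Pv) $$ a) $$ b = scale s (opc v Pv a (H' $$ b))) \<longleftrightarrow> L * Pv = M * Pv"
      unfolding fls_eq_iff L M ..
    also have "\<dots> \<longleftrightarrow> L = M" by (rule fls_unit_cancel[OF Pv(2)])
    also have "\<dots> \<longleftrightarrow> (\<forall>a. esub w (H $$ a) $$ b = scale s (esub v (H' $$ b) $$ a))"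
      unfolding fls_eq_iff M by (simp add: L_def fls_lift_nth)
    finally show "(\<forall>a. esub w ((H * Pv) $$ a) $$ b = scale s (opc v Pv a (H' $$ b))) \<longleftrightarrow>
      (\<forall>a. esub w (H $$ a) $$ b = scale s (esub v (H' $$ b) $$ a))" .
  qed
  also have "\<dots> \<longleftrightarrow> ?B" unfolding H_def H'_def by blast
  finally show ?thesis .
qed

subsection \<open>Renaming of variables\<close>

definition ren :: "('x \<Rightarrow> 'y) \<Rightarrow> 'x mp \<Rightarrow> 'y mp" where "ren \<rho> = push (push \<rho>)"

lemma lookup_push: "lookup (push h p) y = (\<Sum>x\<in>keys p. if h x = y then lookup p x else 0)"
  by (simp add: push_def lookup_sum lookup_single when_def)

lemma lookup_push_inj: assumes "inj h" shows "lookup (push h p) (h x) = lookup p x"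
proof -
  have "lookup (push h p) (h x) = (\<Sum>x'\<in>keys p. if x' = x then lookup p x' else 0)"
    unfolding lookup_push using assms by (intro sum.cong) (auto simp: inj_eq)
  then show ?thesis by (simp add: in_keys_iff)
qed

lemma lookup_push_notin: "y \<notin> range h \<Longrightarrow> lookup (push h p) y = 0"
  unfolding lookup_push by (intro sum.neutral) auto

lemma push_inj_eqI:
  assumes "inj h" "\<And>x. lookup q (h x) = lookup p x" "\<And>y. y \<notin> range h \<Longrightarrow> lookup q y = 0"
  shows "push h p = q"
proof (rule poly_mapping_eqI)
  fix y show "lookup (push h p) y = lookup q y"
    by (cases "y \<in> range h") (auto simp: lookup_push_inj[OF assms(1)] assms(2,3) lookup_push_notin)
qed

lemma push_add_nat: "inj h \<Longrightarrow> push h (m + m') = push h m + push h m'" for m m' :: "'x \<Rightarrow>\<^sub>0 nat"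
  by (rule push_inj_eqI) (auto simp: lookup_add lookup_push_inj lookup_push_notin)

definition tau :: "'x \<Rightarrow> 'x \<Rightarrow> 'x \<Rightarrow> 'x" where "tau v w = id(v := w, w := v)"

lemma ren_simps: "ren \<rho> (f + g) = ren \<rho> f + ren \<rho> g" "ren \<rho> (f - g) = ren \<rho> f - ren \<rho> g"
  "ren \<rho> (scale c f) = scale c (ren \<rho> f)" "ren \<rho> 0 = 0" "ren \<rho> (single m c) = single (push \<rho> m) c"
  by (simp_all add: ren_def push_simps)

lemma ren_1 [simp]: "ren \<rho> 1 = 1"
proof -
  have "push \<rho> (0 :: _ \<Rightarrow>\<^sub>0 nat) = 0" by (simp add: push_def)
  then show ?thesis using ren_simps(5)[of \<rho> 0 1] by simp
qed

lemma ren_mult: assumes "inj \<rho>" shows "ren \<rho> (f * g) = ren \<rho> f * ren \<rho> g"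
proof (induction f rule: pm_induct)
  case (single m)
  show ?case
  proof (induction g rule: pm_induct)
    case (single m') then show ?case by (simp add: single_mult_single ren_simps push_add_nat[OF assms])
  qed (simp_all add: ren_simps distrib_left scale_mult_right)
qed (simp_all add: ren_simps distrib_right scale_mult_left)

lemma ren_mX [simp]: "ren \<rho> (mX v) = mX (\<rho> v)"
  by (simp add: mX_def ren_simps) (simp add: push_def)

lemma ren_cong: assumes "pin S f" "\<And>x. x \<in> S \<Longrightarrow> \<rho> x = \<rho>' x" shows "ren \<rho> f = ren \<rho>' f"
proof -
  have "push \<rho> m = push \<rho>' m" if "m \<in> keys f" for m
    unfolding push_def using assms that by (intro sum.cong) (auto simp: pin_def subset_iff)
  then show ?thesis unfolding ren_def push_def[of "push _"] by (intro sum.cong) auto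
qed

lemma keys_push: "keys (push \<rho> p) \<subseteq> \<rho> ` keys p"
  unfolding push_def by (rule subset_trans[OF keys_sum]) auto

lemma pin_ren: "pin S f \<Longrightarrow> pin (\<rho> ` S) (ren \<rho> f)"
  using keys_push[of "push \<rho>" f] keys_push[of \<rho>] unfolding pin_def ren_def by blast

lemma ren_comp: assumes "inj \<rho>" "inj \<rho>'" shows "ren \<rho> (ren \<rho>' f) = ren (\<rho> \<circ> \<rho>') f"
proof (induction f rule: pm_induct)
  case (single m)
  have "push \<rho> (push \<rho>' m) = push (\<rho> \<circ> \<rho>') m"
  proof (rule push_inj_eqI[OF assms(1)])
    fix x
    show "lookup (push (\<rho> \<circ> \<rho>') m) (\<rho> x) = lookup (push \<rho>' m) x"
    proof (cases "x \<in> range \<rho>'")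
      case True
      then obtain y where "x = \<rho>' y" by blast
      then show ?thesis using lookup_push_inj[OF inj_compose[OF assms], of m y] lookup_push_inj[OF assms(2), of m y] by simp
    next
      case False
      then have "\<rho> x \<notin> range (\<rho> \<circ> \<rho>')" using assms(1) by (auto simp: inj_eq)
      then show ?thesis using False by (simp add: lookup_push_notin)
    qed
  next
    fix y assume "y \<notin> range \<rho>"
    then show "lookup (push (\<rho> \<circ> \<rho>') m) y = 0" by (intro lookup_push_notin) auto
  qed
  then show ?case by (simp only: ren_simps)
qed (simp_all add: ren_simps)

lemma ren_id: "ren (\<lambda>x. x) f = f"
proof (induction f rule: pm_induct)
  case (single m)
  have "push (\<lambda>x. x) m = m" by (rule push_inj_eqI) auto
  then show ?case by (simp add: ren_simps)
qed (simp_all add: ren_simps)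

lemma inj_push_nat: "inj \<rho> \<Longrightarrow> inj (push \<rho> :: (_ \<Rightarrow>\<^sub>0 nat) \<Rightarrow> _)"
  by (rule injI) (metis lookup_push_inj poly_mapping_eqI)

lemma ren_inj: assumes "inj \<rho>" shows "ren \<rho> f = ren \<rho> g \<longleftrightarrow> f = g"
  unfolding ren_def using inj_push_nat[OF assms] by (metis lookup_push_inj poly_mapping_eqI)

lemma esub_ren: assumes "inj \<rho>" shows "esub (\<rho> v) (ren \<rho> f) = fls_lift (ren \<rho>) (esub v f)"
proof (induction f rule: pm_induct)
  case (single m)
  have r: "rmv (\<rho> v) (push \<rho> m) = push \<rho> (rmv v m)"
    by (rule push_inj_eqI[OF assms, symmetric])
      (use assms in \<open>auto simp: lookup_rmv lookup_push_inj lookup_push_notin inj_eq\<close>)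
  show ?case
  proof (rule fls_eqI)
    fix n
    show "esub (\<rho> v) (ren \<rho> (single m 1)) $$ n = fls_lift (ren \<rho>) (esub v (single m 1)) $$ n"
      by (simp add: ren_simps fls_lift_nth esub_single r lookup_push_inj[OF assms] if_distrib[of "ren \<rho>"])
  qed
next
  case (add p q)
  then show ?case by (intro fls_eqI) (simp add: ren_simps esub_add fls_lift_nth)
next
  case (scale c p)
  then show ?case by (intro fls_eqI) (simp add: ren_simps esub_scale_nth fls_lift_nth)
qed

lemma fls_lift_ren: assumes "inj \<rho>"
  shows "fls_lift (ren \<rho>) (G * H) = fls_lift (ren \<rho>) G * fls_lift (ren \<rho>) H"
    "fls_lift (ren \<rho>) (zf x c) = zf (ren \<rho> x) c" "fls_lift (ren \<rho>) (prod f A) = (\<Prod>x\<in>A. fls_lift (ren \<rho>) (f x))"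
  by (rule fls_lift_hom; simp add: ren_simps ren_mult[OF assms])+

lemma opc_ren: assumes "inj \<rho>" shows "ren \<rho> (opc v P a f) = opc (\<rho> v) (fls_lift (ren \<rho>) P) a (ren \<rho> f)"
  unfolding opc_def esub_ren[OF assms] fls_lift_ren(1)[OF assms, symmetric] by (simp add: fls_lift_nth ren_simps)

lemma pin_opc: "pin S f \<Longrightarrow> fpin (S - {v}) P \<Longrightarrow> pin (S - {v}) (opc v P a f)"
  using fpin_mult[OF fpin_esub[of S f v], of P] by (auto simp: opc_def fpin_def)

lemma hd2_opc: "hd2 n f \<Longrightarrow> hdf k P \<Longrightarrow> hd2 (n + k + 2 * a) (opc v P a f)"
  using hdf_mult[OF hdf_esub[of n f v], of k P] by (auto simp: opc_def hdf_def)

lemma inj_tau: "inj (tau v w)" by (auto simp: inj_def tau_def split: if_splits)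

text \<open>Renaming turns the expansion in one variable into the expansion in the other. After both
  expansions neither \<open>v\<close> nor \<open>w\<close> occurs, so the renaming that is left over
  acts trivially.\<close>

lemma esub_esub_tau:
  assumes "v \<noteq> w"
  shows "esub w (esub v (ren (tau v w) g) $$ b) $$ a = esub w (esub v g $$ a) $$ b"
proof -
  let ?r = "ren (tau v w)"
  have t: "tau v w w = v" "tau v w v = w" by (auto simp: tau_def)
  have "esub v (?r g) $$ b = ?r (esub w g $$ b)"
    using esub_ren[OF inj_tau[of v w], of w g] by (simp add: t fls_lift_nth ren_simps)
  moreover have "esub w (?r y) $$ a = ?r (esub v y $$ a)" for y
    using esub_ren[OF inj_tau[of v w], of v y] by (simp add: t fls_lift_nth ren_simps)
  ultimately have "esub w (esub v (?r g) $$ b) $$ a = ?r (esub v (esub w g $$ b) $$ a)" by simp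
  also have "\<dots> = ?r (esub w (esub v g $$ a) $$ b)" using esub_commute[OF assms] by metis
  also have "\<dots> = ren (\<lambda>x. x) (esub w (esub v g $$ a) $$ b)"
  proof (rule ren_cong)
    have "pin UNIV g" by (simp add: pin_def)
    then have "pin (UNIV - {v}) (esub v g $$ a)" using fpin_esub[of UNIV g v] by (simp add: fpin_def)
    then show "pin (UNIV - {v} - {w}) (esub w (esub v g $$ a) $$ b)" using fpin_esub[of "UNIV - {v}" _ w] by (simp add: fpin_def)
  qed (auto simp: tau_def)
  finally show ?thesis by (simp add: ren_id)
qed


section \<open>The pairing between words and symmetric polynomials\<close>

primrec col :: "'v qvar \<Rightarrow> 'v" where "col (Var i k) = i"
primrec idx :: "'v qvar \<Rightarrow> nat" where "idx (Var i k) = k"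

definition rv :: "('v \<Rightarrow> nat \<Rightarrow> nat) \<Rightarrow> 'v qvar \<Rightarrow> 'v qvar" where
  "rv \<sigma> = (\<lambda>v. case v of Var i k \<Rightarrow> Var i (\<sigma> i k))"

lemma rv_Var [simp]: "rv \<sigma> (Var i k) = Var i (\<sigma> i k)" by (simp add: rv_def)

lemma reindex_ren: "reindex \<sigma> = ren (rv \<sigma>)" by (simp add: reindex_def ren_def rv_def)

lemma inj_rv: "(\<And>i. inj (\<sigma> i)) \<Longrightarrow> inj (rv \<sigma>)"
proof (rule injI)
  fix x y assume i: "\<And>i. inj (\<sigma> i)" and e: "rv \<sigma> x = rv \<sigma> y"
  show "x = y" using e by (cases x; cases y) (auto dest: injD[OF i])
qed

definition del :: "'v \<Rightarrow> 'v dimvec \<Rightarrow> 'v dimvec" where "del i d = d - single i 1"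

lemma lookup_del: "lookup (del i d) j = (if j = i then lookup d j - 1 else lookup d j)"
  by (simp add: del_def lookup_minus lookup_single when_def)

lemma del_add: "lookup d i > 0 \<Longrightarrow> del i d + single i 1 = d"
  by (rule poly_mapping_eqI) (auto simp: lookup_add lookup_del lookup_single when_def)

lemma mdeg_del: "lookup d i > 0 \<Longrightarrow> mdeg d = Suc (mdeg (del i d))"
  using mdeg_add[of "del i d" "single i 1"] by (simp only: del_add mdeg_single)

context symmetric_quiver
begin

definition chi :: "'v \<Rightarrow> 'v \<Rightarrow> int" where "chi i j = euler (basis i) (basis j)"

lemma lookup_dim_degree [simp]: "lookup (dim_degree d) i = int (lookup d i)"
  by (simp add: dim_degree_def Poly_Mapping.map.rep_eq when_def)

lemma dim_degree_add: "dim_degree (d + e) = dim_degree d + dim_degree e"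
  by (rule poly_mapping_eqI) (simp add: lookup_add)

lemma dim_degree_inj: "dim_degree d = dim_degree e \<longleftrightarrow> d = e"
  by (metis lookup_dim_degree of_nat_eq_iff poly_mapping_eqI)

lemma dim_degree_0 [simp]: "dim_degree 0 = 0" by (rule poly_mapping_eqI) simp

lemma dim_degree_single [simp]: "dim_degree (single i 1) = basis i"
  by (rule poly_mapping_eqI) (simp add: basis_def lookup_single when_def)

lemma dim_degree_del: "lookup d i > 0 \<Longrightarrow> dim_degree d = dim_degree (del i d) + basis i"
  using dim_degree_add[of "del i d" "single i 1"] by (simp only: del_add dim_degree_single)

lemma dimvecs_del: "d \<in> dimvecs \<Longrightarrow> del i d \<in> dimvecs"
  by (auto simp: dimvecs_def in_keys_iff lookup_del split: if_splits)

lemma dimvecs_add: "d \<in> dimvecs \<Longrightarrow> e \<in> dimvecs \<Longrightarrow> d + e \<in> dimvecs"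
  by (auto simp: dimvecs_def keys_add_nat)

lemma dimvecs_0 [simp]: "0 \<in> dimvecs" by (simp add: dimvecs_def)

lemma dimvecs_pos: "d \<in> dimvecs \<Longrightarrow> lookup d i > 0 \<Longrightarrow> i \<in> verts Q"
  by (auto simp: dimvecs_def in_keys_iff)

lemma euler_right: "euler \<alpha> \<beta> = (\<Sum>j\<in>verts Q. lookup \<beta> j * euler \<alpha> (basis j))"
proof -
  have d: "lookup (basis j) x = (if j = x then 1 else 0)" for j x
    by (simp add: basis_def lookup_single when_def)
  have 1: "(\<Sum>j\<in>verts Q. lookup \<beta> j * (\<Sum>k\<in>verts Q. lookup \<alpha> k * lookup (basis j) k)) = (\<Sum>k\<in>verts Q. lookup \<alpha> k * lookup \<beta> k)"
    by (intro sum.cong refl) (simp add: d if_distrib[of "(*) _"] sum.delta cong: if_cong)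
  have "(\<Sum>j\<in>verts Q. lookup \<beta> j * (\<Sum>a\<in>arcs Q. lookup \<alpha> (tail Q a) * lookup (basis j) (head Q a))) =
    (\<Sum>a\<in>arcs Q. \<Sum>j\<in>verts Q. lookup \<beta> j * (lookup \<alpha> (tail Q a) * lookup (basis j) (head Q a)))"
    unfolding sum_distrib_left by (rule sum.swap)
  also have "\<dots> = (\<Sum>a\<in>arcs Q. lookup \<alpha> (tail Q a) * lookup \<beta> (head Q a))"
    by (intro sum.cong refl) (simp add: d if_distrib[of "(*) _"] sum.delta cong: if_cong)
  finally show ?thesis using 1 by (simp add: euler_def right_diff_distrib sum_subtractf)
qed

text \<open>\<open>chi i j\<close> is the Kronecker delta of the vertices minus a number of arrows.
  As a consequence the exponent \<open>ee i j\<close> below is 0 or 1.\<close>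

lemma chi_le: "i \<noteq> j \<Longrightarrow> chi i j \<le> 0" "chi i i \<le> 1"
proof -
  have n: "(\<Sum>a\<in>arcs Q. lookup (basis i) (tail Q a) * lookup (basis j) (head Q a)) \<ge> 0" for i j
    by (intro sum_nonneg) (simp add: basis_def lookup_single when_def)
  have z: "(\<Sum>k\<in>verts Q. lookup (basis i) k * lookup (basis j) k) = (if i = j \<and> i \<in> verts Q then 1 else 0)" for i j
    by (auto simp: basis_def lookup_single when_def if_distrib[of "\<lambda>x. x * _"] sum.delta cong: if_cong)
  show "i \<noteq> j \<Longrightarrow> chi i j \<le> 0" "chi i i \<le> 1"
    using n[of i j] z[of i j] n[of i i] z[of i i] unfolding chi_def euler_def by auto
qed

definition vset :: "'v dimvec \<Rightarrow> 'v qvar set" where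
  "vset d = {Var i k | i k. i \<in> verts Q \<and> k \<in> {1..lookup d i}}"

lemma Var_vset [simp]: "Var i k \<in> vset d \<longleftrightarrow> i \<in> verts Q \<and> k \<in> {1..lookup d i}"
  by (auto simp: vset_def)

lemma vset_image: "vset d = (\<lambda>(i, k). Var i k) ` (SIGMA i:verts Q. {1..lookup d i})"
  by (auto simp: vset_def)

lemma finite_vset [simp]: "finite (vset d)"
  unfolding vset_image by (intro finite_imageI finite_SigmaI) auto

lemma prod_vset: "(\<Prod>q\<in>vset d. h q) = (\<Prod>i\<in>verts Q. \<Prod>k\<in>{1..lookup d i}. h (Var i k))"
proof -
  have "inj_on (\<lambda>(i, k). Var i k) (SIGMA i:verts Q. {1..lookup d i})" by (auto simp: inj_on_def)
  then show ?thesis unfolding vset_image by (subst prod.reindex) (auto simp: prod.Sigma comp_def case_prod_unfold)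
qed

lemma sum_vset: "(\<Sum>q\<in>vset d. h q) = (\<Sum>i\<in>verts Q. \<Sum>k\<in>{1..lookup d i}. h (Var i k))"
proof -
  have "inj_on (\<lambda>(i, k). Var i k) (SIGMA i:verts Q. {1..lookup d i})" by (auto simp: inj_on_def)
  then show ?thesis unfolding vset_image by (subst sum.reindex) (auto simp: sum.Sigma comp_def case_prod_unfold)
qed

lemma vset_del: "i \<in> verts Q \<Longrightarrow> lookup d i > 0 \<Longrightarrow> vset d = insert (Var i (lookup d i)) (vset (del i d))"
  "Var i (lookup d i) \<notin> vset (del i d) \<or> lookup d i = 0"
proof -
  assume i: "i \<in> verts Q" "lookup d i > 0"
  show "vset d = insert (Var i (lookup d i)) (vset (del i d))"
  proof (rule Set.set_eqI)
    fix x show "x \<in> vset d \<longleftrightarrow> x \<in> insert (Var i (lookup d i)) (vset (del i d))"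
      using i by (cases x) (auto simp: lookup_del)
  qed
qed (auto simp: lookup_del)

lemma vset_del': "i \<in> verts Q \<Longrightarrow> lookup d i > 0 \<Longrightarrow> vset d - {Var i (lookup d i)} = vset (del i d)"
  using vset_del[of i d] by auto

text \<open>Permutations are demanded at every \<open>i\<close>, not only at vertices, so that
  \<open>rv \<sigma>\<close> is injective on all variables; by \<open>sym_iff\<close> this describes
  the same symmetric polynomials.\<close>

definition sig :: "'v dimvec \<Rightarrow> ('v \<Rightarrow> nat \<Rightarrow> nat) \<Rightarrow> bool" where
  "sig d \<sigma> \<longleftrightarrow> (\<forall>i. \<sigma> i permutes {1..lookup d i})"

lemma sig_inj: "sig d \<sigma> \<Longrightarrow> inj (rv \<sigma>)"
  by (rule inj_rv) (auto simp: sig_def dest: permutes_inj)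

lemma sig_vset: "sig d \<sigma> \<Longrightarrow> bij_betw (rv \<sigma>) (vset d) (vset d)"
proof -
  assume s: "sig d \<sigma>"
  have "rv \<sigma> ` vset d = vset d"
  proof (rule endo_inj_surj)
    show "rv \<sigma> ` vset d \<subseteq> vset d"
    proof (rule image_subsetI)
      fix x assume "x \<in> vset d"
      then show "rv \<sigma> x \<in> vset d"
        using s permutes_in_image[of "\<sigma> (col x)" "{1..lookup d (col x)}" "idx x"] by (cases x) (simp add: sig_def)
    qed
    show "inj_on (rv \<sigma>) (vset d)" using sig_inj[OF s] by (rule inj_on_subset) simp
  qed simp
  then show ?thesis using sig_inj[OF s] by (auto simp: bij_betw_def intro: inj_on_subset)
qed

lemma sym_iff: assumes "d \<in> dimvecs"
  shows "f \<in> sym_polys d \<longleftrightarrow> pin (vset d) f \<and> (\<forall>\<sigma>. sig d \<sigma> \<longrightarrow> ren (rv \<sigma>) f = f)"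
proof
  assume "f \<in> sym_polys d"
  then show "pin (vset d) f \<and> (\<forall>\<sigma>. sig d \<sigma> \<longrightarrow> ren (rv \<sigma>) f = f)"
    by (auto simp: sym_polys_def pin_def vset_def sig_def reindex_ren)
next
  assume *: "pin (vset d) f \<and> (\<forall>\<sigma>. sig d \<sigma> \<longrightarrow> ren (rv \<sigma>) f = f)"
  have "ren (rv \<sigma>) f = f" if \<sigma>: "\<forall>i\<in>verts Q. \<sigma> i permutes {1..lookup d i}" for \<sigma>
  proof -
    define \<sigma>' where "\<sigma>' i = (if i \<in> verts Q then \<sigma> i else id)" for i
    have "sig d \<sigma>'" using \<sigma> by (auto simp: sig_def \<sigma>'_def permutes_id)
    then have "ren (rv \<sigma>') f = f" using * by blast
    moreover have "ren (rv \<sigma>) f = ren (rv \<sigma>') f"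
      by (rule ren_cong[of "vset d"]) (use * in \<open>auto simp: vset_def \<sigma>'_def\<close>)
    ultimately show ?thesis by simp
  qed
  then show "f \<in> sym_polys d" using * unfolding sym_polys_def reindex_ren by (auto simp: pin_def vset_def)
qed

lemma sym_add: assumes "d \<in> dimvecs" shows "f \<in> sym_polys d \<Longrightarrow> g \<in> sym_polys d \<Longrightarrow> f + g \<in> sym_polys d"
  "f \<in> sym_polys d \<Longrightarrow> scale c f \<in> sym_polys d" "0 \<in> sym_polys d" "f \<in> sym_polys d \<Longrightarrow> g \<in> sym_polys d \<Longrightarrow> f - g \<in> sym_polys d"
  using sig_inj by (auto simp: sym_iff[OF assms] ren_simps intro: pin_add pin_scale pin_diff)

lemma sym_mult: assumes "d \<in> dimvecs" shows "f \<in> sym_polys d \<Longrightarrow> g \<in> sym_polys d \<Longrightarrow> f * g \<in> sym_polys d"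
  using sig_inj by (auto simp: sym_iff[OF assms] ren_mult intro: pin_mult)

text \<open>Up to sign the reciprocal of the shuffle kernel between one variable z of colour
  \<open>i\<close> and the variables of dimension \<open>d\<close>. This is why it cancels kernel
  factors when a shuffle product is expanded.\<close>

definition PP :: "'v \<Rightarrow> 'v dimvec \<Rightarrow> 'v qpoly fls" where
  "PP i d = (\<Prod>q\<in>vset d. zf (mX q) (chi i (col q)))"

definition PPi :: "'v \<Rightarrow> 'v dimvec \<Rightarrow> 'v qpoly fls" where
  "PPi i d = (\<Prod>q\<in>vset d. zf (mX q) (- chi i (col q)))"

lemma PP_PPi: "PP i d * PPi i d = 1"
  by (simp add: PP_def PPi_def zf_inverse flip: prod.distrib)

lemma PP_0 [simp]: "PP i 0 = 1" by (simp add: PP_def vset_def)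

lemma fpin_PP: "fpin (vset d) (PP i d)" and fpin_PPi: "fpin (vset d) (PPi i d)"
  unfolding PP_def PPi_def by (intro fpin_prod fpin_zf pin_mX; assumption)+

lemma PP_insert: "j \<in> verts Q \<Longrightarrow> lookup d j > 0 \<Longrightarrow> PP i d = PP i (del j d) * zf (mX (Var j (lookup d j))) (chi i j)"
  using vset_del[of j d] by (auto simp: PP_def mult.commute)

lemma PP_sig: assumes "sig d \<sigma>" shows "fls_lift (ren (rv \<sigma>)) (PP i d) = PP i d" "fls_lift (ren (rv \<sigma>)) (PPi i d) = PPi i d"
proof -
  have c: "col (rv \<sigma> q) = col q" for q by (cases q) simp
  have "fls_lift (ren (rv \<sigma>)) (\<Prod>q\<in>vset d. zf (mX q) (h (col q))) = (\<Prod>q\<in>vset d. zf (mX q) (h (col q)))" for h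
    using prod.reindex_bij_betw[OF sig_vset[OF assms], of "\<lambda>q. zf (mX q) (h (col q))"]
    by (simp add: fls_lift_ren[OF sig_inj[OF assms]] c)
  from this[of "chi i"] this[of "\<lambda>j. - chi i j"]
  show "fls_lift (ren (rv \<sigma>)) (PP i d) = PP i d" "fls_lift (ren (rv \<sigma>)) (PPi i d) = PPi i d"
    by (simp_all add: PP_def PPi_def)
qed

lemma hdf_PP: "hdf (2 * euler (basis i) (dim_degree d)) (PP i d)"
proof -
  have "hdf (\<Sum>q\<in>vset d. 2 * chi i (col q)) (PP i d)" unfolding PP_def by (intro hdf_prod hdf_zf hd2_mX)
  moreover have "(\<Sum>q\<in>vset d. 2 * chi i (col q)) = 2 * euler (basis i) (dim_degree d)"
    by (simp add: sum_vset euler_right[of _ "dim_degree d"] chi_def sum_distrib_left mult_ac)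
  ultimately show ?thesis by simp
qed

text \<open>The action of the letter \<open>i(n)\<close>: expand the last variable \<open>z\<close> of colour \<open>i\<close> at infinity,
  multiply by the factors \<open>(z - x)\<close> to the power \<open>\<chi>(i, col x)\<close> and take the coefficient of \<open>z\<close> to the
  power \<open>- n - 1\<close>.\<close>

definition aop :: "'v dimvec \<Rightarrow> 'v \<Rightarrow> int \<Rightarrow> 'v qpoly \<Rightarrow> 'v qpoly" where
  "aop d i n = opc (Var i (lookup d i)) (PP i (del i d)) (n + 1)"

text \<open>The leftmost letter acts first, so left multiplication of words is transposed to
  \<open>aop\<close>. A word pairs nontrivially only if it uses up all variables, whence the test
  \<open>d = 0\<close> at the end.\<close>

fun Bf :: "'v dimvec \<Rightarrow> ('v \<times> int) list \<Rightarrow> 'v qpoly \<Rightarrow> rat" where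
  "Bf d [] f = (if d = 0 then lookup f 0 else 0)"
| "Bf d ((i, n) # u) f = (if i \<in> verts Q \<and> lookup d i > 0 then Bf (del i d) u (aop d i n f) else 0)"

abbreviation "BB d f \<equiv> (\<lambda>u. Bf d (letters u) f)"

lemma aop_add: "aop d i n (f + g) = aop d i n f + aop d i n g" "aop d i n (scale c f) = scale c (aop d i n f)"
  "aop d i n 0 = 0"
  by (simp_all add: aop_def opc_add opc_scale)

lemma Bf_add: "Bf d u (f + g) = Bf d u f + Bf d u g" "Bf d u (scale c f) = c * Bf d u f" "Bf d u 0 = 0"
  by (induction u arbitrary: d f g) (auto simp: lookup_add aop_add split: prod.splits)

lemma Bf_diff: "Bf d u (f - g) = Bf d u f - Bf d u g"
  using Bf_add(1)[of d u "f - g" g] by simp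

lemma Bf_sum: "Bf d u (sum h A) = (\<Sum>x\<in>A. Bf d u (h x))"
  by (induction A rule: infinite_finite_induct) (simp_all add: Bf_add)

lemma sig_del: "sig (del i d) \<sigma> \<Longrightarrow> sig d \<sigma>" "sig (del i d) \<sigma> \<Longrightarrow> lookup d i > 0 \<Longrightarrow> \<sigma> i (lookup d i) = lookup d i"
proof -
  assume s: "sig (del i d) \<sigma>"
  show "sig d \<sigma>" unfolding sig_def
  proof
    fix j have "\<sigma> j permutes {1..lookup (del i d) j}" using s by (simp add: sig_def)
    then show "\<sigma> j permutes {1..lookup d j}" by (rule permutes_subset) (auto simp: lookup_del)
  qed
  have "\<sigma> i permutes {1..lookup (del i d) i}" using s by (simp add: sig_def)
  then show "lookup d i > 0 \<Longrightarrow> \<sigma> i (lookup d i) = lookup d i"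
    by (rule permutes_not_in) (simp add: lookup_del)
qed

text \<open>Permutations of the remaining variables fix the expanded one and leave the series
  \<open>PP\<close> invariant, so they commute with the operator.\<close>

lemma aop_sym: assumes d: "d \<in> dimvecs" "i \<in> verts Q" "lookup d i > 0" and f: "f \<in> sym_polys d"
  shows "aop d i n f \<in> sym_polys (del i d)"
  unfolding sym_iff[OF dimvecs_del[OF d(1)]]
proof (intro conjI allI impI)
  have "pin (vset d - {Var i (lookup d i)}) (aop d i n f)" unfolding aop_def
    by (rule pin_opc) (use f fpin_PP in \<open>auto simp: sym_iff[OF d(1)] vset_del'[OF d(2,3)]\<close>)
  then show "pin (vset (del i d)) (aop d i n f)" by (simp add: vset_del'[OF d(2,3)])
  fix \<sigma> assume s: "sig (del i d) \<sigma>"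
  have "ren (rv \<sigma>) f = f" using f sig_del(1)[OF s] by (simp add: sym_iff[OF d(1)])
  then show "ren (rv \<sigma>) (aop d i n f) = aop d i n f"
    unfolding aop_def opc_ren[OF sig_inj[OF s]] PP_sig[OF s] using sig_del(2)[OF s d(3)] by simp
qed

lemma hd2_aop: "hd2 n f \<Longrightarrow> hd2 (n + 2 * euler (basis i) (dim_degree (del i d)) + 2 * (k + 1)) (aop d i k f)"
  unfolding aop_def by (rule hd2_opc[OF _ hdf_PP])

lemma Bf_ldeg: "d \<in> dimvecs \<Longrightarrow> Bf d u f \<noteq> 0 \<Longrightarrow> ldeg (FMon u) = dim_degree d"
proof (induction u arbitrary: d f)
  case (Cons g u)
  obtain i n where g: "g = (i, n)" by force
  from Cons.prems have "lookup d i > 0" "Bf (del i d) u (aop d i n f) \<noteq> 0" by (auto simp: g split: if_splits)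
  then show ?case using Cons.IH[of "del i d"] Cons.prems dim_degree_del[of d i] by (simp add: g gdeg_simp dimvecs_del)
qed (simp split: if_splits)

text \<open>With d' = d - e_i, the form \<chi>(d,d) splits as \<chi>(d',d') + 2\<chi>(e_i,d') +
  \<chi>(e_i,e_i): the middle term is the degree of \<open>PP\<close>, the last one the shift in the
  degree of \<open>i(n)\<close>. Together with the shift of the CoHA by \<chi>(d,d) the pairing has
  degree 0.\<close>

lemma Bf_hom: "hd2 n f \<Longrightarrow> Bf d u f \<noteq> 0 \<Longrightarrow> n + euler (dim_degree d) (dim_degree d) + snd (wdeg (FMon u)) = 0"
proof (induction u arbitrary: d f n)
  case Nil
  then have d: "d = 0" "lookup f 0 \<noteq> 0" by (auto split: if_splits)
  then have "0 \<in> keys f" by (simp add: in_keys_iff)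
  then have "2 * int (mdeg (0 :: 'v qvar \<Rightarrow>\<^sub>0 nat)) = n" using Nil(1) unfolding hd2_def by blast
  then have "n = 0" by (simp add: mdeg_def)
  then show ?case using d by simp
next
  case (Cons g u)
  obtain i k where g: "g = (i, k)" by force
  from Cons.prems have d: "lookup d i > 0" "Bf (del i d) u (aop d i k f) \<noteq> 0" by (auto simp: g split: if_splits)
  have "n + 2 * euler (basis i) (dim_degree (del i d)) + 2 * (k + 1) + euler (dim_degree (del i d)) (dim_degree (del i d)) + snd (wdeg (FMon u)) = 0"
    by (rule Cons.IH[OF hd2_aop[OF Cons.prems(1)] d(2)])
  then show ?case using dim_degree_del[OF d(1)] euler_commute[of "basis i" "dim_degree (del i d)"]
    by (simp add: g gdeg_simp euler_add)
qed

lemma hd2_hpart: "hd2 (2 * int k) (hpart mdeg k f)"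
  by (simp add: hd2_def keys_hpart)

lemma Bf_degree: assumes "Bf d u f \<noteq> 0"
  shows "\<exists>m\<in>keys f. 2 * int (mdeg m) + euler (dim_degree d) (dim_degree d) + snd (wdeg (FMon u)) = 0"
proof -
  have "Bf d u f = (\<Sum>k\<in>mdeg ` keys f. Bf d u (hpart mdeg k f))"
    using sum_hpart[of "mdeg ` keys f" mdeg f] by (simp flip: Bf_sum)
  with assms have "(\<Sum>k\<in>mdeg ` keys f. Bf d u (hpart mdeg k f)) \<noteq> 0" by simp
  then obtain k where "k \<in> mdeg ` keys f" "Bf d u (hpart mdeg k f) \<noteq> 0" by (rule sum.not_neutral_contains_not_neutral)
  then obtain m where "m \<in> keys f" "Bf d u (hpart mdeg (mdeg m) f) \<noteq> 0" by blast
  then show ?thesis using Bf_hom[OF hd2_hpart] by blast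
qed

text \<open>Words beginning with letters of a single colour suffice: by induction all coefficients
  of the expansion times the unit \<open>PP\<close> vanish, hence the expansion vanishes, and with
  it the polynomial.\<close>

lemma Bf_nondegenerate: "d \<in> dimvecs \<Longrightarrow> f \<in> sym_polys d \<Longrightarrow> (\<And>u. Bf d u f = 0) \<Longrightarrow> f = 0"
proof (induction "mdeg d" arbitrary: d f)
  case 0
  then have "d = 0" by (intro poly_mapping_eqI) (auto simp: mdeg_def in_keys_iff)
  then have "pin {} f" using 0 by (simp add: sym_iff vset_def)
  moreover have "lookup f 0 = 0" using 0(4)[of "[]"] \<open>d = 0\<close> by simp
  ultimately show ?case
  proof (intro poly_mapping_eqI)
    fix k assume "pin {} f" "lookup f 0 = 0"
    then show "lookup f k = lookup 0 k" by (cases "k = 0") (auto simp: pin_def in_keys_iff)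
  qed
next
  case (Suc k)
  then have "mdeg d \<noteq> 0" by simp
  then have "\<exists>i. lookup d i > 0" unfolding mdeg_def by (metis gr0I sum.neutral)
  then obtain i where i: "lookup d i > 0" ..
  then have v: "i \<in> verts Q" using Suc.prems dimvecs_pos by blast
  have "aop d i n f = 0" for n
  proof (rule Suc.hyps(1))
    show "k = mdeg (del i d)" using Suc(2) mdeg_del[OF i] by simp
    show "Bf (del i d) u (aop d i n f) = 0" for u using Suc.prems(3)[of "(i, n) # u"] v i by simp
  qed (use Suc.prems v i in \<open>auto simp: dimvecs_del intro: aop_sym\<close>)
  then have "(esub (Var i (lookup d i)) f * PP i (del i d)) $$ n = 0" for n
    using \<open>\<And>n. aop d i n f = 0\<close>[of "n - 1"] by (simp add: aop_def opc_def)
  then have "esub (Var i (lookup d i)) f * PP i (del i d) = 0 * PP i (del i d)" by (simp add: fls_eq_iff)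
  then have "esub (Var i (lookup d i)) f = 0" unfolding fls_unit_cancel[OF PP_PPi] .
  then show ?case by (simp add: esub_eq_0_iff)
qed

subsection \<open>The pairing vanishes on the defining relations of the principal module\<close>

lemma pairing_letter: "pairing (BB d f) (letter (i, n) * p) =
  (if i \<in> verts Q \<and> lookup d i > 0 then pairing (BB (del i d) (aop d i n f)) p else 0)"
proof (induction p rule: pm_induct)
  case (single u) then show ?case by (simp add: letter_def single_mult_single)
qed (auto simp: pairing_add pairing_scale distrib_left scale_mult_right)

text \<open>A prefix acts on the polynomial and leaves a symmetric polynomial of another dimension,
  so relations need to be tested only at the front of a word.\<close>

lemma pairing_prefix:
  assumes "\<And>d f. d \<in> dimvecs \<Longrightarrow> f \<in> sym_polys d \<Longrightarrow> pairing (BB d f) p = 0" "d \<in> dimvecs" "f \<in> sym_polys d"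
  shows "pairing (BB d f) (single u 1 * p) = 0"
proof -
  have "pairing (BB d f) (single (FMon gs) 1 * p) = 0" if "d \<in> dimvecs" "f \<in> sym_polys d" for gs d f
    using that
  proof (induction gs arbitrary: d f)
    case Nil then show ?case using assms(1) by (simp flip: zero_fmon_def)
  next
    case (Cons g gs)
    obtain i n where g: "g = (i, n)" by force
    have "single (FMon (g # gs)) 1 * p = letter (i, n) * (single (FMon gs) 1 * p)"
      by (simp add: g letter_def single_mult_single flip: mult.assoc)
    then show ?case using Cons by (simp add: pairing_letter dimvecs_del aop_sym)
  qed
  from this[OF assms(2,3), of "letters u"] show ?thesis by simp
qed

text \<open>The exponent c + N of \<open>locality_iff\<close> for c = \<chi>(i,j). It is 1 if
  \<open>i = j\<close> is a vertex without loops and 0 otherwise.\<close>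

definition ee :: "'v \<Rightarrow> 'v \<Rightarrow> int" where "ee i j = chi i j + int (N_plus i j)"

lemma ee: "ee i j = max (chi i j) 0" by (simp add: ee_def N_plus_def chi_def)

lemma sg_chi: "sg (basis i) (basis j) = (- 1) powi chi i j" by (simp add: braid_sign_def chi_def)

text \<open>The braiding sign times the sign from reversing the binomial sum. It is the parity of
  \<open>ee\<close>: locality means symmetry, except at a vertex without loops, where it means
  antisymmetry.\<close>

definition lsign :: "'v \<Rightarrow> 'v \<Rightarrow> rat" where "lsign i j = sg (basis i) (basis j) * (- 1) ^ N_plus i j"

lemma lsign: "lsign i j = (- 1) ^ nat (ee i j)"
proof -
  have "lsign i j = (- 1) powi ee i j" unfolding lsign_def sg_chi ee_def by (simp add: power_int_add)
  then show ?thesis by (simp add: ee power_int_def)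
qed

lemma lsign_neq: "i \<noteq> j \<Longrightarrow> ee i j = 0 \<and> lsign i j = 1"
  using chi_le(1)[of i j] by (simp add: lsign ee)

text \<open>Abstract form of the locality relation between two families of polynomials, given by
  series \<open>F\<close> and \<open>F'\<close>, in the variables of \<open>del i d\<close> and of \<open>del j d\<close>.\<close>

lemma locality_series:
  assumes d: "i \<in> verts Q" "j \<in> verts Q" "lookup d i > 0" "lookup (del i d) j > 0"
    and F: "F = G * PP i (del i d)" "F' = G' * PP j (del j d)"
  defines "w \<equiv> Var j (lookup (del i d) j)" and "v \<equiv> Var i (lookup (del j d) i)"
  shows "(\<forall>m n. (\<Sum>k\<le>N_plus i j. scale ((- 1) ^ k * of_nat (N_plus i j choose k))
      (aop (del i d) j (n + int k) (F $$ (m - int k + 1)) -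
       scale (sg (basis i) (basis j)) (aop (del j d) i (m - int k) (F' $$ (n + int k + 1))))) = 0) \<longleftrightarrow>
    (\<forall>a b. esub w ((G * zf (mX w) (ee i j)) $$ a) $$ b = scale (lsign i j) (esub v ((G' * zf (mX v) (ee i j)) $$ b) $$ a))"
    (is "?A \<longleftrightarrow> ?B")
proof -
  have dd: "del i (del j d) = del j (del i d)" by (rule poly_mapping_eqI) (simp add: lookup_del)
  have pos: "lookup (del j d) i > 0" using d by (auto simp: lookup_del split: if_splits)
  let ?P = "\<lambda>i. PP i (del j (del i d))"
  have nv: "v \<notin> vset (del j (del i d))" "w \<notin> vset (del j (del i d))"
    using d(4) pos by (auto simp: vset_def v_def w_def lookup_del split: if_splits)
  have "fpin (- {w}) (PP i (del j (del i d)))" "fpin (- {v}) (PP j (del j (del i d)))"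
    using fpin_mono[OF fpin_PP] nv by (metis ComplI singletonD subsetI)+
  note L = locality_iff[OF this(1) PP_PPi this(2) PP_PPi, of F G "chi i j" F' G' "lsign i j" "sg (basis i) (basis j)" "N_plus i j"]
  have F1: "F = G * PP i (del j (del i d)) * zf (mX w) (chi i j)"
    unfolding F PP_insert[OF d(2,4)] w_def by (simp only: mult.assoc)
  have "chi j i = chi i j" unfolding chi_def by (rule euler_commute)
  then have F2: "F' = G' * PP j (del j (del i d)) * zf (mX v) (chi i j)"
    unfolding F PP_insert[OF d(1) pos] v_def dd by (simp only: mult.assoc)
  \<comment> \<open>\<open>aop\<close> with index n reads off the coefficient n + 1, whence a = m +
    1 and b = n + 1.\<close>
  have "?A \<longleftrightarrow> (\<forall>a b. (\<Sum>k\<le>N_plus i j. scale ((- 1) ^ k * of_nat (N_plus i j choose k))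
      (opc w (PP j (del j (del i d))) (b + int k) (F $$ (a - int k)) - scale (sg (basis i) (basis j)) (opc v (PP i (del j (del i d))) (a - int k) (F' $$ (b + int k))))) = 0)"
    (is "_ \<longleftrightarrow> ?C")
  proof
    assume A: ?A
    show ?C
    proof (intro allI)
      fix a b
      show "(\<Sum>k\<le>N_plus i j. scale ((- 1) ^ k * of_nat (N_plus i j choose k))
        (opc w (PP j (del j (del i d))) (b + int k) (F $$ (a - int k)) - scale (sg (basis i) (basis j)) (opc v (PP i (del j (del i d))) (a - int k) (F' $$ (b + int k))))) = 0"
        using A[rule_format, of "b - 1" "a - 1"] by (simp add: aop_def dd w_def v_def)
    qed
  next
    assume C: ?C
    show ?A
    proof (intro allI)
      fix m n
      show "(\<Sum>k\<le>N_plus i j. scale ((- 1) ^ k * of_nat (N_plus i j choose k))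
      (aop (del i d) j (n + int k) (F $$ (m - int k + 1)) -
       scale (sg (basis i) (basis j)) (aop (del j d) i (m - int k) (F' $$ (n + int k + 1))))) = 0"
        using C[rule_format, of "n + 1" "m + 1"] by (simp add: aop_def dd w_def v_def algebra_simps)
    qed
  qed
  also have "\<dots> \<longleftrightarrow> ?B" using L F1 F2 by (simp add: lsign_def ee_def)
  finally show ?thesis .
qed

text \<open>For distinct colours the two expansions simply commute. For equal colours the power of z
  - x is absorbed into the polynomial: times that power of the difference of the last two variables,
  \<open>f\<close> changes by \<open>lsign\<close> when they are swapped.\<close>

lemma locality_sym:
  assumes dv: "d \<in> dimvecs" and d: "i \<in> verts Q" "j \<in> verts Q" "lookup d i > 0" "lookup (del i d) j > 0"
    and f: "f \<in> sym_polys d"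
  shows "(\<Sum>k\<le>N_plus i j. scale ((- 1) ^ k * of_nat (N_plus i j choose k))
      (aop (del i d) j (n + int k) (aop d i (m - int k) f) -
       scale (sg (basis i) (basis j)) (aop (del j d) i (m - int k) (aop d j (n + int k) f)))) = 0"
proof -
  let ?G = "esub (Var i (lookup d i)) f" and ?G' = "esub (Var j (lookup d j)) f"
  let ?w = "Var j (lookup (del i d) j)" and ?v = "Var i (lookup (del j d) i)"
  have "esub ?w ((?G * zf (mX ?w) (ee i j)) $$ a) $$ b = scale (lsign i j) (esub ?v ((?G' * zf (mX ?v) (ee i j)) $$ b) $$ a)" for a b
  proof (cases "i = j")
    case False
    then show ?thesis using lsign_neq[OF False] esub_commute[of "Var i (lookup d i)" "Var j (lookup d j)" f a b]
      by (simp add: lookup_del)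
  next
    case True
    let ?T1 = "Var i (lookup d i)" and ?T2 = "Var i (lookup d i - 1)"
    have ne: "?T1 \<noteq> ?T2" using d by simp
    let ?t = "ren (tau ?T1 ?T2)"
    define e where "e = nat (ee i i)"
    \<comment> \<open>Chosen so that its expansion at \<open>?T1\<close> is the series in the
      condition of \<open>locality_series\<close>, see \<open>Eg\<close>.\<close>
    define g where "g = f * (mX ?T1 - mX ?T2) ^ e"
    have tau: "tau ?T1 ?T2 ?T1 = ?T2" "tau ?T1 ?T2 ?T2 = ?T1" using ne by (auto simp: tau_def)
    have "?t f = f"
    proof -
      define \<sigma> where "\<sigma> = (\<lambda>l. if l = i then Transposition.transpose (lookup d i) (lookup d i - 1) else id)"
      have "Transposition.transpose (lookup d i) (lookup d i - 1) permutes {1..lookup d i}"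
        using d True by (intro permutes_swap_id) (auto simp: lookup_del)
      then have "sig d \<sigma>" by (auto simp: sig_def \<sigma>_def permutes_id)
      then have "ren (rv \<sigma>) f = f" using f by (simp add: sym_iff[OF dv])
      moreover have "rv \<sigma> = tau ?T1 ?T2"
      proof
        fix x show "rv \<sigma> x = tau ?T1 ?T2 x" by (cases x) (auto simp: \<sigma>_def tau_def Transposition.transpose_def)
      qed
      ultimately show ?thesis by simp
    qed
    moreover have "?t ((mX ?T1 - mX ?T2) ^ n) = (mX ?T2 - mX ?T1) ^ n" for n
      by (induction n) (simp_all only: power_0 ren_1 power_Suc ren_mult[OF inj_tau] ren_simps ren_mX tau)
    moreover have "(mX ?T2 - mX ?T1) ^ e = scale ((-1) ^ e) ((mX ?T1 - mX ?T2) ^ e)"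
      using scale_sign[of e 1 "(mX ?T1 - mX ?T2) ^ e"] power_minus[of "mX ?T1 - mX ?T2" e] by simp
    ultimately have tg: "?t g = scale (lsign i i) g"
      unfolding g_def by (simp add: ren_mult[OF inj_tau] scale_mult_right lsign e_def)
    have Eg: "esub ?T1 g = ?G * zf (mX ?T2) (ee i i)"
    proof -
      have "esub ?T1 (mX ?T1 - mX ?T2) = zmx (mX ?T2)"
      proof -
        have "esub ?T1 (mX ?T1 - mX ?T2) = esub ?T1 (mX ?T1 + scale (-1) (mX ?T2))" by (simp add: pm.scale_minus_left)
        also have "\<dots> = fls_X_inv + fls_const (single 0 (-1)) * fls_const (mX ?T2)"
          using ne by (simp only: esub_add esub_var esub_scale, subst esub_free) (auto intro: pin_mX)
        also have "\<dots> = zmx (mX ?T2)" by (simp add: single_uminus)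
        finally show ?thesis .
      qed
      then show ?thesis using zf_nat[of "mX ?T2" e] by (simp add: g_def esub_mult esub_power e_def ee)
    qed
    have "esub ?T2 (esub ?T1 (scale (lsign i i) g) $$ b) $$ a = esub ?T2 (esub ?T1 g $$ a) $$ b"
      unfolding tg[symmetric] by (rule esub_esub_tau[OF ne])
    then have "esub ?T2 (esub ?T1 g $$ a) $$ b = scale (lsign i i) (esub ?T2 (esub ?T1 g $$ b) $$ a)"
      by (simp add: esub_scale_nth)
    then show ?thesis unfolding Eg True[symmetric] by (simp add: lookup_del)
  qed
  then have *: "\<forall>a b. esub ?w ((?G * zf (mX ?w) (ee i j)) $$ a) $$ b = scale (lsign i j) (esub ?v ((?G' * zf (mX ?v) (ee i j)) $$ b) $$ a)" by blast
  show ?thesis using iffD2[OF locality_series[OF d refl refl] *, rule_format, of n m]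
    by (simp add: aop_def[of d] opc_def)
qed

lemma Bf_locality:
  assumes dv: "d \<in> dimvecs" and ij: "i \<in> verts Q" "j \<in> verts Q" and f: "f \<in> sym_polys d"
  shows "pairing (BB d f) (locrel i j m n * single v 1) = 0"
proof -
  let ?c = "\<lambda>k. (- 1) ^ k * of_nat (N_plus i j choose k) :: rat"
  have e: "pairing (BB d f) (locrel i j m n * single v 1) = (\<Sum>k\<le>N_plus i j. ?c k *
     (pairing (BB d f) (letter (i, m - int k) * (letter (j, n + int k) * single v 1)) -
      sg (basis i) (basis j) * pairing (BB d f) (letter (j, n + int k) * (letter (i, m - int k) * single v 1))))"
    unfolding locrel_def sum_distrib_right pairing_sum
    by (intro sum.cong refl) (simp add: scale_mult_left pairing_scale pairing_diff left_diff_distrib mult.assoc)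
  show ?thesis
  proof (cases "lookup d i > 0 \<and> lookup (del i d) j > 0")
    case False
    then have "\<not> (lookup d j > 0 \<and> lookup (del j d) i > 0)" by (auto simp: lookup_del split: if_splits)
    then show ?thesis unfolding e pairing_letter using False ij by (intro sum.neutral) auto
  next
    case True
    then have T: "lookup d j > 0" "lookup (del j d) i > 0" by (auto simp: lookup_del split: if_splits)
    have dd: "del i (del j d) = del j (del i d)" by (rule poly_mapping_eqI) (simp add: lookup_del)
    have "pairing (BB d f) (locrel i j m n * single v 1) = Bf (del j (del i d)) (letters v)
      (\<Sum>k\<le>N_plus i j. scale (?c k) (aop (del i d) j (n + int k) (aop d i (m - int k) f) -
       scale (sg (basis i) (basis j)) (aop (del j d) i (m - int k) (aop d j (n + int k) f))))"
      unfolding e pairing_letter using True T ij by (simp add: Bf_sum Bf_add Bf_diff dd)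
    also have "\<dots> = 0" using True locality_sym[OF dv ij _ _ f] by (simp add: Bf_add)
    finally show ?thesis .
  qed
qed

lemma Bf_kills_rels: assumes "r \<in> rels" "d \<in> dimvecs" "f \<in> sym_polys d" shows "pairing (BB d f) (r * single v 1) = 0"
  using assms Bf_locality by (auto simp: rels_def pairing_letter)

lemma Bf_kills_J0: assumes "p \<in> J0" "d \<in> dimvecs" "f \<in> sym_polys d" shows "pairing (BB d f) p = 0"
proof -
  have "J0 \<subseteq> {p. pairing (BB d f) p = 0}"
    unfolding JX_def
  proof (rule pm.span_minimal[OF _ subspace_pairing_0], intro subsetI CollectI)
    fix p assume "p \<in> rel_gens \<union> letter_gens X0"
    then show "pairing (BB d f) p = 0"
    proof
      assume "p \<in> rel_gens"
      then obtain u r v where p: "p = single u 1 * r * single v 1" "r \<in> rels" by blast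
      show ?thesis unfolding p(1) mult.assoc by (rule pairing_prefix[OF Bf_kills_rels[OF p(2)] assms(2,3)])
    next
      assume "p \<in> letter_gens X0"
      then obtain u i n where p: "p = single u 1 * letter (i, n)" "n \<ge> 0" by (auto simp: X0_def)
      \<comment> \<open>A one-letter word meets only d = e_i, where the product \<open>PP\<close> is
        empty, and the expansion of a polynomial has no coefficient at a negative power of
        z.\<close>
      have "pairing (BB d f) (letter (i, n)) = 0" for d f
        using p(2) by (auto simp: letter_def aop_def opc_def)
      then show ?thesis unfolding p(1) using assms(2,3) by (intro pairing_prefix)
    qed
  qed
  then show ?thesis using assms(1) by blast
qed

end

section \<open>Functionals on the principal module are symmetric polynomials\<close>

lemma esub_expand:
  assumes "\<And>n. n < L \<Longrightarrow> esub v f $$ n = 0" shows "f = (\<Sum>n\<in>{L..0}. esub v f $$ n * mX v ^ nat (- n))"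
proof -
  have "esub v (\<Sum>n\<in>{L..0}. esub v f $$ n * mX v ^ nat (- n)) = (\<Sum>n\<in>{L..0}. fls_const (esub v f $$ n) * fls_X_inv ^ nat (- n))"
    unfolding esub_sum using fpin_esub'(2)[of v f]
    by (intro sum.cong refl) (simp add: esub_mult esub_power esub_var esub_free fpin_def)
  also have "\<dots> = esub v f"
  proof (rule fls_eqI)
    fix k
    have "(\<Sum>n\<in>{L..0}. fls_const (esub v f $$ n) * fls_X_inv ^ nat (- n)) $$ k = (\<Sum>n\<in>{L..0}. esub v f $$ n * (if k = n then 1 else 0))"
      by (simp add: fls_nth_sum)
    also have "\<dots> = esub v f $$ k" using assms[of k] by (auto simp: sum.delta' if_distrib[of "(*) _"] cong: if_cong)
    finally show "(\<Sum>n\<in>{L..0}. fls_const (esub v f $$ n) * fls_X_inv ^ nat (- n)) $$ k = esub v f $$ k" .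
  qed
  finally show ?thesis by (simp add: esub_inj)
qed

lemma esub_diff: "esub v (f - g) = esub v f - esub v g"
  using esub_add[of v "f - g" g] by (simp add: algebra_simps)

lemma esub_diff_power: "v \<noteq> w \<Longrightarrow> esub v (f * (mX v - mX w) ^ n) = esub v f * zf (mX w) (int n)"
  by (simp add: esub_mult esub_power esub_diff esub_var esub_free pin_mX zf_nat)

lemma mX_inj: "mX v = mX w \<longleftrightarrow> v = w"
  by (metis esub_free esub_var fls_X_inv_nth fls_const_nth one_neq_zero pin_mX ComplI singletonD zero_neq_neg_one)

text \<open>The series \<open>H\<close> is polynomial in z and antisymmetric under exchange of z and
  \<open>w\<close>, so it vanishes at z = w and is divisible by z - w. For the expansion
  \<open>G\<close> of the quotient at infinity this means that no negative powers of z
  occur.\<close>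

lemma antisymmetric_divisible:
  fixes G :: "'x mp fls" and w :: 'x
  defines "H \<equiv> G * zmx (mX w)"
  assumes anti: "\<And>a b. esub w (H $$ a) $$ b = - esub w (H $$ b) $$ a" and H: "\<And>a. a > 0 \<Longrightarrow> H $$ a = 0"
    and a: "a > 0"
  shows "G $$ a = 0"
proof -
  define L where "L = fls_subdegree H"
  have e: "H $$ p = (\<Sum>q\<in>{L..0}. esub w (H $$ p) $$ q * mX w ^ nat (- q))" for p
  proof (rule esub_expand)
    fix q assume "q < L"
    then have "H $$ q = 0" by (simp add: L_def)
    then show "esub w (H $$ p) $$ q = 0" using anti[of p q] by simp
  qed
  define S where "S = (\<Sum>p\<in>{L..0}. H $$ p * mX w ^ nat (- p))"
  have S: "S = (\<Sum>p\<in>{L..0}. \<Sum>q\<in>{L..0}. esub w (H $$ p) $$ q * mX w ^ nat (- q) * mX w ^ nat (- p))"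
    unfolding S_def sum_distrib_right[symmetric] using e by (intro sum.cong refl) simp
  also have "\<dots> = (\<Sum>q\<in>{L..0}. \<Sum>p\<in>{L..0}. esub w (H $$ p) $$ q * mX w ^ nat (- q) * mX w ^ nat (- p))"
    by (rule sum.swap)
  also have "\<dots> = - (\<Sum>q\<in>{L..0}. \<Sum>p\<in>{L..0}. esub w (H $$ q) $$ p * mX w ^ nat (- p) * mX w ^ nat (- q))"
    unfolding sum_negf[symmetric] by (intro sum.cong refl) (subst anti, simp add: mult_ac)
  also have "\<dots> = - S" by (simp only: S)
  finally have "S = - S" .
  then have "scale 2 S = 0" using pm.scale_left_distrib[of 1 1 S] by (simp add: eq_neg_iff_add_eq_0)
  then have S0: "S = 0" by simp
  \<comment> \<open>Divided by the geometric series, each coefficient of a negative power of z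
    becomes a multiple of \<open>S\<close>.\<close>
  have "G = H * zinv (mX w)" unfolding H_def by (simp add: mult.assoc zmx_zinv)
  then have "G $$ a = (\<Sum>i=L..a-1. H $$ i * zinv (mX w) $$ (a - i))"
    by (simp only:) (rule fls_times_nth_bound, simp_all add: L_def zinv_nth)
  also have "\<dots> = (\<Sum>i=L..0. H $$ i * zinv (mX w) $$ (a - i))"
    using H a by (intro sum.mono_neutral_right) auto
  also have "\<dots> = (\<Sum>i=L..0. mX w ^ nat (a - 1) * (H $$ i * mX w ^ nat (- i)))"
  proof (rule sum.cong[OF refl])
    fix i assume "i \<in> {L..0}"
    then have "nat (a - i - 1) = nat (a - 1) + nat (- i)" "a - i \<ge> 1" using a by auto
    then show "H $$ i * zinv (mX w) $$ (a - i) = mX w ^ nat (a - 1) * (H $$ i * mX w ^ nat (- i))"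
      by (simp add: zinv_nth power_add mult_ac)
  qed
  also have "\<dots> = mX w ^ nat (a - 1) * S" by (simp only: S_def sum_distrib_left)
  finally show ?thesis by (simp add: S0)
qed

context symmetric_quiver
begin

lemma ldeg_nonneg: "lookup (fst (wdeg (FMon u))) k \<ge> 0"
  by (induction u) (auto simp: gdeg_simp lookup_add basis_def lookup_single when_def)

lemma ldeg_pos: "lookup (fst (wdeg (FMon ((i, n) # u)))) i > 0"
  using ldeg_nonneg[of u i] by (simp add: gdeg_simp lookup_add basis_def)

text \<open>The symmetric group on N indices is generated by the stabilizer of N and the
  transposition of N - 1 and N.\<close>

lemma perm_decompose:
  assumes s: "sig d \<sigma>" and n: "lookup d i > 0"
    and f: "\<And>\<tau>. sig (del i d) \<tau> \<Longrightarrow> ren (rv \<tau>) f = f"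
    and sw: "lookup d i \<ge> 2 \<Longrightarrow> ren (tau (Var i (lookup d i)) (Var i (lookup d i - 1))) f = f"
  shows "ren (rv \<sigma>) f = f"
proof -
  define N where "N = lookup d i"
  have si: "\<sigma> i permutes {1..N}" using s by (simp add: sig_def N_def)
  have sub: "sig (del i d) \<tau>" if "sig d \<tau>" "\<tau> i N = N" for \<tau>
    unfolding sig_def
  proof
    fix j
    have p: "\<tau> j permutes {1..lookup d j}" using that by (simp add: sig_def)
    show "\<tau> j permutes {1..lookup (del i d) j}"
    proof (cases "j = i")
      case True
      then have "\<tau> j permutes {1..N}" using p by (simp add: N_def)
      then have "\<tau> j permutes {1..N} - {N}" 
        by (rule permutes_superset) (use that(2) True in auto)
      moreover have "{1..N} - {N} = {1..lookup (del i d) j}" using True by (auto simp: lookup_del N_def)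
      ultimately show ?thesis by simp
    qed (use p in \<open>simp add: lookup_del\<close>)
  qed
  define k where "k = \<sigma> i N"
  show ?thesis
  proof (cases "k = N")
    case True then show ?thesis using f sub s by (simp add: k_def)
  next
    case False
    have k: "k \<in> {1..N}" using permutes_in_image[OF si, of N] n by (simp add: k_def N_def)
    then have N2: "N \<ge> 2" "k \<in> {1..N-1}" using False by auto
    define T where "T a b = (\<lambda>j. if j = i then Transposition.transpose a b else (id :: nat \<Rightarrow> nat))" for a b
    have T: "sig d (T a b)" if "a \<in> {1..N}" "b \<in> {1..N}" for a b
      using that by (auto simp: sig_def T_def N_def permutes_id intro: permutes_swap_id)
    define t where "t = T k (N - 1)"
    define s' where "s' = T (N - 1) N"
    have t: "sig d t" "sig d s'" unfolding t_def s'_def using N2 k by (auto intro!: T)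
    have tf: "ren (rv t) f = f"
    proof (rule f, rule sub[OF t(1)])
      show "t i N = N" using N2 by (auto simp: t_def T_def Transposition.transpose_def)
    qed
    have sf: "ren (rv s') f = f"
    proof -
      have "rv s' = tau (Var i (lookup d i)) (Var i (lookup d i - 1))"
      proof
        fix x show "rv s' x = tau (Var i (lookup d i)) (Var i (lookup d i - 1)) x"
          by (cases x) (auto simp: s'_def T_def tau_def Transposition.transpose_def N_def)
      qed
      then show ?thesis using sw N2 by (simp add: N_def)
    qed
    \<comment> \<open>With k the image of N under \<sigma>, \<open>t\<close> moves k to N - 1
      without touching N, and then \<open>s'\<close> moves N - 1 to N; so the composite fixes
      N.\<close>
    define \<sigma>' where "\<sigma>' = (\<lambda>j. s' j \<circ> (t j \<circ> \<sigma> j))"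
    have "sig d \<sigma>'" using s t by (auto simp: sig_def \<sigma>'_def intro: permutes_compose)
    moreover have "\<sigma>' i N = N" using N2 by (auto simp: \<sigma>'_def k_def[symmetric] t_def s'_def T_def Transposition.transpose_def)
    ultimately have "ren (rv \<sigma>') f = f" using f sub by blast
    moreover have "rv \<sigma>' = rv s' \<circ> (rv t \<circ> rv \<sigma>)"
    proof
      fix x show "rv \<sigma>' x = (rv s' \<circ> (rv t \<circ> rv \<sigma>)) x" by (cases x) (simp add: \<sigma>'_def)
    qed
    ultimately have "ren (rv s') (ren (rv t) (ren (rv \<sigma>) f)) = f"
      using sig_inj[OF t(1)] sig_inj[OF t(2)] sig_inj[OF s] by (simp add: ren_comp inj_compose)
    then have "ren (rv s') (ren (rv t) (ren (rv \<sigma>) f)) = ren (rv s') (ren (rv t) f)" by (simp add: tf sf)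
    then show ?thesis by (simp only: ren_inj[OF sig_inj[OF t(2)]] ren_inj[OF sig_inj[OF t(1)]])
  qed
qed

text \<open>Induction on the size of \<open>d\<close>: after a first letter \<open>i(n)\<close> the
  functional is represented by a polynomial \<open>f i n\<close>, and these are the coefficients of
  a series in z. The bound \<open>M\<close> makes it a Laurent series; every functional that comes
  from a polynomial has such a bound, see \<open>Bf_lower\<close>.\<close>

theorem functional_representation:
  assumes "d \<in> dimvecs" "\<And>j. j \<in> J0 \<Longrightarrow> pairing \<xi> j = 0" "\<And>u. \<xi> u \<noteq> 0 \<Longrightarrow> ldeg u = dim_degree d"
    "\<And>u. \<xi> u \<noteq> 0 \<Longrightarrow> snd (wdeg u) \<ge> M"
  shows "\<exists>f\<in>sym_polys d. \<forall>u. \<xi> u = Bf d (letters u) f"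
  using assms
proof (induction "mdeg d" arbitrary: d \<xi> M)
  case 0
  then have d: "d = 0" by (intro poly_mapping_eqI) (auto simp: mdeg_def in_keys_iff)
  have "\<xi> (FMon u) = Bf d u (single 0 (\<xi> 0))" for u
  proof (cases u)
    case Nil then show ?thesis using d by (simp add: zero_fmon_def)
  next
    case (Cons g u')
    obtain i n where g: "g = (i, n)" by force
    have "\<xi> (FMon u) = 0" using 0(4)[of "FMon u"] ldeg_pos[of i n u'] d Cons g by (metis dim_degree_0 less_irrefl lookup_zero)
    then show ?thesis using d Cons g by simp
  qed
  then have "\<xi> u = Bf d (letters u) (single 0 (\<xi> 0))" for u by (cases u) simp
  moreover have "single 0 (\<xi> 0) \<in> sym_polys d"
  proof -
    have "ren \<rho> (single 0 c) = single 0 c" for \<rho> :: "'v qvar \<Rightarrow> 'v qvar" and c by (simp add: ren_simps) (simp add: push_def)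
    then show ?thesis by (simp add: sym_iff[OF 0(2)] pin_single)
  qed
  ultimately show ?case by blast
next
  case (Suc sz)
  note dv = Suc.prems(1) and kill = Suc.prems(2) and supp = Suc.prems(3) and bnd = Suc.prems(4)
  have dne: "d \<noteq> 0" using Suc(2) by (auto simp: mdeg_def)
  have zero: "\<xi> (FMon ((i, n) # u)) = 0" if "lookup d i = 0" for i n u
    using supp[of "FMon ((i, n) # u)"] ldeg_pos[of i n u] that by (metis less_irrefl lookup_dim_degree of_nat_0)
  have "\<exists>f\<in>sym_polys (del i d). \<forall>u. \<xi> (FMon ((i, n) # u)) = Bf (del i d) u f" if i: "lookup d i > 0" for i n
  proof -
    define \<eta> where "\<eta> u = \<xi> (FMon [(i, n)] + u)" for u
    have "\<exists>f\<in>sym_polys (del i d). \<forall>u. \<eta> u = Bf (del i d) (letters u) f"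
    proof (rule Suc.hyps(1))
      show "sz = mdeg (del i d)" using Suc(2) mdeg_del[OF i] by simp
      show "del i d \<in> dimvecs" using dv by (rule dimvecs_del)
      have "pairing \<eta> p = pairing \<xi> (letter (i, n) * p)" for p
        by (induction p rule: pm_induct) (simp_all add: \<eta>_def letter_def single_mult_single pairing_add pairing_scale distrib_left scale_mult_right)
      then show "pairing \<eta> j = 0" if "j \<in> J0" for j using kill JX_left[OF that] by simp
      show "ldeg u = dim_degree (del i d)" if "\<eta> u \<noteq> 0" for u
        using supp[OF that[unfolded \<eta>_def]] dim_degree_del[OF i] by (simp add: gdeg_simp)
      show "snd (wdeg u) \<ge> M - snd (gdeg (i, n))" if "\<eta> u \<noteq> 0" for u
        using bnd[OF that[unfolded \<eta>_def]] by simp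
    qed
    then show ?thesis unfolding \<eta>_def by (metis fmon_plus append_Cons append_Nil fmon.sel)
  qed
  then have "\<forall>i n. \<exists>f. lookup d i > 0 \<longrightarrow> f \<in> sym_polys (del i d) \<and> (\<forall>u. \<xi> (FMon ((i, n) # u)) = Bf (del i d) u f)" by blast
  then obtain f where f: "\<And>i n. lookup d i > 0 \<Longrightarrow> f i n \<in> sym_polys (del i d)"
    "\<And>i n u. lookup d i > 0 \<Longrightarrow> \<xi> (FMon ((i, n) # u)) = Bf (del i d) u (f i n)" by metis
  \<comment> \<open>Threshold from degrees: with d' = \<open>del i d\<close>, a word that pairs with
    a polynomial of dimension d' has degree at most -\<chi>(d',d'), and together with the letter
    \<open>i(n)\<close> its degree must still reach \<open>M\<close>.\<close>
  define L where "L i = M + euler (dim_degree (del i d)) (dim_degree (del i d)) + chi i i" for i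
  have fz: "f i n = 0" if i: "lookup d i > 0" and n: "2 * (n + 1) < L i" for i n
  proof (rule Bf_nondegenerate[OF dimvecs_del[OF dv, of i] f(1)[OF i]])
    fix u
    show "Bf (del i d) u (f i n) = 0"
    proof (rule ccontr)
      assume ne: "Bf (del i d) u (f i n) \<noteq> 0"
      then have "snd (wdeg (FMon ((i, n) # u))) \<ge> M" using bnd f(2)[OF i] by metis
      moreover obtain m :: "'v qvar \<Rightarrow>\<^sub>0 nat" where "2 * int (mdeg m) + euler (dim_degree (del i d)) (dim_degree (del i d)) + snd (wdeg (FMon u)) = 0"
        using Bf_degree[OF ne] by blast
      ultimately show False using n by (simp add: L_def gdeg_simp chi_def)
    qed
  qed
  \<comment> \<open>The letter \<open>i(n)\<close> stands for z to the power -n-1, which shifts the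
    index by one.\<close>
  define F where "F i = Abs_fls (\<lambda>a. f i (a - 1))" for i
  have Fn: "F i $$ a = f i (a - 1)" if "lookup d i > 0" for i a
    unfolding F_def by (rule nth_Abs_fls_lower_bound[where N="- \<bar>L i\<bar>"]) (use fz[OF that] in auto)
  define G where "G i = F i * PPi i (del i d)" for i
  have FG: "F i = G i * PP i (del i d)" for i
    using PP_PPi[of i "del i d"] by (simp add: G_def mult.assoc mult.commute)
  have pinG: "fpin (vset (del i d)) (G i)" if "lookup d i > 0" for i
    unfolding G_def
  proof (rule fpin_mult[OF _ fpin_PPi])
    show "fpin (vset (del i d)) (F i)" using f(1)[OF that] by (simp add: fpin_def Fn[OF that] sym_iff[OF dimvecs_del[OF dv]])
  qed
  let ?w = "\<lambda>i j. Var j (lookup (del i d) j)"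
  \<comment> \<open>Paired with a word u, the binomial sum of polynomials gives the value of \<xi>
    on a locality relation followed by u, which is zero. Nondegeneracy kills the sum itself, and
    \<open>locality_series\<close> translates the result.\<close>
  have RB: "esub (?w i j) ((G i * zf (mX (?w i j)) (ee i j)) $$ a) $$ b =
      scale (lsign i j) (esub (?w j i) ((G j * zf (mX (?w j i)) (ee i j)) $$ b) $$ a)"
    if ij: "lookup d i > 0" "lookup (del i d) j > 0" for i j a b
  proof -
    have v: "i \<in> verts Q" "j \<in> verts Q" using ij dv dimvecs_pos dimvecs_del by blast+
    have T: "lookup d j > 0" "lookup (del j d) i > 0" using ij by (auto simp: lookup_del split: if_splits)
    have dd: "del i (del j d) = del j (del i d)" by (rule poly_mapping_eqI) (simp add: lookup_del)
    have "(\<Sum>k\<le>N_plus i j. scale ((- 1) ^ k * of_nat (N_plus i j choose k))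
      (aop (del i d) j (n + int k) (F i $$ (m - int k + 1)) -
       scale (sg (basis i) (basis j)) (aop (del j d) i (m - int k) (F j $$ (n + int k + 1))))) = 0" (is "?X = 0") for m n
    proof (rule Bf_nondegenerate)
      show dj: "del j (del i d) \<in> dimvecs" by (intro dimvecs_del dv)
      have "aop (del i d) j k (F i $$ l) \<in> sym_polys (del j (del i d))" for k l
        using v ij f(1) by (intro aop_sym dimvecs_del dv) (simp_all add: Fn)
      moreover have "aop (del j d) i k (F j $$ l) \<in> sym_polys (del j (del i d))" for k l
        unfolding dd[symmetric] using v T f(1) by (intro aop_sym dimvecs_del dv) (simp_all add: Fn)
      ultimately have s: "scale c (aop (del i d) j k (F i $$ l) - scale c' (aop (del j d) i k' (F j $$ l'))) \<in> sym_polys (del j (del i d))" for c k l c' k' l'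
        by (intro sym_add[OF dj])
      have sums: "(\<And>x. x \<in> A \<Longrightarrow> h x \<in> sym_polys (del j (del i d))) \<Longrightarrow> sum h A \<in> sym_polys (del j (del i d))" for h :: "nat \<Rightarrow> _" and A
        by (induction A rule: infinite_finite_induct) (auto intro: sym_add[OF dj])
      show "?X \<in> sym_polys (del j (del i d))" by (intro sums s)
      fix u
      have "Bf (del j (del i d)) u ?X = (\<Sum>k\<le>N_plus i j. (- 1) ^ k * of_nat (N_plus i j choose k) *
         (\<xi> (FMon ((i, m - int k) # (j, n + int k) # u)) - sg (basis i) (basis j) * \<xi> (FMon ((j, n + int k) # (i, m - int k) # u))))"
        using ij T v by (simp add: Bf_sum Bf_add Bf_diff f(2) Fn dd)
      also have "\<dots> = pairing \<xi> (locrel i j m n * single (FMon u) 1)"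
        unfolding locrel_def sum_distrib_right pairing_sum
        by (intro sum.cong refl) (simp add: scale_mult_left pairing_scale pairing_diff left_diff_distrib mult.assoc letter_def single_mult_single)
      also have "\<dots> = 0"
      proof (rule kill, rule subsetD[OF II_JX], rule II_ideal(2), rule rels_II)
        show "locrel i j m n \<in> rels" using v by (auto simp: rels_def)
      qed
      finally show "Bf (del j (del i d)) u ?X = 0" .
    qed
    then show ?thesis using locality_series[OF v ij FG FG] by blast
  qed
  \<comment> \<open>With a single variable this is the relation i(n) = 0 for n >= 0. With more
    variables it follows from locality: the right side of \<open>RB\<close> is the coefficient with
    index \<open>a\<close> of an expanded polynomial, which is zero for a > 0. A remaining factor z
    - x is removed by \<open>antisymmetric_divisible\<close>.\<close>
  have Gpoly: "G i $$ a = 0" if i: "lookup d i > 0" and a: "a > 0" for i a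
  proof (cases "\<exists>j. lookup (del i d) j > 0")
    case False
    then have d0: "del i d = 0" by (intro poly_mapping_eqI) simp
    have "f i n = 0" if n: "n \<ge> 0" for n
    proof (rule Bf_nondegenerate[OF dimvecs_del[OF dv, of i] f(1)[OF i]])
      fix u
      show "Bf (del i d) u (f i n) = 0"
      proof (cases u)
        case Nil
        have "letter (i, n) \<in> J0" using JX_gen[of "(i, n)" X0 1] n dimvecs_pos[OF dv i] by (simp add: X0_def)
        from kill[OF this] show ?thesis using f(2)[OF i, of n "[]"] Nil by (simp add: letter_def)
      next
        case (Cons g u') then show ?thesis by (cases g) (simp add: d0)
      qed
    qed
    then have "f i (a - 1) = 0" using a by simp
    then show ?thesis by (simp add: G_def d0 PPi_def vset_def Fn[OF i])
  next
    case True
    then obtain j where j: "lookup (del i d) j > 0" by blast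
    define H where "H = G i * zf (mX (?w i j)) (ee i j)"
    have H: "H $$ b = 0" if "b > 0" for b
    proof -
      have "esub (?w i j) (H $$ b) = 0" unfolding H_def by (rule fls_eqI) (simp add: RB[OF i j] that)
      then show ?thesis by (simp add: esub_eq_0_iff)
    qed
    consider "ee i j = 0" | "i = j" "ee i j = 1" using ee[of i j] chi_le(1)[of i j] chi_le(2)[of i] by (cases "i = j") (auto simp: max_def split: if_splits)
    then show ?thesis
    proof cases
      case 1 then show ?thesis using H[OF a] by (simp add: H_def)
    next
      case 2
      have He: "H = G i * zmx (mX (?w i i))" using zf_nat[of "mX (?w i i)" 1] 2 by (simp add: H_def)
      show ?thesis
      proof (rule antisymmetric_divisible[OF _ _ a])
        show "esub (?w i i) ((G i * zmx (mX (?w i i))) $$ a) $$ b = - esub (?w i i) ((G i * zmx (mX (?w i i))) $$ b) $$ a" for a b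
          using RB[OF i, of i a b] j 2(2) zf_nat[of "mX (?w i i)" 1] unfolding 2(1)[symmetric] by (simp add: lsign pm.scale_minus_left)
        show "(G i * zmx (mX (?w i i))) $$ a = 0" if "a > 0" for a using H[OF that] He by simp
      qed
    qed
  qed
  let ?T = "\<lambda>i. Var i (lookup d i)"
  define h where "h i = unsub (?T i) (G i)" for i
  have Eh: "esub (?T i) (h i) = G i" if i: "lookup d i > 0" for i
    unfolding h_def
  proof (rule esub_unsub)
    show "fpin (- {?T i}) (G i)" by (rule fpin_mono[OF pinG[OF i]]) (use i in \<open>auto simp: lookup_del\<close>)
  qed (rule Gpoly[OF i])
  \<comment> \<open>For distinct colours \<open>RB\<close> has exponent 0 and sign 1, so it equates
    the double expansions of \<open>h i\<close> and \<open>h j\<close>, and expansions are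
    injective.\<close>
  have cons: "h i = h j" if ij: "lookup d i > 0" "lookup d j > 0" for i j
  proof (cases "i = j")
    case False
    have j: "lookup (del i d) j > 0" using ij False by (simp add: lookup_del)
    have "esub (?T j) (esub (?T i) (h i) $$ a) = esub (?T j) (esub (?T i) (h j) $$ a)" for a
    proof (rule fls_eqI)
      fix b
      have "esub (?T j) (esub (?T i) (h i) $$ a) $$ b = esub (?T i) (esub (?T j) (h j) $$ b) $$ a"
        using RB[OF ij(1) j, of a b] lsign_neq[OF False] False by (simp add: Eh ij lookup_del)
      then show "esub (?T j) (esub (?T i) (h i) $$ a) $$ b = esub (?T j) (esub (?T i) (h j) $$ a) $$ b"
        using esub_commute[of "?T i" "?T j" "h j" a b] False by simp
    qed
    then have "esub (?T i) (h i) = esub (?T i) (h j)" by (intro fls_eqI) (simp only: esub_inj)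
    then show ?thesis by (simp only: esub_inj)
  qed simp
  have "\<exists>i. lookup d i > 0" using dne by (metis gr0I lookup_zero poly_mapping_eqI)
  then obtain i where i: "lookup d i > 0" ..
  have iv: "i \<in> verts Q" using dv i by (rule dimvecs_pos)
  have "h i \<in> sym_polys d"
    unfolding sym_iff[OF dv]
  proof (intro conjI allI impI)
    show "pin (vset d) (h i)"
      unfolding h_def unsub_def using pinG[OF i] vset_del(1)[OF iv i]
      by (intro pin_sum pin_mult pin_power pin_mX) (auto simp: fpin_def intro: pin_mono)
    fix \<sigma> assume s: "sig d \<sigma>"
    show "ren (rv \<sigma>) (h i) = h i"
    proof (rule perm_decompose[OF s i])
      fix \<tau> assume t: "sig (del i d) \<tau>"
      have "fls_lift (ren (rv \<tau>)) (F i) = F i"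
        using f(1)[OF i] t by (intro fls_eqI) (simp add: fls_lift_nth ren_simps Fn[OF i] sym_iff[OF dimvecs_del[OF dv]])
      then have "fls_lift (ren (rv \<tau>)) (G i) = G i" unfolding G_def by (simp add: fls_lift_ren[OF sig_inj[OF t]] PP_sig[OF t])
      then have "esub (?T i) (ren (rv \<tau>) (h i)) = esub (?T i) (h i)"
        using esub_ren[OF sig_inj[OF t], of "?T i" "h i"] sig_del(2)[OF t i] by (simp add: Eh[OF i])
      then show "ren (rv \<tau>) (h i) = h i" by (simp add: esub_inj)
    next
      assume d2: "lookup d i \<ge> 2"
      let ?T2 = "Var i (lookup d i - 1)"
      have ne: "?T i \<noteq> ?T2" using d2 by simp
      have tt: "tau (?T i) ?T2 (?T i) = ?T2" "tau (?T i) ?T2 ?T2 = ?T i" using ne by (auto simp: tau_def)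
      define n where "n = nat (ee i i)"
      \<comment> \<open>Multiplication by this power turns \<open>RB\<close> into a statement on the
        swap of the last two variables. The power is cancelled at the end, polynomials forming a
        domain.\<close>
      define g where "g = h i * (mX (?T i) - mX ?T2) ^ n"
      have Eg: "esub (?T i) g = G i * zf (mX ?T2) (ee i i)"
        unfolding g_def esub_diff_power[OF ne] Eh[OF i] by (simp add: n_def ee)
      have "lookup (del i d) i > 0" using d2 by (simp add: lookup_del)
      note R = RB[OF i this]
      have "esub ?T2 (esub (?T i) (ren (tau (?T i) ?T2) g) $$ b) = esub ?T2 (esub (?T i) (scale (lsign i i) g) $$ b)" for b
      proof (rule fls_eqI)
        fix a
        have "esub ?T2 (esub (?T i) (ren (tau (?T i) ?T2) g) $$ b) $$ a = esub ?T2 (esub (?T i) g $$ a) $$ b"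
          by (rule esub_esub_tau[OF ne])
        also have "\<dots> = scale (lsign i i) (esub ?T2 (esub (?T i) g $$ b) $$ a)"
          using R[of a b] by (simp add: Eg lookup_del)
        finally show "esub ?T2 (esub (?T i) (ren (tau (?T i) ?T2) g) $$ b) $$ a = esub ?T2 (esub (?T i) (scale (lsign i i) g) $$ b) $$ a"
          by (simp add: esub_scale_nth)
      qed
      then have "esub (?T i) (ren (tau (?T i) ?T2) g) = esub (?T i) (scale (lsign i i) g)" by (intro fls_eqI) (simp only: esub_inj)
      then have tg: "ren (tau (?T i) ?T2) g = scale (lsign i i) g" by (simp only: esub_inj)
      have "ren (tau (?T i) ?T2) ((mX (?T i) - mX ?T2) ^ k) = (mX ?T2 - mX (?T i)) ^ k" for k
        by (induction k) (simp_all only: power_0 ren_1 power_Suc ren_mult[OF inj_tau] ren_simps ren_mX tt)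
      then have "ren (tau (?T i) ?T2) (h i) * (mX ?T2 - mX (?T i)) ^ n = scale (lsign i i) g"
        using tg by (simp add: g_def ren_mult[OF inj_tau])
      also have "scale (lsign i i) g = h i * (mX ?T2 - mX (?T i)) ^ n"
        using scale_sign[of n 1 g] power_minus[of "mX (?T i) - mX ?T2" n] by (simp add: g_def lsign n_def mult_ac)
      finally have "(ren (tau (?T i) ?T2) (h i) - h i) * (mX ?T2 - mX (?T i)) ^ n = 0" by (simp add: algebra_simps)
      moreover have "mX ?T2 - mX (?T i) \<noteq> 0" using ne by (metis mX_inj right_minus_eq)
      ultimately show "ren (tau (?T i) ?T2) (h i) = h i" by simp
    qed
  qed
  moreover have "\<xi> u = Bf d (letters u) (h i)" for u
  proof -
    have "\<xi> (FMon u) = Bf d u (h i)" for u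
    proof (cases u)
      case Nil
      have "\<xi> (FMon []) = 0" using supp[of "FMon []"] dne dim_degree_inj[of d 0] by auto
      then show ?thesis using Nil dne by simp
    next
      case (Cons g u')
      obtain j n where g: "g = (j, n)" by force
      show ?thesis
      proof (cases "lookup d j > 0")
        case False then show ?thesis using zero Cons g by simp
      next
        case True
        have "aop d j n (h i) = f j n"
          unfolding aop_def opc_def cons[OF i True] Eh[OF True] FG[symmetric] by (simp add: Fn[OF True])
        then show ?thesis using True Cons g dimvecs_pos[OF dv True] by (simp add: f(2))
      qed
    qed
    from this[of "letters u"] show ?thesis by simp
  qed
  ultimately show ?case by blast
qed

end

section \<open>The shuffle product\<close>

lemma to_frac_simps:
  "to_frac (f + g) = to_frac f + to_frac g" "to_frac (f - g) = to_frac f - to_frac g"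
  "to_frac (f * g) = to_frac f * to_frac g" "to_frac 0 = 0" "to_frac 1 = 1"
  by (simp_all add: fract_collapse)

lemma to_frac_inj: "to_frac f = to_frac g \<longleftrightarrow> f = g"
  by (simp add: eq_fract)

definition Lf :: "'v qpoly fls \<Rightarrow> 'v qpoly fract fls" where "Lf = fls_lift (\<lambda>f. to_frac f)"

lemma Lf_hom: "Lf (G * H) = Lf G * Lf H" "Lf 1 = 1" "Lf (zf x c) = zf (to_frac x) c"
  "Lf (prod h A) = (\<Prod>x\<in>A. Lf (h x))" "Lf G $$ n = to_frac (G $$ n)"
  unfolding Lf_def by (rule fls_lift_hom; simp add: to_frac_simps del: add_fract mult_fract)+
    (rule fls_lift_nth, simp add: fract_collapse)

lemma Lf_add: "Lf (G + H) = Lf G + Lf H" "Lf G = 0 \<longleftrightarrow> G = 0"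
proof -
  show "Lf (G + H) = Lf G + Lf H" by (rule fls_eqI) (simp only: Lf_hom fls_plus_nth to_frac_simps)
  show "Lf G = 0 \<longleftrightarrow> G = 0" unfolding fls_eq_iff Lf_hom by (simp add: to_frac_inj flip: to_frac_simps(4))
qed

text \<open>The extension of \<open>esub\<close> to rational functions, again expanded at infinity.\<close>

definition EE :: "'v qvar \<Rightarrow> 'v qpoly fract \<Rightarrow> 'v qpoly fract fls" where
  "EE v x = (let p = (SOME p. snd p \<noteq> 0 \<and> x = Fraction_Field.Fract (fst p) (snd p)) in Lf (esub v (fst p)) / Lf (esub v (snd p)))"

lemma Lf_esub_0: "Lf (esub v f) = 0 \<longleftrightarrow> f = 0" by (simp add: Lf_add esub_eq_0_iff)

text \<open>Independence of the chosen fraction: \<open>esub\<close> is multiplicative and thus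
  preserves cross multiplication, and it is injective, so denominators stay nonzero in the field of
  Laurent series over the fraction field.\<close>

lemma EE_Fract: assumes "b \<noteq> 0" shows "EE v (Fraction_Field.Fract a b) = Lf (esub v a) / Lf (esub v b)"
proof -
  define p where "p = (SOME p. snd p \<noteq> 0 \<and> Fraction_Field.Fract a b = Fraction_Field.Fract (fst p) (snd p))"
  have "snd p \<noteq> 0 \<and> Fraction_Field.Fract a b = Fraction_Field.Fract (fst p) (snd p)"
    unfolding p_def by (rule someI[of _ "(a, b)"]) (use assms in simp)
  then have p: "snd p \<noteq> 0" "a * snd p = fst p * b" using assms by (auto simp: eq_fract)
  have "Lf (esub v a) * Lf (esub v (snd p)) = Lf (esub v (fst p)) * Lf (esub v b)"
    unfolding Lf_hom(1)[symmetric] esub_mult[symmetric] p(2) ..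
  then show ?thesis using p(1) assms unfolding EE_def Let_def p_def[symmetric]
    by (simp add: frac_eq_eq Lf_esub_0)
qed

lemma EE_to_frac: "EE v (to_frac f) = Lf (esub v f)"
  by (simp add: EE_Fract Lf_hom)

lemma EE_add: "EE v (x + y) = EE v x + EE v y"
proof -
  obtain a b where x: "x = Fraction_Field.Fract a b" "b \<noteq> 0" by (cases x) auto
  obtain c d where y: "y = Fraction_Field.Fract c d" "d \<noteq> 0" by (cases y) auto
  have nz: "Lf (esub v b) \<noteq> 0" "Lf (esub v d) \<noteq> 0" using x(2) y(2) by (simp_all add: Lf_esub_0)
  show ?thesis unfolding x y add_frac_eq[OF nz, symmetric] EE_Fract[OF x(2)] EE_Fract[OF y(2)] add_fract[OF x(2) y(2)]
    using EE_Fract[of "b * d" v "a * d + c * b"] x(2) y(2) by (simp only: esub_add esub_mult Lf_add Lf_hom mult_eq_0_iff add_frac_eq[OF nz]) simp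
qed

lemma EE_mult: "EE v (x * y) = EE v x * EE v y"
proof -
  obtain a b where x: "x = Fraction_Field.Fract a b" "b \<noteq> 0" by (cases x) auto
  obtain c d where y: "y = Fraction_Field.Fract c d" "d \<noteq> 0" by (cases y) auto
  show ?thesis unfolding x y using x(2) y(2)
    by (simp add: EE_Fract esub_mult Lf_hom)
qed

lemma EE_0: "EE v 0 = 0" and EE_1: "EE v 1 = 1"
  using EE_to_frac[of v 0] EE_to_frac[of v 1] by (simp_all add: to_frac_simps Lf_hom Lf_add)

lemma EE_sum: "EE v (sum h A) = (\<Sum>x\<in>A. EE v (h x))"
  by (induction A rule: infinite_finite_induct) (simp_all add: EE_0 EE_add)

lemma EE_prod: "EE v (prod h A) = (\<Prod>x\<in>A. EE v (h x))"
  by (induction A rule: infinite_finite_induct) (simp_all add: EE_1 EE_mult)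

lemma EE_power: "EE v (x ^ n) = EE v x ^ n"
  by (induction n) (simp_all add: EE_1 EE_mult)

lemma EE_inverse: "EE v (inverse x) = inverse (EE v x)"
proof (cases "x = 0")
  case False
  then have "EE v x * EE v (inverse x) = 1" by (simp flip: EE_mult add: EE_1)
  then show ?thesis by (metis inverse_unique)
qed (simp add: EE_0)

lemma EE_powi: "EE v (x powi n) = EE v x powi n"
  by (simp add: power_int_def EE_power EE_inverse)

lemma EE_eq_0: "EE v x = 0 \<longleftrightarrow> x = 0"
proof -
  obtain a b where x: "x = Fraction_Field.Fract a b" "b \<noteq> 0" by (cases x) auto
  show ?thesis unfolding x using x(2) by (simp add: EE_Fract Lf_esub_0 eq_fract Zero_fract_def)
qed

lemma EE_diff: "EE v (x - y) = EE v x - EE v y"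
  using EE_add[of v "x - y" y] by (simp add: algebra_simps)

lemma EE_inj: "EE v x = EE v y \<longleftrightarrow> x = y"
  using EE_eq_0[of v "x - y"] by (simp add: EE_diff)

abbreviation XX :: "'v qvar \<Rightarrow> 'v qpoly fract" where "XX v \<equiv> to_frac (mX v)"

lemma EE_free: "pin (- {v}) f \<Longrightarrow> EE v (to_frac f) = fls_const (to_frac f)"
  by (rule fls_eqI) (auto simp: EE_to_frac esub_free Lf_hom fract_collapse)

lemma EE_XX: "EE v (XX v) = fls_X_inv" "w \<noteq> v \<Longrightarrow> EE v (XX w) = fls_const (XX w)"
proof -
  show "EE v (XX v) = fls_X_inv"
    by (rule fls_eqI) (auto simp: EE_to_frac esub_var Lf_hom fract_collapse)
qed (simp add: EE_free pin_mX)

lemma fls_const_inverse': "inverse (fls_const x) = fls_const (inverse x)" for x :: "'a::field"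
proof (cases "x = 0")
  case False
  then have "fls_const x * fls_const (inverse x) = 1" by simp
  then show ?thesis by (metis inverse_unique)
qed simp

lemma fls_const_powi: "fls_const (x powi n) = fls_const x powi n" for x :: "'a::field"
  by (simp add: power_int_def fls_const_power fls_const_inverse')

lemma fls_const_prod: "fls_const (prod h A) = (\<Prod>x\<in>A. fls_const (h x))" for h :: "_ \<Rightarrow> 'a::comm_ring_1"
  by (induction A rule: infinite_finite_induct) (simp_all flip: fls_const_mult_const)

lemma zf_powi: "zf x c = zmx x powi c" for x :: "'a::field"
proof -
  have "zinv x = inverse (zmx x)" using zmx_zinv[of x] by (metis inverse_unique)
  then show ?thesis by (simp add: zf_def power_int_def)
qed

context symmetric_quiver
begin

text \<open>The place of the variables of the second factor, whose indices are first moved behind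
  the block of \<open>d\<close>.\<close>

abbreviation "gm d \<sigma> \<equiv> rv (\<lambda>j l. \<sigma> j (lookup d j + l))"

definition shuffle_kernel :: "'v dimvec \<Rightarrow> 'v dimvec \<Rightarrow> ('v \<Rightarrow> nat \<Rightarrow> nat) \<Rightarrow> 'v qpoly fract" where
  "shuffle_kernel d e \<sigma> = (\<Prod>p\<in>vset d. \<Prod>q\<in>vset e. (XX (gm d \<sigma> q) - XX (rv \<sigma> p)) powi (- chi (col p) (col q)))"

definition shuffle_term :: "'v dimvec \<Rightarrow> 'v dimvec \<Rightarrow> ('v \<Rightarrow> nat \<Rightarrow> nat) \<Rightarrow> 'v qpoly \<Rightarrow> 'v qpoly \<Rightarrow> 'v qpoly fract" where
  "shuffle_term d e \<sigma> f g = to_frac (ren (rv \<sigma>) f) * to_frac (ren (gm d \<sigma>) g) * shuffle_kernel d e \<sigma>"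

lemma shuffle_sum_shuffle_term: "shuffle_sum d e f g = (\<Sum>\<sigma>\<in>shuffle_perms d e. shuffle_term d e \<sigma> f g)"
  unfolding shuffle_sum_def shuffle_term_def reindex_ren
proof (rule sum.cong[OF refl])
  fix \<sigma>
  have q: "qX i k = mX (Var i k)" for i k by (simp add: qX_def mX_def)
  have "shuffle_kernel d e \<sigma> = (\<Prod>i\<in>verts Q. \<Prod>k\<in>{1..lookup d i}. \<Prod>j\<in>verts Q. \<Prod>l\<in>{1..lookup e j}.
         (XX (Var j (\<sigma> j (lookup d j + l))) - XX (Var i (\<sigma> i k))) powi (- chi i j))"
    by (simp add: shuffle_kernel_def prod_vset)
  also have "\<dots> = (\<Prod>i\<in>verts Q. \<Prod>j\<in>verts Q. \<Prod>k\<in>{1..lookup d i}. \<Prod>l\<in>{1..lookup e j}.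
         (XX (Var j (\<sigma> j (lookup d j + l))) - XX (Var i (\<sigma> i k))) powi (- chi i j))"
    by (intro prod.cong refl prod.swap)
  finally show "to_frac (ren (rv \<sigma>) f) * to_frac (ren (rv (\<lambda>i l. \<sigma> i (lookup d i + l))) g) *
     (\<Prod>i\<in>verts Q. \<Prod>j\<in>verts Q. \<Prod>k\<in>{1..lookup d i}. \<Prod>l\<in>{1..lookup e j}.
       (to_frac (qX j (\<sigma> j (lookup d j + l))) - to_frac (qX i (\<sigma> i k))) powi - euler (basis i) (basis j)) =
     to_frac (ren (rv \<sigma>) f) * to_frac (ren (gm d \<sigma>) g) * shuffle_kernel d e \<sigma>"
    by (simp only: q chi_def)
qed

lemma shuffle_sig: "\<sigma> \<in> shuffle_perms d e \<Longrightarrow> sig (d + e) \<sigma>"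
  by (simp add: shuffle_perms_def sig_def lookup_add)

lemma inj_gm: "sig D \<sigma> \<Longrightarrow> inj (gm d \<sigma>)"
  by (rule inj_rv) (auto simp: inj_def sig_def dest!: permutes_inj spec)

lemma prod_shuffle:
  fixes H :: "'v qvar \<Rightarrow> 'c::comm_monoid_mult"
  assumes "\<sigma> \<in> shuffle_perms d e"
  shows "(\<Prod>q\<in>vset (d + e). H q) = (\<Prod>p\<in>vset d. H (rv \<sigma> p)) * (\<Prod>q\<in>vset e. H (gm d \<sigma> q))"
proof -
  have "(\<Prod>q\<in>vset (d + e). H q) = (\<Prod>q\<in>vset (d + e). H (rv \<sigma> q))"
    by (rule prod.reindex_bij_betw[OF sig_vset[OF shuffle_sig[OF assms]], symmetric])
  also have "\<dots> = (\<Prod>j\<in>verts Q. (\<Prod>k\<in>{1..lookup d j}. H (Var j (\<sigma> j k))) * (\<Prod>l\<in>{1..lookup e j}. H (Var j (\<sigma> j (lookup d j + l)))))"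
    unfolding prod_vset
  proof (rule prod.cong[OF refl])
    fix j
    have a: "{1..lookup (d + e) j} = {1..lookup d j} \<union> (\<lambda>l. lookup d j + l) ` {1..lookup e j}"
      by (auto simp: lookup_add image_iff)
    have b: "{1..lookup d j} \<inter> (\<lambda>l. lookup d j + l) ` {1..lookup e j} = {}" by auto
    have c: "(\<Prod>k\<in>(\<lambda>l. lookup d j + l) ` {1..lookup e j}. h k) = (\<Prod>l\<in>{1..lookup e j}. h (lookup d j + l))" for h :: "nat \<Rightarrow> 'c"
      by (rule prod.reindex[unfolded comp_def]) (auto simp: inj_on_def)
    show "(\<Prod>k\<in>{1..lookup (d + e) j}. H (rv \<sigma> (Var j k))) =
       (\<Prod>k\<in>{1..lookup d j}. H (Var j (\<sigma> j k))) * (\<Prod>l\<in>{1..lookup e j}. H (Var j (\<sigma> j (lookup d j + l))))"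
      unfolding a rv_Var by (simp only: prod.union_disjoint[OF finite_atLeastAtMost finite_imageI[OF finite_atLeastAtMost] b] c)
  qed
  also have "\<dots> = (\<Prod>p\<in>vset d. H (rv \<sigma> p)) * (\<Prod>q\<in>vset e. H (gm d \<sigma> q))"
    by (simp add: prod.distrib prod_vset)
  finally show ?thesis .
qed

lemma rv_shuffle: assumes "\<sigma> \<in> shuffle_perms d e"
  shows "p \<in> vset d \<Longrightarrow> rv \<sigma> p \<in> vset (d + e)" "q \<in> vset e \<Longrightarrow> gm d \<sigma> q \<in> vset (d + e)"
proof -
  have s: "\<sigma> j k \<in> {1..lookup (d + e) j}" if "k \<in> {1..lookup (d + e) j}" for j k
    using permutes_in_image[of "\<sigma> j" "{1..lookup (d + e) j}" k] shuffle_sig[OF assms] that by (simp add: sig_def)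
  show "p \<in> vset d \<Longrightarrow> rv \<sigma> p \<in> vset (d + e)" using s by (cases p) (simp add: lookup_add)
  show "q \<in> vset e \<Longrightarrow> gm d \<sigma> q \<in> vset (d + e)" using s by (cases q) (simp add: lookup_add)
qed

lemma EE_shuffle_kernel: assumes s: "\<sigma> \<in> shuffle_perms d e" and T: "T \<notin> vset (d + e)"
  shows "EE T (shuffle_kernel d e \<sigma>) = fls_const (shuffle_kernel d e \<sigma>)"
proof -
  have "EE T (XX (gm d \<sigma> q) - XX (rv \<sigma> p)) = fls_const (XX (gm d \<sigma> q) - XX (rv \<sigma> p))" if "p \<in> vset d" "q \<in> vset e" for p q
  proof -
    have ne: "gm d \<sigma> q \<noteq> T" "rv \<sigma> p \<noteq> T" using rv_shuffle[OF s] that T by metis+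
    show ?thesis unfolding EE_diff EE_XX(2)[OF ne(1)] EE_XX(2)[OF ne(2)] by (rule fls_minus_const)
  qed
  then show ?thesis unfolding shuffle_kernel_def EE_prod EE_powi fls_const_prod fls_const_powi
    by (intro prod.cong refl) (simp only:)
qed

lemma EE_ren_const:
  assumes "\<And>p. p \<in> S \<Longrightarrow> \<rho> p \<noteq> T" "pin S f" shows "EE T (to_frac (ren \<rho> f)) = fls_const (to_frac (ren \<rho> f))"
proof (rule EE_free)
  show "pin (- {T}) (ren \<rho> f)" by (rule pin_mono[OF pin_ren[OF assms(2)]]) (use assms(1) in auto)
qed

lemma Lf_ren_PP:
  assumes "\<And>q. col (\<rho> q) = col q" "inj \<rho>"
  shows "Lf (fls_lift (ren \<rho>) (PP i d)) = (\<Prod>q\<in>vset d. zf (XX (\<rho> q)) (chi i (col q)))"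
  unfolding PP_def fls_lift_ren[OF assms(2)] Lf_hom by simp

lemma col_rv [simp]: "col (rv \<sigma> q) = col q" by (cases q) simp

lemma chi_commute: "chi i j = chi j i" unfolding chi_def by (rule euler_commute)

section \<open>Shuffles sorted by the factor that supplies the last variable of colour i\<close>

definition blk :: "nat \<Rightarrow> nat \<Rightarrow> (nat \<Rightarrow> nat) \<Rightarrow> bool" where
  "blk a b \<tau> \<longleftrightarrow> \<tau> permutes {1..a + b} \<and> strict_mono_on {1..a} \<tau> \<and> strict_mono_on {a + 1..a + b} \<tau>"

lemma shuffle_mem: "\<sigma> \<in> shuffle_perms d e \<longleftrightarrow> (\<forall>j. blk (lookup d j) (lookup e j) (\<sigma> j))"
  by (simp add: shuffle_perms_def blk_def)

lemma shuffle_upd: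
  assumes "\<sigma> \<in> shuffle_perms d e" "\<And>j. j \<noteq> i \<Longrightarrow> lookup d' j = lookup d j" "blk (lookup d' i) (lookup e i) \<tau>"
  shows "\<sigma>(i := \<tau>) \<in> shuffle_perms d' e"
  using assms unfolding shuffle_mem by auto

text \<open>When the top index is fixed, all other values are smaller, so adding it to the second
  block imposes no further monotonicity condition.\<close>

lemma shuffle_second:
  assumes "lookup e i > 0"
  shows "shuffle_perms d (del i e) = {\<sigma> \<in> shuffle_perms d e. \<sigma> i (lookup (d + e) i) = lookup (d + e) i}"
proof -
  define D where "D = lookup d i + lookup e i"
  have D: "lookup d i + lookup (del i e) i = D - 1" "D > 0" "lookup d i + 1 \<le> D" using assms by (auto simp: lookup_del D_def)
  have set: "{1..D} - {D} = {1..D-1}" using D by auto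
  have i: "\<tau> permutes {1..D-1} \<and> strict_mono_on {lookup d i + 1..D-1} \<tau> \<longleftrightarrow>
    \<tau> permutes {1..D} \<and> strict_mono_on {lookup d i + 1..D} \<tau> \<and> \<tau> D = D" for \<tau> :: "nat \<Rightarrow> nat"
  proof
    assume *: "\<tau> permutes {1..D-1} \<and> strict_mono_on {lookup d i + 1..D-1} \<tau>"
    then have fx: "\<tau> D = D" using D by (auto intro: permutes_not_in)
    have le: "\<tau> k \<le> D - 1" if "k \<in> {1..D-1}" for k using * permutes_in_image[of \<tau> "{1..D-1}" k] that by auto
    have "strict_mono_on {lookup d i + 1..D} \<tau>"
    proof (rule strict_mono_onI)
      fix r s assume rs: "r \<in> {lookup d i + 1..D}" "s \<in> {lookup d i + 1..D}" "r < s"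
      show "\<tau> r < \<tau> s"
      proof (cases "s = D")
        case True then show ?thesis using le[of r] rs fx D(2) by simp linarith
      next
        case False
        then show ?thesis using * rs by (intro strict_mono_onD[of "{lookup d i + 1..D-1}" \<tau>]) auto
      qed
    qed
    moreover have "\<tau> permutes {1..D}" by (rule permutes_subset[OF conjunct1[OF *]]) auto
    ultimately show "\<tau> permutes {1..D} \<and> strict_mono_on {lookup d i + 1..D} \<tau> \<and> \<tau> D = D"
      using fx by blast
  next
    assume *: "\<tau> permutes {1..D} \<and> strict_mono_on {lookup d i + 1..D} \<tau> \<and> \<tau> D = D"
    have "\<tau> permutes {1..D-1}"
    proof (rule permutes_superset[OF conjunct1[OF *]])
      fix x assume "x \<in> {1..D} - {1..D-1}"
      then have "x = D" by auto
      then show "\<tau> x = x" using * by simp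
    qed
    then show "\<tau> permutes {1..D-1} \<and> strict_mono_on {lookup d i + 1..D-1} \<tau>"
      using * monotone_on_subset[of "{lookup d i + 1..D}" "(<)" "(<)" \<tau> "{lookup d i + 1..D-1}"] by auto
  qed
  have bi: "blk (lookup d i) (lookup (del i e) i) \<tau> \<longleftrightarrow> blk (lookup d i) (lookup e i) \<tau> \<and> \<tau> D = D" for \<tau>
    
  proof -
    have "\<tau> permutes {1..D-1} \<and> strict_mono_on {1..lookup d i} \<tau> \<and> strict_mono_on {lookup d i + 1..D-1} \<tau> \<longleftrightarrow>
      (\<tau> permutes {1..D} \<and> strict_mono_on {1..lookup d i} \<tau> \<and> strict_mono_on {lookup d i + 1..D} \<tau>) \<and> \<tau> D = D"
      using i[of \<tau>] by argo
    then show ?thesis unfolding blk_def D(1) unfolding D_def[symmetric] .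
  qed
  have bj: "lookup (del i e) j = lookup e j" if "j \<noteq> i" for j using that by (simp add: lookup_del)
  have sp: "(\<forall>j. P j) \<longleftrightarrow> (\<forall>j. j \<noteq> i \<longrightarrow> P j) \<and> P i" for P :: "'v \<Rightarrow> bool" by (rule iffI, simp, rule allI, case_tac "j = i", simp_all)
  have "(\<forall>j. blk (lookup d j) (lookup (del i e) j) (\<sigma> j)) \<longleftrightarrow> (\<forall>j. blk (lookup d j) (lookup e j) (\<sigma> j)) \<and> \<sigma> i D = D" for \<sigma>
    unfolding sp[of "\<lambda>j. blk (lookup d j) (lookup (del i e) j) (\<sigma> j)"] sp[of "\<lambda>j. blk (lookup d j) (lookup e j) (\<sigma> j)"] bi
    by (simp add: bj cong: imp_cong)
  then have "\<sigma> \<in> shuffle_perms d (del i e) \<longleftrightarrow> \<sigma> \<in> shuffle_perms d e \<and> \<sigma> i D = D" for \<sigma>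
    unfolding shuffle_mem by simp
  then show ?thesis unfolding lookup_add D_def[symmetric] by (intro Set.set_eqI) simp
qed

text \<open>\<open>rot a D\<close> moves \<open>a\<close>, the last element of the first block, to the end \<open>D\<close> of the second
  block; composition with it adds to a shuffle a largest index coming from the first block.\<close>

definition rot :: "nat \<Rightarrow> nat \<Rightarrow> nat \<Rightarrow> nat" where
  "rot a D k = (if k = a then D else if a < k \<and> k \<le> D then k - 1 else k)"

definition rot_inv :: "nat \<Rightarrow> nat \<Rightarrow> nat \<Rightarrow> nat" where
  "rot_inv a D m = (if m = D then a else if a \<le> m \<and> m < D then m + 1 else m)"

lemma rot_inverse: "a \<le> D \<Longrightarrow> rot a D (rot_inv a D m) = m" "a \<le> D \<Longrightarrow> rot_inv a D (rot a D m) = m"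
  by (auto simp: rot_def rot_inv_def)

lemma rot_permutes: "1 \<le> a \<Longrightarrow> a \<le> D \<Longrightarrow> rot a D permutes {1..D}" "1 \<le> a \<Longrightarrow> a \<le> D \<Longrightarrow> rot_inv a D permutes {1..D}"
proof -
  assume a: "1 \<le> a" "a \<le> D"
  show "rot a D permutes {1..D}"
  proof (rule bij_imp_permutes)
    show "bij_betw (rot a D) {1..D} {1..D}"
      by (rule bij_betw_byWitness[where f'="rot_inv a D"]) (use a in \<open>auto simp: rot_inverse\<close>, use a in \<open>auto simp: rot_def rot_inv_def\<close>)
  qed (use a in \<open>auto simp: rot_def\<close>)
  show "rot_inv a D permutes {1..D}"
  proof (rule bij_imp_permutes)
    show "bij_betw (rot_inv a D) {1..D} {1..D}"
      by (rule bij_betw_byWitness[where f'="rot a D"]) (use a in \<open>auto simp: rot_inverse\<close>, use a in \<open>auto simp: rot_def rot_inv_def\<close>)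
  qed (use a in \<open>auto simp: rot_inv_def\<close>)
qed

lemma rot_block:
  assumes a: "1 \<le> a" "a \<le> D" and t: "\<tau> permutes {1..D-1}" "strict_mono_on {1..a-1} \<tau>" "strict_mono_on {a..D-1} \<tau>"
  shows "(\<tau> \<circ> rot a D) permutes {1..D}" "strict_mono_on {1..a} (\<tau> \<circ> rot a D)"
    "strict_mono_on {a+1..D} (\<tau> \<circ> rot a D)" "(\<tau> \<circ> rot a D) a = D"
proof -
  have D: "\<tau> D = D" using t(1) a by (auto intro: permutes_not_in)
  have le: "\<tau> k < D" if "1 \<le> k" "k < D" for k
    using permutes_in_image[OF t(1), of k] that by auto
  show "(\<tau> \<circ> rot a D) permutes {1..D}"
    by (intro permutes_compose rot_permutes a permutes_subset[OF t(1)]) auto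
  show "(\<tau> \<circ> rot a D) a = D" using D by (simp add: rot_def)
  show "strict_mono_on {1..a} (\<tau> \<circ> rot a D)"
  proof (rule strict_mono_onI)
    fix r s assume rs: "r \<in> {1..a}" "s \<in> {1..a}" "r < s"
    then have r: "rot a D r = r" by (auto simp: rot_def)
    show "(\<tau> \<circ> rot a D) r < (\<tau> \<circ> rot a D) s"
    proof (cases "s = a")
      case True then show ?thesis using r rs D le[of r] a by (simp add: rot_def)
    next
      case False
      then have "rot a D s = s" using rs by (auto simp: rot_def)
      moreover have "\<tau> r < \<tau> s" using False rs by (intro strict_mono_onD[OF t(2)]) auto
      ultimately show ?thesis using r by simp
    qed
  qed
  show "strict_mono_on {a+1..D} (\<tau> \<circ> rot a D)"
  proof (rule strict_mono_onI)
    fix r s assume rs: "r \<in> {a+1..D}" "s \<in> {a+1..D}" "r < s"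
    then have "rot a D r = r - 1" "rot a D s = s - 1" by (auto simp: rot_def)
    moreover have "\<tau> (r - 1) < \<tau> (s - 1)" using rs by (intro strict_mono_onD[OF t(3)]) auto
    ultimately show "(\<tau> \<circ> rot a D) r < (\<tau> \<circ> rot a D) s" by simp
  qed
qed

lemma rot_inv_block:
  assumes a: "1 \<le> a" "a \<le> D" and t: "\<tau> permutes {1..D}" "strict_mono_on {1..a} \<tau>" "strict_mono_on {a+1..D} \<tau>" "\<tau> a = D"
  shows "(\<tau> \<circ> rot_inv a D) permutes {1..D-1}" "strict_mono_on {1..a-1} (\<tau> \<circ> rot_inv a D)"
    "strict_mono_on {a..D-1} (\<tau> \<circ> rot_inv a D)"
proof -
  have "(\<tau> \<circ> rot_inv a D) permutes {1..D}" by (intro permutes_compose rot_permutes a t(1))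
  then show "(\<tau> \<circ> rot_inv a D) permutes {1..D-1}"
    by (rule permutes_superset) (use t(4) in \<open>auto simp: rot_inv_def\<close>)
  show "strict_mono_on {1..a-1} (\<tau> \<circ> rot_inv a D)"
  proof (rule strict_mono_onI)
    fix r s assume rs: "r \<in> {1..a-1}" "s \<in> {1..a-1}" "r < s"
    then have "rot_inv a D r = r" "rot_inv a D s = s" using a by (auto simp: rot_inv_def)
    moreover have "\<tau> r < \<tau> s" using rs by (intro strict_mono_onD[OF t(2)]) auto
    ultimately show "(\<tau> \<circ> rot_inv a D) r < (\<tau> \<circ> rot_inv a D) s" by simp
  qed
  show "strict_mono_on {a..D-1} (\<tau> \<circ> rot_inv a D)"
  proof (rule strict_mono_onI)
    fix r s assume rs: "r \<in> {a..D-1}" "s \<in> {a..D-1}" "r < s"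
    then have "rot_inv a D r = r + 1" "rot_inv a D s = s + 1" using a by (auto simp: rot_inv_def)
    moreover have "\<tau> (r + 1) < \<tau> (s + 1)" using rs a by (intro strict_mono_onD[OF t(3)]) auto
    ultimately show "(\<tau> \<circ> rot_inv a D) r < (\<tau> \<circ> rot_inv a D) s" by simp
  qed
qed

lemma shuffle_first:
  assumes a: "lookup d i > 0"
  shows "bij_betw (\<lambda>\<sigma>. \<sigma>(i := \<sigma> i \<circ> rot (lookup d i) (lookup (d + e) i))) (shuffle_perms (del i d) e)
    {\<sigma> \<in> shuffle_perms d e. \<sigma> i (lookup d i) = lookup (d + e) i}"
proof -
  define A where "A = lookup d i"
  define D where "D = lookup (d + e) i"
  have aD: "1 \<le> A" "A \<le> D" "lookup d i + lookup e i = D" "lookup d i - 1 + lookup e i = D - 1" "lookup d i - 1 + 1 = A" "lookup d i = A"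
    using a by (auto simp: A_def D_def lookup_add)
  have 1: "\<sigma>(i := \<sigma> i \<circ> rot A D) \<in> shuffle_perms d e \<and> (\<sigma>(i := \<sigma> i \<circ> rot A D)) i A = D" if s: "\<sigma> \<in> shuffle_perms (del i d) e" for \<sigma>
  proof -
    have "\<sigma> i permutes {1..D-1}" "strict_mono_on {1..A-1} (\<sigma> i)" "strict_mono_on {A..D-1} (\<sigma> i)"
      using s aD unfolding shuffle_perms_def by (auto simp: lookup_del dest!: spec[of _ i])
    note c = rot_block[OF aD(1,2) this]
    have "\<sigma>(i := \<sigma> i \<circ> rot A D) \<in> shuffle_perms d e"
      by (rule shuffle_upd[OF s]) (use c aD in \<open>simp_all add: blk_def lookup_del\<close>)
    then show ?thesis using c(4) by simp
  qed
  have 2: "\<sigma>(i := \<sigma> i \<circ> rot_inv A D) \<in> shuffle_perms (del i d) e" if s: "\<sigma> \<in> shuffle_perms d e" "\<sigma> i A = D" for \<sigma>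
  proof -
    have "\<sigma> i permutes {1..D}" "strict_mono_on {1..A} (\<sigma> i)" "strict_mono_on {A+1..D} (\<sigma> i)"
      using s aD unfolding shuffle_perms_def by (auto dest!: spec[of _ i])
    note c = rot_inv_block[OF aD(1,2) this s(2)]
    show ?thesis
      by (rule shuffle_upd[OF s(1)]) (use c aD in \<open>simp_all add: blk_def lookup_del\<close>)
  qed
  have 3: "\<tau> \<circ> rot A D \<circ> rot_inv A D = \<tau>" "\<tau> \<circ> rot_inv A D \<circ> rot A D = \<tau>" for \<tau> :: "nat \<Rightarrow> nat"
    using rot_inverse[OF aD(2)] by (auto simp: fun_eq_iff)
  show ?thesis
    unfolding A_def[symmetric] D_def[symmetric]
  proof (rule bij_betw_byWitness[where f'="\<lambda>\<sigma>. \<sigma>(i := \<sigma> i \<circ> rot_inv A D)"])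
    show "\<forall>\<sigma>\<in>shuffle_perms (del i d) e. (\<sigma>(i := \<sigma> i \<circ> rot A D))(i := (\<sigma>(i := \<sigma> i \<circ> rot A D)) i \<circ> rot_inv A D) = \<sigma>"
      by (simp only: fun_upd_same fun_upd_upd 3 fun_upd_triv) simp
    show "\<forall>\<sigma>\<in>{\<sigma> \<in> shuffle_perms d e. \<sigma> i A = D}. (\<sigma>(i := \<sigma> i \<circ> rot_inv A D))(i := (\<sigma>(i := \<sigma> i \<circ> rot_inv A D)) i \<circ> rot A D) = \<sigma>"
      by (simp only: fun_upd_same fun_upd_upd 3 fun_upd_triv) simp
    show "(\<lambda>\<sigma>. \<sigma>(i := \<sigma> i \<circ> rot A D)) ` shuffle_perms (del i d) e \<subseteq> {\<sigma> \<in> shuffle_perms d e. \<sigma> i A = D}"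
      using 1 by blast
    show "(\<lambda>\<sigma>. \<sigma>(i := \<sigma> i \<circ> rot_inv A D)) ` {\<sigma> \<in> shuffle_perms d e. \<sigma> i A = D} \<subseteq> shuffle_perms (del i d) e"
      using 2 by blast
  qed
qed

lemma finite_shuffle: "finite (shuffle_perms d e)"
proof -
  let ?B = "\<Union>i\<in>keys (d + e). {p. p permutes {1..lookup (d + e) i}}"
  have "finite {\<sigma>. \<forall>i. (i \<in> keys (d + e) \<longrightarrow> \<sigma> i \<in> ?B) \<and> (i \<notin> keys (d + e) \<longrightarrow> \<sigma> i = (id :: nat \<Rightarrow> nat))}"
    by (rule finite_set_of_finite_funs) (auto simp: finite_permutations)
  moreover have "shuffle_perms d e \<subseteq> {\<sigma>. \<forall>i. (i \<in> keys (d + e) \<longrightarrow> \<sigma> i \<in> ?B) \<and> (i \<notin> keys (d + e) \<longrightarrow> \<sigma> i = id)}"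
  proof (intro subsetI CollectI allI conjI impI)
    fix \<sigma> i assume "\<sigma> \<in> shuffle_perms d e"
    then have p: "\<sigma> i permutes {1..lookup (d + e) i}" by (simp add: shuffle_perms_def lookup_add)
    then show "\<sigma> i \<in> ?B" if "i \<in> keys (d + e)" using that by blast
    show "\<sigma> i = id" if "i \<notin> keys (d + e)" using p that by (simp add: in_keys_iff)
  qed
  ultimately show ?thesis by (rule finite_subset[rotated])
qed

definition first_top :: "'v \<Rightarrow> 'v dimvec \<Rightarrow> 'v dimvec \<Rightarrow> ('v \<Rightarrow> nat \<Rightarrow> nat) set" where
  "first_top i d e = {\<sigma> \<in> shuffle_perms d e. lookup d i > 0 \<and> \<sigma> i (lookup d i) = lookup (d + e) i}"

definition second_top :: "'v \<Rightarrow> 'v dimvec \<Rightarrow> 'v dimvec \<Rightarrow> ('v \<Rightarrow> nat \<Rightarrow> nat) set" where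
  "second_top i d e = {\<sigma> \<in> shuffle_perms d e. lookup e i > 0 \<and> \<sigma> i (lookup (d + e) i) = lookup (d + e) i}"

text \<open>The largest value is attained at the end of one of the two increasing blocks, and by
  injectivity at only one of them.\<close>

lemma shuffle_split:
  assumes D: "lookup (d + e) i > 0"
  shows "shuffle_perms d e = first_top i d e \<union> second_top i d e" "first_top i d e \<inter> second_top i d e = {}"
proof -
  let ?A = "first_top i d e" and ?B = "second_top i d e"
  note first_top_def [simp] second_top_def [simp]
  define a where "a = lookup d i"
  define N where "N = lookup (d + e) i"
  have N: "N = a + lookup e i" "N > 0" using D by (auto simp: N_def a_def lookup_add)
  show "?A \<inter> ?B = {}"
  proof -
    have False if "\<sigma> \<in> shuffle_perms d e" "\<sigma> i a = N" "\<sigma> i N = N" "lookup e i > 0" for \<sigma>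
    proof -
      have "\<sigma> i permutes {1..N}" using that(1) by (simp add: shuffle_perms_def N a_def)
      then have "a = N" using that(2,3) by (metis permutes_inj injD)
      then show False using that(4) N by simp
    qed
    then show ?thesis unfolding first_top_def second_top_def a_def N_def by blast
  qed
  have "\<sigma> \<in> ?A \<union> ?B" if s: "\<sigma> \<in> shuffle_perms d e" for \<sigma>
  proof -
    have p: "\<sigma> i permutes {1..N}" "strict_mono_on {1..a} (\<sigma> i)" "strict_mono_on {a+1..N} (\<sigma> i)"
      using s by (simp_all add: shuffle_perms_def N a_def)
    have im: "\<sigma> i ` {1..N} = {1..N}" by (rule permutes_image[OF p(1)])
    have "N \<in> \<sigma> i ` {1..N}" unfolding im using N(2) by simp
    then obtain k where k: "k \<in> {1..N}" "\<sigma> i k = N" by (elim imageE) simp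
    have le: "\<sigma> i l \<le> N" if "l \<in> {1..N}" for l using im that by (metis atLeastAtMost_iff imageI)
    show ?thesis
    proof (cases "k \<le> a")
      case True
      have "k = a"
      proof (rule ccontr)
        assume "k \<noteq> a"
        then have "\<sigma> i k < \<sigma> i a" using True k by (intro strict_mono_onD[OF p(2)]) auto
        then show False using le[of a] k True N by auto
      qed
      then show ?thesis using s k by (auto simp: a_def N_def)
    next
      case False
      have "k = N"
      proof (rule ccontr)
        assume "k \<noteq> N"
        then have "\<sigma> i k < \<sigma> i N" using False k by (intro strict_mono_onD[OF p(3)]) auto
        then show False using le[of N] k N by auto
      qed
      then show ?thesis using s k False N by (auto simp: a_def N_def)
    qed
  qed
  then have "shuffle_perms d e \<subseteq> ?A \<union> ?B" by (rule subsetI)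
  moreover have "?A \<union> ?B \<subseteq> shuffle_perms d e" by auto
  ultimately show "shuffle_perms d e = ?A \<union> ?B" by (rule equalityI)
qed

end


lemma powi_minus_one: "(-1 :: 'a::field) powi k = (if even k then 1 else -1)"
  by (auto simp: power_int_def minus_one_power_iff even_nat_iff)

lemma prod_minus_one_powi: "(\<Prod>x\<in>A. (-1 :: 'a::field) powi h x) = (-1) powi (\<Sum>x\<in>A. h x)"
  by (induction A rule: infinite_finite_induct) (simp_all add: power_int_add)

lemma neg_powi: "(- x) powi k = (-1) powi k * x powi k" for x :: "'a::field"
  using power_int_mult_distrib[of "-1" x k] by simp

lemma pairing_fun_add: "pairing (\<lambda>x. \<xi> x + \<eta> x) p = pairing \<xi> p + pairing \<eta> p"
  and pairing_fun_mult: "pairing (\<lambda>x. c * \<xi> x) p = c * pairing \<xi> p"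
  by (simp_all add: pairing_eq distrib_left sum.distrib sum_distrib_left mult_ac)

context symmetric_quiver
begin

section \<open>Expansion of the shuffle product at its last variable of a given colour\<close>

definition ks :: "rat \<Rightarrow> 'v qpoly fract" where "ks c = to_frac (single 0 c)"

lemma to_frac_scale: "to_frac (scale c f) = ks c * to_frac f"
  unfolding ks_def to_frac_simps(3)[symmetric] scale_def by (simp only: mult_map_scale_conv_mult)

lemma ks_powi: "(-1 :: 'v qpoly fract fls) powi k = fls_const (ks ((-1) powi k))"
proof -
  have "ks 1 = 1" "ks (-1) = -1" using to_frac_simps(2)[of 0 "1 :: 'v qpoly"] to_frac_simps(4,5)
    by (simp_all add: ks_def single_uminus fract_collapse)
  then show ?thesis unfolding powi_minus_one by (cases "even k") simp_all
qed

lemma sum_vset_chi: "(\<Sum>q\<in>vset e. chi i (col q)) = euler (basis i) (dim_degree e)"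
  by (simp add: sum_vset euler_right[of _ "dim_degree e"] chi_def)

text \<open>The top variable T comes from \<open>f\<close>. The part of \<open>PP\<close> over the
  variables y of \<open>g\<close> cancels the kernel factors (y - T)^(-\<chi>) up to sign, which
  leaves the braiding sign of the letter past \<open>g\<close>. The part over the remaining
  variables of \<open>f\<close> turns the expansion of \<open>f\<close> into
  \<open>aop d i n f\<close>.\<close>

lemma EE_term_first:
  assumes dv: "d \<in> dimvecs" "e \<in> dimvecs" and a: "lookup d i > 0"
    and f: "f \<in> sym_polys d" and g: "g \<in> sym_polys e" and s: "\<sigma>' \<in> shuffle_perms (del i d) e"
  defines "\<sigma> \<equiv> \<sigma>'(i := \<sigma>' i \<circ> rot (lookup d i) (lookup (d + e) i))" and "T \<equiv> Var i (lookup (d + e) i)"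
  shows "(EE T (shuffle_term d e \<sigma> f g) * Lf (PP i (del i (d + e)))) $$ (n + 1) =
    ks (sg (basis i) (dim_degree e)) * shuffle_term (del i d) e \<sigma>' (aop d i n f) g"
proof -
  have iv: "i \<in> verts Q" using dimvecs_pos[OF dv(1) a] .
  have D: "del i (d + e) = del i d + e" using a by (intro poly_mapping_eqI) (auto simp: lookup_del lookup_add)
  have nin: "Var i (lookup d i) \<notin> vset (del i d)" using vset_del(2)[of i d] a by linarith
  have T: "T \<notin> vset (del i d + e)" using a by (auto simp: T_def lookup_del lookup_add)
  have sS: "\<sigma> \<in> shuffle_perms d e" "\<sigma> i (lookup d i) = lookup (d + e) i"
    using bij_betwE[OF shuffle_first[OF a]] s unfolding \<sigma>_def by blast+
  have r1: "rv \<sigma> p = rv \<sigma>' p" if "p \<in> vset (del i d)" for p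
    using that by (cases p) (auto simp: \<sigma>_def rot_def lookup_del)
  have r2: "gm d \<sigma> q = gm (del i d) \<sigma>' q" if "q \<in> vset e" for q
    using that a by (cases q) (auto simp: \<sigma>_def rot_def lookup_del lookup_add)
  have r3: "rv \<sigma> (Var i (lookup d i)) = T" by (simp add: sS(2) T_def)
  have inj: "inj (rv \<sigma>)" "inj (rv \<sigma>')" using sig_inj[OF shuffle_sig[OF sS(1)]] sig_inj[OF shuffle_sig[OF s]] by auto
  have K: "shuffle_kernel d e \<sigma> = (\<Prod>q\<in>vset e. (XX (gm (del i d) \<sigma>' q) - XX T) powi (- chi i (col q))) * shuffle_kernel (del i d) e \<sigma>'"
  proof -
    have "shuffle_kernel d e \<sigma> = (\<Prod>q\<in>vset e. (XX (gm d \<sigma> q) - XX (rv \<sigma> (Var i (lookup d i)))) powi (- chi i (col q))) *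
       (\<Prod>p\<in>vset (del i d). \<Prod>q\<in>vset e. (XX (gm d \<sigma> q) - XX (rv \<sigma> p)) powi (- chi (col p) (col q)))"
      unfolding shuffle_kernel_def vset_del(1)[OF iv a] prod.insert[OF finite_vset nin] by simp
    also have "\<dots> = (\<Prod>q\<in>vset e. (XX (gm (del i d) \<sigma>' q) - XX T) powi (- chi i (col q))) * shuffle_kernel (del i d) e \<sigma>'"
      unfolding shuffle_kernel_def r3 by (intro arg_cong2[where f="(*)"] prod.cong refl) (simp_all only: r1 r2)
    finally show ?thesis .
  qed
  have EK1: "EE T ((XX (gm (del i d) \<sigma>' q) - XX T) powi (- chi i (col q))) * zf (XX (gm (del i d) \<sigma>' q)) (chi i (col q)) = (-1) powi (- chi i (col q))"
    if q: "q \<in> vset e" for q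
  proof -
    let ?x = "XX (gm (del i d) \<sigma>' q)"
    have ne: "gm (del i d) \<sigma>' q \<noteq> T" using rv_shuffle(2)[OF s q] T by metis
    have "EE T (?x - XX T) = - zmx ?x" unfolding EE_diff EE_XX(1) EE_XX(2)[OF ne] by simp
    then have "EE T ((?x - XX T) powi (- chi i (col q))) = (-1) powi (- chi i (col q)) * zf ?x (- chi i (col q))"
      by (simp only: EE_powi neg_powi[of "zmx ?x"] zf_powi)
    then have "EE T ((?x - XX T) powi (- chi i (col q))) * zf ?x (chi i (col q)) = (-1) powi (- chi i (col q)) * (zf ?x (chi i (col q)) * zf ?x (- chi i (col q)))"
      by (simp only: mult_ac)
    then show ?thesis by (simp only: zf_inverse mult_1_right)
  qed
  have PPe: "Lf (PP i (del i (d + e))) = Lf (fls_lift (ren (rv \<sigma>')) (PP i (del i d))) * (\<Prod>q\<in>vset e. zf (XX (gm (del i d) \<sigma>' q)) (chi i (col q)))"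
    unfolding D Lf_ren_PP[OF col_rv inj(2)] unfolding PP_def Lf_hom prod_shuffle[OF s] by simp
  have Ef: "EE T (to_frac (ren (rv \<sigma>) f)) = Lf (fls_lift (ren (rv \<sigma>')) (esub (Var i (lookup d i)) f))"
  proof -
    have "esub T (ren (rv \<sigma>) f) = fls_lift (ren (rv \<sigma>)) (esub (Var i (lookup d i)) f)"
      using esub_ren[OF inj(1), of "Var i (lookup d i)" f] by (simp only: r3)
    also have "\<dots> = fls_lift (ren (rv \<sigma>')) (esub (Var i (lookup d i)) f)"
    proof (rule fls_eqI)
      fix k
      have "fpin (vset d - {Var i (lookup d i)}) (esub (Var i (lookup d i)) f)" using f by (intro fpin_esub) (simp add: sym_iff[OF dv(1)])
      then have "pin (vset (del i d)) (esub (Var i (lookup d i)) f $$ k)" by (simp add: fpin_def vset_del'[OF iv a])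
      then show "fls_lift (ren (rv \<sigma>)) (esub (Var i (lookup d i)) f) $$ k = fls_lift (ren (rv \<sigma>')) (esub (Var i (lookup d i)) f) $$ k"
        using ren_cong[OF _ r1] by (simp add: fls_lift_nth ren_simps)
    qed
    finally show ?thesis by (simp add: EE_to_frac)
  qed
  have Eg: "ren (gm d \<sigma>) g = ren (gm (del i d) \<sigma>') g" using g by (intro ren_cong[of "vset e"] r2) (simp add: sym_iff[OF dv(2)])
  have Eg': "EE T (to_frac (ren (gm (del i d) \<sigma>') g)) = fls_const (to_frac (ren (gm (del i d) \<sigma>') g))"
    using rv_shuffle(2)[OF s] T g by (intro EE_ren_const[of "vset e"]) (auto simp: sym_iff[OF dv(2)])
  have EK: "EE T (shuffle_kernel d e \<sigma>) * (\<Prod>q\<in>vset e. zf (XX (gm (del i d) \<sigma>' q)) (chi i (col q))) =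
    fls_const (ks (sg (basis i) (dim_degree e))) * fls_const (shuffle_kernel (del i d) e \<sigma>')"
  proof -
    have "EE T (shuffle_kernel d e \<sigma>) * (\<Prod>q\<in>vset e. zf (XX (gm (del i d) \<sigma>' q)) (chi i (col q))) =
      (\<Prod>q\<in>vset e. EE T ((XX (gm (del i d) \<sigma>' q) - XX T) powi (- chi i (col q))) * zf (XX (gm (del i d) \<sigma>' q)) (chi i (col q))) * fls_const (shuffle_kernel (del i d) e \<sigma>')"
      unfolding K EE_mult EE_prod EE_shuffle_kernel[OF s T] prod.distrib by (simp only: mult_ac)
    also have "(\<Prod>q\<in>vset e. EE T ((XX (gm (del i d) \<sigma>' q) - XX T) powi (- chi i (col q))) * zf (XX (gm (del i d) \<sigma>' q)) (chi i (col q))) = (\<Prod>q\<in>vset e. (-1) powi (- chi i (col q)))"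
      by (intro prod.cong refl EK1)
    also have "\<dots> = (-1) powi (- euler (basis i) (dim_degree e))"
      by (simp only: prod_minus_one_powi sum_negf sum_vset_chi)
    also have "\<dots> = fls_const (ks (sg (basis i) (dim_degree e)))"
      unfolding ks_powi braid_sign_def by (simp add: powi_minus_one)
    finally show ?thesis .
  qed
  have "EE T (shuffle_term d e \<sigma> f g) * Lf (PP i (del i (d + e))) =
     EE T (to_frac (ren (rv \<sigma>) f)) * Lf (fls_lift (ren (rv \<sigma>')) (PP i (del i d))) * EE T (to_frac (ren (gm (del i d) \<sigma>') g)) *
     (EE T (shuffle_kernel d e \<sigma>) * (\<Prod>q\<in>vset e. zf (XX (gm (del i d) \<sigma>' q)) (chi i (col q))))"
    unfolding shuffle_term_def EE_mult PPe Eg by (simp only: mult_ac)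
  also have "\<dots> = fls_const (to_frac (ren (gm (del i d) \<sigma>') g)) * (fls_const (ks (sg (basis i) (dim_degree e))) * fls_const (shuffle_kernel (del i d) e \<sigma>')) *
     Lf (fls_lift (ren (rv \<sigma>')) (esub (Var i (lookup d i)) f * PP i (del i d)))"
    unfolding Ef Eg' EK fls_lift_ren[OF inj(2)] Lf_hom by (simp only: mult_ac)
  finally have "(EE T (shuffle_term d e \<sigma> f g) * Lf (PP i (del i (d + e)))) $$ (n + 1) =
    to_frac (ren (gm (del i d) \<sigma>') g) * (ks (sg (basis i) (dim_degree e)) * shuffle_kernel (del i d) e \<sigma>') * to_frac (ren (rv \<sigma>') (aop d i n f))"
    by (simp only: fls_const_mult_const fls_const_times_nth Lf_hom aop_def opc_def) (simp add: fls_lift_nth ren_simps)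
  then show ?thesis by (simp only: shuffle_term_def mult_ac)
qed

text \<open>Here T comes from \<open>g\<close>. The kernel factors (T - x)^(-\<chi>) expand to the
  exact inverses of the factors of \<open>PP\<close> over the variables of \<open>f\<close>, so no
  sign appears.\<close>

lemma EE_term_second:
  assumes dv: "d \<in> dimvecs" "e \<in> dimvecs" and a: "lookup e i > 0"
    and f: "f \<in> sym_polys d" and g: "g \<in> sym_polys e" and s: "\<sigma> \<in> shuffle_perms d (del i e)"
  defines "T \<equiv> Var i (lookup (d + e) i)"
  shows "(EE T (shuffle_term d e \<sigma> f g) * Lf (PP i (del i (d + e)))) $$ (n + 1) = shuffle_term d (del i e) \<sigma> f (aop e i n g)"
proof -
  have iv: "i \<in> verts Q" using dimvecs_pos[OF dv(2) a] .
  have D: "del i (d + e) = d + del i e" using a by (intro poly_mapping_eqI) (auto simp: lookup_del lookup_add)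
  have nin: "Var i (lookup e i) \<notin> vset (del i e)" using vset_del(2)[of i e] a by linarith
  have T: "T \<notin> vset (d + del i e)" using a by (auto simp: T_def lookup_del lookup_add)
  have sS: "\<sigma> \<in> shuffle_perms d e" "\<sigma> i (lookup (d + e) i) = lookup (d + e) i"
    using s unfolding shuffle_second[OF a] by blast+
  have r3: "gm d \<sigma> (Var i (lookup e i)) = T" using sS(2) by (simp add: T_def lookup_add)
  have inj: "inj (gm d \<sigma>)" by (rule inj_gm[OF shuffle_sig[OF s]])
  have K: "shuffle_kernel d e \<sigma> = (\<Prod>p\<in>vset d. (XX T - XX (rv \<sigma> p)) powi (- chi i (col p))) * shuffle_kernel d (del i e) \<sigma>"
  proof -
    have "(\<Prod>q\<in>vset e. (XX (gm d \<sigma> q) - XX (rv \<sigma> p)) powi (- chi (col p) (col q))) =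
      (XX T - XX (rv \<sigma> p)) powi (- chi i (col p)) * (\<Prod>q\<in>vset (del i e). (XX (gm d \<sigma> q) - XX (rv \<sigma> p)) powi (- chi (col p) (col q)))" for p
      unfolding vset_del(1)[OF iv a] prod.insert[OF finite_vset nin] r3 by (simp add: chi_commute[of i "col p"])
    then show ?thesis unfolding shuffle_kernel_def by (simp only: prod.distrib)
  qed
  have EK1: "EE T ((XX T - XX (rv \<sigma> p)) powi (- chi i (col p))) * zf (XX (rv \<sigma> p)) (chi i (col p)) = 1"
    if p: "p \<in> vset d" for p
  proof -
    let ?x = "XX (rv \<sigma> p)"
    have ne: "rv \<sigma> p \<noteq> T" using rv_shuffle(1)[OF s p] T by metis
    have "EE T (XX T - ?x) = zmx ?x" unfolding EE_diff EE_XX(1) EE_XX(2)[OF ne] ..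
    then have "EE T ((XX T - ?x) powi (- chi i (col p))) = zf ?x (- chi i (col p))"
      by (simp only: EE_powi zf_powi)
    then show ?thesis using zf_inverse[of ?x "chi i (col p)"] by (simp only: mult.commute)
  qed
  have PPe: "Lf (PP i (del i (d + e))) = (\<Prod>p\<in>vset d. zf (XX (rv \<sigma> p)) (chi i (col p))) * Lf (fls_lift (ren (gm d \<sigma>)) (PP i (del i e)))"
    unfolding D Lf_ren_PP[OF col_rv inj] unfolding PP_def Lf_hom prod_shuffle[OF s] by simp
  have Eg: "EE T (to_frac (ren (gm d \<sigma>) g)) = Lf (fls_lift (ren (gm d \<sigma>)) (esub (Var i (lookup e i)) g))"
    using esub_ren[OF inj, of "Var i (lookup e i)" g] by (simp only: r3 EE_to_frac)
  have Ef: "EE T (to_frac (ren (rv \<sigma>) f)) = fls_const (to_frac (ren (rv \<sigma>) f))"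
    using rv_shuffle(1)[OF s] T f by (intro EE_ren_const[of "vset d"]) (auto simp: sym_iff[OF dv(1)])
  have EK: "EE T (shuffle_kernel d e \<sigma>) * (\<Prod>p\<in>vset d. zf (XX (rv \<sigma> p)) (chi i (col p))) = fls_const (shuffle_kernel d (del i e) \<sigma>)"
  proof -
    have "EE T (shuffle_kernel d e \<sigma>) * (\<Prod>p\<in>vset d. zf (XX (rv \<sigma> p)) (chi i (col p))) =
      (\<Prod>p\<in>vset d. EE T ((XX T - XX (rv \<sigma> p)) powi (- chi i (col p))) * zf (XX (rv \<sigma> p)) (chi i (col p))) * fls_const (shuffle_kernel d (del i e) \<sigma>)"
      unfolding K EE_mult EE_prod EE_shuffle_kernel[OF s T] prod.distrib by (simp only: mult_ac)
    then show ?thesis using EK1 by simp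
  qed
  have "EE T (shuffle_term d e \<sigma> f g) * Lf (PP i (del i (d + e))) =
     EE T (to_frac (ren (rv \<sigma>) f)) * (EE T (to_frac (ren (gm d \<sigma>) g)) * Lf (fls_lift (ren (gm d \<sigma>)) (PP i (del i e)))) *
     (EE T (shuffle_kernel d e \<sigma>) * (\<Prod>p\<in>vset d. zf (XX (rv \<sigma> p)) (chi i (col p))))"
    unfolding shuffle_term_def EE_mult PPe by (simp only: mult_ac)
  also have "\<dots> = fls_const (to_frac (ren (rv \<sigma>) f)) * fls_const (shuffle_kernel d (del i e) \<sigma>) *
     Lf (fls_lift (ren (gm d \<sigma>)) (esub (Var i (lookup e i)) g * PP i (del i e)))"
    unfolding Ef Eg EK fls_lift_ren[OF inj] Lf_hom by (simp only: mult_ac)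
  finally have "(EE T (shuffle_term d e \<sigma> f g) * Lf (PP i (del i (d + e)))) $$ (n + 1) =
    to_frac (ren (rv \<sigma>) f) * shuffle_kernel d (del i e) \<sigma> * to_frac (ren (gm d \<sigma>) (aop e i n g))"
    by (simp only: fls_const_mult_const fls_const_times_nth Lf_hom aop_def opc_def) (simp add: fls_lift_nth ren_simps)
  then show ?thesis by (simp only: shuffle_term_def mult_ac)
qed

text \<open>The operators \<open>aop\<close> are braided derivations of the shuffle product.\<close>

lemma EE_shuffle_sum:
  assumes dv: "d \<in> dimvecs" "e \<in> dimvecs" and D: "lookup (d + e) i > 0"
    and f: "f \<in> sym_polys d" and g: "g \<in> sym_polys e"
  defines "T \<equiv> Var i (lookup (d + e) i)"
  shows "(EE T (shuffle_sum d e f g) * Lf (PP i (del i (d + e)))) $$ (n + 1) =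
    (if lookup d i > 0 then ks (sg (basis i) (dim_degree e)) * shuffle_sum (del i d) e (aop d i n f) g else 0) +
    (if lookup e i > 0 then shuffle_sum d (del i e) f (aop e i n g) else 0)"
proof -
  let ?t = "\<lambda>\<sigma>. (EE T (shuffle_term d e \<sigma> f g) * Lf (PP i (del i (d + e)))) $$ (n + 1)"
  have fin: "finite (first_top i d e)" "finite (second_top i d e)"
    using finite_shuffle[of d e] shuffle_split(1)[OF D] by (metis finite_Un)+
  have "(EE T (shuffle_sum d e f g) * Lf (PP i (del i (d + e)))) $$ (n + 1) = (\<Sum>\<sigma>\<in>shuffle_perms d e. ?t \<sigma>)"
    by (simp only: shuffle_sum_shuffle_term EE_sum sum_distrib_right fls_nth_sum)
  also have "\<dots> = (\<Sum>\<sigma>\<in>first_top i d e. ?t \<sigma>) + (\<Sum>\<sigma>\<in>second_top i d e. ?t \<sigma>)"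
    unfolding shuffle_split(1)[OF D] by (rule sum.union_disjoint[OF fin shuffle_split(2)[OF D]])
  also have "(\<Sum>\<sigma>\<in>first_top i d e. ?t \<sigma>) = (if lookup d i > 0 then ks (sg (basis i) (dim_degree e)) * shuffle_sum (del i d) e (aop d i n f) g else 0)"
  proof (cases "lookup d i > 0")
    case True
    then have "first_top i d e = {\<sigma> \<in> shuffle_perms d e. \<sigma> i (lookup d i) = lookup (d + e) i}" by (simp add: first_top_def)
    then have "(\<Sum>\<sigma>\<in>first_top i d e. ?t \<sigma>) = (\<Sum>\<sigma>\<in>shuffle_perms (del i d) e. ?t (\<sigma>(i := \<sigma> i \<circ> rot (lookup d i) (lookup (d + e) i))))"
      using sum.reindex_bij_betw[OF shuffle_first[OF True, of e], of ?t] by simp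
    also have "\<dots> = (\<Sum>\<sigma>\<in>shuffle_perms (del i d) e. ks (sg (basis i) (dim_degree e)) * shuffle_term (del i d) e \<sigma> (aop d i n f) g)"
      unfolding T_def by (intro sum.cong refl EE_term_first[OF dv True f g])
    finally show ?thesis using True by (simp only: shuffle_sum_shuffle_term sum_distrib_left if_True)
  qed (simp add: first_top_def)
  also have "(\<Sum>\<sigma>\<in>second_top i d e. ?t \<sigma>) = (if lookup e i > 0 then shuffle_sum d (del i e) f (aop e i n g) else 0)"
  proof (cases "lookup e i > 0")
    case True
    then have "second_top i d e = shuffle_perms d (del i e)" by (simp add: second_top_def shuffle_second)
    then have "(\<Sum>\<sigma>\<in>second_top i d e. ?t \<sigma>) = (\<Sum>\<sigma>\<in>shuffle_perms d (del i e). shuffle_term d (del i e) \<sigma> f (aop e i n g))"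
      unfolding T_def by (simp only:) (intro sum.cong refl EE_term_second[OF dv True f g])
    then show ?thesis using True by (simp only: shuffle_sum_shuffle_term if_True)
  qed (simp add: second_top_def)
  finally show ?thesis .
qed

section \<open>The coproduct is dual to the shuffle product\<close>

definition zeta :: "'v dimvec \<Rightarrow> 'v dimvec \<Rightarrow> 'v qpoly \<Rightarrow> 'v qpoly \<Rightarrow> ('v \<times> int) fmon \<Rightarrow> rat" where
  "zeta d e f g u = sg (dim_degree d) (dim_degree e) *
     pairing (\<lambda>(a, b). BB d f a * BB e g b) (Dact (single u 1) (otimes 1 1))"

lemma pairing_zeta: "pairing (zeta d e f g) t = sg (dim_degree d) (dim_degree e) *
     pairing (\<lambda>(a, b). BB d f a * BB e g b) (Dact t (otimes 1 1))"
  by (induction t rule: pm_induct) (simp_all add: zeta_def pairing_add pairing_scale Dact_simps(1,3) distrib_left)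

text \<open>The sign in \<open>Dl\<close> depends on the degree of the first word, the sign on the
  right on \<open>d\<close>; they agree on all words where \<open>BB d f\<close> is nonzero.\<close>

lemma pairing_Dl:
  assumes d: "d \<in> dimvecs"
  shows "pairing (\<lambda>(a, b). BB d f a * BB e g b) (Dl (i, n) x) =
    pairing (\<lambda>(a, b). Bf d ((i, n) # letters a) f * BB e g b + sg (basis i) (dim_degree d) * (BB d f a * Bf e ((i, n) # letters b) g)) x"
proof (induction x rule: pm_induct)
  case (single x)
  obtain a b where x: "x = (a, b)" by force
  have "sg (basis i) (ldeg a) * (BB d f a * t) = sg (basis i) (dim_degree d) * (BB d f a * t)" for t
    using Bf_ldeg[OF d, of "letters a" f] by (cases "BB d f a = 0") auto
  then show ?case unfolding x
    by (simp add: Dl_def pairing_add plus_fmon_def del: Bf.simps)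
qed (simp_all add: Dl_simps pairing_add pairing_scale del: Bf.simps)

text \<open>The prefactor of \<open>zeta\<close> is made for this recursion to match
  \<open>EE_shuffle_sum\<close>: sg(d,e) equals sg(e_i,e) sg(d - e_i,e), and times the sign
  sg(e_i,d) of the coproduct it equals sg(d,e - e_i).\<close>

lemma zeta_Cons:
  assumes dv: "d \<in> dimvecs" "e \<in> dimvecs"
  shows "zeta d e f g (FMon ((i, n) # u)) =
    (if lookup d i > 0 then sg (basis i) (dim_degree e) * zeta (del i d) e (aop d i n f) g (FMon u) else 0) +
    (if lookup e i > 0 then zeta d (del i e) f (aop e i n g) (FMon u) else 0)"
proof -
  let ?x = "Dact (single (FMon u) 1) (otimes 1 1)"
  have "Dact (single (FMon ((i, n) # u)) 1) (otimes 1 1) = Dl (i, n) ?x"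
    by (simp add: Dact_simps)
  then have z: "zeta d e f g (FMon ((i, n) # u)) = sg (dim_degree d) (dim_degree e) *
    (pairing (\<lambda>p. Bf d ((i, n) # letters (fst p)) f * BB e g (snd p)) ?x + sg (basis i) (dim_degree d) * pairing (\<lambda>p. BB d f (fst p) * Bf e ((i, n) # letters (snd p)) g) ?x)"
    using pairing_Dl[OF dv(1), of f e g i n ?x] unfolding zeta_def case_prod_unfold pairing_fun_add pairing_fun_mult by simp
  have 1: "sg (dim_degree d) (dim_degree e) * pairing (\<lambda>p. Bf d ((i, n) # letters (fst p)) f * BB e g (snd p)) ?x =
    (if lookup d i > 0 then sg (basis i) (dim_degree e) * zeta (del i d) e (aop d i n f) g (FMon u) else 0)"
  proof (cases "lookup d i > 0")
    case True
    have "sg (dim_degree d) (dim_degree e) = sg (basis i) (dim_degree e) * sg (dim_degree (del i d)) (dim_degree e)"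
      unfolding dim_degree_del[OF True] sg_add by (rule mult.commute)
    then show ?thesis using True dimvecs_pos[OF dv(1) True] by (simp add: zeta_def case_prod_unfold)
  qed (simp add: pairing_eq)
  have 2: "sg (dim_degree d) (dim_degree e) * (sg (basis i) (dim_degree d) * pairing (\<lambda>p. BB d f (fst p) * Bf e ((i, n) # letters (snd p)) g) ?x) =
    (if lookup e i > 0 then zeta d (del i e) f (aop e i n g) (FMon u) else 0)"
  proof (cases "lookup e i > 0")
    case True
    have "sg (dim_degree d) (dim_degree e) = sg (dim_degree d) (dim_degree (del i e)) * sg (basis i) (dim_degree d)"
      unfolding dim_degree_del[OF True] sg_add by (simp add: sg_commute)
    then show ?thesis using True dimvecs_pos[OF dv(2) True] by (simp add: zeta_def case_prod_unfold mult.assoc)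
  qed (simp add: pairing_eq)
  show ?thesis unfolding z distrib_left 1 2 ..
qed

lemma wdeg_Dact: "(a, b) \<in> keys (foldr Dl u (otimes 1 1)) \<Longrightarrow> wdeg a + wdeg b = wdeg (FMon u)"
proof (induction u arbitrary: a b)
  case Nil
  have "otimes 1 1 = single (0 :: ('v \<times> int) fmon, 0 :: ('v \<times> int) fmon) (1 :: rat)" using otimes_simps(9)[of 0 1 0 1] by simp
  then show ?case using Nil by (simp split: if_splits add: wdeg_def zero_fmon_def)
next
  case (Cons h u)
  let ?x = "foldr Dl u (otimes 1 1)"
  have "(a, b) \<in> (\<Union>p\<in>keys ?x. keys (scale (lookup ?x p) (case p of (u, v) \<Rightarrow> single (FMon [h] + u, v) 1 + single (u, FMon [h] + v) (sg (basis (fst h)) (ldeg u)))))"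
  proof (rule subsetD[OF keys_sum])
    show "(a, b) \<in> keys (\<Sum>p\<in>keys ?x. scale (lookup ?x p) (case p of (u, v) \<Rightarrow> single (FMon [h] + u, v) 1 + single (u, FMon [h] + v) (sg (basis (fst h)) (ldeg u))))"
      using Cons.prems unfolding foldr_Cons comp_apply Dl_def lin_ext_def .
  qed
  then obtain c d where cd: "(c, d) \<in> keys ?x"
    "(a, b) \<in> keys (scale (lookup ?x (c, d)) (single (FMon [h] + c, d) 1 + single (c, FMon [h] + d) (sg (basis (fst h)) (ldeg c))))" by auto
  have "(a, b) \<in> keys (single (FMon [h] + c, d) (1::rat)) \<union> keys (single (c, FMon [h] + d) (sg (basis (fst h)) (ldeg c)))"
    by (rule subsetD[OF keys_add subsetD[OF keys_scale cd(2)]])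
  then have "(a, b) = (FMon [h] + c, d) \<or> (a, b) = (c, FMon [h] + d)" by (auto split: if_splits)
  then show ?case using Cons.IH[OF cd(1)] by (auto simp: ac_simps)
qed

text \<open>The sum of the degrees of all monomials is a crude substitute for the largest one;
  \<open>functional_representation\<close> accepts any bound.\<close>

lemma Bf_lower: assumes "Bf d u f \<noteq> 0"
  shows "snd (wdeg (FMon u)) \<ge> - euler (dim_degree d) (dim_degree d) - 2 * int (\<Sum>m\<in>keys f. mdeg m)"
proof -
  obtain m where m: "m \<in> keys f" "2 * int (mdeg m) + euler (dim_degree d) (dim_degree d) + snd (wdeg (FMon u)) = 0"
    using Bf_degree[OF assms] by blast
  have "mdeg m \<le> (\<Sum>m\<in>keys f. mdeg m)" using m(1) by (intro member_le_sum) auto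
  then have "int (mdeg m) \<le> int (\<Sum>m\<in>keys f. mdeg m)" by (simp only: of_nat_le_iff)
  then show ?thesis using m(2) by linarith
qed

lemma zeta_nonzero:
  assumes "zeta d e f g u \<noteq> 0"
  shows "\<exists>a b. BB d f a \<noteq> 0 \<and> BB e g b \<noteq> 0 \<and> wdeg a + wdeg b = wdeg u"
proof -
  let ?x = "foldr Dl (letters u) (otimes 1 1)"
  have "(\<Sum>p\<in>keys ?x. lookup ?x p * (case p of (a, b) \<Rightarrow> BB d f a * BB e g b)) \<noteq> 0"
    using assms by (simp add: zeta_def Dact_simps pairing_eq)
  then obtain p where "p \<in> keys ?x" "lookup ?x p * (case p of (a, b) \<Rightarrow> BB d f a * BB e g b) \<noteq> 0"
    by (rule sum.not_neutral_contains_not_neutral)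
  moreover obtain a b where "p = (a, b)" by force
  ultimately have "(a, b) \<in> keys ?x" "BB d f a \<noteq> 0" "BB e g b \<noteq> 0" by auto
  then show ?thesis using wdeg_Dact[of a b "letters u"] by (intro exI[of _ a] exI[of _ b]) simp
qed

text \<open>The coproduct maps \<open>J0\<close> into the tensor kernel, so \<open>zeta\<close>
  vanishes on \<open>J0\<close>; degrees of the two words of a pair add up, so it is bounded below.
  This is where the polynomial comes from that the shuffle sum turns out to be.\<close>

lemma zeta_representation:
  assumes dv: "d \<in> dimvecs" "e \<in> dimvecs" and f: "f \<in> sym_polys d" and g: "g \<in> sym_polys e"
  shows "\<exists>h\<in>sym_polys (d + e). \<forall>u. zeta d e f g u = Bf (d + e) (letters u) h"
proof (rule functional_representation[OF dimvecs_add[OF dv]])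
  show "pairing (zeta d e f g) j = 0" if "j \<in> J0" for j
    unfolding pairing_zeta using pairing_tensor_ker[OF Dact_J0[OF that] Bf_kills_J0[OF _ dv(1) f] Bf_kills_J0[OF _ dv(2) g]] by simp
  have *: "\<exists>a b. Bf d (letters a) f \<noteq> 0 \<and> Bf e (letters b) g \<noteq> 0 \<and> wdeg a + wdeg b = wdeg u" if "zeta d e f g u \<noteq> 0" for u
    by (rule zeta_nonzero[OF that])
  { fix u assume "zeta d e f g u \<noteq> 0"
    then obtain a b where ab: "Bf d (letters a) f \<noteq> 0" "Bf e (letters b) g \<noteq> 0" "wdeg a + wdeg b = wdeg u" using * by blast
    show "ldeg u = dim_degree (d + e)"
      using Bf_ldeg[OF dv(1) ab(1)] Bf_ldeg[OF dv(2) ab(2)] by (simp add: ab(3)[symmetric] dim_degree_add)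
    show "snd (wdeg u) \<ge> (- euler (dim_degree d) (dim_degree d) - 2 * int (\<Sum>m\<in>keys f. mdeg m)) + (- euler (dim_degree e) (dim_degree e) - 2 * int (\<Sum>m\<in>keys g. mdeg m))"
      using add_mono[OF Bf_lower[OF ab(1)] Bf_lower[OF ab(2)]] by (simp add: ab(3)[symmetric]) }
qed

lemma shuffle_perms_0: "shuffle_perms 0 0 = {\<lambda>_. id}"
  by (auto simp: shuffle_perms_def permutes_empty fun_eq_iff strict_mono_on_def)

text \<open>Cancellation of the denominators is not shown directly. The shuffle sum is compared with
  the polynomial \<open>h\<close> that represents \<open>zeta\<close>: by induction on the size of
  \<open>d + e\<close> their expansions at a last variable have the same coefficients, and
  \<open>EE\<close> is injective.\<close>

theorem shuffle_product_pairing: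
  assumes "d \<in> dimvecs" "e \<in> dimvecs" "f \<in> sym_polys d" "g \<in> sym_polys e"
  shows "\<exists>h\<in>sym_polys (d + e). to_frac h = shuffle_sum d e f g \<and> (\<forall>u. zeta d e f g u = Bf (d + e) (letters u) h)"
  using assms
proof (induction "mdeg (d + e)" arbitrary: d e f g)
  case 0
  obtain h where h: "h \<in> sym_polys (d + e)" "\<And>u. zeta d e f g u = Bf (d + e) (letters u) h"
    using zeta_representation[OF 0(2-5)] by blast
  have "d + e = 0" using 0(1) by (intro poly_mapping_eqI) (auto simp: mdeg_def in_keys_iff)
  then have z: "d = 0" "e = 0" by (metis add_is_0 lookup_add lookup_zero poly_mapping_eqI)+
  have c: "p = single 0 (lookup p 0)" if "p \<in> sym_polys 0" for p :: "'v qpoly"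
  proof (rule poly_mapping_eqI)
    fix k
    have "pin {} p" using that by (simp add: sym_iff vset_def)
    then show "lookup p k = lookup (single 0 (lookup p 0)) k" by (cases "k = 0") (auto simp: pin_def in_keys_iff lookup_single when_def)
  qed
  have "otimes 1 1 = single (0 :: ('v \<times> int) fmon, 0 :: ('v \<times> int) fmon) (1 :: rat)" using otimes_simps(9)[of 0 1 0 1] by simp
  then have "zeta d e f g (FMon []) = lookup f 0 * lookup g 0"
    by (simp add: zeta_def z Dact_simps zero_fmon_def[symmetric])
  then have l: "lookup h 0 = lookup f 0 * lookup g 0" using h(2)[of "FMon []"] z by simp
  have fg: "f = single 0 (lookup f 0)" "g = single 0 (lookup g 0)" "h = single 0 (lookup h 0)"
    using c[of f] c[of g] c[of h] 0(4,5) h(1) z by simp_all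
  have hfg: "h = f * g"
    by (subst fg(1), subst fg(2), subst fg(3)) (simp add: l mult_single)
  have r: "rv (\<lambda>_. id) = (\<lambda>x :: 'v qvar. x)" "rv (\<lambda>j l. id (lookup (0 :: 'v dimvec) j + l)) = (\<lambda>x :: 'v qvar. x)"
  proof -
    show "rv (\<lambda>_. id) = (\<lambda>x :: 'v qvar. x)" "rv (\<lambda>j l. id (lookup (0 :: 'v dimvec) j + l)) = (\<lambda>x :: 'v qvar. x)"
    proof (rule_tac [!] ext)
      fix x :: "'v qvar"
      show "rv (\<lambda>_. id) x = x" "rv (\<lambda>j l. id (lookup (0 :: 'v dimvec) j + l)) x = x" by (cases x; simp)+
    qed
  qed
  have r': "rv (\<lambda>_ l. l) = (\<lambda>x :: 'v qvar. x)"
  proof (rule ext)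
    fix x :: "'v qvar" show "rv (\<lambda>_ l. l) x = x" by (cases x) simp
  qed
  have "shuffle_sum d e f g = to_frac f * to_frac g"
    unfolding z shuffle_sum_shuffle_term shuffle_perms_0 shuffle_term_def by (subst sum.insert) (simp_all add: r r' ren_id shuffle_kernel_def vset_def)
  then have "to_frac h = shuffle_sum d e f g" by (simp only: hfg to_frac_simps)
  then show ?case using h by blast
next
  case (Suc k)
  note dv = Suc.prems(1,2) and fg = Suc.prems(3,4)
  obtain h where h: "h \<in> sym_polys (d + e)" "\<And>u. zeta d e f g u = Bf (d + e) (letters u) h"
    using zeta_representation[OF Suc.prems] by blast
  have "mdeg (d + e) \<noteq> 0" using Suc(2) by simp
  then have "\<exists>i. lookup (d + e) i > 0" unfolding mdeg_def by (metis gr0I sum.neutral)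
  then obtain i where i: "lookup (d + e) i > 0" ..
  have iv: "i \<in> verts Q" by (rule dimvecs_pos[OF dimvecs_add[OF dv] i])
  let ?T = "Var i (lookup (d + e) i)"
  have md: "k = mdeg (del i (d + e))" using mdeg_del[OF i] Suc(2) by simp
  have D1: "del i (d + e) = del i d + e" if "lookup d i > 0"
    using that by (intro poly_mapping_eqI) (auto simp: lookup_del lookup_add)
  have D2: "del i (d + e) = d + del i e" if "lookup e i > 0"
    using that by (intro poly_mapping_eqI) (auto simp: lookup_del lookup_add)
  \<comment> \<open>\<open>zeta_Cons\<close> on words and \<open>EE_shuffle_sum\<close> on rational
    functions reduce both sides to smaller dimensions, where \<open>h1\<close> and \<open>h2\<close>
    represent the two terms by induction; a missing term is represented by 0.\<close>
  have main: "to_frac (aop (d + e) i n h) = (EE ?T (shuffle_sum d e f g) * Lf (PP i (del i (d + e)))) $$ (n + 1)" for n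
  proof -
    have dd: "del i (d + e) \<in> dimvecs" by (intro dimvecs_del dimvecs_add dv)
    have "\<exists>h1. h1 \<in> sym_polys (del i (d + e)) \<and> to_frac h1 = (if lookup d i > 0 then shuffle_sum (del i d) e (aop d i n f) g else 0) \<and>
      (\<forall>u. Bf (del i (d + e)) (letters u) h1 = (if lookup d i > 0 then zeta (del i d) e (aop d i n f) g u else 0))"
    proof (cases "lookup d i > 0")
      case True
      note ih = Suc.hyps(1)[OF md[unfolded D1[OF True]] dimvecs_del[OF dv(1)] dv(2) aop_sym[OF dv(1) iv True fg(1)] fg(2)]
      show ?thesis unfolding D1[OF True] if_P[OF True] using ih[of n] unfolding Bex_def by (elim exE conjE) (intro exI conjI allI, assumption+, simp)
    next
      case False
      then show ?thesis by (intro exI[of _ 0]) (simp add: sym_add[OF dd] Bf_add fract_collapse)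
    qed
    then obtain h1 where h1: "h1 \<in> sym_polys (del i (d + e))" "to_frac h1 = (if lookup d i > 0 then shuffle_sum (del i d) e (aop d i n f) g else 0)"
      "\<And>u. Bf (del i (d + e)) (letters u) h1 = (if lookup d i > 0 then zeta (del i d) e (aop d i n f) g u else 0)" by blast
    have "\<exists>h2. h2 \<in> sym_polys (del i (d + e)) \<and> to_frac h2 = (if lookup e i > 0 then shuffle_sum d (del i e) f (aop e i n g) else 0) \<and>
      (\<forall>u. Bf (del i (d + e)) (letters u) h2 = (if lookup e i > 0 then zeta d (del i e) f (aop e i n g) u else 0))"
    proof (cases "lookup e i > 0")
      case True
      note ih = Suc.hyps(1)[OF md[unfolded D2[OF True]] dv(1) dimvecs_del[OF dv(2)] fg(1) aop_sym[OF dv(2) iv True fg(2)]]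
      show ?thesis unfolding D2[OF True] if_P[OF True] using ih[of n] unfolding Bex_def by (elim exE conjE) (intro exI conjI allI, assumption+, simp)
    next
      case False
      then show ?thesis by (intro exI[of _ 0]) (simp add: sym_add[OF dd] Bf_add fract_collapse)
    qed
    then obtain h2 where h2: "h2 \<in> sym_polys (del i (d + e))" "to_frac h2 = (if lookup e i > 0 then shuffle_sum d (del i e) f (aop e i n g) else 0)"
      "\<And>u. Bf (del i (d + e)) (letters u) h2 = (if lookup e i > 0 then zeta d (del i e) f (aop e i n g) u else 0)" by blast
    let ?c = "sg (basis i) (dim_degree e)"
    have "aop (d + e) i n h - (scale ?c h1 + h2) = 0"
    proof (rule Bf_nondegenerate[OF dd])
      show "aop (d + e) i n h - (scale ?c h1 + h2) \<in> sym_polys (del i (d + e))"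
        by (intro sym_add[OF dd] aop_sym dimvecs_add dv iv i h h1 h2)
      fix u
      have "Bf (del i (d + e)) u (aop (d + e) i n h) = zeta d e f g (FMon ((i, n) # u))"
        using iv i by (simp add: h(2))
      also have "\<dots> = Bf (del i (d + e)) u (scale ?c h1 + h2)"
        using h1(3)[of "FMon u"] h2(3)[of "FMon u"] unfolding zeta_Cons[OF dv] by (simp add: Bf_add)
      finally show "Bf (del i (d + e)) u (aop (d + e) i n h - (scale ?c h1 + h2)) = 0" by (simp add: Bf_diff)
    qed
    then have "aop (d + e) i n h = scale ?c h1 + h2" by simp
    then have "to_frac (aop (d + e) i n h) = ks ?c * to_frac h1 + to_frac h2" by (simp only: to_frac_simps to_frac_scale)
    then show ?thesis unfolding EE_shuffle_sum[OF dv i fg] h1(2) h2(2) by auto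
  qed
  have "EE ?T (to_frac h) * Lf (PP i (del i (d + e))) = EE ?T (shuffle_sum d e f g) * Lf (PP i (del i (d + e)))"
  proof (rule fls_eqI)
    fix m
    have "(EE ?T (to_frac h) * Lf (PP i (del i (d + e)))) $$ m = to_frac (aop (d + e) i (m - 1) h)"
      by (simp only: EE_to_frac Lf_hom(1)[symmetric] Lf_hom(5) aop_def opc_def) simp
    also have "\<dots> = (EE ?T (shuffle_sum d e f g) * Lf (PP i (del i (d + e)))) $$ m" using main[of "m - 1"] by simp
    finally show "(EE ?T (to_frac h) * Lf (PP i (del i (d + e)))) $$ m = (EE ?T (shuffle_sum d e f g) * Lf (PP i (del i (d + e)))) $$ m" .
  qed
  moreover have "Lf (PP i (del i (d + e))) * Lf (PPi i (del i (d + e))) = 1"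
    unfolding Lf_hom(1)[symmetric] PP_PPi Lf_hom(2) ..
  ultimately have "EE ?T (to_frac h) = EE ?T (shuffle_sum d e f g)" using fls_unit_cancel by blast
  then have "to_frac h = shuffle_sum d e f g" by (simp only: EE_inj)
  then show ?case using h by blast
qed

end

section \<open>Framings\<close>

lemma pairing_push: "pairing \<xi> (push h p) = pairing (\<lambda>u. \<xi> (h u)) p"
  unfolding push_eq_lin_ext pairing_lin_ext by simp

definition sh :: "('v \<Rightarrow> int) \<Rightarrow> ('v \<times> int) fmon \<Rightarrow> ('v \<times> int) fmon" where
  "sh c u = FMon (map (\<lambda>(i, n). (i, n + c i)) (letters u))"

lemma sh_add: "sh c (u + v) = sh c u + sh c v" by (simp add: sh_def plus_fmon_def)

lemma sh_sh: "(\<And>i. c i + c' i = 0) \<Longrightarrow> sh c (sh c' u) = u"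
proof -
  assume c: "\<And>i. c i + c' i = 0"
  have "map (\<lambda>(i, n). (i, n + c i)) (map (\<lambda>(i, n). (i, n + c' i)) l) = l" for l
    using c by (induction l) (auto simp: add.assoc add.commute[of "c' _"])
  then show ?thesis by (simp add: sh_def)
qed

lemma push_sh_mult: "push (sh c) (p * q) = push (sh c) p * push (sh c) (q :: _ \<Rightarrow>\<^sub>0 rat)"
proof (induction p rule: pm_induct)
  case (single u)
  show ?case
  proof (induction q rule: pm_induct)
    case (single v) then show ?case by (simp add: single_mult_single sh_add)
  qed (simp_all add: push_simps distrib_left scale_mult_right)
qed (simp_all add: push_simps distrib_right scale_mult_left)

lemma push_sh_letter: "push (sh c) (letter (i, n)) = letter (i, n + c i)"
  by (simp add: letter_def sh_def)

lemma push_sum: "push h (sum f A) = (\<Sum>x\<in>A. push h (f x :: _ \<Rightarrow>\<^sub>0 rat))"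
  by (induction A rule: infinite_finite_induct) (simp_all add: push_simps)

lemma mdeg_push: "mdeg (push h m) = mdeg m"
proof -
  have "mdeg (\<Sum>x\<in>A. single (h x) (lookup m x)) = (\<Sum>x\<in>A. lookup m x)" for A
    by (induction A rule: infinite_finite_induct) (simp_all add: mdeg_add, simp_all add: mdeg_def)
  then show ?thesis unfolding push_def mdeg_def[of m] .
qed

lemma ren_hpart: "ren \<rho> (hpart mdeg k f) = hpart mdeg k (ren \<rho> f)"
proof (induction f rule: pm_induct)
  case (single m)
  have h: "hpart mdeg k (single m 1) = (if mdeg m = k then single m 1 else 0)" for m :: "'b \<Rightarrow>\<^sub>0 nat"
    by (rule poly_mapping_eqI) (auto simp: lookup_hpart lookup_single when_def)
  have h': "hpart mdeg k (single m 1) = (if mdeg m = k then single m 1 else 0)" for m :: "'a \<Rightarrow>\<^sub>0 nat"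
    by (rule poly_mapping_eqI) (auto simp: lookup_hpart lookup_single when_def)
  show ?case by (simp add: h h' ren_simps mdeg_push)
qed (simp_all add: hpart_simps ren_simps)

context symmetric_quiver
begin

lemma hpart_sym: assumes d: "d \<in> dimvecs" and f: "f \<in> sym_polys d" shows "hpart mdeg k f \<in> sym_polys d"
proof -
  have p: "pin (vset d) f" and s: "\<And>\<sigma>. sig d \<sigma> \<Longrightarrow> ren (rv \<sigma>) f = f" using f unfolding sym_iff[OF d] by blast+
  have "pin (vset d) (hpart mdeg k f)" using p by (simp add: pin_def keys_hpart)
  moreover have "ren (rv \<sigma>) (hpart mdeg k f) = hpart mdeg k f" if "sig d \<sigma>" for \<sigma>
    unfolding ren_hpart s[OF that] ..
  ultimately show ?thesis unfolding sym_iff[OF d] by blast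
qed

lemma homogeneous_iff_hd2: "homogeneous_deg2 n f \<longleftrightarrow> hd2 n f"
  by (simp add: homogeneous_deg2_def hd2_def mdeg_def)

text \<open>A homogeneous part of \<open>f\<close> in a wrong degree would pair nontrivially with
  some word, and the other parts of \<open>f\<close> do not pair with a word of that degree.\<close>

lemma homogeneous_polynomial:
  assumes d: "d \<in> dimvecs" and f: "f \<in> sym_polys d" and s: "\<And>u. Bf d u f \<noteq> 0 \<Longrightarrow> snd (wdeg (FMon u)) = N"
  shows "hd2 (- N - euler (dim_degree d) (dim_degree d)) f"
  unfolding hd2_def
proof (rule ballI, rule ccontr)
  fix m assume m: "m \<in> keys f" "2 * int (mdeg m) \<noteq> - N - euler (dim_degree d) (dim_degree d)"
  let ?h = "hpart mdeg (mdeg m) f"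
  have "lookup ?h m \<noteq> 0" using m(1) by (simp add: lookup_hpart in_keys_iff)
  then have "?h \<noteq> 0" by auto
  then obtain u where u: "Bf d u ?h \<noteq> 0" using Bf_nondegenerate[OF d hpart_sym[OF d f]] by blast
  have du: "2 * int (mdeg m) + euler (dim_degree d) (dim_degree d) + snd (wdeg (FMon u)) = 0"
    by (rule Bf_hom[OF hd2_hpart u])
  have "Bf d u (f - ?h) = 0"
  proof (rule ccontr)
    assume "Bf d u (f - ?h) \<noteq> 0"
    then obtain m' where m': "m' \<in> keys (f - ?h)" "2 * int (mdeg m') + euler (dim_degree d) (dim_degree d) + snd (wdeg (FMon u)) = 0"
      using Bf_degree by blast
    then have "mdeg m' = mdeg m" using du by linarith
    then show False using m'(1) by (simp add: in_keys_iff lookup_minus lookup_hpart)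
  qed
  then have "Bf d u f \<noteq> 0" using u by (simp add: Bf_diff)
  then show False using s[of u] du m(2) by linarith
qed

lemma framing_class_vset: "framing_class w d = (\<Prod>q\<in>vset d. mX q ^ lookup w (col q))"
  by (simp add: framing_class_def prod_vset qX_def mX_def)

lemma framing_class_0: "framing_class w 0 = 1" by (simp add: framing_class_def)

lemma pin_prod: "(\<And>x. x \<in> A \<Longrightarrow> pin S (f x)) \<Longrightarrow> pin S (prod f A)"
  by (induction A rule: infinite_finite_induct) (auto intro: pin_mult)

lemma pin_framing_class: "pin (vset d) (framing_class w d)"
  unfolding framing_class_vset by (intro pin_prod pin_power pin_mX)

lemma ren_framing: assumes "inj \<rho>" shows "ren \<rho> (\<Prod>q\<in>A. mX q ^ h q) = (\<Prod>q\<in>A. mX (\<rho> q) ^ h q)"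
proof -
  have "ren \<rho> (mX q ^ n) = mX (\<rho> q) ^ n" for q n by (induction n) (simp_all add: ren_mult[OF assms])
  then show ?thesis by (induction A rule: infinite_finite_induct) (simp_all add: ren_mult[OF assms])
qed

lemma framing_sym: assumes d: "d \<in> dimvecs" shows "framing_class w d \<in> sym_polys d"
  unfolding sym_iff[OF d]
proof (intro conjI allI impI pin_framing_class)
  fix \<sigma> assume s: "sig d \<sigma>"
  have "(\<Prod>q\<in>vset d. mX (rv \<sigma> q) ^ lookup w (col q)) = (\<Prod>q\<in>vset d. mX (rv \<sigma> q) ^ lookup w (col (rv \<sigma> q)))"
    by simp
  also have "\<dots> = (\<Prod>q\<in>vset d. mX q ^ lookup w (col q))"
    by (rule prod.reindex_bij_betw[OF sig_vset[OF s]])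
  finally show "ren (rv \<sigma>) (framing_class w d) = framing_class w d"
    unfolding framing_class_vset ren_framing[OF sig_inj[OF s]] .
qed

abbreviation "fw w \<equiv> (\<lambda>i. int (lookup w i))"

text \<open>The expanded variable contributes \<open>lookup w i\<close> powers, which shift the
  coefficient by \<open>opc_power\<close>; the remaining factors are free of it and come
  out.\<close>

lemma aop_framing:
  assumes "i \<in> verts Q" "lookup d i > 0"
  shows "aop d i n (framing_class w d * g) = framing_class w (del i d) * aop d i (n + fw w i) g"
proof -
  let ?v = "Var i (lookup d i)"
  have nin: "?v \<notin> vset (del i d)" using vset_del(2)[of i d] assms(2) by linarith
  have e: "framing_class w d = mX ?v ^ lookup w i * framing_class w (del i d)"
    unfolding framing_class_vset vset_del(1)[OF assms] prod.insert[OF finite_vset nin] by simp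
  have "pin (- {?v}) (framing_class w (del i d))"
    by (rule pin_mono[OF pin_framing_class]) (use nin in blast)
  then show ?thesis unfolding aop_def e mult.assoc opc_power by (simp add: opc_free add_ac)
qed

lemma Bf_framing: "d \<in> dimvecs \<Longrightarrow> BB d (framing_class w d * g) u = BB d g (sh (fw w) u)"
proof -
  have "Bf d u (framing_class w d * g) = Bf d (map (\<lambda>(i, n). (i, n + fw w i)) u) g" for u
  proof (induction u arbitrary: d g)
    case Nil then show ?case by (simp add: framing_class_0)
  next
    case (Cons x u)
    obtain i n where x: "x = (i, n)" by force
    show ?case using Cons by (simp add: x aop_framing)
  qed
  then show ?thesis by (simp add: sh_def)
qed

text \<open>The shift takes letters with index at least - w_i to letters with index at least 0,
  which the pairing with \<open>g\<close> kills. Words of L-degree zero are killed because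
  \<open>d\<close> is nonzero.\<close>

lemma framed_kills_Jb:
  assumes d: "d \<in> dimvecs" "d \<noteq> 0" and g: "g \<in> sym_polys d" and p: "p \<in> Jb w"
  shows "pairing (BB d (framing_class w d * g)) p = 0"
proof -
  let ?f = "framing_class w d * g"
  have fs: "?f \<in> sym_polys d" by (rule sym_mult[OF d(1) framing_sym[OF d(1)] g])
  have "Jb w \<subseteq> {p. pairing (BB d ?f) p = 0}"
    unfolding Jb_def
  proof (rule pm.span_minimal[OF _ subspace_pairing_0], intro Un_least subsetI CollectI)
    fix x assume "x \<in> rel_gens"
    then obtain u r v where x: "x = single u 1 * r * single v 1" "r \<in> rels" by blast
    show "pairing (BB d ?f) x = 0" unfolding x(1) mult.assoc by (rule pairing_prefix[OF Bf_kills_rels[OF x(2)] d(1) fs])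
  next
    fix x assume "x \<in> letter_gens (Xw w)"
    then obtain u i n where x: "x = single u 1 * letter (i, n)" "i \<in> verts Q" "n \<ge> - int (lookup w i)" by (auto simp: Xw_def)
    have "pairing (BB d ?f) x = pairing (BB d g) (push (sh (fw w)) x)"
      unfolding pairing_push Bf_framing[OF d(1)] ..
    also have "push (sh (fw w)) x = single (sh (fw w) u) 1 * letter (i, n + fw w i)"
      unfolding x(1) push_sh_mult push_sh_letter by simp
    also have "pairing (BB d g) (single (sh (fw w) u) 1 * letter (i, n + fw w i)) = 0"
      by (rule Bf_kills_J0[OF JX_gen d(1) g]) (use x in \<open>simp add: X0_def\<close>)
    finally show "pairing (BB d ?f) x = 0" .
  next
    fix x :: "('v \<times> int) walg" assume "x \<in> {single u 1 | u. ldeg u = 0}"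
    then obtain u where x: "x = single u 1" "ldeg u = 0" by blast
    have "dim_degree d \<noteq> 0" using d(2) dim_degree_inj[of d 0] by simp
    then show "pairing (BB d ?f) x = 0" using Bf_ldeg[OF d(1), of "letters u" ?f] x by (cases "BB d ?f u = 0") auto
  qed
  then show ?thesis using p by blast
qed

text \<open>Translating the indices of each colour by a constant changes only the parameters of a
  locality relation, so shifts preserve the relations.\<close>

lemma push_sh_locrel: "push (sh c) (locrel i j m n) = locrel i j (m + c i) (n + c j)"
  unfolding locrel_def by (simp add: push_sum push_simps push_sh_mult push_sh_letter add_ac diff_add_eq add_diff_eq)

lemma push_sh_rels: "r \<in> rels \<Longrightarrow> push (sh c) r \<in> rels"
  unfolding rels_def
proof (elim UnE)
  assume "r \<in> {locrel i j m n | i j m n. i \<in> verts Q \<and> j \<in> verts Q}"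
  then obtain i j m n where r: "r = locrel i j m n" "i \<in> verts Q" "j \<in> verts Q" by blast
  show "push (sh c) r \<in> {locrel i j m n | i j m n. i \<in> verts Q \<and> j \<in> verts Q} \<union> {letter (i, n) | i n. i \<notin> verts Q}"
    unfolding r(1) push_sh_locrel using r(2,3) by blast
next
  assume "r \<in> {letter (i, n) | i n. i \<notin> verts Q}"
  then obtain i n where r: "r = letter (i, n)" "i \<notin> verts Q" by blast
  show "push (sh c) r \<in> {locrel i j m n | i j m n. i \<in> verts Q \<and> j \<in> verts Q} \<union> {letter (i, n) | i n. i \<notin> verts Q}"
    unfolding r(1) push_sh_letter using r(2) by blast
qed

lemma push_sh_J0: assumes "p \<in> J0" shows "push (sh (\<lambda>i. - fw w i)) p \<in> JX (Xw w)"
proof (rule linear_in_subspace[OF linear_push subspace_JX _ assms[unfolded JX_def]])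
  let ?s = "sh (\<lambda>i. - fw w i)"
  fix x assume "x \<in> rel_gens \<union> letter_gens X0"
  then show "push ?s x \<in> JX (Xw w)"
  proof (elim UnE)
    assume "x \<in> rel_gens"
    then obtain u r v where x: "x = single u 1 * r * single v 1" "r \<in> rels" by blast
    have "push ?s x = single (?s u) 1 * push ?s r * single (?s v) 1" unfolding x(1) push_sh_mult by simp
    moreover have "single (?s u) 1 * push ?s r * single (?s v) 1 \<in> II"
      unfolding II_def using push_sh_rels[OF x(2)] by (intro pm.span_base) blast
    ultimately show ?thesis using II_JX by auto
  next
    assume "x \<in> letter_gens X0"
    then obtain u i n where x: "x = single u 1 * letter (i, n)" "i \<in> verts Q" "n \<ge> 0" by (auto simp: X0_def)
    show ?thesis unfolding x(1) push_sh_mult push_sh_letter by (rule JX_gen) (use x in \<open>simp add: Xw_def\<close>)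
  qed
qed

lemma wdeg_sh: "ldeg (sh (\<lambda>i. - fw w i) u) = ldeg u" "snd (wdeg (sh (\<lambda>i. - fw w i) u)) \<le> snd (wdeg u)"
proof -
  have "fst (wdeg (FMon (map (\<lambda>(i, n). (i, n + - fw w i)) l))) = fst (wdeg (FMon l)) \<and>
    snd (wdeg (FMon (map (\<lambda>(i, n). (i, n + - fw w i)) l))) \<le> snd (wdeg (FMon l))" for l
  proof (induction l)
    case (Cons x l)
    obtain i n where "x = (i, n)" by force
    then show ?case using Cons by (simp add: gdeg_simp)
  qed simp
  from this[of "letters u"] show "ldeg (sh (\<lambda>i. - fw w i) u) = ldeg u" "snd (wdeg (sh (\<lambda>i. - fw w i) u)) \<le> snd (wdeg u)"
    unfolding sh_def by simp_all
qed

text \<open>Conjugation with the shift reduces this to the unframed case: the shift by - w carries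
  \<open>J0\<close> into \<open>JX (Xw w)\<close>, and since it does not raise degrees, the bound
  \<open>M\<close> survives.\<close>

lemma framed_representation:
  assumes d: "d \<in> dimvecs" and k: "\<And>j. j \<in> JX (Xw w) \<Longrightarrow> pairing \<eta> j = 0"
    and l: "\<And>u. \<eta> u \<noteq> 0 \<Longrightarrow> ldeg u = dim_degree d" and M: "\<And>u. \<eta> u \<noteq> 0 \<Longrightarrow> snd (wdeg u) \<ge> M"
  shows "\<exists>g\<in>sym_polys d. \<forall>u. \<eta> u = BB d (framing_class w d * g) u"
proof -
  let ?s = "sh (\<lambda>i. - fw w i)"
  have "\<exists>g\<in>sym_polys d. \<forall>u. \<eta> (?s u) = BB d g u"
  proof (rule functional_representation[OF d])
    show "pairing (\<lambda>u. \<eta> (?s u)) j = 0" if "j \<in> J0" for j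
      unfolding pairing_push[symmetric] by (rule k[OF push_sh_J0[OF that]])
    show "ldeg u = dim_degree d" if "\<eta> (?s u) \<noteq> 0" for u using l[OF that] by (simp add: wdeg_sh)
    show "snd (wdeg u) \<ge> M" if "\<eta> (?s u) \<noteq> 0" for u using M[OF that] wdeg_sh(2)[of w u] by linarith
  qed
  then obtain g where g: "g \<in> sym_polys d" "\<And>u. \<eta> (?s u) = BB d g u" by blast
  have "\<eta> u = BB d (framing_class w d * g) u" for u
    using g(2)[of "sh (fw w) u"] unfolding Bf_framing[OF d] by (simp add: sh_sh)
  then show ?thesis using g(1) by blast
qed

section \<open>The kernel of the reduced coaction\<close>

lemma shuffle_prod_pairing:
  assumes "d \<in> dimvecs" "e \<in> dimvecs" "f \<in> sym_polys d" "g \<in> sym_polys e"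
  shows "shuffle_prod d e f g \<in> sym_polys (d + e)"
    "BB (d + e) (shuffle_prod d e f g) u = zeta d e f g u"
    "pairing (BB (d + e) (shuffle_prod d e f g)) t =
      sg (dim_degree d) (dim_degree e) * pairing (\<lambda>(a, b). BB d f a * BB e g b) (Dact t (otimes 1 1))"
proof -
  obtain h where h: "h \<in> sym_polys (d + e)" "to_frac h = shuffle_sum d e f g" "\<And>u. zeta d e f g u = BB (d + e) h u"
    using shuffle_product_pairing[OF assms] by blast
  have s: "shuffle_prod d e f g = h" unfolding shuffle_prod_def h(2)[symmetric] to_frac_inj by simp
  show "shuffle_prod d e f g \<in> sym_polys (d + e)" "BB (d + e) (shuffle_prod d e f g) u = zeta d e f g u"
    unfolding s using h by simp_all
  have "pairing (BB (d + e) h) t = pairing (zeta d e f g) t" by (rule pairing_fun_cong) (simp add: h(3))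
  then show "pairing (BB (d + e) (shuffle_prod d e f g)) t =
      sg (dim_degree d) (dim_degree e) * pairing (\<lambda>(a, b). BB d f a * BB e g b) (Dact t (otimes 1 1))"
    unfolding s pairing_zeta .
qed

text \<open>Read off from the words that pair with the product: for such a word there are two words
  pairing with \<open>f\<close> and \<open>g\<close> whose degrees add up to its own, and these
  degrees are prescribed.\<close>

lemma shuffle_prod_homogeneous:
  assumes de: "d \<in> dimvecs" "e \<in> dimvecs" and fg: "f \<in> sym_polys d" "g \<in> sym_polys e" and h: "hd2 a f" "hd2 b g"
  shows "hd2 (a + euler (dim_degree d) (dim_degree d) + b + euler (dim_degree e) (dim_degree e) - euler (dim_degree (d + e)) (dim_degree (d + e))) (shuffle_prod d e f g)"
proof -
  note sp = shuffle_prod_pairing[OF de fg]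
  have "hd2 (- (- a - euler (dim_degree d) (dim_degree d) - b - euler (dim_degree e) (dim_degree e)) - euler (dim_degree (d + e)) (dim_degree (d + e))) (shuffle_prod d e f g)"
  proof (rule homogeneous_polynomial[OF dimvecs_add[OF de] sp(1)])
    fix u assume "Bf (d + e) u (shuffle_prod d e f g) \<noteq> 0"
    then have "zeta d e f g (FMon u) \<noteq> 0" using sp(2)[of "FMon u"] by simp
    then obtain x y where xy: "BB d f x \<noteq> 0" "BB e g y \<noteq> 0" "wdeg x + wdeg y = wdeg (FMon u)" using zeta_nonzero by blast
    have "snd (wdeg x) + snd (wdeg y) = snd (wdeg (FMon u))" unfolding xy(3)[symmetric] by simp
    then show "snd (wdeg (FMon u)) = - a - euler (dim_degree d) (dim_degree d) - b - euler (dim_degree e) (dim_degree e)"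
      using Bf_hom[OF h(1) xy(1)] Bf_hom[OF h(2) xy(2)] by simp
  qed
  then show ?thesis by (simp add: algebra_simps)
qed

lemma ldeg_dimvec: "set u \<subseteq> verts Q \<times> UNIV \<Longrightarrow> \<exists>d\<in>dimvecs. ldeg (FMon u) = dim_degree d"
proof (induction u)
  case Nil show ?case by (rule bexI[of _ 0]) simp_all
next
  case (Cons x u)
  obtain i n where x: "x = (i, n)" by force
  obtain d where d: "d \<in> dimvecs" "ldeg (FMon u) = dim_degree d" using Cons by auto
  have i: "single i 1 \<in> dimvecs" using Cons.prems by (simp add: dimvecs_def x)
  show ?case
  proof (rule bexI[OF _ dimvecs_add[OF i d(1)]])
    show "ldeg (FMon (x # u)) = dim_degree (single i 1 + d)"
      unfolding x wdeg_simps fst_add dim_degree_add d(2) dim_degree_single gdeg_simp by simp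
  qed
qed

text \<open>A word with a letter outside the quiver lies in \<open>II\<close>, so only words in
  vertices of the quiver can have a nonzero value.\<close>

lemma kills_II_dimvec:
  assumes k: "\<And>j. j \<in> II \<Longrightarrow> pairing \<xi> j = 0" and u: "\<xi> u \<noteq> 0"
  shows "\<exists>d\<in>dimvecs. ldeg u = dim_degree d"
proof -
  have "set (letters u) \<subseteq> verts Q \<times> UNIV"
  proof (rule ccontr)
    assume "\<not> set (letters u) \<subseteq> verts Q \<times> UNIV"
    then obtain i n where x: "(i, n) \<in> set (letters u)" "i \<notin> verts Q" by auto
    then obtain as bs where l: "letters u = as @ (i, n) # bs" by (meson split_list)
    have "u = FMon as + FMon [(i, n)] + FMon bs" using l by (cases u) (simp add: plus_fmon_def)
    then have "single u 1 = single (FMon as) 1 * letter (i, n) * single (FMon bs) (1 :: rat)"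
      by (simp add: letter_def single_mult_single)
    also have "\<dots> \<in> II" unfolding II_def using x(2) by (intro pm.span_base) (unfold rels_def, blast)
    finally show False using k[of "single u 1"] u by simp
  qed
  then show ?thesis using ldeg_dimvec[of "letters u"] by simp
qed

lemma homogeneous_representation:
  assumes k: "\<And>j. j \<in> J0 \<Longrightarrow> pairing \<xi> j = 0" and s: "\<And>u. wdeg u \<noteq> a \<Longrightarrow> \<xi> u = 0" and n: "\<xi> u0 \<noteq> 0"
  shows "\<exists>d\<in>dimvecs. \<exists>f\<in>sym_polys d. fst a = dim_degree d \<and> hd2 (- snd a - euler (dim_degree d) (dim_degree d)) f \<and> (\<forall>u. \<xi> u = BB d f u)"
proof -
  have a: "wdeg u = a" if "\<xi> u \<noteq> 0" for u using s that by blast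
  obtain d where d: "d \<in> dimvecs" "ldeg u0 = dim_degree d"
    using kills_II_dimvec[of \<xi> u0] k subsetD[OF II_JX] n by blast
  have fa: "fst a = dim_degree d" using d(2) a[OF n] by simp
  have "\<exists>f\<in>sym_polys d. \<forall>u. \<xi> u = BB d f u"
    by (rule functional_representation[where M="snd a", OF d(1) k]) (use a fa in auto)
  then obtain f where f: "f \<in> sym_polys d" "\<And>u. \<xi> u = BB d f u" by blast
  have "hd2 (- snd a - euler (dim_degree d) (dim_degree d)) f"
    by (rule homogeneous_polynomial[OF d(1) f(1)]) (use a f(2) in \<open>metis fmon.sel\<close>)
  then show ?thesis using d f fa by blast
qed

text \<open>Since \<open>Jb w\<close> contains the words of L-degree zero, the dimension vector is
  nonzero; this matches the condition d > 0 in the framing ideal. The degree \<open>snd a\<close>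
  itself serves as lower bound.\<close>

lemma homogeneous_framed_representation:
  assumes k: "\<And>j. j \<in> Jb w \<Longrightarrow> pairing \<xi> j = 0" and s: "\<And>u. wdeg u \<noteq> a \<Longrightarrow> \<xi> u = 0" and n: "\<xi> u0 \<noteq> 0"
  shows "\<exists>d\<in>dimvecs. \<exists>g\<in>sym_polys d. d \<noteq> 0 \<and> (\<exists>b. hd2 b (framing_class w d * g)) \<and> (\<forall>u. \<xi> u = BB d (framing_class w d * g) u)"
proof -
  have a: "wdeg u = a" if "\<xi> u \<noteq> 0" for u using s that by blast
  have kI: "pairing \<xi> j = 0" if "j \<in> II" for j using k[OF subsetD[OF JX_Jb subsetD[OF II_JX that]]] .
  obtain d where d: "d \<in> dimvecs" "ldeg u0 = dim_degree d" using kills_II_dimvec[of \<xi> u0] kI n by blast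
  have "ldeg u0 \<noteq> 0" using k[OF Jb_single] n by auto
  then have d0: "d \<noteq> 0" using d(2) by auto
  have fa: "fst a = dim_degree d" using d(2) a[OF n] by simp
  have "\<exists>g\<in>sym_polys d. \<forall>u. \<xi> u = BB d (framing_class w d * g) u"
    by (rule framed_representation[where M="snd a", OF d(1) k[OF subsetD[OF JX_Jb]]]) (use a fa in auto)
  then obtain g where g: "g \<in> sym_polys d" "\<And>u. \<xi> u = BB d (framing_class w d * g) u" by blast
  have "hd2 (- snd a - euler (dim_degree d) (dim_degree d)) (framing_class w d * g)"
    by (rule homogeneous_polynomial[OF d(1) sym_mult[OF d(1) framing_sym[OF d(1)] g(1)]]) (use a g(2) in \<open>metis fmon.sel\<close>)
  then show ?thesis using d d0 g by blast
qed

section \<open>The kernel as the orthogonal complement of the framing ideal\<close>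

definition "ker_lift w = {t. Dact t (otimes 1 1) \<in> tensor_ker J0 (Jb w)}"

lemma ker_lift_kills:
  assumes "t \<in> ker_lift w" "d \<in> dimvecs" "e \<in> dimvecs" "e \<noteq> 0" "f \<in> sym_polys d" "g \<in> sym_polys e"
  shows "pairing (BB (d + e) (shuffle_prod d e f (framing_class w e * g))) t = 0"
proof -
  have fg: "framing_class w e * g \<in> sym_polys e" by (rule sym_mult[OF assms(3) framing_sym[OF assms(3)] assms(6)])
  have "Dact t (otimes 1 1) \<in> tensor_ker J0 (Jb w)" using assms(1) by (simp add: ker_lift_def)
  then have "pairing (\<lambda>(a, b). BB d f a * BB e (framing_class w e * g) b) (Dact t (otimes 1 1)) = 0"
    by (rule pairing_tensor_ker[OF _ Bf_kills_J0[OF _ assms(2,5)] framed_kills_Jb[OF assms(3,4,6)]])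
  then show ?thesis unfolding shuffle_prod_pairing(3)[OF assms(2,3,5) fg] by simp
qed

text \<open>By \<open>tensor_ker_separation\<close> only products of two homogeneous forms have to
  be tested, and these come from some \<open>f\<close> and some multiple of the framing class.
  Testing homogeneous pairs only is what \<open>functional_lift\<close> can offer, as the pairing is
  prescribed there in one degree.\<close>

lemma ker_lift_I:
  assumes k: "\<And>d e f g a b. d \<in> dimvecs \<Longrightarrow> e \<in> dimvecs \<Longrightarrow> e \<noteq> 0 \<Longrightarrow> f \<in> sym_polys d \<Longrightarrow> g \<in> sym_polys e \<Longrightarrow>
    hd2 a f \<Longrightarrow> hd2 b (framing_class w e * g) \<Longrightarrow> pairing (BB (d + e) (shuffle_prod d e f (framing_class w e * g))) t = 0"
  shows "t \<in> ker_lift w"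
  unfolding ker_lift_def
proof (rule CollectI, rule tensor_ker_separation[OF graded_JX graded_Jb])
  fix \<xi> \<eta> :: "('v \<times> int) fmon \<Rightarrow> rat" and a b
  assume x: "\<And>j. j \<in> J0 \<Longrightarrow> pairing \<xi> j = 0" "\<And>u. wdeg u \<noteq> a \<Longrightarrow> \<xi> u = 0"
    and e: "\<And>j. j \<in> Jb w \<Longrightarrow> pairing \<eta> j = 0" "\<And>u. wdeg u \<noteq> b \<Longrightarrow> \<eta> u = 0"
  show "pairing (\<lambda>(u, v). \<xi> u * \<eta> v) (Dact t (otimes 1 1)) = 0"
  proof (cases "(\<exists>u. \<xi> u \<noteq> 0) \<and> (\<exists>u. \<eta> u \<noteq> 0)")
    case False
    then have z: "\<xi> u * \<eta> v = 0" for u v by auto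
    show ?thesis unfolding pairing_eq case_prod_unfold z by simp
  next
    case True
    then obtain u0 v0 where n: "\<xi> u0 \<noteq> 0" "\<eta> v0 \<noteq> 0" by blast
    obtain d f where df: "d \<in> dimvecs" "f \<in> sym_polys d" "hd2 (- snd a - euler (dim_degree d) (dim_degree d)) f" "\<And>u. \<xi> u = BB d f u"
      using homogeneous_representation[OF x n(1)] by blast
    obtain d' g c where g: "d' \<in> dimvecs" "g \<in> sym_polys d'" "d' \<noteq> 0" "hd2 c (framing_class w d' * g)" "\<And>u. \<eta> u = BB d' (framing_class w d' * g) u"
      using homogeneous_framed_representation[OF e n(2)] by blast
    have "pairing (BB (d + d') (shuffle_prod d d' f (framing_class w d' * g))) t = 0"
      by (rule k[OF df(1) g(1) g(3) df(2) g(2) df(3) g(4)])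
    then have "pairing (\<lambda>(a, b). BB d f a * BB d' (framing_class w d' * g) b) (Dact t (otimes 1 1)) = 0"
      unfolding shuffle_prod_pairing(3)[OF df(1) g(1) df(2) sym_mult[OF g(1) framing_sym[OF g(1)] g(2)]] by simp
    then show ?thesis by (simp only: df(4) g(5))
  qed
qed

lemma coaction_kernel_ker_lift: "coaction_kernel w = q0 ` ker_lift w"
  unfolding coaction_kernel_eq ker_lift_def ..

end

section \<open>The graded dual of the CoHA-module\<close>

text \<open>The vectors \<open>(b u y)\<close>, indexed by the elements \<open>y\<close> of a basis of \<open>H\<close>, span the whole
  coordinate space, since a linear form that kills them is a vector of \<open>H\<close> that \<open>b\<close> kills.\<close>

lemma finite_dual:
  fixes b :: "'u \<Rightarrow> ('x \<Rightarrow>\<^sub>0 rat) \<Rightarrow> rat"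
  assumes H: "pm.subspace H" "H \<subseteq> pm.span T" "finite T"
    and b: "\<And>u f g. b u (f + g) = b u f + b u g" "\<And>u c f. b u (scale c f) = c * b u f"
    and nd: "\<And>f. f \<in> H \<Longrightarrow> (\<And>u. u \<in> A \<Longrightarrow> b u f = 0) \<Longrightarrow> f = 0"
    and l: "\<And>f g. f \<in> H \<Longrightarrow> g \<in> H \<Longrightarrow> l (f + g) = l f + l g" "\<And>c f. f \<in> H \<Longrightarrow> l (scale c f) = c * l f"
  shows "\<exists>t. keys t \<subseteq> A \<and> (\<forall>f\<in>H. pairing (\<lambda>u. b u f) t = l f)"
proof -
  obtain B where B: "B \<subseteq> H" "pm.independent B" "H \<subseteq> pm.span B"
    using pm.basis_exists[of H] by metis
  have fB: "finite B" using pm.independent_span_bound[OF H(3) B(2) subset_trans[OF B(1) H(2)]] ..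
  define v where "v u = (\<Sum>y\<in>B. single y (b u y))" for u
  define p where "p = (\<Sum>y\<in>B. single y (l y))"
  have b0: "b u 0 = 0" for u using b(2)[of u 0 0] by simp
  have bsum: "b u (\<Sum>y\<in>C. scale (\<xi> y) y) = (\<Sum>y\<in>C. \<xi> y * b u y)" for u C \<xi>
    by (induction C rule: infinite_finite_induct) (simp_all add: b b0)
  have "p \<in> pm.span (v ` A)"
  proof (rule graded_separation[of "\<lambda>_. ()"])
    show "graded_subspace (\<lambda>_. ()) (pm.span (v ` A))" by (rule graded_subspace_span) simp
    fix \<xi> :: "('x \<Rightarrow>\<^sub>0 rat) \<Rightarrow> rat" and a :: unit
    assume k: "\<And>j. j \<in> pm.span (v ` A) \<Longrightarrow> pairing \<xi> j = 0"
    have z: "(\<Sum>y\<in>B. scale (\<xi> y) y) = 0"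
    proof (rule nd)
      show "(\<Sum>y\<in>B. scale (\<xi> y) y) \<in> H" using B(1) by (intro pm.subspace_sum[OF H(1)] pm.subspace_scale[OF H(1)]) blast
      fix u assume "u \<in> A"
      then have "pairing \<xi> (v u) = 0" by (intro k pm.span_base imageI)
      then show "b u (\<Sum>y\<in>B. scale (\<xi> y) y) = 0" by (simp add: bsum v_def pairing_sum mult.commute)
    qed
    have "\<xi> y = 0" if "y \<in> B" for y by (rule pm.independentD[OF B(2) fB subset_refl z that])
    then show "pairing \<xi> p = 0" by (simp add: p_def pairing_sum)
  qed
  then have "\<exists>t. keys t \<subseteq> A \<and> lin_ext scale v t = p"
  proof (induction rule: pm.span_induct_alt)
    case base show ?case by (intro exI[of _ 0]) (simp add: lin_scale_simps)
  next
    case (step c x y)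
    then obtain u t where ut: "u \<in> A" "x = v u" "keys t \<subseteq> A" "lin_ext scale v t = y" by blast
    have "keys (single u c + t) \<subseteq> A" using keys_add[of "single u c" t] ut by (auto split: if_splits)
    then show ?case using ut by (intro exI[of _ "single u c + t"]) (simp add: lin_scale_simps)
  qed
  then obtain t where t: "keys t \<subseteq> A" "lin_ext scale v t = p" by blast
  have lv: "lookup (\<Sum>y\<in>B. single y (h y)) x = h x" if "x \<in> B" for h :: "_ \<Rightarrow> rat" and x
    using that fB by (simp add: lookup_sum lookup_single when_def)
  have tB: "pairing (\<lambda>u. b u x) t = l x" if "x \<in> B" for x
  proof -
    have "lookup (lin_ext scale v t) x = pairing (\<lambda>u. b u x) t"
      unfolding lookup_lin_ext v_def lv[OF that] ..
    then show ?thesis unfolding t(2) p_def lv[OF that] by simp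
  qed
  have "f \<in> H \<and> pairing (\<lambda>u. b u f) t = l f" if "f \<in> pm.span B" for f
    using that
  proof (induction rule: pm.span_induct_alt)
    case base
    have "l 0 = 0" using l(2)[OF pm.subspace_0[OF H(1)], of 0] by simp
    then show ?case using pm.subspace_0[OF H(1)] by (simp add: b0 pairing_eq)
  next
    case (step c x y)
    then have x: "x \<in> H" using B(1) by blast
    then have cx: "scale c x \<in> H" by (rule pm.subspace_scale[OF H(1)])
    have "pairing (\<lambda>u. b u (scale c x + y)) t = l (scale c x + y)"
      unfolding b pairing_fun_add pairing_fun_mult tB[OF step(1)] using step cx x l by simp
    then show ?case using step cx by (simp add: pm.subspace_add[OF H(1)])
  qed
  then show ?thesis using t(1) B(3) by blast
qed

text \<open>Gives the finite-dimensionality of the homogeneous components, on which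
  \<open>finite_dual\<close> relies.\<close>

lemma finite_monomials: assumes "finite V" shows "finite {m :: 'x \<Rightarrow>\<^sub>0 nat. keys m \<subseteq> V \<and> mdeg m = k}"
proof (rule finite_imageD)
  let ?F = "{f :: 'x \<Rightarrow> nat. \<forall>x. (x \<in> V \<longrightarrow> f x \<in> {0..k}) \<and> (x \<notin> V \<longrightarrow> f x = 0)}"
  have "lookup ` {m :: 'x \<Rightarrow>\<^sub>0 nat. keys m \<subseteq> V \<and> mdeg m = k} \<subseteq> ?F"
  proof (intro image_subsetI CollectI allI conjI impI)
    fix m :: "'x \<Rightarrow>\<^sub>0 nat" and x assume m: "m \<in> {m. keys m \<subseteq> V \<and> mdeg m = k}"
    { assume x: "x \<in> V"
      have "lookup m x \<le> (\<Sum>v\<in>V. lookup m v)" using x assms by (intro member_le_sum) auto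
      then show "lookup m x \<in> {0..k}" using m mdeg_superset[OF assms, of m] by simp }
    show "x \<notin> V \<Longrightarrow> lookup m x = 0" using m by (auto simp: in_keys_iff)
  qed
  then show "finite (lookup ` {m :: 'x \<Rightarrow>\<^sub>0 nat. keys m \<subseteq> V \<and> mdeg m = k})"
    by (rule finite_subset) (rule finite_set_of_finite_funs[OF assms finite_atLeastAtMost])
  show "inj_on lookup {m :: 'x \<Rightarrow>\<^sub>0 nat. keys m \<subseteq> V \<and> mdeg m = k}"
    by (rule inj_onI) (metis poly_mapping_eqI)
qed

definition coha_scale :: "rat \<Rightarrow> ('v dimvec \<Rightarrow>\<^sub>0 'v qpoly) \<Rightarrow> 'v dimvec \<Rightarrow>\<^sub>0 'v qpoly" where
  "coha_scale c = Poly_Mapping.map (scale c)"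

lemma lookup_coha_scale [simp]: "lookup (coha_scale c h) d = scale c (lookup h d)"
  by (simp add: coha_scale_def Poly_Mapping.map.rep_eq when_def)

lemma coha_scale_single: "coha_scale c (single d p) = single d (scale c p)"
  by (rule poly_mapping_eqI) (simp add: lookup_single when_def)

lemma vector_space_coha_scale: "vector_space coha_scale"
  by unfold_locales (auto intro!: poly_mapping_eqI simp: lookup_add pm.scale_right_distrib pm.scale_left_distrib)

interpretation cv: vector_space "coha_scale :: rat \<Rightarrow> ('v dimvec \<Rightarrow>\<^sub>0 'v qpoly) \<Rightarrow> _"
  by (rule vector_space_coha_scale)

context symmetric_quiver
begin

abbreviation "CH \<equiv> carrier coha"

lemma CH_iff: "h \<in> CH \<longleftrightarrow> keys h \<subseteq> dimvecs \<and> (\<forall>d\<in>dimvecs. lookup h d \<in> sym_polys d)"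
  by (simp add: coha_def)

lemma CH_single: "d \<in> dimvecs \<Longrightarrow> f \<in> sym_polys d \<Longrightarrow> single d f \<in> CH"
  by (simp add: CH_iff lookup_single when_def sym_add(3))

lemma subspace_CH: "cv.subspace CH"
proof (rule cv.subspaceI)
  show "0 \<in> CH" by (simp add: CH_iff sym_add(3))
  show "x + y \<in> CH" if "x \<in> CH" "y \<in> CH" for x y
    using that keys_add[of x y] unfolding CH_iff lookup_add by (blast intro: sym_add(1))
  show "coha_scale c x \<in> CH" if "x \<in> CH" for c x
  proof -
    have "keys (coha_scale c x) \<subseteq> keys x" by (auto simp: in_keys_iff)
    then show ?thesis using that unfolding CH_iff lookup_coha_scale by (blast intro: sym_add(2))
  qed
qed

sublocale CO: presentation coha_scale CH coha id
proof
  show "pres coha_scale CH coha id" unfolding pres_def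
    using vector_space_coha_scale subspace_CH by (simp add: coha_def coha_scale_def)
qed

lemma coha_comp_iff: "h \<in> coha_comp (\<alpha>, n) \<longleftrightarrow> h \<in> CH \<and> (\<forall>d\<in>keys h. dim_degree d = \<alpha> \<and>
    hd2 (n - euler (dim_degree d) (dim_degree d)) (lookup h d))"
  by (simp add: coha_comp_def homogeneous_iff_hd2)

lemma coha_comp_CH: "h \<in> coha_comp \<gamma> \<Longrightarrow> h \<in> CH"
  by (cases \<gamma>) (simp add: coha_comp_iff)

lemma coha_comp_hd2: "h \<in> coha_comp (\<alpha>, n) \<Longrightarrow> hd2 (n - euler (dim_degree d) (dim_degree d)) (lookup h d)"
proof (cases "d \<in> keys h")
  case True
  assume "h \<in> coha_comp (\<alpha>, n)"
  then show ?thesis using True unfolding coha_comp_iff by blast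
qed (simp add: in_keys_iff)

lemma coha_comp_single: "d \<in> dimvecs \<Longrightarrow> f \<in> sym_polys d \<Longrightarrow> hd2 (n - euler (dim_degree d) (dim_degree d)) f \<Longrightarrow>
    single d f \<in> coha_comp (dim_degree d, n)"
  by (simp add: coha_comp_iff CH_single)

lemma subspace_coha_comp: "cv.subspace (coha_comp \<gamma>)"
proof (cases \<gamma>)
  case (Pair \<alpha> n)
  show ?thesis unfolding Pair
  proof (rule cv.subspaceI)
    show "0 \<in> coha_comp (\<alpha>, n)" by (simp add: coha_comp_iff)
    show "x + y \<in> coha_comp (\<alpha>, n)" if xy: "x \<in> coha_comp (\<alpha>, n)" "y \<in> coha_comp (\<alpha>, n)" for x y
      unfolding coha_comp_iff
    proof (intro conjI ballI)
      show "x + y \<in> CH" using xy by (intro CO.Dadd coha_comp_CH)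
      fix d assume "d \<in> keys (x + y)"
      then have "d \<in> keys x \<or> d \<in> keys y" using keys_add[of x y] by blast
      then show "dim_degree d = \<alpha>" using xy by (auto simp: coha_comp_iff)
      show "hd2 (n - euler (dim_degree d) (dim_degree d)) (lookup (x + y) d)"
        unfolding lookup_add using xy by (intro hd2_add coha_comp_hd2)
    qed
    show "coha_scale c x \<in> coha_comp (\<alpha>, n)" if x: "x \<in> coha_comp (\<alpha>, n)" for c x
      unfolding coha_comp_iff
    proof (intro conjI ballI)
      show "coha_scale c x \<in> CH" using x by (intro CO.Dscale coha_comp_CH)
      fix d assume "d \<in> keys (coha_scale c x)"
      then have "d \<in> keys x" by (auto simp: in_keys_iff)
      then show "dim_degree d = \<alpha>" using x by (auto simp: coha_comp_iff)
      show "hd2 (n - euler (dim_degree d) (dim_degree d)) (lookup (coha_scale c x) d)"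
        unfolding lookup_coha_scale using x by (intro hd2_scale coha_comp_hd2)
    qed
  qed
qed

lemma shuffle_prod_0: "shuffle_prod d e 0 g = 0" "shuffle_prod d e f 0 = 0"
proof -
  have z: "shuffle_sum d e 0 g = to_frac 0" "shuffle_sum d e f 0 = to_frac 0"
    unfolding shuffle_sum_def reindex_ren ren_simps(4) to_frac_simps(4) by simp_all
  show "shuffle_prod d e 0 g = 0" "shuffle_prod d e f 0 = 0"
    unfolding shuffle_prod_def z to_frac_inj by simp_all
qed

lemma coha_mult_single: "single d f \<otimes>\<^bsub>coha\<^esub> single e g = single (d + e) (shuffle_prod d e f g)"
  by (cases "f = 0"; cases "g = 0") (simp_all add: coha_def shuffle_prod_0)

definition "framing_gens w = {single (d' + d) (shuffle_prod d' d f (framing_class w d * g)) | d' d f g.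
        d' \<in> dimvecs \<and> d \<in> dimvecs \<and> d \<noteq> 0 \<and> f \<in> sym_polys d' \<and> g \<in> sym_polys d}"

definition "framing_span w = cv.span (framing_gens w)"

lemma framing_gens_CH: "framing_gens w \<subseteq> CH"
proof
  fix x assume "x \<in> framing_gens w"
  then obtain d' d f g where x: "x = single (d' + d) (shuffle_prod d' d f (framing_class w d * g))"
    and d: "d' \<in> dimvecs" "d \<in> dimvecs" "f \<in> sym_polys d'" "g \<in> sym_polys d" unfolding framing_gens_def by blast
  show "x \<in> CH" unfolding x
    by (intro CH_single dimvecs_add shuffle_prod_pairing(1) sym_mult framing_sym d)
qed

lemma framing_ideal_eq: "framing_ideal w = id ` framing_span w"
  using CO.lin_span_image[OF framing_gens_CH, of w] by (simp add: framing_ideal_def coha_mult_single framing_gens_def[symmetric] framing_span_def)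

lemma framing_span: "cv.subspace (framing_span w)" "framing_span w \<subseteq> CH" "\<And>x. x \<in> CH \<Longrightarrow> id x = id 0 \<Longrightarrow> x \<in> framing_span w"
  using CO.span_subset_D[OF framing_gens_CH] cv.span_zero by (auto simp: framing_span_def)

definition "coha_class w = CO.coset (framing_span w)"

lemma pres_coha_class: "pres coha_scale CH (coha_module w) (coha_class w)"
  unfolding coha_module_def framing_ideal_eq coha_class_def by (rule CO.pres_quot[OF framing_span])

lemma coha_class_eq_iff: "x \<in> CH \<Longrightarrow> y \<in> CH \<Longrightarrow> coha_class w x = coha_class w y \<longleftrightarrow> x - y \<in> framing_span w"
  unfolding coha_class_def by (rule CO.coset_eq_iff[OF framing_span])

lemma coha_module_comp_eq: "coha_module_comp w \<gamma> = coha_class w ` coha_comp \<gamma>"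
  by (simp add: coha_module_comp_def quot_comp_def coha_class_def CO.coset_def framing_ideal_eq)

section \<open>The pairing with the CoHA and the map from the kernel to the graded dual\<close>

definition coha_pairing :: "('v \<times> int) walg \<Rightarrow> ('v dimvec \<Rightarrow>\<^sub>0 'v qpoly) \<Rightarrow> rat" where
  "coha_pairing t h = (\<Sum>d\<in>keys h. pairing (BB d (lookup h d)) t)"

lemma pairing_BB: "pairing (BB d (f + g)) t = pairing (BB d f) t + pairing (BB d g) t"
  "pairing (BB d (scale c f)) t = c * pairing (BB d f) t" "pairing (BB d 0) t = 0"
  by (simp_all add: Bf_add pairing_fun_add pairing_fun_mult pairing_eq)

lemma coha_pairing_superset: "finite A \<Longrightarrow> keys h \<subseteq> A \<Longrightarrow> coha_pairing t h = (\<Sum>d\<in>A. pairing (BB d (lookup h d)) t)"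
  unfolding coha_pairing_def by (rule sum.mono_neutral_left) (auto simp: in_keys_iff pairing_BB(3))

lemma coha_pairing_single: "coha_pairing t (single d f) = pairing (BB d f) t"
  by (simp add: coha_pairing_superset[of "{d}"])

lemma coha_pairing_right: "coha_pairing t (h + h') = coha_pairing t h + coha_pairing t h'" "coha_pairing t (coha_scale c h) = c * coha_pairing t h" "coha_pairing t 0 = 0"
proof -
  show "coha_pairing t (h + h') = coha_pairing t h + coha_pairing t h'"
    using keys_add[of h h'] by (simp add: coha_pairing_superset[of "keys h \<union> keys h'"] lookup_add pairing_BB(1) sum.distrib)
  have "keys (coha_scale c h) \<subseteq> keys h" by (auto simp: in_keys_iff)
  then show "coha_pairing t (coha_scale c h) = c * coha_pairing t h" by (simp add: coha_pairing_superset[of "keys h"] pairing_BB(2) sum_distrib_left)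
qed (simp add: coha_pairing_def)

lemma coha_pairing_left: "coha_pairing (t + t') h = coha_pairing t h + coha_pairing t' h" "coha_pairing (scale c t) h = c * coha_pairing t h" "coha_pairing (t - t') h = coha_pairing t h - coha_pairing t' h"
  "coha_pairing 0 h = 0" "coha_pairing (sum f A) h = (\<Sum>x\<in>A. coha_pairing (f x) h)"
  by (simp_all add: coha_pairing_def pairing_add pairing_scale pairing_diff sum.distrib sum_subtractf sum_distrib_left)
    (simp add: pairing_sum sum.swap[of _ A])

lemma coha_pairing_J0: "t \<in> J0 \<Longrightarrow> h \<in> CH \<Longrightarrow> coha_pairing t h = 0"
  unfolding coha_pairing_def by (intro sum.neutral ballI Bf_kills_J0) (auto simp: CH_iff)

lemma coha_pairing_framing_span: assumes "t \<in> ker_lift w" "k \<in> framing_span w" shows "coha_pairing t k = 0"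
proof -
  have "cv.subspace {k. coha_pairing t k = 0}" by (rule cv.subspaceI) (simp_all add: coha_pairing_right)
  moreover have "framing_gens w \<subseteq> {k. coha_pairing t k = 0}"
    unfolding framing_gens_def using ker_lift_kills[OF assms(1)] by (auto simp: coha_pairing_single)
  ultimately show ?thesis using cv.span_minimal[of "framing_gens w" "{k. coha_pairing t k = 0}"] assms(2) unfolding framing_span_def by blast
qed

lemma coha_pairing_comp: assumes h: "h \<in> coha_comp (\<alpha>, - n)" and n: "coha_pairing t h \<noteq> 0" shows "(\<alpha>, n) \<in> wdeg ` keys t"
proof -
  obtain d where d: "d \<in> keys h" "pairing (BB d (lookup h d)) t \<noteq> 0"
    using n unfolding coha_pairing_def by (rule sum.not_neutral_contains_not_neutral)
  obtain u where u: "u \<in> keys t" "lookup t u * BB d (lookup h d) u \<noteq> 0"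
    using d(2) unfolding pairing_eq by (rule sum.not_neutral_contains_not_neutral)
  have B: "Bf d (letters u) (lookup h d) \<noteq> 0" using u(2) by auto
  have dv: "d \<in> dimvecs" "dim_degree d = \<alpha>" using h d(1) by (auto simp: coha_comp_iff CH_iff)
  have "ldeg u = \<alpha>" using Bf_ldeg[OF dv(1) B] dv(2) by simp
  moreover have "snd (wdeg u) = n" using Bf_hom[OF coha_comp_hd2[OF h] B] by simp
  ultimately show ?thesis using u(1) by (metis image_eqI prod.collapse)
qed

text \<open>Pairing with \<open>t\<close>, read on the quotient; for \<open>t\<close> in
  \<open>ker_lift w\<close> the choice of representative does not matter. Outside the component the
  value is undefined, as \<open>comp_dual\<close> demands of its extensional functions.\<close>

definition dual_functional :: "'v dimvec \<Rightarrow> ('v \<times> int) walg \<Rightarrow> 'v degree \<Rightarrow> ('v dimvec \<Rightarrow>\<^sub>0 'v qpoly) set \<Rightarrow> rat" where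
  "dual_functional w t = (\<lambda>(\<alpha>, n). \<lambda>v\<in>coha_module_comp w (\<alpha>, - n). coha_pairing t (SOME h. h \<in> coha_comp (\<alpha>, - n) \<and> coha_class w h = v))"

lemma dual_functional_coha_class: assumes t: "t \<in> ker_lift w" and h: "h \<in> coha_comp (\<alpha>, - n)" shows "dual_functional w t (\<alpha>, n) (coha_class w h) = coha_pairing t h"
proof -
  define h' where "h' = (SOME h'. h' \<in> coha_comp (\<alpha>, - n) \<and> coha_class w h' = coha_class w h)"
  have h': "h' \<in> coha_comp (\<alpha>, - n)" "coha_class w h' = coha_class w h"
    using someI[of "\<lambda>h'. h' \<in> coha_comp (\<alpha>, - n) \<and> coha_class w h' = coha_class w h" h] h by (auto simp: h'_def)
  then have "h' - h \<in> framing_span w" using coha_class_eq_iff[OF coha_comp_CH[OF h'(1)] coha_comp_CH[OF h]] by blast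
  then have "coha_pairing t (h' - h) = 0" by (rule coha_pairing_framing_span[OF t])
  then have "coha_pairing t h' = coha_pairing t h" using coha_pairing_right(1)[of t "h' - h" h] by simp
  then show ?thesis using h by (simp add: dual_functional_def h'_def coha_module_comp_eq)
qed

lemma dual_linear:
  assumes f: "f \<in> lin_maps (coha_module w\<lparr>carrier := coha_module_comp w \<gamma>\<rparr>) rat_space"
  shows "h \<in> coha_comp \<gamma> \<Longrightarrow> h' \<in> coha_comp \<gamma> \<Longrightarrow> f (coha_class w (h + h')) = f (coha_class w h) + f (coha_class w h')"
    "h \<in> coha_comp \<gamma> \<Longrightarrow> f (coha_class w (coha_scale c h)) = c * f (coha_class w h)" "f (coha_class w 0) = 0"
proof -
  interpret M: presentation coha_scale CH "coha_module w" "coha_class w" by unfold_locales (rule pres_coha_class)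
  have a: "f (x \<oplus>\<^bsub>coha_module w\<^esub> y) = f x + f y" if "x \<in> coha_module_comp w \<gamma>" "y \<in> coha_module_comp w \<gamma>" for x y
    using f that by (simp add: lin_maps_def rat_space_def)
  have s: "f (c \<odot>\<^bsub>coha_module w\<^esub> x) = c * f x" if "x \<in> coha_module_comp w \<gamma>" for x c
    using f that by (simp add: lin_maps_def rat_space_def)
  show "h \<in> coha_comp \<gamma> \<Longrightarrow> h' \<in> coha_comp \<gamma> \<Longrightarrow> f (coha_class w (h + h')) = f (coha_class w h) + f (coha_class w h')"
    using a[of "coha_class w h" "coha_class w h'"] by (simp add: M.add coha_comp_CH coha_module_comp_eq)
  show sc: "h \<in> coha_comp \<gamma> \<Longrightarrow> f (coha_class w (coha_scale c h)) = c * f (coha_class w h)" for h c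
    using s[of "coha_class w h" c] by (simp add: M.smul coha_comp_CH coha_module_comp_eq)
  show "f (coha_class w 0) = 0" using sc[of 0 0] cv.subspace_0[OF subspace_coha_comp] by simp
qed

text \<open>\<open>finite_dual\<close> yields a homogeneous \<open>t\<close> with the prescribed
  pairing. It lies in \<open>ker_lift w\<close> because a generator of the framing ideal either has
  another degree, where \<open>t\<close> pairs to zero, or is zero in the quotient, where
  \<open>f\<close> vanishes.\<close>

lemma functional_lift:
  assumes f: "f \<in> lin_maps (coha_module w\<lparr>carrier := coha_module_comp w (\<alpha>, - n)\<rparr>) rat_space"
  shows "\<exists>t\<in>ker_lift w. homog (\<alpha>, n) t \<and> (\<forall>h\<in>coha_comp (\<alpha>, - n). coha_pairing t h = f (coha_class w h))"
proof -
  note fl = dual_linear[OF f]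
  have "\<exists>t. homog (\<alpha>, n) t \<and> (\<forall>h\<in>coha_comp (\<alpha>, - n). coha_pairing t h = f (coha_class w h))"
  proof (cases "\<exists>d\<in>dimvecs. dim_degree d = \<alpha>")
    case False
    have "h = 0" if "h \<in> coha_comp (\<alpha>, - n)" for h
    proof -
      have "keys h = {}"
      proof (rule equals0I)
        fix d assume "d \<in> keys h"
        then have "d \<in> dimvecs" "dim_degree d = \<alpha>" using that by (auto simp: coha_comp_iff CH_iff)
        then show False using False by blast
      qed
      then show ?thesis by simp
    qed
    then show ?thesis using fl(3) by (intro exI[of _ 0]) (auto simp: homog_simps coha_pairing_left(4))
  next
    case True
    then obtain d where d: "d \<in> dimvecs" "dim_degree d = \<alpha>" by blast
    let ?n = "- n - euler (dim_degree d) (dim_degree d)"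
    define H where "H = {p \<in> sym_polys d. hd2 ?n p}"
    define Ms where "Ms = {m. keys m \<subseteq> vset d \<and> mdeg m = nat (?n div 2)}"
    have Hc: "single d p \<in> coha_comp (\<alpha>, - n)" if "p \<in> H" for p
      using coha_comp_single[OF d(1), of p "- n"] that d(2) by (simp add: H_def)
    have "\<exists>t. keys t \<subseteq> {u. wdeg u = (\<alpha>, n)} \<and> (\<forall>p\<in>H. pairing (\<lambda>u. BB d p u) t = f (coha_class w (single d p)))"
    proof (rule finite_dual[where T="(\<lambda>m. single m 1) ` Ms"])
      show "pm.subspace H"
        by (rule pm.subspaceI) (auto simp: H_def intro: sym_add[OF d(1)] hd2_add hd2_scale)
      show "finite ((\<lambda>m. single m (1::rat)) ` Ms)" unfolding Ms_def by (intro finite_imageI finite_monomials finite_vset)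
      show "H \<subseteq> pm.span ((\<lambda>m. single m 1) ` Ms)"
      proof
        fix p assume p: "p \<in> H"
        have "pin (vset d) p" using p by (simp add: H_def sym_iff[OF d(1)])
        then have "keys p \<subseteq> Ms" using p by (auto simp: H_def hd2_def pin_def Ms_def)
        then show "p \<in> pm.span ((\<lambda>m. single m 1) ` Ms)"
          by (intro subsetD[OF pm.span_mono pm_in_span] image_mono)
      qed
      \<comment> \<open>Words of any other degree pair to zero with \<open>H\<close>, so the words
        of degree (\<alpha>, n) already detect its elements.\<close>
      show "p = 0" if p: "p \<in> H" "\<And>u. u \<in> {u. wdeg u = (\<alpha>, n)} \<Longrightarrow> BB d p u = 0" for p
      proof (rule Bf_nondegenerate[OF d(1)])
        show "p \<in> sym_polys d" using p by (simp add: H_def)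
        show "Bf d u p = 0" for u
        proof (rule ccontr)
          assume B: "Bf d u p \<noteq> 0"
          have "hd2 ?n p" using p by (simp add: H_def)
          then have "snd (wdeg (FMon u)) = n" using Bf_hom[OF _ B] by fastforce
          then have "wdeg (FMon u) = (\<alpha>, n)" using Bf_ldeg[OF d(1) B] d(2) by (intro prod_eqI) simp_all
          then show False using p(2)[of "FMon u"] B by simp
        qed
      qed
      show "f (coha_class w (single d (p + p'))) = f (coha_class w (single d p)) + f (coha_class w (single d p'))" if "p \<in> H" "p' \<in> H" for p p'
        unfolding single_add by (rule fl(1)[OF Hc[OF that(1)] Hc[OF that(2)]])
      show "f (coha_class w (single d (scale c p))) = c * f (coha_class w (single d p))" if "p \<in> H" for c p
        unfolding coha_scale_single[symmetric] by (rule fl(2)[OF Hc[OF that]])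
    qed (simp_all add: Bf_add)
    then obtain t where t: "keys t \<subseteq> {u. wdeg u = (\<alpha>, n)}" "\<And>p. p \<in> H \<Longrightarrow> pairing (BB d p) t = f (coha_class w (single d p))" by blast
    have "coha_pairing t h = f (coha_class w h)" if h: "h \<in> coha_comp (\<alpha>, - n)" for h
    proof -
      have "keys h \<subseteq> {d}" using h d(2) dim_degree_inj by (auto simp: coha_comp_iff)
      then have z: "lookup h k = 0" if "k \<noteq> d" for k using that by (auto simp: in_keys_iff)
      have e: "h = single d (lookup h d)"
      proof (rule poly_mapping_eqI)
        fix k show "lookup h k = lookup (single d (lookup h d)) k" by (cases "k = d") (simp_all add: z lookup_single)
      qed
      have "lookup h d \<in> H" using coha_comp_hd2[OF h, of d] coha_comp_CH[OF h] d(1) by (simp add: H_def CH_iff)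
      then show ?thesis using t(2) e coha_pairing_single[of t d "lookup h d"] by simp
    qed
    then show ?thesis using t(1) by (intro exI[of _ t]) (auto simp: homog_def)
  qed
  then obtain t where t: "homog (\<alpha>, n) t" "\<And>h. h \<in> coha_comp (\<alpha>, - n) \<Longrightarrow> coha_pairing t h = f (coha_class w h)" by blast
  have "t \<in> ker_lift w"
  proof (rule ker_lift_I, rule ccontr)
    fix d e p g a b
    assume d: "d \<in> dimvecs" "e \<in> dimvecs" "e \<noteq> 0" "p \<in> sym_polys d" "g \<in> sym_polys e" and h: "hd2 a p" "hd2 b (framing_class w e * g)"
    let ?s = "shuffle_prod d e p (framing_class w e * g)"
    let ?N = "a + euler (dim_degree d) (dim_degree d) + b + euler (dim_degree e) (dim_degree e)"
    assume n0: "pairing (BB (d + e) ?s) t \<noteq> 0"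
    have fg: "framing_class w e * g \<in> sym_polys e" by (rule sym_mult[OF d(2) framing_sym[OF d(2)] d(5)])
    have c: "single (d + e) ?s \<in> coha_comp (dim_degree (d + e), - (- ?N))"
      by (rule coha_comp_single[OF dimvecs_add[OF d(1,2)] shuffle_prod_pairing(1)[OF d(1,2,4) fg]])
        (unfold minus_minus, rule shuffle_prod_homogeneous[OF d(1,2,4) fg h])
    have "(dim_degree (d + e), - ?N) \<in> wdeg ` keys t" by (rule coha_pairing_comp[OF c]) (use n0 in \<open>simp add: coha_pairing_single\<close>)
    then have e: "dim_degree (d + e) = \<alpha>" "- ?N = n" using t(1) by (auto simp: homog_def)
    have c': "single (d + e) ?s \<in> coha_comp (\<alpha>, - n)" using c unfolding e .
    have "single (d + e) ?s \<in> framing_gens w" unfolding framing_gens_def using d by blast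
    then have "single (d + e) ?s - 0 \<in> framing_span w" unfolding framing_span_def diff_0_right by (rule cv.span_base)
    then have "coha_class w (single (d + e) ?s) = coha_class w 0" using coha_class_eq_iff[OF coha_comp_CH[OF c'] CO.D0] by blast
    then have "pairing (BB (d + e) ?s) t = 0" using t(2)[OF c'] fl(3) by (simp add: coha_pairing_single)
    then show False using n0 by simp
  qed
  then show ?thesis using t by blast
qed

lemma subspace_ker_lift: "pm.subspace (ker_lift w)"
  by (rule pm.subspaceI) (simp_all add: ker_lift_def Dact_simps pm.subspace_0[OF subspace_tensor_ker]
    pm.subspace_add[OF subspace_tensor_ker] pm.subspace_scale[OF subspace_tensor_ker])

lemma J0_ker_lift: assumes "t \<in> J0" shows "t \<in> ker_lift w"
  by (rule ker_lift_I, rule Bf_kills_J0[OF assms]) (intro dimvecs_add shuffle_prod_pairing(1) sym_mult framing_sym; assumption)+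

lemma ker_lift_cong: assumes "q0 t = q0 t'" "t' \<in> ker_lift w" shows "t \<in> ker_lift w"
proof -
  have "t - t' \<in> ker_lift w" using assms(1) by (intro J0_ker_lift) (simp add: cq_eq_iff)
  then have "t - t' + t' \<in> ker_lift w" using assms(2) by (rule pm.subspace_add[OF subspace_ker_lift])
  then show ?thesis by simp
qed

abbreviation "module_dual w \<equiv> graded_dual (coha_module w) (coha_module_comp w)"

lemma dual_functional_carrier: assumes t: "t \<in> ker_lift w" shows "dual_functional w t \<in> carrier (module_dual w)"
proof -
  interpret M: presentation coha_scale CH "coha_module w" "coha_class w" by unfold_locales (rule pres_coha_class)
  have "dual_functional w t (\<alpha>, n) \<in> lin_maps (coha_module w\<lparr>carrier := coha_module_comp w (\<alpha>, - n)\<rparr>) rat_space" for \<alpha> n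
    unfolding lin_maps_def
  proof (intro CollectI conjI ballI allI)
    show "dual_functional w t (\<alpha>, n) \<in> carrier (coha_module w\<lparr>carrier := coha_module_comp w (\<alpha>, - n)\<rparr>) \<rightarrow>\<^sub>E carrier rat_space"
      by (simp add: dual_functional_def rat_space_def)
    fix x assume "x \<in> carrier (coha_module w\<lparr>carrier := coha_module_comp w (\<alpha>, - n)\<rparr>)"
    then obtain h where h: "h \<in> coha_comp (\<alpha>, - n)" "x = coha_class w h" by (auto simp: coha_module_comp_eq)
    { fix y assume "y \<in> carrier (coha_module w\<lparr>carrier := coha_module_comp w (\<alpha>, - n)\<rparr>)"
      then obtain h' where h': "h' \<in> coha_comp (\<alpha>, - n)" "y = coha_class w h'" by (auto simp: coha_module_comp_eq)
      have "dual_functional w t (\<alpha>, n) (coha_class w (h + h')) = coha_pairing t (h + h')"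
        by (rule dual_functional_coha_class[OF t cv.subspace_add[OF subspace_coha_comp h(1) h'(1)]])
      then show "dual_functional w t (\<alpha>, n) (x \<oplus>\<^bsub>coha_module w\<lparr>carrier := coha_module_comp w (\<alpha>, - n)\<rparr>\<^esub> y) =
          dual_functional w t (\<alpha>, n) x \<oplus>\<^bsub>rat_space\<^esub> dual_functional w t (\<alpha>, n) y"
        using h h' by (simp add: M.add coha_comp_CH dual_functional_coha_class[OF t] coha_pairing_right rat_space_def) }
    fix c
    have "dual_functional w t (\<alpha>, n) (coha_class w (coha_scale c h)) = coha_pairing t (coha_scale c h)"
      by (rule dual_functional_coha_class[OF t cv.subspace_scale[OF subspace_coha_comp h(1)]])
    then show "dual_functional w t (\<alpha>, n) (c \<odot>\<^bsub>coha_module w\<lparr>carrier := coha_module_comp w (\<alpha>, - n)\<rparr>\<^esub> x) = c \<odot>\<^bsub>rat_space\<^esub> dual_functional w t (\<alpha>, n) x"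
      using h by (simp add: M.smul coha_comp_CH dual_functional_coha_class[OF t] coha_pairing_right rat_space_def)
  qed
  then have "dual_functional w t \<gamma> \<in> comp_dual (coha_module w) (coha_module_comp w) \<gamma>" for \<gamma>
    by (cases \<gamma>) (simp add: comp_dual_def)
  moreover have "{(\<alpha>, n). \<exists>v\<in>coha_module_comp w (\<alpha>, - n). dual_functional w t (\<alpha>, n) v \<noteq> 0} \<subseteq> wdeg ` keys t"
  proof clarify
    fix \<alpha> n v assume "v \<in> coha_module_comp w (\<alpha>, - n)" and v: "dual_functional w t (\<alpha>, n) v \<noteq> 0"
    then obtain h where h: "h \<in> coha_comp (\<alpha>, - n)" "v = coha_class w h" by (auto simp: coha_module_comp_eq)
    show "(\<alpha>, n) \<in> wdeg ` keys t" using v unfolding h(2) dual_functional_coha_class[OF t h(1)] by (rule coha_pairing_comp[OF h(1)])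
  qed
  from finite_subset[OF this] have "finite {(\<alpha>, n). \<exists>v\<in>coha_module_comp w (\<alpha>, - n). dual_functional w t (\<alpha>, n) v \<noteq> 0}" by simp
  ultimately show ?thesis by (simp add: graded_dual_def)
qed

lemma dual_functional_eqI:
  assumes t: "t \<in> ker_lift w" and F: "F \<in> carrier (module_dual w)"
    and e: "\<And>\<alpha> n h. h \<in> coha_comp (\<alpha>, - n) \<Longrightarrow> coha_pairing t h = F (\<alpha>, n) (coha_class w h)"
  shows "dual_functional w t = F"
proof (intro ext)
  fix \<gamma> :: "'v degree" and v
  obtain \<alpha> n where \<gamma>: "\<gamma> = (\<alpha>, n)" by force
  have "F \<gamma> \<in> comp_dual (coha_module w) (coha_module_comp w) \<gamma>"
    using F unfolding graded_dual_def by (cases \<gamma>) simp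
  then have "F \<gamma> \<in> extensional (coha_module_comp w (\<alpha>, - n))" by (auto simp: \<gamma> comp_dual_def lin_maps_def PiE_def)
  then have x: "v \<notin> coha_module_comp w (\<alpha>, - n) \<Longrightarrow> F \<gamma> v = undefined" by (simp add: extensional_def)
  show "dual_functional w t \<gamma> v = F \<gamma> v"
  proof (cases "v \<in> coha_module_comp w (\<alpha>, - n)")
    case True
    then obtain h where h: "h \<in> coha_comp (\<alpha>, - n)" "v = coha_class w h" by (auto simp: coha_module_comp_eq)
    then show ?thesis using e[OF h(1)] by (simp add: \<gamma> dual_functional_coha_class[OF t])
  qed (simp add: x, simp add: \<gamma> dual_functional_def)
qed

lemma dual_add: assumes "F \<in> carrier (module_dual w)" "F' \<in> carrier (module_dual w)" "h \<in> coha_comp (\<alpha>, - n)"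
  shows "(F \<oplus>\<^bsub>module_dual w\<^esub> F') (\<alpha>, n) (coha_class w h) = F (\<alpha>, n) (coha_class w h) + F' (\<alpha>, n) (coha_class w h)"
    "(c \<odot>\<^bsub>module_dual w\<^esub> F) (\<alpha>, n) (coha_class w h) = c * F (\<alpha>, n) (coha_class w h)"
  using assms(3) by (simp_all add: graded_dual_def coha_module_comp_eq)

lemma dual_functional_add: assumes "t \<in> ker_lift w" "t' \<in> ker_lift w" shows "dual_functional w (t + t') = dual_functional w t \<oplus>\<^bsub>module_dual w\<^esub> dual_functional w t'"
proof (intro ext)
  fix \<gamma> :: "'v degree" and v
  obtain \<alpha> n where \<gamma>: "\<gamma> = (\<alpha>, n)" by force
  have s: "t + t' \<in> ker_lift w" by (rule pm.subspace_add[OF subspace_ker_lift assms])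
  show "dual_functional w (t + t') \<gamma> v = (dual_functional w t \<oplus>\<^bsub>module_dual w\<^esub> dual_functional w t') \<gamma> v"
  proof (cases "v \<in> coha_module_comp w (\<alpha>, - n)")
    case True
    then obtain h where h: "h \<in> coha_comp (\<alpha>, - n)" "v = coha_class w h" by (auto simp: coha_module_comp_eq)
    show ?thesis unfolding \<gamma> h(2) dual_add(1)[OF dual_functional_carrier[OF assms(1)] dual_functional_carrier[OF assms(2)] h(1)]
      dual_functional_coha_class[OF s h(1)] dual_functional_coha_class[OF assms(1) h(1)] dual_functional_coha_class[OF assms(2) h(1)] by (rule coha_pairing_left)
  qed (simp add: \<gamma> dual_functional_def graded_dual_def)
qed

lemma dual_functional_scale: assumes "t \<in> ker_lift w" shows "dual_functional w (scale c t) = c \<odot>\<^bsub>module_dual w\<^esub> dual_functional w t"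
proof (intro ext)
  fix \<gamma> :: "'v degree" and v
  obtain \<alpha> n where \<gamma>: "\<gamma> = (\<alpha>, n)" by force
  have s: "scale c t \<in> ker_lift w" by (rule pm.subspace_scale[OF subspace_ker_lift assms])
  show "dual_functional w (scale c t) \<gamma> v = (c \<odot>\<^bsub>module_dual w\<^esub> dual_functional w t) \<gamma> v"
  proof (cases "v \<in> coha_module_comp w (\<alpha>, - n)")
    case True
    then obtain h where h: "h \<in> coha_comp (\<alpha>, - n)" "v = coha_class w h" by (auto simp: coha_module_comp_eq)
    show ?thesis unfolding \<gamma> h(2) dual_add(2)[OF dual_functional_carrier[OF assms] dual_functional_carrier[OF assms] h(1)]
      dual_functional_coha_class[OF s h(1)] dual_functional_coha_class[OF assms h(1)] by (rule coha_pairing_left)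
  qed (simp add: \<gamma> dual_functional_def graded_dual_def)
qed

text \<open>The pairing separates the points of \<open>PQ\<close>: by
  \<open>graded_separation\<close> only homogeneous forms killing \<open>J0\<close> have to be
  tested, and each nonzero one is the pairing with a homogeneous symmetric polynomial, that is, with
  an element of some \<open>coha_comp\<close>.\<close>

lemma dual_functional_eq_iff: assumes t: "t \<in> ker_lift w" "t' \<in> ker_lift w" shows "dual_functional w t = dual_functional w t' \<longleftrightarrow> q0 t = q0 t'"
proof -
  have "dual_functional w t = dual_functional w t' \<longleftrightarrow> (\<forall>\<alpha> n. \<forall>h\<in>coha_comp (\<alpha>, - n). coha_pairing t h = coha_pairing t' h)"
  proof
    assume e: "dual_functional w t = dual_functional w t'"
    show "\<forall>\<alpha> n. \<forall>h\<in>coha_comp (\<alpha>, - n). coha_pairing t h = coha_pairing t' h"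
    proof (intro allI ballI)
      fix \<alpha> n h assume h: "h \<in> coha_comp (\<alpha>, - n)"
      show "coha_pairing t h = coha_pairing t' h" using dual_functional_coha_class[OF t(1) h] dual_functional_coha_class[OF t(2) h] e by simp
    qed
  next
    assume "\<forall>\<alpha> n. \<forall>h\<in>coha_comp (\<alpha>, - n). coha_pairing t h = coha_pairing t' h"
    then show "dual_functional w t = dual_functional w t'"
      by (intro dual_functional_eqI[OF t(1) dual_functional_carrier[OF t(2)]]) (simp add: dual_functional_coha_class[OF t(2)])
  qed
  also have "\<dots> \<longleftrightarrow> t - t' \<in> J0"
  proof
    assume "t - t' \<in> J0"
    then have "coha_pairing (t - t') h = 0" if "h \<in> CH" for h using that by (rule coha_pairing_J0)
    then show "\<forall>\<alpha> n. \<forall>h\<in>coha_comp (\<alpha>, - n). coha_pairing t h = coha_pairing t' h"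
      using coha_comp_CH by (simp add: coha_pairing_left)
  next
    assume e: "\<forall>\<alpha> n. \<forall>h\<in>coha_comp (\<alpha>, - n). coha_pairing t h = coha_pairing t' h"
    show "t - t' \<in> J0"
    proof (rule graded_separation[OF graded_JX])
      fix \<xi> :: "('v \<times> int) fmon \<Rightarrow> rat" and a
      assume k: "\<And>j. j \<in> J0 \<Longrightarrow> pairing \<xi> j = 0" "\<And>u. wdeg u \<noteq> a \<Longrightarrow> \<xi> u = 0"
      show "pairing \<xi> (t - t') = 0"
      proof (cases "\<exists>u. \<xi> u \<noteq> 0")
        case True
        then obtain u0 where "\<xi> u0 \<noteq> 0" ..
        then obtain d f where d: "d \<in> dimvecs" "f \<in> sym_polys d" "hd2 (- snd a - euler (dim_degree d) (dim_degree d)) f" "\<And>u. \<xi> u = BB d f u"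
          using homogeneous_representation[OF k] by blast
        have "pairing \<xi> s = coha_pairing s (single d f)" for s unfolding coha_pairing_single by (rule pairing_fun_cong) (rule d(4))
        then show ?thesis using e coha_comp_single[OF d(1-3)] by (simp add: pairing_diff)
      qed (simp add: pairing_eq)
    qed
  qed
  finally show ?thesis by (simp add: cq_eq_iff)
qed

text \<open>An element of the graded dual is nonzero in finitely many degrees only, so the lifts of
  its components can be added; a lift of degree \<gamma> pairs to zero with all other
  components.\<close>

lemma dual_functional_surj: assumes F: "F \<in> carrier (module_dual w)" shows "\<exists>t\<in>ker_lift w. dual_functional w t = F"
proof -
  have l: "F (\<alpha>, n) \<in> lin_maps (coha_module w\<lparr>carrier := coha_module_comp w (\<alpha>, - n)\<rparr>) rat_space" for \<alpha> n
    using F by (auto simp: graded_dual_def comp_dual_def)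
  have "\<exists>t\<in>ker_lift w. homog (fst \<gamma>, snd \<gamma>) t \<and> (\<forall>h\<in>coha_comp (fst \<gamma>, - snd \<gamma>). coha_pairing t h = F (fst \<gamma>, snd \<gamma>) (coha_class w h))" for \<gamma>
    by (rule functional_lift[OF l])
  then obtain T where T: "\<And>\<gamma>. T \<gamma> \<in> ker_lift w" "\<And>\<gamma>. homog \<gamma> (T \<gamma>)"
    "\<And>\<gamma> h. h \<in> coha_comp (fst \<gamma>, - snd \<gamma>) \<Longrightarrow> coha_pairing (T \<gamma>) h = F \<gamma> (coha_class w h)" unfolding prod.collapse by metis
  define S where "S = {(\<alpha>, n). \<exists>v\<in>coha_module_comp w (\<alpha>, - n). F (\<alpha>, n) v \<noteq> 0}"
  have fS: "finite S" using F by (simp add: graded_dual_def S_def)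
  have s: "sum T S \<in> ker_lift w" by (rule pm.subspace_sum[OF subspace_ker_lift T(1)])
  have "dual_functional w (sum T S) = F"
  proof (rule dual_functional_eqI[OF s F])
    fix \<alpha> n h assume h: "h \<in> coha_comp (\<alpha>, - n)"
    have z: "coha_pairing (T \<gamma>) h = 0" if "\<gamma> \<noteq> (\<alpha>, n)" for \<gamma>
    proof (rule ccontr)
      assume "coha_pairing (T \<gamma>) h \<noteq> 0"
      from coha_pairing_comp[OF h this] have "(\<alpha>, n) = \<gamma>" using T(2)[of \<gamma>] by (auto simp: homog_def)
      then show False using that by simp
    qed
    have "coha_pairing (sum T S) h = (\<Sum>\<gamma>\<in>S. if \<gamma> = (\<alpha>, n) then coha_pairing (T \<gamma>) h else 0)"
      unfolding coha_pairing_left by (intro sum.cong refl) (simp add: z)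
    also have "\<dots> = (if (\<alpha>, n) \<in> S then coha_pairing (T (\<alpha>, n)) h else 0)" using fS by (simp add: sum.delta')
    also have "\<dots> = F (\<alpha>, n) (coha_class w h)"
      using T(3)[of h "(\<alpha>, n)"] h by (auto simp: S_def coha_module_comp_eq)
    finally show "coha_pairing (sum T S) h = F (\<alpha>, n) (coha_class w h)" .
  qed
  then show ?thesis using s by blast
qed

lemma dual_functional_comp: "(\<lambda>t. dual_functional w t) ` {t \<in> ker_lift w. homog \<gamma> t} = graded_dual_comp (coha_module w) (coha_module_comp w) \<gamma>"
proof (intro equalityI subsetI)
  fix F assume "F \<in> (\<lambda>t. dual_functional w t) ` {t \<in> ker_lift w. homog \<gamma> t}"
  then obtain t where t: "t \<in> ker_lift w" "homog \<gamma> t" "F = dual_functional w t" by blast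
  have "dual_functional w t (\<alpha>, n) v = 0" if n: "(\<alpha>, n) \<noteq> \<gamma>" and v: "v \<in> coha_module_comp w (\<alpha>, - n)" for \<alpha> n v
  proof (rule ccontr)
    obtain h where h: "h \<in> coha_comp (\<alpha>, - n)" "v = coha_class w h" using v by (auto simp: coha_module_comp_eq)
    assume "dual_functional w t (\<alpha>, n) v \<noteq> 0"
    then have "(\<alpha>, n) \<in> wdeg ` keys t" unfolding h(2) dual_functional_coha_class[OF t(1) h(1)] by (rule coha_pairing_comp[OF h(1)])
    then show False using t(2) n by (auto simp: homog_def)
  qed
  then show "F \<in> graded_dual_comp (coha_module w) (coha_module_comp w) \<gamma>"
    unfolding graded_dual_comp_def using dual_functional_carrier[OF t(1)] t(3) by simp
next
  fix F assume F: "F \<in> graded_dual_comp (coha_module w) (coha_module_comp w) \<gamma>"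
  obtain \<alpha> n where \<gamma>: "\<gamma> = (\<alpha>, n)" by force
  have c: "F \<in> carrier (module_dual w)" using F by (simp add: graded_dual_comp_def)
  then have "F (\<alpha>, n) \<in> lin_maps (coha_module w\<lparr>carrier := coha_module_comp w (\<alpha>, - n)\<rparr>) rat_space"
    by (auto simp: graded_dual_def comp_dual_def)
  from functional_lift[OF this] obtain t where t: "t \<in> ker_lift w" "homog (\<alpha>, n) t"
    "\<And>h. h \<in> coha_comp (\<alpha>, - n) \<Longrightarrow> coha_pairing t h = F (\<alpha>, n) (coha_class w h)" by blast
  have "dual_functional w t = F"
  proof (rule dual_functional_eqI[OF t(1) c])
    fix \<beta> m h assume h: "h \<in> coha_comp (\<beta>, - m)"
    show "coha_pairing t h = F (\<beta>, m) (coha_class w h)"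
    proof (cases "(\<beta>, m) = (\<alpha>, n)")
      case True then show ?thesis using t(3) h by simp
    next
      case False
      then have "F (\<beta>, m) (coha_class w h) = 0" using F h by (auto simp: graded_dual_comp_def \<gamma> coha_module_comp_eq)
      moreover have "coha_pairing t h = 0"
      proof (rule ccontr)
        assume "coha_pairing t h \<noteq> 0"
        from coha_pairing_comp[OF h this] show False using t(2) False by (auto simp: homog_def)
      qed
      ultimately show ?thesis by simp
    qed
  qed
  then show "F \<in> (\<lambda>t. dual_functional w t) ` {t \<in> ker_lift w. homog \<gamma> t}" using t by (auto simp: \<gamma>)
qed

theorem coaction_kernel_iso:
  "graded_iso (PQ\<lparr>carrier := coaction_kernel w\<rparr>) (\<lambda>\<gamma>. coaction_kernel w \<inter> PQ_comp \<gamma>)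
    (module_dual w) (graded_dual_comp (coha_module w) (coha_module_comp w))"
proof -
  let ?V = "PQ\<lparr>carrier := coaction_kernel w\<rparr>"
  \<comment> \<open>Independent of the chosen representative by
    \<open>dual_functional_eq_iff\<close>.\<close>
  define \<phi> where "\<phi> = (\<lambda>p\<in>coaction_kernel w. dual_functional w (SOME t. t \<in> ker_lift w \<and> q0 t = p))"
  have \<phi>: "\<phi> (q0 t) = dual_functional w t" if t: "t \<in> ker_lift w" for t
  proof -
    define s where "s = (SOME s. s \<in> ker_lift w \<and> q0 s = q0 t)"
    have s: "s \<in> ker_lift w" "q0 s = q0 t" using someI[of "\<lambda>s. s \<in> ker_lift w \<and> q0 s = q0 t" t] t by (auto simp: s_def)
    have "\<phi> (q0 t) = dual_functional w s" using t by (simp add: \<phi>_def s_def coaction_kernel_ker_lift)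
    also have "\<dots> = dual_functional w t" using s t by (simp add: dual_functional_eq_iff)
    finally show ?thesis .
  qed
  have "\<phi> \<in> lin_maps ?V (module_dual w)"
    unfolding lin_maps_def
  proof (intro CollectI conjI ballI allI)
    show "\<phi> \<in> carrier ?V \<rightarrow>\<^sub>E carrier (module_dual w)"
    proof (rule PiE_I)
      fix p assume "p \<in> carrier ?V"
      then obtain t where "t \<in> ker_lift w" "p = q0 t" by (auto simp: coaction_kernel_ker_lift)
      then show "\<phi> p \<in> carrier (module_dual w)" using \<phi> dual_functional_carrier by simp
    qed (simp add: \<phi>_def)
    fix p assume "p \<in> carrier ?V"
    then obtain t where t: "t \<in> ker_lift w" "p = q0 t" by (auto simp: coaction_kernel_ker_lift)
    { fix p' assume "p' \<in> carrier ?V"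
      then obtain t' where t': "t' \<in> ker_lift w" "p' = q0 t'" by (auto simp: coaction_kernel_ker_lift)
      have "p \<oplus>\<^bsub>?V\<^esub> p' = q0 (t + t')" using t t' by (simp add: PQ.add)
      then show "\<phi> (p \<oplus>\<^bsub>?V\<^esub> p') = \<phi> p \<oplus>\<^bsub>module_dual w\<^esub> \<phi> p'"
        using t t' pm.subspace_add[OF subspace_ker_lift t(1) t'(1)] by (simp add: \<phi> dual_functional_add) }
    fix c
    have "c \<odot>\<^bsub>?V\<^esub> p = q0 (scale c t)" using t by (simp add: PQ.smul)
    then show "\<phi> (c \<odot>\<^bsub>?V\<^esub> p) = c \<odot>\<^bsub>module_dual w\<^esub> \<phi> p"
      using t pm.subspace_scale[OF subspace_ker_lift t(1)] by (simp add: \<phi> dual_functional_scale)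
  qed
  moreover have "bij_betw \<phi> (carrier ?V) (carrier (module_dual w))"
    unfolding bij_betw_def
  proof
    show "inj_on \<phi> (carrier ?V)"
    proof (rule inj_onI)
      fix p p' assume "p \<in> carrier ?V" "p' \<in> carrier ?V" and e: "\<phi> p = \<phi> p'"
      then obtain t t' where "t \<in> ker_lift w" "p = q0 t" "t' \<in> ker_lift w" "p' = q0 t'" by (auto simp: coaction_kernel_ker_lift)
      then show "p = p'" using e by (simp add: \<phi> dual_functional_eq_iff)
    qed
    show "\<phi> ` carrier ?V = carrier (module_dual w)"
    proof (intro equalityI subsetI)
      fix F assume "F \<in> \<phi> ` carrier ?V"
      then obtain t where "t \<in> ker_lift w" "F = \<phi> (q0 t)" by (auto simp: coaction_kernel_ker_lift)
      then show "F \<in> carrier (module_dual w)" using \<phi> dual_functional_carrier by simp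
    next
      fix F assume "F \<in> carrier (module_dual w)"
      then obtain t where "t \<in> ker_lift w" "dual_functional w t = F" using dual_functional_surj by blast
      then have "q0 t \<in> carrier ?V" "F = \<phi> (q0 t)" using \<phi>[of t] by (auto simp: coaction_kernel_ker_lift)
      then show "F \<in> \<phi> ` carrier ?V" by blast
    qed
  qed
  moreover have "\<phi> ` (coaction_kernel w \<inter> PQ_comp \<gamma>) = graded_dual_comp (coha_module w) (coha_module_comp w) \<gamma>" for \<gamma>
  proof -
    have "coaction_kernel w \<inter> PQ_comp \<gamma> = q0 ` {t \<in> ker_lift w. homog \<gamma> t}"
    proof (intro equalityI subsetI)
      fix p assume "p \<in> coaction_kernel w \<inter> PQ_comp \<gamma>"
      then obtain t t' where "t' \<in> ker_lift w" "p = q0 t'" "p = q0 t" "homog \<gamma> t"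
        unfolding coaction_kernel_ker_lift PQ_comp_eq by blast
      \<comment> \<open>A homogeneous representative of a kernel element differs from one in
        \<open>ker_lift w\<close> by an element of \<open>J0\<close>, which
        \<open>ker_lift w\<close> contains.\<close>
      moreover then have "t \<in> ker_lift w" using ker_lift_cong[of t t'] by simp
      ultimately show "p \<in> q0 ` {t \<in> ker_lift w. homog \<gamma> t}" by blast
    qed (auto simp: coaction_kernel_ker_lift PQ_comp_eq)
    then have "\<phi> ` (coaction_kernel w \<inter> PQ_comp \<gamma>) = (\<lambda>t. \<phi> (q0 t)) ` {t \<in> ker_lift w. homog \<gamma> t}"
      by (simp add: image_image)
    also have "\<dots> = (\<lambda>t. dual_functional w t) ` {t \<in> ker_lift w. homog \<gamma> t}" by (rule image_cong) (simp_all add: \<phi>)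
    finally show ?thesis unfolding dual_functional_comp .
  qed
  ultimately show ?thesis unfolding graded_iso_def by (intro bexI[of _ \<phi>]) simp_all
qed

end

theorem theorem6p3:
  fixes Q :: "('v, 'a) pre_digraph" and w :: "'v \<Rightarrow>\<^sub>0 nat"
  assumes "symmetric_quiver Q"
    and "w \<in> symmetric_quiver.dimvecs Q"
  shows "graded_iso
    ((symmetric_quiver.PQ Q)\<lparr>carrier := symmetric_quiver.coaction_kernel Q w\<rparr>)
    (\<lambda>\<gamma>. symmetric_quiver.coaction_kernel Q w \<inter> symmetric_quiver.PQ_comp Q \<gamma>)
    (graded_dual (symmetric_quiver.coha_module Q w) (symmetric_quiver.coha_module_comp Q w))
    (graded_dual_comp (symmetric_quiver.coha_module Q w) (symmetric_quiver.coha_module_comp Q w))"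
proof -
  interpret symmetric_quiver Q by fact
  show ?thesis by (rule coaction_kernel_iso)
qed

end
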